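(* Let $\varphi$ be a plurisubharmonic $\mathcal C^2$-function on $\mathbb C^n$ such that the lowest eigenvalue $\lambda_\varphi(z)$ of the Levi matrix $M_\varphi(z)$ satisfies $$\lim_{|z|\to\infty}\lambda_\varphi(z)=+\infty .$$ Then the canonical solution operator $S^{can}$ to $\overline\partial$, from $L^2_{(0,1)}(\mathbb C^n,\varphi)\cap\operatorname{Ker}\overline\partial$ to $L^2(\mathbb C^n,\varphi)$, is compact.
   Context: $L^2(\mathbb C^n,\varphi)$ is the Hilbert space of measurable $f:\mathbb C^n\to\mathbb C$ with $\int_{\mathbb C^n}|f|^2e^{-2\varphi}\,d\lambda<\infty$ ($\lambda$ Lebesgue measure), and $L^2_{(0,1)}(\mathbb C^n,\varphi)$ is the space of $(0,1)$-forms $f=\sum_{j=1}^n f_j\,d\overline z_j$ with coefficients in $L^2(\mathbb C^n,\varphi)$, with norm $\|f\|^2=\sum_j\|f_j\|^2$. The operator $\overline\partial$ is taken in the sense of distributions. The canonical solution operator $S^{can}$ maps $f\in L^2_{(0,1)}(\mathbb C^n,\varphi)$ with $\overline\partial f=0$ to the unique $u\in L^2(\mathbb C^n,\varphi)$ with $\overline\partial u=f$ and $u\perp\operatorname{Ker}\overline\partial$ in $L^2(\mathbb C^n,\varphi)$ (the minimal-norm solution). The assertion that $S^{can}$ is compact includes that it is well defined on all of $L^2_{(0,1)}(\mathbb C^n,\varphi)\cap\operatorname{Ker}\overline\partial$. The Levi matrix is $M_\varphi=\left(\frac{\partial^2\varphi}{\partial z_j\partial\overline z_k}\right)_{j,k=1}^n$.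 *)

theory Defs
  imports "HOL-Analysis.Analysis"
begin

section \<open>Differentiability and Wirtinger derivatives\<close>

text \<open>Real differentiability of class \<open>C\<^sup>k\<close>; in finite dimensions, continuity of all directional
  derivatives of order at most \<open>k\<close> is continuity of the iterated Frechet derivatives.\<close>

primrec C_k :: "nat \<Rightarrow> ('a::real_normed_vector \<Rightarrow> 'b::real_normed_vector) \<Rightarrow> bool" where
  "C_k 0 f \<longleftrightarrow> continuous_on UNIV f"
| "C_k (Suc k) f \<longleftrightarrow>
     (\<forall>x. f differentiable (at x)) \<and> (\<forall>v. C_k k (\<lambda>x. frechet_derivative f (at x) v))"

text \<open>With \<open>z\<^sub>j = x\<^sub>j + i y\<^sub>j\<close>, \<open>axis j 1\<close> is the \<open>x\<^sub>j\<close>-direction and \<open>axis j \<i>\<close> the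
  \<open>y\<^sub>j\<close>-direction.\<close>

definition d_z :: "'n \<Rightarrow> (complex ^ 'n \<Rightarrow> complex) \<Rightarrow> complex ^ 'n \<Rightarrow> complex" where
  "d_z j f z = (frechet_derivative f (at z) (axis j 1)
                 - \<i> * frechet_derivative f (at z) (axis j \<i>)) / 2"

definition d_zbar :: "'n \<Rightarrow> (complex ^ 'n \<Rightarrow> complex) \<Rightarrow> complex ^ 'n \<Rightarrow> complex" where
  "d_zbar j f z = (frechet_derivative f (at z) (axis j 1)
                 + \<i> * frechet_derivative f (at z) (axis j \<i>)) / 2"


section \<open>Plurisubharmonic functions and the Levi matrix\<close>

definition upper_semicontinuous :: "('a::topological_space \<Rightarrow> real) \<Rightarrow> bool" where
  "upper_semicontinuous u \<longleftrightarrow> (\<forall>c. open {x. u x < c})"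

text \<open>Integrability over circles is automatic for finite-valued subharmonic functions; it is spelled
  out because the integral of a non-integrable function is \<open>0\<close> by convention, not \<open>-\<infinity>\<close>.\<close>

definition subharmonic :: "(complex \<Rightarrow> real) \<Rightarrow> bool" where
  "subharmonic u \<longleftrightarrow> upper_semicontinuous u \<and>
     (\<forall>a r. r > 0 \<longrightarrow>
        (\<lambda>t. u (a + of_real r * cis t)) absolutely_integrable_on {0..2 * pi} \<and>
        u a \<le> integral {0..2 * pi} (\<lambda>t. u (a + of_real r * cis t)) / (2 * pi))"

definition plurisubharmonic :: "(complex ^ 'n \<Rightarrow> real) \<Rightarrow> bool" where
  "plurisubharmonic \<phi> \<longleftrightarrow>
     upper_semicontinuous \<phi> \<and> (\<forall>z w. subharmonic (\<lambda>\<zeta>. \<phi> (z + \<zeta> *s w)))"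

definition levi_matrix :: "(complex ^ 'n \<Rightarrow> real) \<Rightarrow> complex ^ 'n \<Rightarrow> complex ^ 'n ^ 'n" where
  "levi_matrix \<phi> z = (\<chi> j k. d_z j (d_zbar k (\<lambda>w. complex_of_real (\<phi> w))) z)"

text \<open>Intended for Hermitian matrices, where the set of real eigenvalues is finite, nonempty and
  comprises all eigenvalues.\<close>

definition lowest_eigenvalue :: "complex ^ 'n ^ 'n \<Rightarrow> real" where
  "lowest_eigenvalue A = Min {t::real. \<exists>v. v \<noteq> 0 \<and> A *v v = complex_of_real t *s v}"


section \<open>Weighted \<open>L\<^sup>2\<close> spaces\<close>

text \<open>Elements are functions rather than classes modulo null functions. A \<open>(0,1)\<close>-form
  \<open>\<Sum>\<^sub>j f\<^sub>j d\<close>\<open>z\<^sub>j\<close>-bar is the vector field \<open>f\<close> of its coefficients, \<open>f z $ j = f\<^sub>j(z)\<close>.\<close>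

definition L2 :: "(complex ^ 'n \<Rightarrow> real) \<Rightarrow> (complex ^ 'n \<Rightarrow> complex) set" where
  "L2 \<phi> = {f \<in> borel_measurable lebesgue.
             integrable lebesgue (\<lambda>z. (cmod (f z))\<^sup>2 * exp (- 2 * \<phi> z))}"

definition L2_norm :: "(complex ^ 'n \<Rightarrow> real) \<Rightarrow> (complex ^ 'n \<Rightarrow> complex) \<Rightarrow> real" where
  "L2_norm \<phi> f = sqrt (LINT z|lebesgue. (cmod (f z))\<^sup>2 * exp (- 2 * \<phi> z))"

definition L2_inner ::
  "(complex ^ 'n \<Rightarrow> real) \<Rightarrow> (complex ^ 'n \<Rightarrow> complex) \<Rightarrow> (complex ^ 'n \<Rightarrow> complex) \<Rightarrow> complex" where
  "L2_inner \<phi> f g = (LINT z|lebesgue. f z * cnj (g z) * complex_of_real (exp (- 2 * \<phi> z)))"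

definition L2_forms :: "(complex ^ 'n \<Rightarrow> real) \<Rightarrow> (complex ^ 'n \<Rightarrow> complex ^ 'n) set" where
  "L2_forms \<phi> = {f. \<forall>j. (\<lambda>z. f z $ j) \<in> L2 \<phi>}"

definition L2_forms_norm :: "(complex ^ 'n \<Rightarrow> real) \<Rightarrow> (complex ^ 'n \<Rightarrow> complex ^ 'n) \<Rightarrow> real" where
  "L2_forms_norm \<phi> f = sqrt (\<Sum>j\<in>UNIV. (L2_norm \<phi> (\<lambda>z. f z $ j))\<^sup>2)"


section \<open>The \<open>\<partial>\<close>-bar operator in the sense of distributions\<close>

definition test_functions :: "(complex ^ 'n \<Rightarrow> complex) set" where
  "test_functions = {\<psi>. (\<forall>k. C_k k \<psi>) \<and> compact (closure {z. \<psi> z \<noteq> 0})}"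

definition dbar_eq :: "(complex ^ 'n \<Rightarrow> complex) \<Rightarrow> (complex ^ 'n \<Rightarrow> complex ^ 'n) \<Rightarrow> bool" where
  "dbar_eq u f \<longleftrightarrow> (\<forall>\<psi>\<in>test_functions. \<forall>j.
     - (LINT z|lebesgue. u z * d_zbar j \<psi> z) = (LINT z|lebesgue. f z $ j * \<psi> z))"

text \<open>The coefficients \<open>\<partial>f\<^sub>k/\<partial>\<close>\<open>z\<^sub>j\<close>-bar \<open>-\<close> \<open>\<partial>f\<^sub>j/\<partial>\<close>\<open>z\<^sub>k\<close>-bar of the \<open>(0,2)\<close>-form
  \<open>\<partial>\<close>-bar \<open>f\<close> vanish as distributions.\<close>

definition dbar_closed :: "(complex ^ 'n \<Rightarrow> complex ^ 'n) \<Rightarrow> bool" where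
  "dbar_closed f \<longleftrightarrow> (\<forall>\<psi>\<in>test_functions. \<forall>j k.
     - (LINT z|lebesgue. f z $ k * d_zbar j \<psi> z) + (LINT z|lebesgue. f z $ j * d_zbar k \<psi> z) = 0)"

definition ker_dbar :: "(complex ^ 'n \<Rightarrow> real) \<Rightarrow> (complex ^ 'n \<Rightarrow> complex) set" where
  "ker_dbar \<phi> = {h \<in> L2 \<phi>. dbar_eq h (\<lambda>z. 0)}"

definition closed_forms :: "(complex ^ 'n \<Rightarrow> real) \<Rightarrow> (complex ^ 'n \<Rightarrow> complex ^ 'n) set" where
  "closed_forms \<phi> = {f \<in> L2_forms \<phi>. dbar_closed f}"


section \<open>The canonical solution operator\<close>

definition canonical_solution ::
  "(complex ^ 'n \<Rightarrow> real) \<Rightarrow> (complex ^ 'n \<Rightarrow> complex ^ 'n) \<Rightarrow> (complex ^ 'n \<Rightarrow> complex) \<Rightarrow> bool" where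
  "canonical_solution \<phi> f u \<longleftrightarrow>
     u \<in> L2 \<phi> \<and> dbar_eq u f \<and> (\<forall>h\<in>ker_dbar \<phi>. L2_inner \<phi> u h = 0)"

definition S_can_well_defined :: "(complex ^ 'n \<Rightarrow> real) \<Rightarrow> bool" where
  "S_can_well_defined \<phi> \<longleftrightarrow> (\<forall>f\<in>closed_forms \<phi>.
     (\<exists>u. canonical_solution \<phi> f u) \<and>
     (\<forall>u v. canonical_solution \<phi> f u \<longrightarrow> canonical_solution \<phi> f v \<longrightarrow> (AE z in lebesgue. u z = v z)))"

text \<open>The choice is only between representatives of one class modulo null functions.\<close>

definition S_can ::
  "(complex ^ 'n \<Rightarrow> real) \<Rightarrow> (complex ^ 'n \<Rightarrow> complex ^ 'n) \<Rightarrow> (complex ^ 'n \<Rightarrow> complex)" where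
  "S_can \<phi> f = (SOME u. canonical_solution \<phi> f u)"

text \<open>Compactness of a linear operator from the closed forms to \<open>L\<^sup>2\<close>: it maps bounded sequences to
  sequences with norm convergent subsequences.\<close>

definition compact_operator ::
  "(complex ^ 'n \<Rightarrow> real) \<Rightarrow> ((complex ^ 'n \<Rightarrow> complex ^ 'n) \<Rightarrow> (complex ^ 'n \<Rightarrow> complex)) \<Rightarrow> bool" where
  "compact_operator \<phi> T \<longleftrightarrow>
     (\<forall>f\<in>closed_forms \<phi>. T f \<in> L2 \<phi>) \<and>
     (\<forall>f\<in>closed_forms \<phi>. \<forall>g\<in>closed_forms \<phi>. \<forall>a b.
        AE z in lebesgue. T (\<lambda>w. a *s f w + b *s g w) z = a * T f z + b * T g z) \<and>
     (\<forall>F :: nat \<Rightarrow> complex ^ 'n \<Rightarrow> complex ^ 'n.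
        (\<forall>k. F k \<in> closed_forms \<phi>) \<and> (\<exists>C. \<forall>k. L2_forms_norm \<phi> (F k) \<le> C) \<longrightarrow>
        (\<exists>r :: nat \<Rightarrow> nat. \<exists>g\<in>L2 \<phi>. strict_mono r \<and>
           (\<lambda>k. L2_norm \<phi> (\<lambda>z. T (F (r k)) z - g z)) \<longlonglongrightarrow> 0))"

end

theory Submission
  imports Defs "HOL-Library.Diagonal_Subsequence" "HOL-Complex_Analysis.Great_Picard"
begin

text \<open>Compactness rests on the estimate \<open>\<parallel>u\<parallel> \<le> \<epsilon> \<parallel>f\<parallel> + C \<parallel>1\<^sub>B u\<parallel>\<close> for canonical solutions \<open>u\<close> of
  \<open>\<partial>\<close>-bar \<open>u = f\<close>, with a ball \<open>B\<close> that depends on \<open>\<epsilon>\<close>. For a cut-off function \<open>c\<close> that is \<open>1\<close> on a large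
  ball, \<open>c u\<close> solves the equation up to the error \<open>(1 - c) f - u \<partial>\<close>-bar \<open>c\<close>. Hoermander's weighted estimate
  solves for this error at a cost of the order of \<open>\<parallel>(1 - c) f / \<surd>\<lambda>\<parallel> + \<parallel>1\<^sub>B u\<parallel>\<close>, where the first term is small because
  the lowest eigenvalue \<open>\<lambda>\<close> of the Levi matrix is large outside the large ball, and \<open>u\<close> has minimal norm.
  Hoermander's estimate needs a strictly positive Levi form; adding to the weight a multiple
  of a cut-off version of \<open>\<parallel>z\<parallel>\<^sup>2\<close> on a large ball achieves this, and only changes the norms to equivalent ones. Rellich's lemma
  makes \<open>\<parallel>1\<^sub>B u\<parallel>\<close> small along a subsequence of differences, and a diagonal argument concludes.\<close>

section \<open>Functions of class \<open>C\<^sup>k\<close>\<close>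

text \<open>The hard point is that the Kohn-Morrey identity needs compactly supported forms of class
  C^2, while duality needs the resulting estimate for every closed form that has a weak adjoint in
  the weighted space. Cutting off and mollifying bridges the gap: the top-order coefficients are
  constant, so only multiplication by first derivatives of \<phi> fails to commute with convolution,
  and that error tends to 0; gradients of dilated cut-offs decay. The bump added to the weight must
  not spoil the growth that determines its size: its Levi form has bounds invariant under dilation,
  so the constants can be fixed before the radius. The dbar equation does not mention the weight,
  hence a bounded change of weight costs only a constant factor in the norms, and the growth of the
  Levi form can be made to beat that factor. All Hilbert space arguments use the real scalar
  product; complex equations are recovered by multiplying test functions by \<open>\<i>\<close>.
  Factors 2 next to the Levi form stem from the weight \<open>exp (- 2 * \<phi> z)\<close>.\<close>

definition dd :: "'a::real_normed_vector \<Rightarrow> ('a \<Rightarrow> 'b::real_normed_vector) \<Rightarrow> 'a \<Rightarrow> 'b" where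
  "dd v f = (\<lambda>x. frechet_derivative f (at x) v)"

lemma C_k_Suc: "C_k (Suc k) f \<longleftrightarrow> (\<forall>x. f differentiable (at x)) \<and> (\<forall>v. C_k k (dd v f))"
  by (simp add: dd_def)

declare C_k.simps(2) [simp del]

lemma dd_eq: "(f has_derivative f') (at x) \<Longrightarrow> dd v f x = f' v"
  by (metis dd_def frechet_derivative_at)

lemma has_derivative_dd: "f differentiable (at x) \<Longrightarrow> (f has_derivative (\<lambda>v. dd v f x)) (at x)"
  unfolding dd_def using frechet_derivative_works by blast

lemma C_k_has_derivative: "C_k (Suc k) f \<Longrightarrow> (f has_derivative (\<lambda>v. dd v f x)) (at x)"
  by (simp add: C_k_Suc has_derivative_dd)

lemma C_k_dd: "C_k (Suc k) f \<Longrightarrow> C_k k (dd v f)"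
  by (simp add: C_k_Suc)

text \<open>The form in which closure properties are proved: an explicit candidate \<open>f'\<close>
  for the derivative, itself of class C^k, keeps \<open>frechet_derivative\<close> out of the
  inductions.\<close>

lemma C_k_SucI:
  assumes "\<And>x. (f has_derivative (\<lambda>v. f' v x)) (at x)" and "\<And>v. C_k k (f' v)"
  shows "C_k (Suc k) f"
proof -
  have "dd v f = f' v" for v using dd_eq[OF assms(1)] by auto
  then show ?thesis using assms unfolding C_k_Suc differentiable_def by auto
qed

lemma C_k_Suc_imp: "C_k (Suc k) f \<Longrightarrow> C_k k f"
proof (induction k arbitrary: f)
  case 0
  then show ?case
    by (auto simp: C_k_Suc continuous_on_eq_continuous_within intro!: differentiable_imp_continuous_within)
next
  case (Suc k)
  then show ?case unfolding C_k_Suc[of "Suc k"] C_k_Suc[of k] by blast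
qed

lemma C_k_antimono: "C_k m f \<Longrightarrow> k \<le> m \<Longrightarrow> C_k k f"
  by (induction m) (auto simp: le_Suc_eq dest: C_k_Suc_imp)

lemma C_k_continuous: "C_k k f \<Longrightarrow> continuous_on UNIV f"
  using C_k_antimono[of k f 0] by simp

lemma C_k_const: "C_k k (\<lambda>x. c)"
proof (induction k arbitrary: c)
  case (Suc k)
  show ?case by (rule C_k_SucI[where f'="\<lambda>v x. 0"]) (auto intro: Suc)
qed simp

lemma C_k_bounded_linear:
  assumes "bounded_linear L" and "C_k k f" shows "C_k k (\<lambda>x. L (f x))"
  using assms(2)
proof (induction k arbitrary: f)
  case 0
  then show ?case using assms(1) by (auto intro: bounded_linear.continuous_on)
next
  case (Suc k)
  show ?case
    by (rule C_k_SucI[where f'="\<lambda>v x. L (dd v f x)"])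
      (use Suc assms in \<open>auto intro!: bounded_linear.has_derivative[OF assms(1)] C_k_has_derivative C_k_dd\<close>)
qed

lemma C_k_add:
  assumes "C_k k f" "C_k k g" shows "C_k k (\<lambda>x. f x + g x)"
  using assms
proof (induction k arbitrary: f g)
  case 0
  then show ?case by (auto intro: continuous_on_add)
next
  case (Suc k)
  show ?case
    by (rule C_k_SucI[where f'="\<lambda>v x. dd v f x + dd v g x"])
      (use Suc in \<open>auto intro!: has_derivative_add C_k_has_derivative C_k_dd\<close>)
qed

lemma C_k_minus: "C_k k f \<Longrightarrow> C_k k (\<lambda>x. - f x)"
  by (rule C_k_bounded_linear) (auto intro: bounded_linear_minus bounded_linear_ident)

lemma C_k_diff: "C_k k f \<Longrightarrow> C_k k g \<Longrightarrow> C_k k (\<lambda>x. f x - g x)"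
  using C_k_add[of k f "\<lambda>x. - g x"] C_k_minus[of k g] by simp

lemma C_k_bilinear:
  assumes "bounded_bilinear B" and "C_k k f" "C_k k g" shows "C_k k (\<lambda>x. B (f x) (g x))"
  using assms(2,3)
proof (induction k arbitrary: f g)
  case 0
  then show ?case using bounded_bilinear.continuous_on[OF assms(1)] by auto
next
  case (Suc k)
  show ?case
    by (rule C_k_SucI[where f'="\<lambda>v x. B (f x) (dd v g x) + B (dd v f x) (g x)"])
      (use Suc in \<open>auto intro!: bounded_bilinear.FDERIV[OF assms(1)] C_k_has_derivative C_k_dd C_k_add
        dest: C_k_Suc_imp\<close>)
qed

lemmas C_k_mult = C_k_bilinear[OF bounded_bilinear_mult]
lemma C_k_affine:
  assumes "bounded_linear L" and "C_k k f" shows "C_k k (\<lambda>x. f (L x + a))"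
  using assms(2)
proof (induction k arbitrary: f)
  case 0
  have "continuous_on UNIV (\<lambda>x. L x + a)"
    by (intro continuous_intros linear_continuous_on assms(1))
  then show ?case using 0 continuous_on_compose2[of UNIV f UNIV] by auto
next
  case (Suc k)
  have L: "((\<lambda>x. L x + a) has_derivative L) (at x)" for x
    using bounded_linear_imp_has_derivative[OF assms(1)] by (auto intro!: derivative_eq_intros)
  show ?case
  proof (rule C_k_SucI[where f'="\<lambda>v x. dd (L v) f (L x + a)"])
    show "((\<lambda>x. f (L x + a)) has_derivative (\<lambda>v. dd (L v) f (L x + a))) (at x)" for x
      using has_derivative_compose[OF L, of f "\<lambda>v. dd v f (L x + a)"] C_k_has_derivative[OF Suc.prems]
      by auto
  qed (use Suc in \<open>auto intro: C_k_dd\<close>)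
qed

lemma C_k_linear: "bounded_linear L \<Longrightarrow> C_k k L"
proof (cases k)
  case 0
  then show "bounded_linear L \<Longrightarrow> ?thesis"
    by (simp add: linear_continuous_on)
next
  case (Suc m)
  then show "bounded_linear L \<Longrightarrow> ?thesis"
    by (auto intro!: C_k_SucI[where f'="\<lambda>v x. L v"] C_k_const intro: bounded_linear_imp_has_derivative)
qed

lemma dd_bounded_linear:
  assumes "bounded_linear L" "f differentiable (at x)" shows "dd v (\<lambda>x. L (f x)) x = L (dd v f x)"
  by (rule dd_eq[OF bounded_linear.has_derivative[OF assms(1) has_derivative_dd[OF assms(2)]]])

lemma dd_bilinear:
  assumes "bounded_bilinear B" "f differentiable (at x)" "g differentiable (at x)"
  shows "dd v (\<lambda>x. B (f x) (g x)) x = B (f x) (dd v g x) + B (dd v f x) (g x)"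
  by (rule dd_eq[OF bounded_bilinear.FDERIV[OF assms(1) has_derivative_dd has_derivative_dd]]) (use assms in auto)

lemma dd_add:
  assumes "f differentiable (at x)" "g differentiable (at x)"
  shows "dd v (\<lambda>x. f x + g x) x = dd v f x + dd v g x"
  by (rule dd_eq[OF has_derivative_add[OF has_derivative_dd has_derivative_dd]]) (use assms in auto)

lemma dd_affine:
  assumes "bounded_linear L" "f differentiable (at (L x + a))"
  shows "dd v (\<lambda>x. f (L x + a)) x = dd (L v) f (L x + a)"
proof -
  have L: "((\<lambda>x. L x + a) has_derivative L) (at x)"
    using bounded_linear_imp_has_derivative[OF assms(1)] by (auto intro!: derivative_eq_intros)
  show ?thesis
    by (rule dd_eq[OF has_derivative_compose[OF L has_derivative_dd[OF assms(2)]]])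
qed

lemma linear_dd: "f differentiable (at x) \<Longrightarrow> linear (\<lambda>v. dd v f x)"
  using has_derivative_linear has_derivative_dd by blast

lemma dd_outside:
  assumes "\<And>x. R < norm x \<Longrightarrow> f x = 0" "R < norm x" shows "dd v f x = 0"
proof -
  have "open {x. R < norm x}" by (intro open_Collect_less continuous_intros)
  then have "(f has_derivative (\<lambda>v. 0)) (at x)"
    using has_derivative_transform_within_open[of "\<lambda>x. 0" "\<lambda>v. 0" x UNIV "{x. R < norm x}" f] assms
    by auto
  then show ?thesis by (rule dd_eq)
qed

text \<open>Two applications of the mean value theorem, first in direction \<open>v\<close> to a
  difference of values of \<open>f\<close>, then in direction \<open>w\<close> to
  \<open>dd v f\<close>. The left-hand side is symmetric in \<open>v\<close> and \<open>w\<close>,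
  so exchanging them expresses the same number through \<open>dd v (dd w f)\<close>.\<close>

lemma second_difference:
  fixes f :: "'a::real_normed_vector \<Rightarrow> real"
  assumes "C_k 2 f" and "h > 0"
  shows "\<exists>s t. 0 < s \<and> s < h \<and> 0 < t \<and> t < h \<and>
    f (x + h *\<^sub>R v + h *\<^sub>R w) - f (x + h *\<^sub>R v) - f (x + h *\<^sub>R w) + f x
      = h\<^sup>2 * dd w (dd v f) (x + s *\<^sub>R v + t *\<^sub>R w)"
proof -
  have f: "(f has_derivative (\<lambda>v. dd v f y)) (at y)" for y
    using assms by (auto intro: C_k_has_derivative simp: numeral_2_eq_2)
  have g: "(dd v f has_derivative (\<lambda>w. dd w (dd v f) y)) (at y)" for y
    using assms by (auto intro!: C_k_has_derivative[of 0] C_k_dd simp: numeral_2_eq_2 simp del: C_k.simps)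
  have line: "((\<lambda>s. k (y + s *\<^sub>R u)) has_real_derivative dd u k (y + s *\<^sub>R u)) (at s)"
    if "(k has_derivative (\<lambda>v. dd v k (y + s *\<^sub>R u))) (at (y + s *\<^sub>R u))"
    for k :: "'a \<Rightarrow> real" and y u s
  proof -
    have "((\<lambda>s. y + s *\<^sub>R u) has_derivative (\<lambda>s. s *\<^sub>R u)) (at s)"
      by (auto intro!: derivative_eq_intros)
    from has_derivative_compose[OF this that]
    show ?thesis
      by (simp add: has_field_derivative_def linear_scale[OF has_derivative_linear[OF that]] mult_commute_abs)
  qed
  let ?p = "\<lambda>s. f (x + h *\<^sub>R w + s *\<^sub>R v) - f (x + s *\<^sub>R v)"
  have "\<exists>s. 0 < s \<and> s < h \<and> ?p h - ?p 0 = (h - 0) * (dd v f (x + h *\<^sub>R w + s *\<^sub>R v) - dd v f (x + s *\<^sub>R v))"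
    by (intro MVT2 assms DERIV_diff line f)
  then obtain s where s: "0 < s" "s < h"
    "?p h - ?p 0 = h * (dd v f (x + h *\<^sub>R w + s *\<^sub>R v) - dd v f (x + s *\<^sub>R v))" by auto
  have "\<exists>t. 0 < t \<and> t < h \<and> dd v f (x + s *\<^sub>R v + h *\<^sub>R w) - dd v f (x + s *\<^sub>R v + 0 *\<^sub>R w)
     = (h - 0) * dd w (dd v f) (x + s *\<^sub>R v + t *\<^sub>R w)"
    by (intro MVT2 assms line g)
  then obtain t where t: "0 < t" "t < h"
    "dd v f (x + h *\<^sub>R w + s *\<^sub>R v) - dd v f (x + s *\<^sub>R v) = h * dd w (dd v f) (x + s *\<^sub>R v + t *\<^sub>R w)"
    by (auto simp: algebra_simps)
  show ?thesis
    using s t by (intro exI[of _ s] exI[of _ t]) (auto simp: algebra_simps power2_eq_square)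
qed

lemma dd_commute_real:
  fixes f :: "'a::real_normed_vector \<Rightarrow> real"
  assumes "C_k 2 f" shows "dd w (dd v f) x = dd v (dd w f) x"
proof (rule ccontr)
  assume ne: "dd w (dd v f) x \<noteq> dd v (dd w f) x"
  define e where "e = \<bar>dd w (dd v f) x - dd v (dd w f) x\<bar> / 2"
  have e: "e > 0" using ne by (simp add: e_def)
  have c: "continuous_on UNIV (dd a (dd b f))" for a b
    using assms by (auto intro!: C_k_dd C_k_continuous[of 0] simp: numeral_2_eq_2 simp del: C_k.simps)
  obtain d where d: "d > 0" "\<And>y. dist y x < d \<Longrightarrow> dist (dd w (dd v f) y) (dd w (dd v f) x) < e"
    using c[of w v] e unfolding continuous_on_iff by blast
  obtain d' where d': "d' > 0" "\<And>y. dist y x < d' \<Longrightarrow> dist (dd v (dd w f) y) (dd v (dd w f) x) < e"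
    using c[of v w] e unfolding continuous_on_iff by blast
  \<comment> \<open>Small enough that the intermediate points of both mean value formulas lie within
    \<open>min d d'\<close> of \<open>x\<close>; the summand 1 keeps the denominator positive when
    \<open>v\<close> and \<open>w\<close> vanish.\<close>
  define h where "h = min d d' / (norm v + norm w + 1)"
  have n: "norm v + norm w + 1 > 0" by (smt (verit) norm_ge_zero)
  have h: "h > 0" unfolding h_def using d d' n by auto
  have near: "dist (x + s *\<^sub>R a + t *\<^sub>R b) x < min d d'"
    if "0 < s" "s < h" "0 < t" "t < h" "norm a + norm b = norm v + norm w" for s t a b
  proof -
    have "dist (x + s *\<^sub>R a + t *\<^sub>R b) x \<le> s * norm a + t * norm b"
      using norm_triangle_ineq[of "s *\<^sub>R a" "t *\<^sub>R b"] that by (auto simp: dist_norm)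
    also have "\<dots> \<le> h * norm a + h * norm b" using that by (intro add_mono mult_right_mono) auto
    also have "\<dots> < h * (norm v + norm w + 1)" using that h by (simp add: algebra_simps flip: that(5))
    also have "\<dots> = min d d'" using n by (simp add: h_def)
    finally show ?thesis .
  qed
  obtain s t where 1: "0 < s" "s < h" "0 < t" "t < h"
    "f (x + h *\<^sub>R v + h *\<^sub>R w) - f (x + h *\<^sub>R v) - f (x + h *\<^sub>R w) + f x
      = h\<^sup>2 * dd w (dd v f) (x + s *\<^sub>R v + t *\<^sub>R w)"
    using second_difference[OF assms h] by blast
  obtain s' t' where 2: "0 < s'" "s' < h" "0 < t'" "t' < h"
    "f (x + h *\<^sub>R w + h *\<^sub>R v) - f (x + h *\<^sub>R w) - f (x + h *\<^sub>R v) + f x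
      = h\<^sup>2 * dd v (dd w f) (x + s' *\<^sub>R w + t' *\<^sub>R v)"
    using second_difference[OF assms h] by blast
  have "h\<^sup>2 * dd w (dd v f) (x + s *\<^sub>R v + t *\<^sub>R w) = h\<^sup>2 * dd v (dd w f) (x + s' *\<^sub>R w + t' *\<^sub>R v)"
    using 1(5) 2(5) by (simp add: algebra_simps)
  then have eq: "dd w (dd v f) (x + s *\<^sub>R v + t *\<^sub>R w) = dd v (dd w f) (x + s' *\<^sub>R w + t' *\<^sub>R v)"
    using h by simp
  have "dist (dd w (dd v f) (x + s *\<^sub>R v + t *\<^sub>R w)) (dd w (dd v f) x) < e"
    by (rule d(2)) (use near[OF 1(1-4), of v w] in auto)
  moreover have "dist (dd v (dd w f) (x + s' *\<^sub>R w + t' *\<^sub>R v)) (dd v (dd w f) x) < e"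
    by (rule d'(2)) (use near[OF 2(1-4), of w v] in auto)
  ultimately show False using eq unfolding e_def dist_real_def by (simp add: field_simps abs_if split: if_splits)
qed

lemma dd_commute:
  fixes f :: "'a::real_normed_vector \<Rightarrow> 'b::euclidean_space"
  assumes "C_k 2 f" shows "dd w (dd v f) x = dd v (dd w f) x"
proof (rule euclidean_eqI)
  fix b :: 'b
  have bl: "bounded_linear (\<lambda>y. y \<bullet> b)" by (rule bounded_linear_inner_left)
  have f: "C_k (Suc (Suc 0)) f" using assms by (simp add: numeral_2_eq_2 del: C_k.simps)
  have d: "f differentiable (at y)" "dd u f differentiable (at y)" for y u
    using f by (auto simp: C_k_Suc simp del: C_k.simps)
  have eq: "dd u (\<lambda>x. f x \<bullet> b) = (\<lambda>x. dd u f x \<bullet> b)" for u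
    using dd_bounded_linear[OF bl d(1)] by auto
  have eq2: "dd u' (dd u (\<lambda>x. f x \<bullet> b)) x = dd u' (dd u f) x \<bullet> b" for u u'
    unfolding eq using dd_bounded_linear[OF bl d(2)] by auto
  show "dd w (dd v f) x \<bullet> b = dd v (dd w f) x \<bullet> b"
    using dd_commute_real[OF C_k_bounded_linear[OF bl assms], of w v x] by (simp add: eq2)
qed

section \<open>Functions of compact support: bounds and difference quotients\<close>

lemma continuous_supp_bounded:
  fixes f :: "'a::euclidean_space \<Rightarrow> 'b::real_normed_vector"
  assumes "continuous_on UNIV f" "\<And>x. R < norm x \<Longrightarrow> f x = 0"
  obtains B where "B > 0" "\<And>x. norm (f x) \<le> B"
proof -
  have "compact (f ` cball 0 R)"
    using assms(1) by (intro compact_continuous_image) (auto intro: continuous_on_subset)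
  then obtain B where B: "B > 0" "\<And>y. y \<in> f ` cball 0 R \<Longrightarrow> norm y \<le> B"
    by (meson bounded_pos compact_imp_bounded)
  have "norm (f x) \<le> B" for x
    using B assms(2)[of x] by (cases "norm x \<le> R") auto
  with B show ?thesis using that by blast
qed

lemma continuous_supp_integrable:
  fixes f :: "'a::euclidean_space \<Rightarrow> 'b::euclidean_space"
  assumes "continuous_on UNIV f" "\<And>x. R < norm x \<Longrightarrow> f x = 0"
  shows "integrable lborel f" "integrable lebesgue f"
proof -
  have "integrable lborel (\<lambda>x. indicator (cball 0 R) x *\<^sub>R f x)"
    using assms(1) by (intro borel_integrable_compact) (auto intro: continuous_on_subset)
  also have "(\<lambda>x. indicator (cball 0 R) x *\<^sub>R f x) = f"
    using assms(2) by (force simp: indicator_def fun_eq_iff)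
  finally show *: "integrable lborel f" .
  then show "integrable lebesgue f"
    by (simp add: integrable_completion borel_measurable_integrable)
qed

text \<open>Derivatives along the basis are continuous with compact support, hence bounded;
  linearity in the direction extends the bound to all \<open>v\<close>, and the mean value
  inequality gives the Lipschitz bound with the same constant.\<close>

lemma C1_supp_lipschitz:
  fixes f :: "'a::euclidean_space \<Rightarrow> 'b::real_normed_vector"
  assumes "C_k (Suc 0) f" "\<And>x. R < norm x \<Longrightarrow> f x = 0"
  obtains B where "B > 0" "\<And>x v. norm (dd v f x) \<le> B * norm v" "\<And>x y. norm (f x - f y) \<le> B * norm (x - y)"
proof -
  have "\<exists>B>0. \<forall>x. norm (dd b f x) \<le> B" for b
    by (rule continuous_supp_bounded[of "dd b f" R])
      (use C_k_dd[OF assms(1)] dd_outside[OF assms(2)] in auto)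
  then obtain B where B: "\<And>b. B b > 0" "\<And>b x. norm (dd b f x) \<le> B b" by metis
  define C where "C = (\<Sum>b\<in>Basis. B b) + 1"
  have C0: "C > 0" unfolding C_def using B(1) by (intro add_nonneg_pos sum_nonneg) (auto intro: less_imp_le)
  have C: "norm (dd v f x) \<le> C * norm v" for x v
  proof -
    have lin: "linear (\<lambda>v. dd v f x)" using assms(1) by (intro linear_dd) (auto simp: C_k_Suc simp del: C_k.simps)
    have "dd v f x = (\<Sum>b\<in>Basis. (v \<bullet> b) *\<^sub>R dd b f x)"
      by (subst euclidean_representation[symmetric, of v]) (simp only: linear_sum[OF lin] linear_scale[OF lin])
    also have "norm \<dots> \<le> (\<Sum>b\<in>Basis. norm v * B b)"
      by (intro sum_norm_le) (auto intro!: mult_mono B Basis_le_norm)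
    also have "\<dots> \<le> C * norm v" by (simp add: C_def sum_distrib_left algebra_simps)
    finally show ?thesis .
  qed
  have "norm (f x - f y) \<le> C * norm (x - y)" for x y
  proof (rule differentiable_bound[of UNIV f "\<lambda>x v. dd v f x"])
    show "(f has_derivative (\<lambda>v. dd v f x)) (at x within UNIV)" for x
      using C_k_has_derivative[OF assms(1)] by simp
    show "onorm (\<lambda>v. dd v f x) \<le> C" for x
      by (rule onorm_le) (use C in auto)
  qed auto
  with C C0 show ?thesis using that by blast
qed

text \<open>The data for dominated convergence of difference quotients: translation by at most
  \<open>norm v\<close> keeps the support in the ball of radius \<open>R + norm v\<close>, on which
  the Lipschitz bound is a majorant independent of \<open>n\<close>.\<close>

lemma difference_quotients:
  fixes f :: "'a::euclidean_space \<Rightarrow> 'b::real_normed_vector" and v :: 'a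
  assumes "C_k (Suc 0) f" "\<And>x. R < norm x \<Longrightarrow> f x = 0"
  defines "q \<equiv> \<lambda>n x. real (Suc n) *\<^sub>R (f (x + (1 / real (Suc n)) *\<^sub>R v) - f x)"
  obtains B where "B > 0" "\<And>n x. norm (q n x) \<le> indicator (cball 0 (R + norm v)) x *\<^sub>R (B * norm v)"
    "\<And>x. (\<lambda>n. q n x) \<longlonglongrightarrow> dd v f x"
proof -
  obtain B where B: "B > 0" "\<And>x v. norm (dd v f x) \<le> B * norm v" "\<And>x y. norm (f x - f y) \<le> B * norm (x - y)"
    using C1_supp_lipschitz[OF assms(1,2)] by blast
  have bound: "norm (q n x) \<le> indicator (cball 0 (R + norm v)) x *\<^sub>R (B * norm v)" for n x
  proof (cases "norm x \<le> R + norm v")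
    case True
    have "norm (q n x) = real (Suc n) * norm (f (x + (1 / real (Suc n)) *\<^sub>R v) - f x)" by (simp add: q_def)
    also have "\<dots> \<le> real (Suc n) * (B * norm (x + (1 / real (Suc n)) *\<^sub>R v - x))"
      by (intro mult_left_mono B) auto
    also have "\<dots> = B * norm v" by (simp add: field_simps)
    finally show ?thesis using True by simp
  next
    case False
    have "norm ((1 / real (Suc n)) *\<^sub>R v) \<le> norm v" by (simp add: divide_le_eq mult_le_cancel_left1)
    then have "norm (x + (1 / real (Suc n)) *\<^sub>R v) > R"
      using False norm_diff_ineq[of x "(1 / real (Suc n)) *\<^sub>R v"] by linarith
    moreover have "norm x > R" using False norm_ge_zero[of v] by linarith
    ultimately show ?thesis using False assms(2) by (simp add: q_def)
  qed
  moreover have "(\<lambda>n. q n x) \<longlonglongrightarrow> dd v f x" for x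
  proof -
    have l: "((\<lambda>s. x + s *\<^sub>R v) has_derivative (\<lambda>s. s *\<^sub>R v)) (at 0)"
      by (auto intro!: derivative_eq_intros)
    have k: "(f has_derivative (\<lambda>v. dd v f x)) (at (x + 0 *\<^sub>R v))"
      using C_k_has_derivative[OF assms(1)] by simp
    have "((\<lambda>t. f (x + t *\<^sub>R v)) has_derivative (\<lambda>t. t *\<^sub>R dd v f x)) (at 0)"
      using has_derivative_compose[OF l k] by (simp add: linear_scale[OF has_derivative_linear[OF k]])
    then have lim: "((\<lambda>h. norm (f (x + h *\<^sub>R v) - f x - h *\<^sub>R dd v f x) / norm h) \<longlongrightarrow> 0) (at 0)"
      by (simp add: has_derivative_at)
    have "filterlim (\<lambda>n. 1 / real (Suc n)) (at 0) sequentially"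
      by (rule filterlim_atI) (use LIMSEQ_Suc[OF lim_1_over_n] in auto)
    from filterlim_compose[OF lim this]
    have "(\<lambda>n. norm (f (x + (1 / real (Suc n)) *\<^sub>R v) - f x - (1 / real (Suc n)) *\<^sub>R dd v f x)
        / norm (1 / real (Suc n))) \<longlonglongrightarrow> 0" .
    also have "(\<lambda>n. norm (f (x + (1 / real (Suc n)) *\<^sub>R v) - f x - (1 / real (Suc n)) *\<^sub>R dd v f x)
        / norm (1 / real (Suc n))) = (\<lambda>n. norm (q n x - dd v f x))"
    proof
      fix n
      have "q n x - dd v f x
        = real (Suc n) *\<^sub>R (f (x + (1 / real (Suc n)) *\<^sub>R v) - f x - (1 / real (Suc n)) *\<^sub>R dd v f x)"
        by (simp add: q_def algebra_simps)
      then show "norm (f (x + (1 / real (Suc n)) *\<^sub>R v) - f x - (1 / real (Suc n)) *\<^sub>R dd v f x)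
        / norm (1 / real (Suc n)) = norm (q n x - dd v f x)"
        by (simp del: of_nat_Suc)
    qed
    finally show "(\<lambda>n. q n x) \<longlonglongrightarrow> dd v f x"
      by (simp add: LIM_zero_iff tendsto_norm_zero_iff)
  qed
  ultimately show ?thesis using B(1) that by blast
qed

text \<open>Differentiating the translation-invariant integral under the integral sign.\<close>

lemma integral_dd_eq_0:
  fixes f :: "'a::euclidean_space \<Rightarrow> 'b::euclidean_space"
  assumes "C_k (Suc 0) f" "\<And>x. R < norm x \<Longrightarrow> f x = 0"
  shows "integral\<^sup>L lborel (dd v f) = 0"
proof -
  let ?q = "\<lambda>n x. real (Suc n) *\<^sub>R (f (x + (1 / real (Suc n)) *\<^sub>R v) - f x)"
  obtain B where B: "B > 0" "\<And>n x. norm (?q n x) \<le> indicator (cball 0 (R + norm v)) x *\<^sub>R (B * norm v)"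
    "\<And>x. (\<lambda>n. ?q n x) \<longlonglongrightarrow> dd v f x"
    using difference_quotients[OF assms] by blast
  have cf: "continuous_on UNIV f" by (rule C_k_continuous[OF assms(1)])
  have fi: "integrable lborel f" by (rule continuous_supp_integrable[OF cf assms(2)])
  have shift: "has_bochner_integral lborel (\<lambda>x. f (x + c)) (integral\<^sup>L lborel f)" for c
  proof -
    have "has_bochner_integral (distr lborel borel ((+) c)) f (integral\<^sup>L lborel f)"
      using fi by (simp add: lborel_distr_plus has_bochner_integral_integrable)
    moreover have "f \<in> borel_measurable borel" using borel_measurable_integrable[OF fi] by simp
    ultimately show ?thesis
      by (simp add: has_bochner_integral_iff integrable_distr_eq integral_distr add.commute)
  qed
  have q0: "integral\<^sup>L lborel (?q n) = 0" for n
    using shift by (simp add: has_bochner_integral_iff fi)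
  have "(\<lambda>n. integral\<^sup>L lborel (?q n)) \<longlonglongrightarrow> integral\<^sup>L lborel (dd v f)"
  proof (rule integral_dominated_convergence[where w="\<lambda>x. indicator (cball 0 (R + norm v)) x *\<^sub>R (B * norm v)"])
    show "dd v f \<in> borel_measurable lborel"
      using C_k_continuous[OF C_k_dd[OF assms(1)]] by (simp add: borel_measurable_continuous_onI)
    have "f \<in> borel_measurable borel" using cf by (simp add: borel_measurable_continuous_onI)
    then show "?q n \<in> borel_measurable lborel" for n by simp
    show "integrable lborel (\<lambda>x. indicator (cball 0 (R + norm v)) x *\<^sub>R (B * norm v))"
      by (rule borel_integrable_compact) auto
    show "AE x in lborel. norm (?q n x) \<le> indicator (cball 0 (R + norm v)) x *\<^sub>R (B * norm v)" for n
      by (rule AE_I2) (rule B(2))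
    show "AE x in lborel. (\<lambda>n. ?q n x) \<longlonglongrightarrow> dd v f x" by (rule AE_I2) (rule B(3))
  qed
  then show ?thesis using q0 LIMSEQ_unique by (simp add: LIMSEQ_const_iff)
qed

section \<open>Cut-off functions\<close>

text \<open>\<open>flat 0\<close> is the standard function \<open>exp (- 1 / t)\<close> extended by
  0. The powers of \<open>1 / t\<close> make the linear span of the family closed under
  differentiation, so one induction gives smoothness of every order.\<close>

definition flat :: "nat \<Rightarrow> real \<Rightarrow> real" where
  "flat n t = (if t > 0 then (1 / t) ^ n * exp (- 1 / t) else 0)"

lemma flat_tendsto_0: "(flat n \<longlongrightarrow> 0) (at 0)"
proof -
  have "((\<lambda>x::real. x ^ n / exp x) \<longlongrightarrow> 0) at_top" by (rule tendsto_power_div_exp_0)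
  then have "((\<lambda>t. (inverse t) ^ n / exp (inverse t)) \<longlongrightarrow> 0) (at_right (0::real))"
    by (rule filterlim_compose[OF _ filterlim_inverse_at_top_right])
  then have "(flat n \<longlongrightarrow> 0) (at_right 0)"
  proof (rule Lim_transform_eventually)
    show "\<forall>\<^sub>F t in at_right 0. inverse t ^ n / exp (inverse t) = flat n t"
      using eventually_at_right_less[of "0::real"]
      by eventually_elim (simp add: flat_def exp_minus field_simps inverse_eq_divide)
  qed
  moreover have "(flat n \<longlongrightarrow> 0) (at_left 0)"
    by (rule tendsto_eventually) (auto simp: flat_def eventually_at_filter)
  ultimately show ?thesis by (simp add: filterlim_split_at)
qed

text \<open>At 0 the difference quotient of \<open>flat n\<close> is \<open>flat (n + 1)\<close>,
  which tends to 0; for positive \<open>t\<close> the formula is the product rule.\<close>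

lemma DERIV_flat: "(flat n has_real_derivative flat (n + 2) t - real n * flat (n + 1) t) (at t)"
proof -
  consider "t > 0" | "t < 0" | "t = 0" by linarith
  then show ?thesis
  proof cases
    case 1
    have "((\<lambda>t. (1 / t) ^ n * exp (- 1 / t)) has_real_derivative flat (n + 2) t - real n * flat (n + 1) t) (at t)"
    proof (cases n)
      case 0
      then show ?thesis
        using 1 by (auto intro!: derivative_eq_intros simp: flat_def field_simps power2_eq_square)
    next
      case (Suc m)
      have d: "((\<lambda>t. 1 / t) has_real_derivative - 1 / t\<^sup>2) (at t)"
        "((\<lambda>t. exp (- 1 / t)) has_real_derivative exp (- 1 / t) / t\<^sup>2) (at t)"
        using 1 by (auto intro!: derivative_eq_intros simp: field_simps power2_eq_square)
      show ?thesis unfolding Suc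
        by (rule DERIV_cong[OF DERIV_mult[OF DERIV_power_Suc[OF d(1)] d(2)]])
          (use 1 in \<open>auto simp: flat_def field_simps power2_eq_square\<close>)
    qed
    then show ?thesis
      by (rule has_field_derivative_transform_within_open[of _ _ _ "{0<..}"]) (use 1 in \<open>auto simp: flat_def\<close>)
  next
    case 2
    have "((\<lambda>t. 0) has_real_derivative flat (n + 2) t - real n * flat (n + 1) t) (at t)"
      using 2 by (simp add: flat_def)
    then show ?thesis
      by (rule has_field_derivative_transform_within_open[of _ _ _ "{..<0}"]) (use 2 in \<open>auto simp: flat_def\<close>)
  next
    case 3
    have "(flat n has_real_derivative 0) (at 0)"
      unfolding has_field_derivative_iff
    proof (rule Lim_transform_eventually[OF flat_tendsto_0[of "n + 1"]])
      show "\<forall>\<^sub>F t in at 0. flat (n + 1) t = (flat n t - flat n 0) / (t - 0)"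
        by (auto simp: eventually_at_filter flat_def)
    qed
    then show ?thesis using 3 by (simp add: flat_def)
  qed
qed

definition bump :: "real \<Rightarrow> 'a::euclidean_space \<Rightarrow> real" where
  "bump e x = flat 0 (1 - (x \<bullet> x) / e\<^sup>2)"

text \<open>The induction runs over all \<open>n\<close> at once, since differentiation raises the
  index. The inner function is quadratic, so its derivative is linear in \<open>x\<close> and of
  every class.\<close>

lemma C_k_flat: "C_k k (\<lambda>x::'a::euclidean_space. flat n (1 - (x \<bullet> x) / e\<^sup>2))"
proof (induction k arbitrary: n)
  case 0
  have "continuous_on UNIV (flat n)"
    by (auto intro: DERIV_isCont DERIV_flat simp: continuous_on_eq_continuous_at)
  then show ?case
    by (auto intro!: continuous_on_compose2[of UNIV "flat n"] continuous_intros simp: divide_inverse)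
next
  case (Suc k)
  let ?q = "\<lambda>x::'a. 1 - (x \<bullet> x) / e\<^sup>2"
  show ?case
  proof (rule C_k_SucI[where f'="\<lambda>v x. (flat (n + 2) (?q x) - real n * flat (n + 1) (?q x)) * (x \<bullet> (- 2 / e\<^sup>2) *\<^sub>R v)"])
    fix x
    have "(?q has_derivative (\<lambda>v. x \<bullet> (- 2 / e\<^sup>2) *\<^sub>R v)) (at x)"
      by (auto intro!: derivative_eq_intros simp: inner_commute divide_inverse algebra_simps)
    from has_derivative_compose[OF this, of "flat n"] DERIV_flat[of n "?q x"]
    show "((\<lambda>x. flat n (?q x)) has_derivative
      (\<lambda>v. (flat (n + 2) (?q x) - real n * flat (n + 1) (?q x)) * (x \<bullet> (- 2 / e\<^sup>2) *\<^sub>R v))) (at x)"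
      unfolding has_field_derivative_def by blast
  next
    fix v :: 'a
    have "C_k k (\<lambda>x. x \<bullet> (- 2 / e\<^sup>2) *\<^sub>R v)" by (rule C_k_linear) (rule bounded_linear_inner_left)
    then show "C_k k (\<lambda>x. (flat (n + 2) (?q x) - real n * flat (n + 1) (?q x)) * (x \<bullet> (- 2 / e\<^sup>2) *\<^sub>R v))"
      using Suc.IH by (intro C_k_mult C_k_diff C_k_const)
  qed
qed

lemma C_k_bump: "C_k k (bump e)"
  unfolding bump_def by (rule C_k_flat)

lemma bump_nonneg: "0 \<le> bump e x"
  by (simp add: bump_def flat_def)

lemma bump_outside:
  assumes "e > 0" "e < norm x" shows "bump e x = 0"
proof -
  have "e\<^sup>2 < x \<bullet> x" using assms by (simp add: dot_square_norm power_strict_mono)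
  then show ?thesis using assms by (simp add: bump_def flat_def field_simps)
qed

lemma integral_bump_pos:
  assumes "e > 0" shows "integral\<^sup>L lborel (bump e :: 'a::euclidean_space \<Rightarrow> real) > 0"
proof -
  have i: "integrable lborel (bump e :: 'a \<Rightarrow> real)"
    using continuous_supp_integrable[OF C_k_continuous[OF C_k_bump] bump_outside[OF assms]] by blast
  \<comment> \<open>On the ball of half the radius the argument of \<open>flat 0\<close> exceeds
    3/4, so the bump is at least \<open>exp (- 4 / 3)\<close> there.\<close>
  let ?g = "\<lambda>x::'a. exp (- 4 / 3) * indicat_real (ball 0 (e / 2)) x"
  have "emeasure lborel (ball (0::'a) (e / 2)) < \<infinity>" by (rule emeasure_bounded_finite) simp
  then have ig: "integrable lborel ?g" by (intro integrable_mult_right) simp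
  have "0 < exp (- 4 / 3) * measure lborel (ball (0::'a) (e / 2))"
    using content_ball_pos[of "e / 2" "0::'a"] assms by simp
  also have "\<dots> = integral\<^sup>L lborel ?g" by simp
  also have "\<dots> \<le> integral\<^sup>L lborel (bump e :: 'a \<Rightarrow> real)"
  proof (rule integral_mono[OF ig i])
    fix x :: 'a
    show "?g x \<le> bump e x"
    proof (cases "norm x < e / 2")
      case True
      have "x \<bullet> x < (e / 2)\<^sup>2" using True by (simp add: dot_square_norm power_strict_mono)
      then have *: "1 - (x \<bullet> x) / e\<^sup>2 > 3 / 4" using assms by (simp add: field_simps power2_eq_square)
      then have "1 / (1 - (x \<bullet> x) / e\<^sup>2) \<le> 1 / (3 / 4)" by (intro divide_left_mono) auto
      then have "- 4 / 3 \<le> - 1 / (1 - (x \<bullet> x) / e\<^sup>2)" by simp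
      then have "exp (- 4 / 3) \<le> exp (- 1 / (1 - (x \<bullet> x) / e\<^sup>2))" by simp
      moreover have "1 - (x \<bullet> x) / e\<^sup>2 > 0" using * by linarith
      ultimately show ?thesis using True by (simp only: bump_def flat_def) simp
    qed (simp add: bump_nonneg)
  qed
  finally show ?thesis .
qed

definition mollifier :: "real \<Rightarrow> 'a::euclidean_space \<Rightarrow> real" where
  "mollifier e x = bump e x / integral\<^sup>L lborel (bump e :: 'a \<Rightarrow> real)"

lemma C_k_mollifier: "C_k k (mollifier e)"
proof -
  have "C_k k (\<lambda>x. bump e x * (1 / integral\<^sup>L lborel (bump e :: 'a \<Rightarrow> real)))"
    by (intro C_k_mult C_k_const C_k_bump)
  then show ?thesis by (simp add: mollifier_def[abs_def])
qed

lemma mollifier_nonneg: "0 \<le> mollifier e x"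
  unfolding mollifier_def by (intro divide_nonneg_nonneg bump_nonneg integral_nonneg_AE) (auto simp: bump_nonneg)

lemma mollifier_outside: "e > 0 \<Longrightarrow> e < norm x \<Longrightarrow> mollifier e x = 0"
  by (simp add: mollifier_def bump_outside)

lemma integral_mollifier:
  "e > 0 \<Longrightarrow> integral\<^sup>L lborel (mollifier e :: 'a::euclidean_space \<Rightarrow> real) = 1"
  using integral_bump_pos[of e, where 'a='a] by (simp add: mollifier_def[abs_def])

section \<open>Square integrable functions\<close>

definition sqint :: "'a measure \<Rightarrow> ('a \<Rightarrow> 'b::euclidean_space) set" where
  "sqint M = {f \<in> borel_measurable M. integrable M (\<lambda>x. (norm (f x))\<^sup>2)}"

text \<open>For complex values this is the real part of the Hermitian product. With real scalars one
  theory serves functions and forms, over Lebesgue as well as weighted measures.\<close>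

definition ip :: "'a measure \<Rightarrow> ('a \<Rightarrow> 'b::euclidean_space) \<Rightarrow> ('a \<Rightarrow> 'b) \<Rightarrow> real" where
  "ip M f g = (LINT x|M. f x \<bullet> g x)"

definition nrm :: "'a measure \<Rightarrow> ('a \<Rightarrow> 'b::euclidean_space) \<Rightarrow> real" where
  "nrm M f = sqrt (LINT x|M. (norm (f x))\<^sup>2)"

lemma sqint_measurable [measurable_dest]: "f \<in> sqint M \<Longrightarrow> f \<in> borel_measurable M"
  by (simp add: sqint_def)

lemma sqint_integrable: "f \<in> sqint M \<Longrightarrow> integrable M (\<lambda>x. (norm (f x))\<^sup>2)"
  by (simp add: sqint_def)

lemma nrm_nonneg [simp]: "0 \<le> nrm M f"
  by (simp add: nrm_def)

lemma nrm_power2: "(nrm M f)\<^sup>2 = (LINT x|M. (norm (f x))\<^sup>2)"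
  by (simp add: nrm_def)

lemma nrm_ip: "(nrm M f)\<^sup>2 = ip M f f"
  by (simp add: nrm_power2 ip_def dot_square_norm)

lemma sqint_mult_integrable:
  assumes "f \<in> sqint M" "g \<in> sqint M" shows "integrable M (\<lambda>x. norm (f x) * norm (g x))"
proof (rule Bochner_Integration.integrable_bound)
  show "integrable M (\<lambda>x. (norm (f x))\<^sup>2 + (norm (g x))\<^sup>2)"
    using assms by (auto intro: sqint_integrable)
  show "AE x in M. norm (norm (f x) * norm (g x)) \<le> norm ((norm (f x))\<^sup>2 + (norm (g x))\<^sup>2)"
  proof (intro AE_I2)
    fix x
    have "0 \<le> norm (f x) * norm (g x)" by simp
    then have "norm (f x) * norm (g x) \<le> (norm (f x))\<^sup>2 + (norm (g x))\<^sup>2"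
      using sum_squares_bound[of "norm (f x)" "norm (g x)"] by linarith
    then show "norm (norm (f x) * norm (g x)) \<le> norm ((norm (f x))\<^sup>2 + (norm (g x))\<^sup>2)" by simp
  qed
qed (use assms in measurable)

text \<open>Stated for an arbitrary bounded bilinear map, so that inner products, scalar
  multiplication and products with a conjugate are all instances.\<close>

lemma sqint_bilinear_integrable:
  assumes "bounded_bilinear B" "f \<in> sqint M" "g \<in> sqint M"
  shows "integrable M (\<lambda>x. B (f x) (g x) :: 'c::euclidean_space)"
proof -
  obtain K where K: "K > 0" "\<And>a b. norm (B a b) \<le> norm a * norm b * K"
    using bounded_bilinear.pos_bounded[OF assms(1)] by blast
  show ?thesis
  proof (rule Bochner_Integration.integrable_bound)
    show "integrable M (\<lambda>x. norm (f x) * norm (g x) * K)"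
      by (intro integrable_mult_left sqint_mult_integrable assms)
    have "continuous_on UNIV (\<lambda>p. B (fst p) (snd p))"
      by (rule bounded_bilinear.continuous_on[OF assms(1)]) (intro continuous_intros)+
    then have "(\<lambda>p. B (fst p) (snd p)) \<in> borel_measurable borel" by (rule borel_measurable_continuous_onI)
    moreover have "(\<lambda>x. (f x, g x)) \<in> M \<rightarrow>\<^sub>M borel"
      by (intro borel_measurable_Pair sqint_measurable assms)
    ultimately show "(\<lambda>x. B (f x) (g x)) \<in> borel_measurable M"
      using measurable_compose[of "\<lambda>x. (f x, g x)" M borel "\<lambda>p. B (fst p) (snd p)" borel] by simp
    show "AE x in M. norm (B (f x) (g x)) \<le> norm (norm (f x) * norm (g x) * K)"
      using K by (intro AE_I2) simp
  qed
qed

lemmas sqint_inner_integrable = sqint_bilinear_integrable[OF bounded_bilinear_inner]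

lemma sqintI:
  assumes "f \<in> borel_measurable M" "g \<in> borel_measurable M" "integrable M (\<lambda>x. (g x)\<^sup>2 :: real)"
    and "AE x in M. norm (f x) \<le> \<bar>g x\<bar>"
  shows "f \<in> sqint M"
  unfolding sqint_def mem_Collect_eq
proof (intro conjI assms(1) Bochner_Integration.integrable_bound[OF assms(3)])
  show "AE x in M. norm ((norm (f x))\<^sup>2) \<le> norm ((g x)\<^sup>2)"
    using assms(4) by eventually_elim (auto simp: power2_le_iff_abs_le abs_le_square_iff[symmetric])
qed (use assms(1) in measurable)

lemma sqint_mono:
  assumes "g \<in> sqint M" "f \<in> borel_measurable M" "AE x in M. norm (f x) \<le> norm (g x)"
  shows "f \<in> sqint M"
  by (rule sqintI[of f M "\<lambda>x. norm (g x)"]) (use assms sqint_integrable[of g M] in \<open>auto simp: sqint_measurable\<close>)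

lemma sqint_norm: "f \<in> sqint M \<Longrightarrow> (\<lambda>x. norm (f x)) \<in> sqint M"
  by (auto simp: sqint_def)

lemma sqint_scaleR: "f \<in> sqint M \<Longrightarrow> (\<lambda>x. c *\<^sub>R f x) \<in> sqint M"
  by (auto simp: sqint_def power_mult_distrib)

lemma sqint_add:
  assumes "f \<in> sqint M" "g \<in> sqint M" shows "(\<lambda>x. f x + g x) \<in> sqint M"
proof -
  have "(\<lambda>x. (norm (f x + g x))\<^sup>2) = (\<lambda>x. (norm (f x))\<^sup>2 + 2 * (f x \<bullet> g x) + (norm (g x))\<^sup>2)"
    by (simp add: power2_norm_eq_inner inner_simps inner_commute algebra_simps)
  then show ?thesis using assms sqint_inner_integrable[OF assms]
    by (auto simp: sqint_def)
qed

lemma sqint_diff: "f \<in> sqint M \<Longrightarrow> g \<in> sqint M \<Longrightarrow> (\<lambda>x. f x - g x) \<in> sqint M"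
  using sqint_add[of f M "\<lambda>x. (-1) *\<^sub>R g x"] sqint_scaleR[of g M "-1"] by simp

lemma sqint_0: "(\<lambda>x. 0) \<in> sqint M"
  by (simp add: sqint_def)

lemma sqint_sum: "(\<And>i. i \<in> I \<Longrightarrow> f i \<in> sqint M) \<Longrightarrow> (\<lambda>x. \<Sum>i\<in>I. f i x) \<in> sqint M"
  by (induction I rule: infinite_finite_induct) (auto intro: sqint_0 sqint_add)

lemma ip_commute: "ip M f g = ip M g f"
  by (simp add: ip_def inner_commute)

lemma ip_add_left:
  "f \<in> sqint M \<Longrightarrow> g \<in> sqint M \<Longrightarrow> h \<in> sqint M \<Longrightarrow> ip M (\<lambda>x. f x + g x) h = ip M f h + ip M g h"
  unfolding ip_def by (simp add: inner_simps sqint_inner_integrable)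

lemma ip_scaleR_left: "ip M (\<lambda>x. c *\<^sub>R f x) h = c * ip M f h"
  unfolding ip_def by simp

lemma ip_diff_left:
  "f \<in> sqint M \<Longrightarrow> g \<in> sqint M \<Longrightarrow> h \<in> sqint M \<Longrightarrow> ip M (\<lambda>x. f x - g x) h = ip M f h - ip M g h"
  unfolding ip_def by (simp add: inner_simps sqint_inner_integrable)

lemma nrm_scaleR: "nrm M (\<lambda>x. c *\<^sub>R f x) = \<bar>c\<bar> * nrm M f"
  by (simp add: nrm_def power_mult_distrib real_sqrt_mult)

lemma nrm_minus_commute: "nrm M (\<lambda>x. f x - g x) = nrm M (\<lambda>x. g x - f x)"
  by (simp add: nrm_def norm_minus_commute)

lemma nrm_add_power2:
  assumes "f \<in> sqint M" "g \<in> sqint M"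
  shows "(nrm M (\<lambda>x. f x + c *\<^sub>R g x))\<^sup>2 = (nrm M f)\<^sup>2 + 2 * c * ip M f g + c\<^sup>2 * (nrm M g)\<^sup>2"
proof -
  have "(nrm M (\<lambda>x. f x + c *\<^sub>R g x))\<^sup>2 = (LINT x|M. (norm (f x))\<^sup>2 + 2 * c * (f x \<bullet> g x) + c\<^sup>2 * (norm (g x))\<^sup>2)"
    unfolding nrm_power2
    by (intro Bochner_Integration.integral_cong refl)
      (simp add: power2_norm_eq_inner inner_simps inner_commute algebra_simps power2_eq_square[of c])
  then show ?thesis
    using assms by (simp add: nrm_power2 ip_def sqint_inner_integrable sqint_integrable)
qed

text \<open>At \<open>t = - b / (c + 1)\<close> the polynomial equals
  \<open>- t^2 * (c + 2)\<close>, which forces \<open>t = 0\<close>. This is the first-order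
  condition at a minimum, used for the Riesz representation and for the Rayleigh quotient.\<close>

lemma quadratic_nonneg_imp:
  assumes "\<And>t::real. 0 \<le> 2 * t * b + t\<^sup>2 * c" and "0 \<le> c" shows "b = 0"
proof -
  define t where "t = - b / (c + 1)"
  have b: "b = - t * (c + 1)" using assms(2) by (simp add: t_def)
  have "0 \<le> 2 * t * b + t\<^sup>2 * c" by (rule assms)
  also have "\<dots> = - (t\<^sup>2 * (c + 2))" unfolding b by (simp add: algebra_simps power2_eq_square)
  finally have "t\<^sup>2 * (c + 2) \<le> 0" by simp
  then have "t = 0" using assms(2) by (simp add: mult_le_0_iff)
  then show ?thesis by (simp add: b)
qed

lemma ip_Cauchy_Schwarz:
  assumes "f \<in> sqint M" "g \<in> sqint M" shows "\<bar>ip M f g\<bar> \<le> nrm M f * nrm M g"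
proof -
  have q: "0 \<le> (nrm M f)\<^sup>2 + 2 * t * ip M f g + t\<^sup>2 * (nrm M g)\<^sup>2" for t
    using nrm_add_power2[OF assms, of t] zero_le_power2 by metis
  show ?thesis
  proof (cases "nrm M g = 0")
    case True
    have "ip M f g = 0"
    proof (rule ccontr)
      \<comment> \<open>Without the quadratic term the polynomial in \<open>t\<close> is affine, so
        it takes negative values unless its slope vanishes.\<close>
      assume n: "ip M f g \<noteq> 0"
      have "0 \<le> (nrm M f)\<^sup>2 + 2 * (- ((nrm M f)\<^sup>2 + 1) / ip M f g) * ip M f g"
        using q[of "- ((nrm M f)\<^sup>2 + 1) / ip M f g"] True by simp
      also have "\<dots> = - (nrm M f)\<^sup>2 - 2" using n by simp
      finally show False by (smt (verit) zero_le_power2)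
    qed
    then show ?thesis by simp
  next
    case False
    then have p: "(nrm M g)\<^sup>2 > 0" by simp
    have "0 \<le> (nrm M f)\<^sup>2 - (ip M f g)\<^sup>2 / (nrm M g)\<^sup>2"
      using q[of "- ip M f g / (nrm M g)\<^sup>2"] False by (simp add: field_simps power2_eq_square)
    then have "(ip M f g)\<^sup>2 \<le> (nrm M f * nrm M g)\<^sup>2"
      using p by (simp add: field_simps power_mult_distrib)
    then show ?thesis by (simp add: abs_le_square_iff[symmetric] abs_mult)
  qed
qed

lemma sqint_mult_Cauchy_Schwarz:
  assumes "f \<in> sqint M" "g \<in> sqint M"
  shows "(LINT x|M. norm (f x) * norm (g x)) \<le> nrm M f * nrm M g"
  using ip_Cauchy_Schwarz[OF sqint_norm[OF assms(1)] sqint_norm[OF assms(2)]]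
  by (simp add: ip_def nrm_def)

lemma nrm_triangle:
  assumes "f \<in> sqint M" "g \<in> sqint M" shows "nrm M (\<lambda>x. f x + g x) \<le> nrm M f + nrm M g"
proof (rule power2_le_imp_le)
  show "(nrm M (\<lambda>x. f x + g x))\<^sup>2 \<le> (nrm M f + nrm M g)\<^sup>2"
    using nrm_add_power2[OF assms, of 1] ip_Cauchy_Schwarz[OF assms] by (simp add: power2_sum)
qed simp

lemma nrm_triangle_diff:
  assumes "f \<in> sqint M" "g \<in> sqint M" "h \<in> sqint M"
  shows "nrm M (\<lambda>x. f x - h x) \<le> nrm M (\<lambda>x. f x - g x) + nrm M (\<lambda>x. g x - h x)"
  using nrm_triangle[OF sqint_diff[OF assms(1,2)] sqint_diff[OF assms(2,3)]] by simp

lemma nrm_diff_abs: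
  assumes "f \<in> sqint M" "g \<in> sqint M"
  shows "\<bar>nrm M f - nrm M g\<bar> \<le> nrm M (\<lambda>x. f x - g x)"
  using nrm_triangle[OF sqint_diff[OF assms] assms(2)] nrm_triangle[OF sqint_diff[OF assms(2,1)] assms(1)]
  by (simp add: nrm_minus_commute[of M f g])

lemma nrm_mono:
  assumes "g \<in> sqint M" "f \<in> borel_measurable M" "AE x in M. norm (f x) \<le> norm (g x)"
  shows "nrm M f \<le> nrm M g"
  unfolding nrm_def
  by (intro real_sqrt_le_mono integral_mono_AE sqint_integrable assms sqint_mono[OF assms])
    (use assms(3) in \<open>auto elim!: eventually_mono intro: power_mono\<close>)

lemma nrm_tendsto:
  assumes "\<And>n. s n \<in> sqint M" "u \<in> sqint M" "(\<lambda>n. nrm M (\<lambda>x. s n x - u x)) \<longlonglongrightarrow> 0"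
  shows "(\<lambda>n. nrm M (s n)) \<longlonglongrightarrow> nrm M u"
proof (rule LIM_zero_cancel, rule tendsto_rabs_zero_cancel, rule Lim_null_comparison[OF _ assms(3)])
  show "\<forall>\<^sub>F n in sequentially. norm \<bar>nrm M (s n) - nrm M u\<bar> \<le> nrm M (\<lambda>x. s n x - u x)"
    using nrm_diff_abs[OF assms(1,2)] by simp
qed

lemma ip_tendsto:
  assumes "\<And>n. s n \<in> sqint M" "u \<in> sqint M" "(\<lambda>n. nrm M (\<lambda>x. s n x - u x)) \<longlonglongrightarrow> 0" "v \<in> sqint M"
  shows "(\<lambda>n. ip M (s n) v) \<longlonglongrightarrow> ip M u v"
proof (rule LIM_zero_cancel, rule Lim_null_comparison)
  show "\<forall>\<^sub>F n in sequentially. norm (ip M (s n) v - ip M u v) \<le> nrm M (\<lambda>x. s n x - u x) * nrm M v"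
    using ip_Cauchy_Schwarz[OF sqint_diff[OF assms(1,2)] assms(4)] assms
    by (simp add: ip_diff_left)
  show "(\<lambda>n. nrm M (\<lambda>x. s n x - u x) * nrm M v) \<longlonglongrightarrow> 0"
    using tendsto_mult_right[OF assms(3), of "nrm M v"] by simp
qed

text \<open>Square summability of the increments alone would not suffice; with the factor
  \<open>2 ^ k\<close> they are dominated by a geometric series of ratio
  \<open>1 / sqrt 2\<close>.\<close>

lemma Cauchy_of_geometric_square:
  fixes X :: "nat \<Rightarrow> 'b::euclidean_space"
  assumes "\<And>k. 2 ^ k * (norm (X (Suc k) - X k))\<^sup>2 \<le> S"
  shows "Cauchy X"
proof -
  have S: "S \<ge> 0" using assms[of 0] by (smt (verit) zero_le_power2 mult_nonneg_nonneg power_0)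
  have le: "norm (X (Suc k) - X k) \<le> sqrt S * (1 / sqrt 2) ^ k" for k
  proof (rule power2_le_imp_le)
    have eq: "(sqrt S * (1 / sqrt 2) ^ k)\<^sup>2 = S * (1 / 2) ^ k"
    proof -
      have "(sqrt 2 ^ k)\<^sup>2 = (2::real) ^ k" by (simp add: power2_eq_square flip: power_mult_distrib)
      then show ?thesis using S by (simp add: power_mult_distrib power_divide)
    qed
    show "(norm (X (Suc k) - X k))\<^sup>2 \<le> (sqrt S * (1 / sqrt 2) ^ k)\<^sup>2"
      unfolding eq using assms[of k] by (simp add: power_divide pos_le_divide_eq mult.commute)
  qed (use S in simp)
  have "summable (\<lambda>k. sqrt S * (1 / sqrt 2) ^ k)" by (intro summable_mult summable_geometric) simp
  then have "summable (\<lambda>k. X (Suc k) - X k)" by (rule summable_comparison_test'[of _ 0]) (use le in auto)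
  then have "convergent (\<lambda>n. (\<Sum>k<n. X (Suc k) - X k))" by (simp add: summable_iff_convergent)
  then have "convergent (\<lambda>n. (X n - X 0) + X 0)"
    unfolding sum_lessThan_telescope by (intro convergent_add convergent_const)
  then show ?thesis by (simp add: convergent_Cauchy)
qed

text \<open>The Riesz-Fischer theorem. Along a subsequence with increments below
  \<open>(1 / 2) ^ k\<close> the weighted sum of squared increments has finite integral, so the
  subsequence converges almost everywhere; Fatou's lemma then compares the whole sequence with the
  limit in norm.\<close>

lemma sqint_complete:
  assumes s: "\<And>n. s n \<in> sqint M"
    and C: "\<And>e. e > 0 \<Longrightarrow> \<exists>N. \<forall>m\<ge>N. \<forall>n\<ge>N. nrm M (\<lambda>x. s m x - s n x) < e"
  obtains u where "u \<in> sqint M" "(\<lambda>n. nrm M (\<lambda>x. s n x - u x)) \<longlonglongrightarrow> 0"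
proof -
  have "\<forall>k. \<exists>N. \<forall>m\<ge>N. \<forall>n\<ge>N. nrm M (\<lambda>x. s m x - s n x) < (1 / 2) ^ k" using C by simp
  then obtain N where N: "\<And>k m n. m \<ge> N k \<Longrightarrow> n \<ge> N k \<Longrightarrow> nrm M (\<lambda>x. s m x - s n x) < (1 / 2) ^ k"
    by metis
  \<comment> \<open>The sum dominates every \<open>N i\<close> up to \<open>k\<close>; the summand
    \<open>k\<close> makes the indices tend to infinity, as the Fatou step requires.\<close>
  define r where "r k = (\<Sum>i\<le>k. N i) + k" for k
  have r: "r k \<ge> N k" "r k \<ge> k" "r (Suc k) \<ge> N k" for k
  proof -
    show "r k \<ge> N k" unfolding r_def using member_le_sum[of k "{..k}" N] by simp
    then show "r (Suc k) \<ge> N k" unfolding r_def by simp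
  qed (simp add: r_def)
  let ?d = "\<lambda>k x. s (r (Suc k)) x - s (r k) x"
  have dm: "?d k \<in> sqint M" for k by (intro sqint_diff s)
  have sm [measurable]: "s n \<in> borel_measurable M" for n using s by (simp add: sqint_def)
  have nn: "(\<integral>\<^sup>+x. ennreal ((norm (f x))\<^sup>2) \<partial>M) = ennreal ((nrm M f)\<^sup>2)" if "f \<in> sqint M"
    for f :: "'a \<Rightarrow> 'b"
    unfolding nrm_power2 by (rule nn_integral_eq_integral[OF sqint_integrable[OF that]]) simp
  have "(\<integral>\<^sup>+x. (\<Sum>k. ennreal (2 ^ k * (norm (?d k x))\<^sup>2)) \<partial>M) = (\<Sum>k. \<integral>\<^sup>+x. ennreal (2 ^ k * (norm (?d k x))\<^sup>2) \<partial>M)"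
    by (rule nn_integral_suminf) simp
  also have "\<dots> = (\<Sum>k. ennreal (2 ^ k * (nrm M (?d k))\<^sup>2))"
    using nn[OF dm] by (simp add: ennreal_mult nn_integral_cmult)
  also have "\<dots> \<le> (\<Sum>k. ennreal ((1 / 2) ^ k))"
  proof (rule suminf_le)
    fix k
    have "(nrm M (?d k))\<^sup>2 \<le> ((1 / 2) ^ k)\<^sup>2" using N[of k "r (Suc k)" "r k"] r by (intro power_mono) (auto intro: less_imp_le)
    then have "2 ^ k * (nrm M (?d k))\<^sup>2 \<le> (1 / 2) ^ k"
      by (simp add: field_simps power2_eq_square)
    then show "ennreal (2 ^ k * (nrm M (?d k))\<^sup>2) \<le> ennreal ((1 / 2) ^ k)" by (rule ennreal_leI)
  qed auto
  also have "\<dots> = ennreal (\<Sum>k. (1 / 2) ^ k)" by (intro suminf_ennreal2 summable_geometric) auto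
  finally have "(\<integral>\<^sup>+x. (\<Sum>k. ennreal (2 ^ k * (norm (?d k x))\<^sup>2)) \<partial>M) \<noteq> \<infinity>"
    unfolding infinity_ennreal_def by (rule neq_top_trans[rotated]) simp
  then have "AE x in M. (\<Sum>k. ennreal (2 ^ k * (norm (?d k x))\<^sup>2)) \<noteq> \<infinity>"
    by (intro nn_integral_PInf_AE) auto
  then have AEc: "AE x in M. Cauchy (\<lambda>k. s (r k) x)"
  proof eventually_elim
    case (elim x)
    define S where "S = enn2real (\<Sum>k. ennreal (2 ^ k * (norm (?d k x))\<^sup>2))"
    have S: "(\<Sum>k. ennreal (2 ^ k * (norm (?d k x))\<^sup>2)) = ennreal S" using elim by (simp add: S_def less_top)
    have "2 ^ k * (norm (?d k x))\<^sup>2 \<le> S" for k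
    proof -
      have "ennreal (2 ^ k * (norm (?d k x))\<^sup>2) \<le> ennreal S"
        using sum_le_suminf[of "\<lambda>k. ennreal (2 ^ k * (norm (?d k x))\<^sup>2)" "{k}"] S by simp
      then show ?thesis by (simp add: S_def)
    qed
    then show ?case by (rule Cauchy_of_geometric_square)
  qed
  define u where "u x = lim (\<lambda>k. s (r k) x)" for x
  have um [measurable]: "u \<in> borel_measurable M" unfolding u_def[abs_def] by (rule borel_measurable_lim_metric) simp
  have lim: "AE x in M. (\<lambda>k. s (r k) x) \<longlonglongrightarrow> u x"
    using AEc by eventually_elim (simp add: u_def Cauchy_convergent_iff convergent_LIMSEQ_iff)
  have fatou: "(\<integral>\<^sup>+x. ennreal ((norm (s m x - u x))\<^sup>2) \<partial>M) \<le> ennreal (((1 / 2) ^ k)\<^sup>2)" if "m \<ge> N k" for m k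
  proof -
    have "(\<integral>\<^sup>+x. ennreal ((norm (s m x - u x))\<^sup>2) \<partial>M)
      = (\<integral>\<^sup>+x. liminf (\<lambda>j. ennreal ((norm (s m x - s (r j) x))\<^sup>2)) \<partial>M)"
    proof (rule nn_integral_cong_AE)
      show "AE x in M. ennreal ((norm (s m x - u x))\<^sup>2) = liminf (\<lambda>j. ennreal ((norm (s m x - s (r j) x))\<^sup>2))"
        using lim
      proof eventually_elim
        case (elim x)
        have "(\<lambda>j. ennreal ((norm (s m x - s (r j) x))\<^sup>2)) \<longlonglongrightarrow> ennreal ((norm (s m x - u x))\<^sup>2)"
          by (intro tendsto_ennrealI tendsto_intros elim)
        then show ?case by (intro lim_imp_Liminf[symmetric]) auto
      qed
    qed
    also have "\<dots> \<le> liminf (\<lambda>j. \<integral>\<^sup>+x. ennreal ((norm (s m x - s (r j) x))\<^sup>2) \<partial>M)"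
      by (rule nn_integral_liminf) simp
    also have "\<dots> = liminf (\<lambda>j. ennreal ((nrm M (\<lambda>x. s m x - s (r j) x))\<^sup>2))"
      by (simp add: nn sqint_diff s)
    also have "\<dots> \<le> liminf (\<lambda>j::nat. ennreal (((1 / 2) ^ k)\<^sup>2))"
    proof (rule Liminf_mono)
      show "\<forall>\<^sub>F j in sequentially. ennreal ((nrm M (\<lambda>x. s m x - s (r j) x))\<^sup>2) \<le> ennreal (((1 / 2) ^ k)\<^sup>2)"
        using eventually_ge_at_top[of "N k"]
      proof eventually_elim
        case (elim j)
        then have "nrm M (\<lambda>x. s m x - s (r j) x) < (1 / 2) ^ k" using that r(2)[of j] by (intro N) auto
        then show ?case by (intro ennreal_leI power_mono) auto
      qed
    qed
    also have "\<dots> = ennreal (((1 / 2) ^ k)\<^sup>2)" by (simp add: Liminf_const)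
    finally show ?thesis .
  qed
  have diff: "(\<lambda>x. s m x - u x) \<in> sqint M" if "m \<ge> N 0" for m
  proof -
    have "(\<integral>\<^sup>+x. ennreal ((norm (s m x - u x))\<^sup>2) \<partial>M) < \<infinity>"
      by (rule le_less_trans[OF fatou[OF that]]) simp
    then show ?thesis unfolding sqint_def by (auto intro!: integrableI_bounded)
  qed
  have u: "u \<in> sqint M"
    using sqint_diff[OF s diff[of "N 0"], of "N 0"] by simp
  have "(\<lambda>n. nrm M (\<lambda>x. s n x - u x)) \<longlonglongrightarrow> 0"
  proof (rule LIMSEQ_I)
    fix e :: real assume "e > 0"
    then obtain k where k: "(1 / 2) ^ k < e" using real_arch_pow_inv[of e "1 / 2"] by auto
    have "nrm M (\<lambda>x. s n x - u x) \<le> (1 / 2) ^ k" if "n \<ge> N k" for n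
    proof (rule power2_le_imp_le)
      have "ennreal ((nrm M (\<lambda>x. s n x - u x))\<^sup>2) \<le> ennreal (((1 / 2) ^ k)\<^sup>2)"
        using fatou[OF that] nn[OF sqint_diff[OF s u], of n] by simp
      then show "(nrm M (\<lambda>x. s n x - u x))\<^sup>2 \<le> ((1 / 2) ^ k)\<^sup>2" by simp
    qed simp
    then show "\<exists>no. \<forall>n\<ge>no. norm (nrm M (\<lambda>x. s n x - u x) - 0) < e"
      using k by (intro exI[of _ "N k"]) fastforce
  qed
  with u show ?thesis using that by blast
qed

text \<open>The representing function is the limit of a minimizing sequence of \<open>v \<mapsto> \<parallel>v\<parallel>\<^sup>2 - 2 l v\<close>
  in \<open>V\<close>, which is Cauchy by the parallelogram law.\<close>

lemma riesz_subspace: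
  fixes V :: "('a \<Rightarrow> 'b::euclidean_space) set"
  assumes V: "V \<subseteq> sqint M" "V \<noteq> {}"
    and comb: "\<And>f g a b. f \<in> V \<Longrightarrow> g \<in> V \<Longrightarrow> (\<lambda>x. a *\<^sub>R f x + b *\<^sub>R g x) \<in> V"
    and lin: "\<And>f g a b. f \<in> V \<Longrightarrow> g \<in> V \<Longrightarrow> l (\<lambda>x. a *\<^sub>R f x + b *\<^sub>R g x) = a * l f + b * l g"
    and bd: "\<And>v. v \<in> V \<Longrightarrow> \<bar>l v\<bar> \<le> A * nrm M v" and A: "A \<ge> 0"
  obtains s u where "\<And>n. s n \<in> V" "u \<in> sqint M" "(\<lambda>n. nrm M (\<lambda>x. s n x - u x)) \<longlonglongrightarrow> 0"
    "\<And>v. v \<in> V \<Longrightarrow> ip M u v = l v" "nrm M u \<le> A"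
proof -
  define J where "J v = (nrm M v)\<^sup>2 - 2 * l v" for v
  have J: "J v \<ge> - A\<^sup>2" if "v \<in> V" for v
  proof -
    have "0 \<le> (nrm M v - A)\<^sup>2" by simp
    moreover have "l v \<le> A * nrm M v" using bd[OF that] by simp
    ultimately show ?thesis unfolding J_def by (simp add: power2_diff algebra_simps)
  qed
  define m where "m = Inf (J ` V)"
  have bdd: "bdd_below (J ` V)" using J by (intro bdd_belowI[of _ "- A\<^sup>2"]) auto
  have m: "m \<le> J v" if "v \<in> V" for v unfolding m_def using bdd that by (intro cInf_lower) auto
  have "\<exists>v\<in>V. J v < m + 1 / real (Suc n)" for n
    using cInf_lessD[of "J ` V" "m + 1 / real (Suc n)"] V(2) by (auto simp: m_def)
  then obtain s where s: "\<And>n. s n \<in> V" "\<And>n. J (s n) < m + 1 / real (Suc n)" by metis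
  have sq: "s n \<in> sqint M" for n using s V by auto
  have par: "(nrm M (\<lambda>x. s i x - s j x))\<^sup>2 \<le> 2 * (1 / real (Suc i)) + 2 * (1 / real (Suc j))" for i j
  proof -
    let ?a = "\<lambda>x. (1 / 2) *\<^sub>R s i x + (1 / 2) *\<^sub>R s j x"
    have "(nrm M ?a)\<^sup>2 = ((nrm M (s i))\<^sup>2 + 2 * ip M (s i) (s j) + (nrm M (s j))\<^sup>2) / 4"
      using nrm_add_power2[OF sqint_scaleR[OF sq[of i], of "1/2"] sq[of j], of "1/2"]
      by (simp add: ip_scaleR_left nrm_scaleR power_mult_distrib power2_eq_square field_simps)
    moreover have "(nrm M (\<lambda>x. s i x - s j x))\<^sup>2 = (nrm M (s i))\<^sup>2 - 2 * ip M (s i) (s j) + (nrm M (s j))\<^sup>2"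
      using nrm_add_power2[OF sq[of i] sq[of j], of "-1"] by simp
    moreover have "l ?a = (l (s i) + l (s j)) / 2" using lin[OF s(1) s(1)] by simp
    ultimately have "(nrm M (\<lambda>x. s i x - s j x))\<^sup>2 = 2 * J (s i) + 2 * J (s j) - 4 * J ?a"
      by (simp add: J_def field_simps)
    moreover have "m \<le> J ?a" by (intro m comb s)
    ultimately show ?thesis using s(2)[of i] s(2)[of j] by linarith
  qed
  have "\<exists>N. \<forall>i\<ge>N. \<forall>j\<ge>N. nrm M (\<lambda>x. s i x - s j x) < e" if "e > 0" for e
  proof -
    have "e\<^sup>2 / 4 > 0" using that by simp
    from reals_Archimedean[OF this] obtain N where N: "1 / real (Suc N) < e\<^sup>2 / 4"
      unfolding inverse_eq_divide by blast
    show ?thesis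
    proof (intro exI allI impI)
      fix i j assume ij: "N \<le> i" "N \<le> j"
      have "1 / real (Suc i) \<le> 1 / real (Suc N)" "1 / real (Suc j) \<le> 1 / real (Suc N)" using ij by (auto intro!: frac_le)
      then have "(nrm M (\<lambda>x. s i x - s j x))\<^sup>2 < e\<^sup>2" using par[of i j] N by linarith
      then show "nrm M (\<lambda>x. s i x - s j x) < e" by (rule power_less_imp_less_base) (use that in simp)
    qed
  qed
  then obtain u where u: "u \<in> sqint M" "(\<lambda>n. nrm M (\<lambda>x. s n x - u x)) \<longlonglongrightarrow> 0"
    using sqint_complete[of s M] sq by blast
  have inv: "(\<lambda>n. 1 / real (Suc n)) \<longlonglongrightarrow> 0" using LIMSEQ_Suc[OF lim_1_over_n] by simp
  have eq: "ip M u v = l v" if v: "v \<in> V" for v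
  proof -
    have vs: "v \<in> sqint M" using v V by auto
    \<comment> \<open>Passing from \<open>s n\<close> to the competitor \<open>s n + t v\<close>
      lowers \<open>J\<close> by at most \<open>1 / Suc n\<close>. In the limit a quadratic
      polynomial in \<open>t\<close> is nonnegative, so its linear coefficient vanishes.\<close>
    have "0 \<le> 2 * t * (ip M u v - l v) + t\<^sup>2 * (nrm M v)\<^sup>2" for t
    proof (rule LIMSEQ_le_const)
      have "(\<lambda>n. 1 / real (Suc n) + 2 * t * (ip M (s n) v - l v) + t\<^sup>2 * (nrm M v)\<^sup>2) \<longlonglongrightarrow>
        0 + 2 * t * (ip M u v - l v) + t\<^sup>2 * (nrm M v)\<^sup>2"
        by (intro tendsto_intros inv ip_tendsto sq u vs)
      then show "(\<lambda>n. 1 / real (Suc n) + 2 * t * (ip M (s n) v - l v) + t\<^sup>2 * (nrm M v)\<^sup>2) \<longlonglongrightarrow>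
        2 * t * (ip M u v - l v) + t\<^sup>2 * (nrm M v)\<^sup>2" by simp
      show "\<exists>N. \<forall>n\<ge>N. 0 \<le> 1 / real (Suc n) + 2 * t * (ip M (s n) v - l v) + t\<^sup>2 * (nrm M v)\<^sup>2"
      proof (intro exI allI impI)
        fix n
        have "m \<le> J (\<lambda>x. 1 *\<^sub>R s n x + t *\<^sub>R v x)" by (intro m comb s v)
        also have "\<dots> = J (s n) + 2 * t * (ip M (s n) v - l v) + t\<^sup>2 * (nrm M v)\<^sup>2"
          using lin[OF s(1)[of n] v, of 1 t] nrm_add_power2[OF sq[of n] vs, of t] by (simp add: J_def algebra_simps)
        finally show "0 \<le> 1 / real (Suc n) + 2 * t * (ip M (s n) v - l v) + t\<^sup>2 * (nrm M v)\<^sup>2"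
          using s(2)[of n] by linarith
      qed
    qed
    from quadratic_nonneg_imp[OF this] show ?thesis by simp
  qed
  \<comment> \<open>\<open>V\<close> is not assumed closed, so \<open>u\<close> may lie outside it;
    the bound on \<open>l\<close> is therefore applied to the approximants
    \<open>s n\<close>.\<close>
  have "ip M u u \<le> A * nrm M u"
  proof (rule LIMSEQ_le)
    show "(\<lambda>n. ip M (s n) u) \<longlonglongrightarrow> ip M u u" by (intro ip_tendsto sq u)
    show "(\<lambda>n. A * nrm M (s n)) \<longlonglongrightarrow> A * nrm M u" by (intro tendsto_intros nrm_tendsto sq u)
    show "\<exists>N. \<forall>n\<ge>N. ip M (s n) u \<le> A * nrm M (s n)"
      using eq[OF s(1)] bd[OF s(1)] by (auto simp: ip_commute[of M _ u] abs_le_iff)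
  qed
  then have "nrm M u * nrm M u \<le> A * nrm M u" by (simp add: nrm_ip[symmetric] power2_eq_square)
  then have "nrm M u \<le> A" using A nrm_nonneg[of M u] by (cases "nrm M u = 0") (auto simp: mult_le_cancel_right)
  with s u eq show ?thesis using that by blast
qed

text \<open>The projection is the Riesz representative on \<open>V\<close> of the functional
  \<open>v \<mapsto> ip M f v\<close>; closedness puts it back into \<open>V\<close>.\<close>

lemma projection_closed_subspace:
  fixes V :: "('a \<Rightarrow> 'b::euclidean_space) set"
  assumes V: "V \<subseteq> sqint M" "V \<noteq> {}"
    and comb: "\<And>f g a b. f \<in> V \<Longrightarrow> g \<in> V \<Longrightarrow> (\<lambda>x. a *\<^sub>R f x + b *\<^sub>R g x) \<in> V"
    and cl: "\<And>s u. (\<And>n. s n \<in> V) \<Longrightarrow> u \<in> sqint M \<Longrightarrow> (\<lambda>n. nrm M (\<lambda>x. s n x - u x)) \<longlonglongrightarrow> 0 \<Longrightarrow> u \<in> V"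
    and f: "f \<in> sqint M"
  obtains p where "p \<in> V" "\<And>v. v \<in> V \<Longrightarrow> ip M (\<lambda>x. f x - p x) v = 0"
proof -
  have lin: "ip M f (\<lambda>x. a *\<^sub>R g x + b *\<^sub>R h x) = a * ip M f g + b * ip M f h"
    if "g \<in> V" "h \<in> V" for g h a b
    using ip_add_left[of "\<lambda>x. a *\<^sub>R g x" M "\<lambda>x. b *\<^sub>R h x" f] that V f
    by (auto simp: sqint_scaleR ip_scaleR_left subset_iff ip_commute[of M f])
  have bd: "\<bar>ip M f v\<bar> \<le> nrm M f * nrm M v" if "v \<in> V" for v
    using ip_Cauchy_Schwarz[OF f] that V by auto
  show thesis
  proof (rule riesz_subspace[OF V comb lin bd nrm_nonneg])
    fix s u
    assume *: "\<And>n. s n \<in> V" "u \<in> sqint M" "(\<lambda>n. nrm M (\<lambda>x. s n x - u x)) \<longlonglongrightarrow> 0"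
      "\<And>v. v \<in> V \<Longrightarrow> ip M u v = ip M f v"
    show thesis
    proof (rule that)
      show "u \<in> V" by (rule cl[OF *(1-3)])
      show "ip M (\<lambda>x. f x - u x) v = 0" if "v \<in> V" for v
        using ip_diff_left[OF f *(2), of v] *(4)[OF that] that V by auto
    qed
  qed
qed

section \<open>Mollification\<close>

text \<open>Translation invariance and Fubini are applied on \<open>lborel\<close>, whereas the
  spaces consist of Lebesgue measurable functions; Borel representatives are the bridge. Coordinates
  reduce the claim to real functions.\<close>

lemma lebesgue_ex_borel:
  fixes f :: "'a::euclidean_space \<Rightarrow> 'b::euclidean_space"
  assumes "f \<in> borel_measurable lebesgue"
  obtains g where "g \<in> borel_measurable borel" "AE x in lebesgue. f x = g x"
proof -
  have "\<exists>h\<in>borel_measurable lborel. AE x in lborel. f x \<bullet> b = h x" for b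
    using assms by (intro completion_ex_borel_measurable_real) simp
  then obtain h where h: "\<And>b. h b \<in> borel_measurable borel" "\<And>b. AE x in lborel. f x \<bullet> b = h b x"
    by (metis measurable_lborel1 measurable_lborel2)
  have "AE x in lborel. \<forall>b\<in>Basis. f x \<bullet> b = h b x"
    using h(2) by (intro AE_finite_allI) auto
  then have "AE x in lebesgue. f x = (\<Sum>b\<in>Basis. h b x *\<^sub>R b)"
    by (intro AE_completion) (auto elim!: eventually_mono simp: euclidean_representation[symmetric] intro: euclidean_eqI)
  moreover have "(\<lambda>x. \<Sum>b\<in>Basis. h b x *\<^sub>R b) \<in> borel_measurable borel" using h(1) by measurable
  ultimately show ?thesis using that by blast
qed

definition conv :: "('a::euclidean_space \<Rightarrow> real) \<Rightarrow> ('a \<Rightarrow> 'b::euclidean_space) \<Rightarrow> 'a \<Rightarrow> 'b" where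
  "conv k f x = (LINT y|lebesgue. k (x - y) *\<^sub>R f y)"

lemma reflected_measurable:
  fixes k :: "'a::euclidean_space \<Rightarrow> 'b::euclidean_space"
  assumes "continuous_on UNIV k"
  shows "(\<lambda>y. k (x - y)) \<in> borel_measurable lebesgue"
  by (rule borel_measurable_continuous_on[OF assms, of "\<lambda>y. x - y" lebesgue, simplified] measurable_completion)+ measurable

lemma conv_integrable:
  fixes f :: "'a::euclidean_space \<Rightarrow> 'b::euclidean_space"
  assumes "continuous_on UNIV k" "\<And>x. norm (k x) \<le> B" "integrable lebesgue f"
  shows "integrable lebesgue (\<lambda>y. k (x - y) *\<^sub>R f y)"
proof (rule Bochner_Integration.integrable_bound)
  show "integrable lebesgue (\<lambda>y. B * norm (f y))" using assms(3) by simp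
  show "(\<lambda>y. k (x - y) *\<^sub>R f y) \<in> borel_measurable lebesgue"
    using reflected_measurable[OF assms(1)] borel_measurable_integrable[OF assms(3)] by measurable
  show "AE y in lebesgue. norm (k (x - y) *\<^sub>R f y) \<le> norm (B * norm (f y))"
    using assms(2) by (intro AE_I2) (smt (verit) abs_mult mult_right_mono norm_ge_zero norm_scaleR real_norm_def)
qed

lemma conv_outside:
  assumes "\<And>x. e < norm x \<Longrightarrow> k x = 0" "\<And>x. R < norm x \<Longrightarrow> f x = 0" "R + e < norm x"
  shows "conv k f x = 0"
proof -
  have "k (x - y) *\<^sub>R f y = 0" for y
  proof (cases "norm y \<le> R")
    case True
    then have "e < norm (x - y)" using assms(3) norm_triangle_ineq2[of x y] by linarith
    then show ?thesis using assms(1) by simp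
  qed (use assms(2) in simp)
  then show ?thesis unfolding conv_def by (simp only: Bochner_Integration.integral_zero)
qed

text \<open>Differentiation under the integral sign, with all derivatives on the kernel. The
  Lipschitz bound gives the majorant \<open>2 * B * norm (f y)\<close> for the remainder along an
  arbitrary null sequence of increments, so the derivative is obtained in the Frechet sense and not
  only direction by direction.\<close>

lemma conv_has_derivative:
  fixes f :: "'a::euclidean_space \<Rightarrow> 'b::euclidean_space"
  assumes k: "C_k (Suc 0) k" "\<And>x. e < norm x \<Longrightarrow> k x = 0" and f: "integrable lebesgue f"
  shows "(conv k f has_derivative (\<lambda>v. conv (dd v k) f x)) (at x)"
proof -
  obtain B where B: "B > 0" "\<And>x v. norm (dd v k x) \<le> B * norm v" "\<And>x y. norm (k x - k y) \<le> B * norm (x - y)"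
    using C1_supp_lipschitz[OF k] by blast
  have kc: "continuous_on UNIV k" by (rule C_k_continuous[OF k(1)])
  have dc: "continuous_on UNIV (dd v k)" for v by (rule C_k_continuous[OF C_k_dd[OF k(1)]])
  obtain B0 where B0: "\<And>x. norm (k x) \<le> B0" using continuous_supp_bounded[OF kc k(2)] by metis
  have kd: "(k has_derivative (\<lambda>v. dd v k y)) (at y)" for y by (rule C_k_has_derivative[OF k(1)])
  have lin: "linear (\<lambda>v. dd v k y)" for y using has_derivative_linear[OF kd] .
  have i0: "integrable lebesgue (\<lambda>y. k (z - y) *\<^sub>R f y)" for z by (rule conv_integrable[OF kc B0 f])
  have i1: "integrable lebesgue (\<lambda>y. dd v k (z - y) *\<^sub>R f y)" for v z by (rule conv_integrable[OF dc B(2) f])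
  have fm: "f \<in> borel_measurable lebesgue" by (rule borel_measurable_integrable[OF f])
  have bl: "bounded_linear (\<lambda>v. conv (dd v k) f x)"
  proof (rule bounded_linear_intro[where K="B * (LINT y|lebesgue. norm (f y))"])
    fix v w :: 'a and c :: real
    show "conv (dd (v + w) k) f x = conv (dd v k) f x + conv (dd w k) f x"
      unfolding conv_def by (simp add: linear_add[OF lin] scaleR_left_distrib i1)
    show "conv (dd (c *\<^sub>R v) k) f x = c *\<^sub>R conv (dd v k) f x"
      unfolding conv_def by (simp add: linear_scale[OF lin] flip: scaleR_scaleR)
    have "norm (conv (dd v k) f x) \<le> (LINT y|lebesgue. norm (dd v k (x - y) *\<^sub>R f y))"
      unfolding conv_def by (rule integral_norm_bound)
    also have "\<dots> \<le> (LINT y|lebesgue. (B * norm v) * norm (f y))"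
    proof (rule integral_mono)
      show "integrable lebesgue (\<lambda>y. norm (dd v k (x - y) *\<^sub>R f y))" by (rule integrable_norm[OF i1])
    qed (use f B(2) in \<open>auto intro!: mult_right_mono\<close>)
    finally show "norm (conv (dd v k) f x) \<le> norm v * (B * (LINT y|lebesgue. norm (f y)))"
      by (simp add: mult.commute mult.left_commute)
  qed
  have "((\<lambda>h. norm (conv k f (x + h) - conv k f x - conv (dd h k) f x) / norm h) \<longlongrightarrow> 0) (at 0)"
    unfolding tendsto_at_iff_sequentially
  proof (intro allI impI)
    fix h :: "nat \<Rightarrow> 'a"
    assume h: "\<forall>i. h i \<in> UNIV - {0}" and h0: "h \<longlonglongrightarrow> 0"
    define q where "q n y = (1 / norm (h n)) *\<^sub>R (k (x - y + h n) - k (x - y) - dd (h n) k (x - y))" for n y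
    have hn: "norm (h n) > 0" for n using h by auto
    have "(\<lambda>n. LINT y|lebesgue. q n y *\<^sub>R f y) \<longlonglongrightarrow> (LINT y|lebesgue. 0 *\<^sub>R f y)"
    proof (rule integral_dominated_convergence[where w="\<lambda>y. 2 * B * norm (f y)"])
      show "integrable lebesgue (\<lambda>y. 2 * B * norm (f y))" using f by simp
      show "(\<lambda>y. q n y *\<^sub>R f y) \<in> borel_measurable lebesgue" for n
      proof -
        have "(\<lambda>y. k (x + h n - y)) \<in> borel_measurable lebesgue" "(\<lambda>y. k (x - y)) \<in> borel_measurable lebesgue"
          "(\<lambda>y. dd (h n) k (x - y)) \<in> borel_measurable lebesgue"
          by (rule reflected_measurable kc dc)+
        then show ?thesis unfolding q_def using fm by (simp add: algebra_simps)
      qed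
      show "AE y in lebesgue. (\<lambda>n. q n y *\<^sub>R f y) \<longlonglongrightarrow> 0 *\<^sub>R f y"
      proof (intro AE_I2 tendsto_scaleR tendsto_const)
        fix y
        have "((\<lambda>h. norm (k (x - y + h) - k (x - y) - dd h k (x - y)) / norm h) \<longlongrightarrow> 0) (at 0)"
          using kd[of "x - y"] by (simp add: has_derivative_at)
        then have "(\<lambda>n. norm (k (x - y + h n) - k (x - y) - dd (h n) k (x - y)) / norm (h n)) \<longlonglongrightarrow> 0"
          using h h0 unfolding tendsto_at_iff_sequentially by (auto simp: o_def)
        then have "(\<lambda>n. norm (q n y)) \<longlonglongrightarrow> 0" by (simp add: q_def)
        then show "(\<lambda>n. q n y) \<longlonglongrightarrow> 0" by (rule tendsto_norm_zero_cancel)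
      qed
      show "AE y in lebesgue. norm (q n y *\<^sub>R f y) \<le> 2 * B * norm (f y)" for n
      proof (intro AE_I2)
        fix y
        have "norm (k (x - y + h n) - k (x - y) - dd (h n) k (x - y))
          \<le> norm (k (x - y + h n) - k (x - y)) + norm (dd (h n) k (x - y))" by (rule norm_triangle_ineq4)
        also have "\<dots> \<le> B * norm (h n) + B * norm (h n)"
          using B(3)[of "x - y + h n" "x - y"] B(2)[of "h n" "x - y"] by simp
        finally have "norm (q n y) \<le> 2 * B" using hn[of n] by (simp add: q_def field_simps)
        then show "norm (q n y *\<^sub>R f y) \<le> 2 * B * norm (f y)" by (simp add: mult_right_mono)
      qed
    qed simp
    then have lim: "(\<lambda>n. norm (LINT y|lebesgue. q n y *\<^sub>R f y)) \<longlonglongrightarrow> 0"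
      by (simp add: tendsto_norm_zero)
    have "norm (LINT y|lebesgue. q n y *\<^sub>R f y)
      = norm (conv k f (x + h n) - conv k f x - conv (dd (h n) k) f x) / norm (h n)" for n
    proof -
      have eq: "q n y *\<^sub>R f y = (1 / norm (h n)) *\<^sub>R
         (k (x + h n - y) *\<^sub>R f y - k (x - y) *\<^sub>R f y - dd (h n) k (x - y) *\<^sub>R f y)" for y
        by (simp add: q_def scaleR_left_diff_distrib scaleR_right_diff_distrib algebra_simps)
      show ?thesis unfolding eq conv_def using hn[of n] by (simp add: i0 i1)
    qed
    then show "((\<lambda>h. norm (conv k f (x + h) - conv k f x - conv (dd h k) f x) / norm h) \<circ> h) \<longlonglongrightarrow> 0"
      using lim by (simp add: o_def)
  qed
  with bl show ?thesis by (simp add: has_derivative_at)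
qed

lemma conv_C_k:
  fixes f :: "'a::euclidean_space \<Rightarrow> 'b::euclidean_space"
  assumes "\<And>k. C_k k r" "\<And>x. e < norm x \<Longrightarrow> r x = 0" "integrable lebesgue f"
  shows "C_k k (conv r f)"
  using assms(1,2)
proof (induction k arbitrary: r)
  case 0
  have "conv r f differentiable (at x)" for x
    unfolding differentiable_def using conv_has_derivative[OF 0(1) 0(2) assms(3), of e] by blast
  then show ?case
    by (auto simp: continuous_on_eq_continuous_within intro!: differentiable_imp_continuous_within)
next
  case (Suc k)
  show ?case
  proof (rule C_k_SucI)
    show "(conv r f has_derivative (\<lambda>v. conv (dd v r) f x)) (at x)" for x
      by (rule conv_has_derivative[OF Suc.prems assms(3)])
    show "C_k k (conv (dd v r) f)" for v
      by (rule Suc.IH) (use C_k_dd[OF Suc.prems(1)] dd_outside[OF Suc.prems(2)] in auto)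
  qed
qed

lemma dd_conv:
  fixes f :: "'a::euclidean_space \<Rightarrow> 'b::euclidean_space"
  assumes "\<And>k. C_k k r" "\<And>x. e < norm x \<Longrightarrow> r x = 0" "integrable lebesgue f"
  shows "dd v (conv r f) x = conv (dd v r) f x"
  by (rule dd_eq[OF conv_has_derivative[OF assms(1,2,3)]])

lemma conv_diff:
  fixes f :: "'a::euclidean_space \<Rightarrow> 'b::euclidean_space"
  assumes "continuous_on UNIV k" "\<And>x. e < norm x \<Longrightarrow> k x = 0" "integrable lebesgue f" "integrable lebesgue g"
  shows "conv k (\<lambda>x. f x - g x) x = conv k f x - conv k g x"
proof -
  obtain B where B: "\<And>x. norm (k x) \<le> B" using continuous_supp_bounded[OF assms(1,2)] by metis
  show ?thesis unfolding conv_def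
    using conv_integrable[OF assms(1) B assms(3)] conv_integrable[OF assms(1) B assms(4)]
    by (simp add: scaleR_right_diff_distrib)
qed

lemma nn_integral_translate:
  fixes h :: "'a::euclidean_space \<Rightarrow> ennreal"
  assumes [measurable]: "h \<in> borel_measurable borel"
  shows "(\<integral>\<^sup>+x. h (x + c) \<partial>lborel) = (\<integral>\<^sup>+x. h x \<partial>lborel)"
  using nn_integral_distr[of "(+) c" lborel borel h] by (simp add: lborel_distr_plus add.commute)

lemma lborel_distr_reflect:
  "distr lborel borel (\<lambda>y. x - y) = (lborel :: 'a::euclidean_space measure)"
  using lborel_affine[of "-1" x] by (simp add: density_1)

text \<open>Jensen's inequality for the probability density \<open>k\<close>; \<open>c = 0\<close> gives Young's inequality,
  \<open>c = 1\<close> reduces convergence of mollifications to continuity of translations.\<close>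

lemma conv_nn_integral_le:
  fixes g :: "'a::euclidean_space \<Rightarrow> 'b::euclidean_space"
  assumes g[measurable]: "g \<in> borel_measurable borel" and gi: "integrable lborel g"
    and k: "continuous_on UNIV k" "\<And>x. 0 \<le> k x" "\<And>x. e < norm x \<Longrightarrow> k x = 0" "integral\<^sup>L lborel k = 1"
    and S: "\<And>y. norm y \<le> e \<Longrightarrow> (\<integral>\<^sup>+x. ennreal ((norm (g (x - y) - c *\<^sub>R g x))\<^sup>2) \<partial>lborel) \<le> S"
    and cm[measurable]: "conv k g \<in> borel_measurable borel"
  shows "(\<integral>\<^sup>+x. ennreal ((norm (conv k g x - c *\<^sub>R g x))\<^sup>2) \<partial>lborel) \<le> S"
proof -
  have km[measurable]: "k \<in> borel_measurable borel" using k(1) by (rule borel_measurable_continuous_onI)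
  obtain B where B: "\<And>x. norm (k x) \<le> B" using continuous_supp_bounded[OF k(1,3)] by metis
  have ki: "integrable lborel k" by (rule continuous_supp_integrable[OF k(1,3)])
  have k1: "(\<integral>\<^sup>+y. ennreal (k y) \<partial>lborel) = 1"
    using nn_integral_eq_integral[OF ki] k(2,4) by simp
  have gl: "integrable lebesgue g" using gi by (simp add: integrable_completion)
  \<comment> \<open>Cauchy-Schwarz with the splitting of \<open>k\<close> into \<open>sqrt k\<close>
    times \<open>sqrt k\<close>; the first factor contributes the mass 1.\<close>
  have pt: "ennreal ((norm (conv k g x - c *\<^sub>R g x))\<^sup>2) \<le> (\<integral>\<^sup>+y. ennreal (k y) * ennreal ((norm (g (x - y) - c *\<^sub>R g x))\<^sup>2) \<partial>lborel)" for x
  proof -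
    have i1: "integrable lborel (\<lambda>y. k (x - y) *\<^sub>R g y)"
      using conv_integrable[OF k(1) B gl, of x] by (subst (asm) integrable_completion) auto
    then have i2: "integrable (distr lborel borel (\<lambda>y. x - y)) (\<lambda>y. k (x - y) *\<^sub>R g y)"
      by (simp add: lborel_distr_reflect)
    then have i3: "integrable lborel (\<lambda>y. k y *\<^sub>R g (x - y))" by (subst (asm) integrable_distr_eq) auto
    have "conv k g x = (LINT y|lborel. k (x - y) *\<^sub>R g y)"
      unfolding conv_def by (rule integral_completion) measurable
    also have "\<dots> = (LINT y|distr lborel borel (\<lambda>y. x - y). k (x - y) *\<^sub>R g y)"
      by (simp add: lborel_distr_reflect)
    also have "\<dots> = (LINT y|lborel. k y *\<^sub>R g (x - y))" by (subst integral_distr) auto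
    finally have "conv k g x - c *\<^sub>R g x = (LINT y|lborel. k y *\<^sub>R g (x - y)) - (LINT y|lborel. k y *\<^sub>R (c *\<^sub>R g x))"
      using k(4) ki by simp
    also have "\<dots> = (LINT y|lborel. k y *\<^sub>R (g (x - y) - c *\<^sub>R g x))"
      using i3 ki by (simp add: scaleR_right_diff_distrib)
    finally have eq: "conv k g x - c *\<^sub>R g x = (LINT y|lborel. k y *\<^sub>R (g (x - y) - c *\<^sub>R g x))" .
    have "ennreal (norm (conv k g x - c *\<^sub>R g x)) \<le> (\<integral>\<^sup>+y. norm (k y *\<^sub>R (g (x - y) - c *\<^sub>R g x)) \<partial>lborel)"
      unfolding eq using i3 ki by (intro integral_norm_bound_ennreal) (simp add: scaleR_right_diff_distrib)
    also have "\<dots> = (\<integral>\<^sup>+y. ennreal (sqrt (k y)) * ennreal (sqrt (k y) * norm (g (x - y) - c *\<^sub>R g x)) \<partial>lborel)"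
      using k(2) by (intro nn_integral_cong) (simp add: ennreal_mult[symmetric] mult.assoc[symmetric])
    finally have "(ennreal (norm (conv k g x - c *\<^sub>R g x)))\<^sup>2
      \<le> (\<integral>\<^sup>+y. ennreal (sqrt (k y)) * ennreal (sqrt (k y) * norm (g (x - y) - c *\<^sub>R g x)) \<partial>lborel)\<^sup>2"
      by (rule power_mono) simp
    also have "\<dots> \<le> (\<integral>\<^sup>+y. (ennreal (sqrt (k y)))\<^sup>2 \<partial>lborel) * (\<integral>\<^sup>+y. (ennreal (sqrt (k y) * norm (g (x - y) - c *\<^sub>R g x)))\<^sup>2 \<partial>lborel)"
      by (rule Cauchy_Schwarz_nn_integral) measurable
    also have "(\<integral>\<^sup>+y. (ennreal (sqrt (k y)))\<^sup>2 \<partial>lborel) = 1"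
      using k1 k(2) by (simp add: ennreal_power)
    also have "(\<integral>\<^sup>+y. (ennreal (sqrt (k y) * norm (g (x - y) - c *\<^sub>R g x)))\<^sup>2 \<partial>lborel)
      = (\<integral>\<^sup>+y. ennreal (k y) * ennreal ((norm (g (x - y) - c *\<^sub>R g x))\<^sup>2) \<partial>lborel)"
      using k(2) by (intro nn_integral_cong) (simp add: ennreal_power power_mult_distrib ennreal_mult[symmetric])
    finally show ?thesis by (simp add: ennreal_power)
  qed
  have "(\<integral>\<^sup>+x. ennreal ((norm (conv k g x - c *\<^sub>R g x))\<^sup>2) \<partial>lborel)
    \<le> (\<integral>\<^sup>+x. (\<integral>\<^sup>+y. ennreal (k y) * ennreal ((norm (g (x - y) - c *\<^sub>R g x))\<^sup>2) \<partial>lborel) \<partial>lborel)"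
    by (rule nn_integral_mono) (rule pt)
  also have "\<dots> = (\<integral>\<^sup>+y. (\<integral>\<^sup>+x. ennreal (k y) * ennreal ((norm (g (x - y) - c *\<^sub>R g x))\<^sup>2) \<partial>lborel) \<partial>lborel)"
    by (rule lborel_pair.Fubini'[symmetric]) measurable
  also have "\<dots> = (\<integral>\<^sup>+y. ennreal (k y) * (\<integral>\<^sup>+x. ennreal ((norm (g (x - y) - c *\<^sub>R g x))\<^sup>2) \<partial>lborel) \<partial>lborel)"
    by (intro nn_integral_cong nn_integral_cmult) measurable
  also have "\<dots> \<le> (\<integral>\<^sup>+y. ennreal (k y) * S \<partial>lborel)"
  proof (rule nn_integral_mono)
    fix y
    show "ennreal (k y) * (\<integral>\<^sup>+x. ennreal ((norm (g (x - y) - c *\<^sub>R g x))\<^sup>2) \<partial>lborel) \<le> ennreal (k y) * S"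
      using S[of y] k(3)[of y] by (cases "norm y \<le> e") (auto intro: mult_left_mono)
  qed
  also have "\<dots> = S" using k1 by (simp add: nn_integral_multc)
  finally show ?thesis .
qed

section \<open>Passage between Borel and Lebesgue measurable functions\<close>

lemma nn_integral_nrm:
  "f \<in> sqint M \<Longrightarrow> (\<integral>\<^sup>+x. ennreal ((norm (f x))\<^sup>2) \<partial>M) = ennreal ((nrm M f)\<^sup>2)"
  unfolding nrm_power2 by (rule nn_integral_eq_integral[OF sqint_integrable]) auto

lemma sqint_nn_integralI:
  assumes "f \<in> borel_measurable M" "(\<integral>\<^sup>+x. ennreal ((norm (f x))\<^sup>2) \<partial>M) \<le> ennreal (C\<^sup>2)" "C \<ge> 0"
  shows "f \<in> sqint M" "nrm M f \<le> C"
proof -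
  have "(\<integral>\<^sup>+x. ennreal ((norm (f x))\<^sup>2) \<partial>M) < \<infinity>" by (rule le_less_trans[OF assms(2)]) simp
  then show *: "f \<in> sqint M" unfolding sqint_def using assms(1) by (auto intro!: integrableI_bounded)
  show "nrm M f \<le> C"
    by (rule power2_le_imp_le) (use assms nn_integral_nrm[OF *] in auto)
qed

lemma sqint_lebesgue_borel:
  assumes "g \<in> borel_measurable borel"
  shows "g \<in> sqint lebesgue \<longleftrightarrow> g \<in> sqint lborel" "nrm lebesgue g = nrm lborel g"
proof -
  have [measurable]: "g \<in> borel_measurable lborel" using assms by simp
  show "g \<in> sqint lebesgue \<longleftrightarrow> g \<in> sqint lborel"
    unfolding sqint_def by (auto simp: integrable_completion measurable_completion)
  show "nrm lebesgue g = nrm lborel g"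
    unfolding nrm_def by (subst integral_completion) auto
qed

lemma indicator_cball_sqint: "indicat_real (cball (0::'a::euclidean_space) R) \<in> sqint lebesgue"
proof -
  have "indicat_real (cball (0::'a) R) \<in> sqint lborel"
  proof (rule sqintI[where g="indicat_real (cball (0::'a) R)"])
    have "emeasure lborel (cball (0::'a) R) < \<infinity>" by (rule emeasure_bounded_finite) simp
    then show "integrable lborel (\<lambda>x. (indicat_real (cball (0::'a) R) x)\<^sup>2)"
      by (simp add: power2_eq_square flip: indicator_inter_arith)
  qed (auto intro!: borel_measurable_indicator)
  then show ?thesis
    by (subst sqint_lebesgue_borel) (auto intro!: borel_measurable_indicator)
qed

lemma sqint_supp_integrable:
  fixes f :: "'a::euclidean_space \<Rightarrow> 'b::euclidean_space"
  assumes "f \<in> sqint lebesgue" "\<And>x. R < norm x \<Longrightarrow> f x = 0"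
  shows "integrable lebesgue f"
proof -
  from sqint_bilinear_integrable[OF bounded_bilinear_scaleR indicator_cball_sqint assms(1)]
  have "integrable lebesgue (\<lambda>x. indicat_real (cball 0 R) x *\<^sub>R f x)" .
  also have "(\<lambda>x. indicat_real (cball 0 R) x *\<^sub>R f x) = f"
    using assms(2) by (force simp: indicator_def fun_eq_iff)
  finally show ?thesis .
qed

lemma conv_AE_cong:
  assumes "AE x in lebesgue. f x = g x" "f \<in> borel_measurable lebesgue" "g \<in> borel_measurable lebesgue"
    "continuous_on UNIV k"
  shows "conv k f = conv k g"
proof
  fix x
  show "conv k f x = conv k g x"
    unfolding conv_def using assms reflected_measurable[OF assms(4), of x]
    by (intro integral_cong_AE) (auto elim!: eventually_mono)
qed

lemma AE_lebesgue_translate: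
  fixes y :: "'a::euclidean_space"
  assumes "AE x in lebesgue. P x" shows "AE x in lebesgue. P (x - y)"
proof -
  have "AE x in lborel. P x" using assms by (simp add: AE_completion_iff)
  then obtain N where N: "N \<in> null_sets lborel" "{x. \<not> P x} \<subseteq> N"
    unfolding eventually_ae_filter by auto
  have "AE x in lborel. x \<notin> {x. x - y \<in> N}" by (rule AE_not_in[OF null_sets_translation[OF N(1)]])
  then have "AE x in lborel. P (x - y)" by eventually_elim (use N(2) in auto)
  then show ?thesis by (rule AE_completion)
qed

lemma nn_integral_lebesgue_translate:
  fixes f :: "'a::euclidean_space \<Rightarrow> 'b::euclidean_space"
  assumes "f \<in> borel_measurable lebesgue"
  shows "(\<integral>\<^sup>+x. ennreal ((norm (f (x - y)))\<^sup>2) \<partial>lebesgue) = (\<integral>\<^sup>+x. ennreal ((norm (f x))\<^sup>2) \<partial>lebesgue)"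
proof -
  obtain g where g[measurable]: "g \<in> borel_measurable borel" and AE: "AE x in lebesgue. f x = g x"
    using lebesgue_ex_borel[OF assms] by blast
  have "(\<integral>\<^sup>+x. ennreal ((norm (f (x - y)))\<^sup>2) \<partial>lebesgue) = (\<integral>\<^sup>+x. ennreal ((norm (g (x - y)))\<^sup>2) \<partial>lborel)"
    unfolding nn_integral_completion[symmetric, of lborel]
    by (rule nn_integral_cong_AE) (use AE_lebesgue_translate[OF AE, of y] in \<open>auto elim!: eventually_mono\<close>)
  also have "\<dots> = (\<integral>\<^sup>+x. ennreal ((norm (g x))\<^sup>2) \<partial>lborel)"
    using nn_integral_translate[of "\<lambda>x. ennreal ((norm (g x))\<^sup>2)" "- y"] by simp
  also have "\<dots> = (\<integral>\<^sup>+x. ennreal ((norm (f x))\<^sup>2) \<partial>lebesgue)"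
    unfolding nn_integral_completion[symmetric, of lborel]
    by (rule nn_integral_cong_AE) (use AE in \<open>auto elim!: eventually_mono\<close>)
  finally show ?thesis .
qed

text \<open>Separates the estimates from the construction of the kernel; \<open>e\<close> is the
  radius of the ball outside which it vanishes.\<close>

locale smoothing_kernel =
  fixes k :: "'a::euclidean_space \<Rightarrow> real" and e :: real
  assumes smooth: "\<And>m. C_k m k" and nonneg: "\<And>x. 0 \<le> k x"
    and outside: "\<And>x. e < norm x \<Longrightarrow> k x = 0" and mass: "integral\<^sup>L lborel k = 1"
begin

lemma cont: "continuous_on UNIV k"
  using C_k_continuous[OF smooth] .

lemma conv_measurable:
  fixes f :: "'a \<Rightarrow> 'b::euclidean_space"
  assumes "integrable lebesgue f" shows "conv k f \<in> borel_measurable borel"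
  using C_k_continuous[OF conv_C_k[OF smooth outside assms, of e 0]] by (intro borel_measurable_continuous_onI) auto

text \<open>\<open>conv k f\<close> does not change at any point when \<open>f\<close> is modified
  on a null set, and the norms do not either, so a Borel representative reduces the claim to
  \<open>conv_nn_integral_le\<close>.\<close>

lemma conv_deviation:
  fixes f :: "'a \<Rightarrow> 'b::euclidean_space"
  assumes f: "f \<in> sqint lebesgue" "integrable lebesgue f" and C: "C \<ge> 0"
    and S: "\<And>y. norm y \<le> e \<Longrightarrow> (\<integral>\<^sup>+x. ennreal ((norm (f (x - y) - c *\<^sub>R f x))\<^sup>2) \<partial>lebesgue) \<le> ennreal (C\<^sup>2)"
  shows "(\<lambda>x. conv k f x - c *\<^sub>R f x) \<in> sqint lebesgue" "nrm lebesgue (\<lambda>x. conv k f x - c *\<^sub>R f x) \<le> C"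
proof -
  have fm: "f \<in> borel_measurable lebesgue" using f(1) by (rule sqint_measurable)
  obtain g where g: "g \<in> borel_measurable borel" "AE x in lebesgue. f x = g x"
    using lebesgue_ex_borel[OF fm] by blast
  note [measurable] = g(1)
  have gm: "g \<in> borel_measurable lebesgue" using g(1) by (simp add: measurable_completion)
  have gi: "integrable lebesgue g" using integrable_cong_AE[OF fm gm g(2)] f(2) by simp
  have gi': "integrable lborel g" using gi by (simp add: integrable_completion)
  have ceq: "conv k f = conv k g" by (rule conv_AE_cong[OF g(2) fm gm cont])
  have cm: "conv k g \<in> borel_measurable borel" by (rule conv_measurable[OF gi])
  have "(\<integral>\<^sup>+x. ennreal ((norm (conv k g x - c *\<^sub>R g x))\<^sup>2) \<partial>lborel) \<le> ennreal (C\<^sup>2)"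
  proof (rule conv_nn_integral_le[OF g(1) gi' cont nonneg outside mass _ cm])
    fix y :: 'a assume y: "norm y \<le> e"
    have "AE x in lebesgue. f (x - y) = g (x - y)" by (rule AE_lebesgue_translate[OF g(2)])
    moreover note g(2)
    ultimately have AE: "AE x in lebesgue. f (x - y) - c *\<^sub>R f x = g (x - y) - c *\<^sub>R g x"
      by eventually_elim simp
    have "(\<integral>\<^sup>+x. ennreal ((norm (g (x - y) - c *\<^sub>R g x))\<^sup>2) \<partial>lborel)
      = (\<integral>\<^sup>+x. ennreal ((norm (g (x - y) - c *\<^sub>R g x))\<^sup>2) \<partial>lebesgue)"
      by (rule nn_integral_completion[symmetric])
    also have "\<dots> = (\<integral>\<^sup>+x. ennreal ((norm (f (x - y) - c *\<^sub>R f x))\<^sup>2) \<partial>lebesgue)"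
      by (rule nn_integral_cong_AE) (use AE in \<open>auto elim!: eventually_mono\<close>)
    finally show "(\<integral>\<^sup>+x. ennreal ((norm (g (x - y) - c *\<^sub>R g x))\<^sup>2) \<partial>lborel) \<le> ennreal (C\<^sup>2)"
      using S[OF y] by simp
  qed
  then have "(\<integral>\<^sup>+x. ennreal ((norm (conv k f x - c *\<^sub>R g x))\<^sup>2) \<partial>lebesgue) \<le> ennreal (C\<^sup>2)"
    by (simp add: nn_integral_completion ceq)
  also have "(\<integral>\<^sup>+x. ennreal ((norm (conv k f x - c *\<^sub>R g x))\<^sup>2) \<partial>lebesgue)
    = (\<integral>\<^sup>+x. ennreal ((norm (conv k f x - c *\<^sub>R f x))\<^sup>2) \<partial>lebesgue)"
    by (rule nn_integral_cong_AE) (use g(2) in \<open>auto elim!: eventually_mono\<close>)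
  finally have le: "(\<integral>\<^sup>+x. ennreal ((norm (conv k f x - c *\<^sub>R f x))\<^sup>2) \<partial>lebesgue) \<le> ennreal (C\<^sup>2)" .
  have "conv k f \<in> borel_measurable lebesgue" using conv_measurable[OF f(2)] by (simp add: measurable_completion)
  then have m: "(\<lambda>x. conv k f x - c *\<^sub>R f x) \<in> borel_measurable lebesgue" using fm by measurable
  show "(\<lambda>x. conv k f x - c *\<^sub>R f x) \<in> sqint lebesgue" "nrm lebesgue (\<lambda>x. conv k f x - c *\<^sub>R f x) \<le> C"
    by (rule sqint_nn_integralI[OF m le C])+
qed

lemma conv_sqint:
  fixes f :: "'a \<Rightarrow> 'b::euclidean_space"
  assumes f: "f \<in> sqint lebesgue" "integrable lebesgue f"
  shows "conv k f \<in> sqint lebesgue" "nrm lebesgue (conv k f) \<le> nrm lebesgue f"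
proof -
  have S: "(\<integral>\<^sup>+x. ennreal ((norm (f (x - y) - 0 *\<^sub>R f x))\<^sup>2) \<partial>lebesgue) \<le> ennreal ((nrm lebesgue f)\<^sup>2)" for y
  proof -
    have "(\<integral>\<^sup>+x. ennreal ((norm (f (x - y)))\<^sup>2) \<partial>lebesgue) = (\<integral>\<^sup>+x. ennreal ((norm (f x))\<^sup>2) \<partial>lebesgue)"
      by (rule nn_integral_lebesgue_translate[OF sqint_measurable[OF f(1)]])
    then show ?thesis using nn_integral_nrm[OF f(1)] by simp
  qed
  show "conv k f \<in> sqint lebesgue" "nrm lebesgue (conv k f) \<le> nrm lebesgue f"
    using conv_deviation[OF f nrm_nonneg S] by auto
qed

end

lemma smoothing_kernel_mollifier: "e > 0 \<Longrightarrow> smoothing_kernel (mollifier e) e"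
  by unfold_locales (auto simp: C_k_mollifier mollifier_nonneg mollifier_outside integral_mollifier)

text \<open>For positive \<open>m\<close> this is the radial retraction onto the ball of radius
  \<open>m\<close>. It truncates values without losing continuity.\<close>

definition clamp_norm :: "real \<Rightarrow> 'b::euclidean_space \<Rightarrow> 'b" where
  "clamp_norm m y = (m / max m (norm y)) *\<^sub>R y"

lemma norm_clamp_norm:
  assumes "m > 0" shows "norm (clamp_norm m y) \<le> m" "norm (clamp_norm m y) \<le> norm y"
proof -
  have "norm (clamp_norm m y) = m * norm y / max m (norm y)" using assms by (simp add: clamp_norm_def)
  moreover have "m * norm y / max m (norm y) \<le> m" "m * norm y / max m (norm y) \<le> norm y"
    using assms by (auto simp: divide_le_eq max_def mult_left_mono mult_right_mono)
  ultimately show "norm (clamp_norm m y) \<le> m" "norm (clamp_norm m y) \<le> norm y" by auto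
qed

lemma continuous_clamp_norm: "m > 0 \<Longrightarrow> continuous_on UNIV (clamp_norm m)"
  unfolding clamp_norm_def by (intro continuous_intros) (auto simp: max_def)

lemma clamp_norm_eq: "m > 0 \<Longrightarrow> norm y \<le> m \<Longrightarrow> clamp_norm m y = y"
  by (simp add: clamp_norm_def)

lemma nrm_tendsto_dominated:
  fixes f :: "'a \<Rightarrow> 'b::euclidean_space"
  assumes "\<And>n. s n \<in> borel_measurable M" "f \<in> borel_measurable M" "integrable M (\<lambda>x. (w x)\<^sup>2)"
    and "AE x in M. (\<lambda>n. s n x) \<longlonglongrightarrow> f x" and "\<And>n. AE x in M. norm (s n x - f x) \<le> w x"
  shows "(\<lambda>n. nrm M (\<lambda>x. s n x - f x)) \<longlonglongrightarrow> 0"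
proof -
  have "(\<lambda>n. LINT x|M. (norm (s n x - f x))\<^sup>2) \<longlonglongrightarrow> (LINT x|M. 0)"
  proof (rule integral_dominated_convergence[OF _ _ assms(3)])
    show "AE x in M. (\<lambda>n. (norm (s n x - f x))\<^sup>2) \<longlonglongrightarrow> 0"
      using assms(4)
    proof eventually_elim
      case (elim x)
      have "(\<lambda>n. (norm (s n x - f x))\<^sup>2) \<longlonglongrightarrow> (norm (f x - f x))\<^sup>2" by (intro tendsto_intros elim)
      then show ?case by simp
    qed
    show "AE x in M. norm ((norm (s n x - f x))\<^sup>2) \<le> (w x)\<^sup>2" for n
      using assms(5)[of n] by eventually_elim (auto intro: power_mono)
  qed (use assms(1,2) in measurable)
  then show ?thesis unfolding nrm_def using tendsto_real_sqrt by fastforce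
qed

lemma sqint_continuous_supp:
  fixes f :: "'a::euclidean_space \<Rightarrow> 'b::euclidean_space"
  assumes "continuous_on UNIV f" "\<And>x. R < norm x \<Longrightarrow> f x = 0"
  shows "f \<in> sqint lebesgue"
proof -
  have "integrable lebesgue (\<lambda>x. (norm (f x))\<^sup>2)"
    by (rule continuous_supp_integrable[of _ R]) (use assms in \<open>auto intro!: continuous_intros\<close>)
  moreover have "f \<in> borel_measurable lebesgue"
    using borel_measurable_integrable[OF continuous_supp_integrable(2)[OF assms]] .
  ultimately show ?thesis by (simp add: sqint_def)
qed

text \<open>Clamping first makes the target bounded at a small cost in norm. Continuous functions
  that converge almost everywhere, once clamped and cut off themselves, are dominated by a constant
  on a ball and so converge in norm.\<close>

lemma continuous_dense_sqint:
  fixes f :: "'a::euclidean_space \<Rightarrow> 'b::euclidean_space"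
  assumes f: "f \<in> sqint lebesgue" "\<And>x. R < norm x \<Longrightarrow> f x = 0" and e: "e > 0"
  obtains g where "continuous_on UNIV g" "\<And>x. R + 1 < norm x \<Longrightarrow> g x = 0" "nrm lebesgue (\<lambda>x. f x - g x) < e"
proof -
  have fm[measurable]: "f \<in> borel_measurable lebesgue" using f(1) by (rule sqint_measurable)
  have meas: "(\<lambda>x. clamp_norm (real (Suc n)) (h x)) \<in> borel_measurable lebesgue"
    if "h \<in> borel_measurable lebesgue" for n and h :: "'a \<Rightarrow> 'b"
    using borel_measurable_continuous_on[OF continuous_clamp_norm that, of "real (Suc n)"] by simp
  have "(\<lambda>n. nrm lebesgue (\<lambda>x. clamp_norm (real (Suc n)) (f x) - f x)) \<longlonglongrightarrow> 0"
  proof (rule nrm_tendsto_dominated[where w="\<lambda>x. 2 * norm (f x)"])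
    show "integrable lebesgue (\<lambda>x. (2 * norm (f x))\<^sup>2)"
      using sqint_integrable[OF f(1)] by (simp add: power_mult_distrib)
    show "AE x in lebesgue. (\<lambda>n. clamp_norm (real (Suc n)) (f x)) \<longlonglongrightarrow> f x"
    proof (intro AE_I2 tendsto_eventually)
      fix x
      obtain N where "norm (f x) \<le> real N" using real_arch_simple by blast
      then have "\<forall>n\<ge>N. norm (f x) \<le> real (Suc n)" by (auto intro: order_trans)
      then show "\<forall>\<^sub>F n in sequentially. clamp_norm (real (Suc n)) (f x) = f x"
        by (intro eventually_sequentiallyI[of N] clamp_norm_eq) auto
    qed
    show "AE x in lebesgue. norm (clamp_norm (real (Suc n)) (f x) - f x) \<le> 2 * norm (f x)" for n
    proof (intro AE_I2)
      fix x
      have "norm (clamp_norm (real (Suc n)) (f x)) \<le> norm (f x)" by (intro norm_clamp_norm) simp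
      then show "norm (clamp_norm (real (Suc n)) (f x) - f x) \<le> 2 * norm (f x)"
        using norm_triangle_ineq4[of "clamp_norm (real (Suc n)) (f x)" "f x"] by linarith
    qed
  qed (use meas fm in auto)
  then obtain m where m: "nrm lebesgue (\<lambda>x. clamp_norm (real (Suc m)) (f x) - f x) < e / 2"
    using e order_tendstoD(2)[of _ 0 sequentially "e / 2"] by (auto simp: eventually_sequentially)
  let ?m = "real (Suc m)"
  let ?F = "\<lambda>x. clamp_norm ?m (f x)"
  \<comment> \<open>Supplies continuous functions that converge to \<open>f\<close> off a negligible
    set.\<close>
  have "f measurable_on UNIV" by (rule lebesgue_measurable_imp_measurable_on) simp_all
  then obtain N g where N: "negligible N" and g: "\<And>n. continuous_on UNIV (g n)"
    "\<And>x. x \<notin> N \<Longrightarrow> (\<lambda>n. g n x) \<longlonglongrightarrow> f x"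
    unfolding measurable_on_def by auto
  define c where "c x = max 0 (min 1 (R + 1 - norm x))" for x :: 'a
  have c: "continuous_on UNIV c" "\<And>x. 0 \<le> c x" "\<And>x. c x \<le> 1" "\<And>x. norm x \<le> R \<Longrightarrow> c x = 1"
    "\<And>x. R + 1 < norm x \<Longrightarrow> c x = 0"
    unfolding c_def by (auto intro!: continuous_intros)
  define G where "G n x = c x *\<^sub>R clamp_norm ?m (g n x)" for n x
  have Gc: "continuous_on UNIV (G n)" for n
    unfolding G_def by (intro continuous_on_scaleR c continuous_on_compose2[OF continuous_clamp_norm g(1)]) auto
  have G0: "R + 1 < norm x \<Longrightarrow> G n x = 0" for n x by (simp add: G_def c)
  have Gm: "G n \<in> borel_measurable lebesgue" for n by (rule sqint_measurable[OF sqint_continuous_supp[OF Gc G0]])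
  have lim: "(\<lambda>n. nrm lebesgue (\<lambda>x. G n x - ?F x)) \<longlonglongrightarrow> 0"
  proof (rule nrm_tendsto_dominated[where w="\<lambda>x. 2 * ?m * indicator (cball 0 (R + 1)) x"])
    have "integrable lborel (\<lambda>x::'a. indicator (cball 0 (R + 1)) x *\<^sub>R (2 * ?m)\<^sup>2)"
      by (rule borel_integrable_compact) auto
    then have "integrable lebesgue (\<lambda>x::'a. indicator (cball 0 (R + 1)) x *\<^sub>R (2 * ?m)\<^sup>2)"
      by (subst integrable_completion) auto
    also have "(\<lambda>x::'a. indicator (cball 0 (R + 1)) x *\<^sub>R (2 * ?m)\<^sup>2) = (\<lambda>x. (2 * ?m * indicator (cball 0 (R + 1)) x)\<^sup>2)"
      by (auto simp: indicator_def)
    finally show "integrable lebesgue (\<lambda>x::'a. (2 * ?m * indicator (cball 0 (R + 1)) x)\<^sup>2)" .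
    have "AE x in lebesgue. x \<notin> N" using N by (simp add: negligible_iff_null_sets AE_not_in)
    then show "AE x in lebesgue. (\<lambda>n. G n x) \<longlonglongrightarrow> ?F x"
    proof eventually_elim
      case (elim x)
      have "isCont (clamp_norm ?m) (f x)"
        using continuous_clamp_norm[of ?m] by (auto simp: continuous_on_eq_continuous_at)
      then have "(\<lambda>n. clamp_norm ?m (g n x)) \<longlonglongrightarrow> ?F x" by (rule isCont_tendsto_compose) (rule g(2)[OF elim])
      then have "(\<lambda>n. G n x) \<longlonglongrightarrow> c x *\<^sub>R ?F x" unfolding G_def by (intro tendsto_intros)
      moreover have "c x *\<^sub>R ?F x = ?F x"
        using c(4)[of x] f(2)[of x] by (cases "norm x \<le> R") (auto simp: clamp_norm_def)
      ultimately show ?case by simp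
    qed
    show "AE x in lebesgue. norm (G n x - ?F x) \<le> 2 * ?m * indicator (cball 0 (R + 1)) x" for n
    proof (intro AE_I2)
      fix x
      show "norm (G n x - ?F x) \<le> 2 * ?m * indicator (cball 0 (R + 1)) x"
      proof (cases "norm x \<le> R + 1")
        case True
        have "norm (G n x) \<le> 1 * ?m"
          unfolding G_def norm_scaleR using c(2,3)[of x] norm_clamp_norm(1)[of ?m] by (intro mult_mono) auto
        moreover have "norm (?F x) \<le> ?m" by (rule norm_clamp_norm) simp
        ultimately have "norm (G n x) + norm (?F x) \<le> 1 * ?m + ?m" by (rule add_mono)
        then have "norm (G n x - ?F x) \<le> 2 * ?m" using order_trans[OF norm_triangle_ineq4] by fastforce
        then show ?thesis using True by simp
      next
        case False
        then show ?thesis using G0[of x n] f(2)[of x] by (simp add: clamp_norm_def)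
      qed
    qed
  qed (use meas fm Gm in auto)
  then obtain n where n: "nrm lebesgue (\<lambda>x. G n x - ?F x) < e / 2"
    using e order_tendstoD(2)[of _ 0 sequentially "e / 2"] by (auto simp: eventually_sequentially)
  have F: "?F \<in> sqint lebesgue"
    by (rule sqint_mono[OF f(1) meas[OF fm]]) (auto intro!: norm_clamp_norm)
  have "nrm lebesgue (\<lambda>x. f x - G n x) \<le> nrm lebesgue (\<lambda>x. f x - ?F x) + nrm lebesgue (\<lambda>x. ?F x - G n x)"
    by (rule nrm_triangle_diff[OF f(1) F sqint_continuous_supp[OF Gc G0]])
  then have "nrm lebesgue (\<lambda>x. f x - G n x) < e"
    using m n by (simp add: nrm_minus_commute[of _ f] nrm_minus_commute[of _ _ "G n"])
  with Gc G0 show ?thesis using that by blast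
qed

text \<open>Mollification does not increase norms, so \<open>f\<close> may be replaced by a
  continuous \<open>g\<close> of compact support, for which uniform continuity controls small
  translations.\<close>

lemma mollifier_tendsto:
  fixes f :: "'a::euclidean_space \<Rightarrow> 'b::euclidean_space"
  assumes f: "f \<in> sqint lebesgue" "\<And>x. R < norm x \<Longrightarrow> f x = 0"
  shows "(\<lambda>n. nrm lebesgue (\<lambda>x. conv (mollifier (1 / real (Suc n))) f x - f x)) \<longlonglongrightarrow> 0"
proof (rule LIMSEQ_I)
  fix e :: real assume e: "e > 0"
  obtain g where g: "continuous_on UNIV g" "\<And>x. R + 1 < norm x \<Longrightarrow> g x = 0" "nrm lebesgue (\<lambda>x. f x - g x) < e / 4"
    using continuous_dense_sqint[where e="e / 4" and f=f and R=R] f e by (metis zero_less_divide_iff zero_less_numeral)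
  have gs: "g \<in> sqint lebesgue" by (rule sqint_continuous_supp[OF g(1,2)])
  have gi: "integrable lebesgue g" by (rule continuous_supp_integrable[OF g(1,2)])
  have fi: "integrable lebesgue f" by (rule sqint_supp_integrable[OF f])
  have "emeasure lborel (cball (0::'a) (R + 2)) < \<infinity>" by (rule emeasure_bounded_finite) simp
  then obtain V where V: "emeasure lborel (cball (0::'a) (R + 2)) = ennreal V" "V \<ge> 0"
    by (cases "emeasure lborel (cball (0::'a) (R + 2))") auto
  \<comment> \<open>\<open>V\<close> is the volume of a ball that contains the supports of
    \<open>g\<close> and of its translates by at most 1; a pointwise deviation below
    \<open>eta\<close> on it costs less than \<open>e / 4\<close> in norm.\<close>
  define eta where "eta = e / (4 * (sqrt V + 1))"
  have sV: "sqrt V \<ge> 0" using V by simp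
  have eta: "eta > 0" using e sV unfolding eta_def by (intro divide_pos_pos mult_pos_pos add_nonneg_pos) auto
  have etaV: "eta * sqrt V < e / 4"
  proof -
    have "eta * sqrt V < eta * (sqrt V + 1)" using eta by simp
    also have "\<dots> = e / 4" unfolding eta_def using sV
      by (subst times_divide_eq_left, subst mult_divide_mult_cancel_right) linarith+
    finally show ?thesis .
  qed
  have "uniformly_continuous_on (cball 0 (R + 3)) g"
    by (rule compact_uniformly_continuous) (auto intro: continuous_on_subset[OF g(1)])
  then obtain d where d: "d > 0" "\<And>x x'. x \<in> cball 0 (R + 3) \<Longrightarrow> x' \<in> cball 0 (R + 3) \<Longrightarrow> dist x' x < d \<Longrightarrow> dist (g x') (g x) < eta"
    unfolding uniformly_continuous_on_def using eta by metis
  obtain N where N: "1 / real (Suc N) < d"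
    using reals_Archimedean[OF d(1)] unfolding inverse_eq_divide by blast
  have "nrm lebesgue (\<lambda>x. conv (mollifier (1 / real (Suc n))) f x - f x) < e" if n: "n \<ge> N" for n
  proof -
    let ?h = "1 / real (Suc n)"
    interpret smoothing_kernel "mollifier ?h :: 'a \<Rightarrow> real" ?h by (rule smoothing_kernel_mollifier) simp
    have h: "?h < d" "?h \<le> 1"
      using N n by (auto simp: frac_le intro: le_less_trans[rotated, OF N])
    have S: "(\<integral>\<^sup>+x. ennreal ((norm (g (x - y) - 1 *\<^sub>R g x))\<^sup>2) \<partial>lebesgue) \<le> ennreal ((eta * sqrt V)\<^sup>2)"
      if y: "norm y \<le> ?h" for y
    proof -
      have "(\<integral>\<^sup>+x. ennreal ((norm (g (x - y) - 1 *\<^sub>R g x))\<^sup>2) \<partial>lebesgue)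
        \<le> (\<integral>\<^sup>+x. ennreal (eta\<^sup>2) * indicator (cball (0::'a) (R + 2)) x \<partial>lebesgue)"
      proof (rule nn_integral_mono)
        fix x :: 'a
        show "ennreal ((norm (g (x - y) - 1 *\<^sub>R g x))\<^sup>2) \<le> ennreal (eta\<^sup>2) * indicator (cball 0 (R + 2)) x"
        proof (cases "norm x \<le> R + 2")
          case True
          have "norm (x - y) \<le> R + 3" using True y h norm_triangle_ineq4[of x y] by linarith
          then have "dist (g (x - y)) (g x) < eta" using True y h by (intro d(2)) (auto simp: dist_norm norm_minus_commute)
          then have "(norm (g (x - y) - g x))\<^sup>2 \<le> eta\<^sup>2" by (intro power_mono) (auto simp: dist_norm)
          then show ?thesis using True by (simp add: ennreal_leI)
        next
          case False
          then have "norm (x - y) > R + 1" using y h norm_triangle_ineq2[of x y] by linarith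
          then show ?thesis using False g(2) by simp
        qed
      qed
      also have "\<dots> = ennreal (eta\<^sup>2) * ennreal V"
        using V by (simp add: nn_integral_completion nn_integral_cmult_indicator)
      also have "\<dots> = ennreal ((eta * sqrt V)\<^sup>2)" using V by (simp add: power_mult_distrib ennreal_mult)
      finally show ?thesis .
    qed
    have 1: "(\<lambda>x. conv (mollifier ?h) g x - g x) \<in> sqint lebesgue" "nrm lebesgue (\<lambda>x. conv (mollifier ?h) g x - g x) \<le> eta * sqrt V"
      using conv_deviation[OF gs gi _ S] eta V by auto
    have dfg: "(\<lambda>x. f x - g x) \<in> sqint lebesgue" "integrable lebesgue (\<lambda>x. f x - g x)"
      using sqint_diff[OF f(1) gs] fi gi by auto
    have cd: "conv (mollifier ?h) (\<lambda>x. f x - g x) = (\<lambda>x. conv (mollifier ?h) f x - conv (mollifier ?h) g x)"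
      using conv_diff[OF cont outside fi gi] by blast
    have 2: "(\<lambda>x. conv (mollifier ?h) f x - conv (mollifier ?h) g x) \<in> sqint lebesgue"
      "nrm lebesgue (\<lambda>x. conv (mollifier ?h) f x - conv (mollifier ?h) g x) \<le> e / 4"
      using conv_sqint[OF dfg] g(3) unfolding cd by auto
    have 3: "(\<lambda>x. g x - f x) \<in> sqint lebesgue" "nrm lebesgue (\<lambda>x. g x - f x) < e / 4"
      using sqint_diff[OF gs f(1)] g(3) by (auto simp: nrm_minus_commute[of _ g])
    have "nrm lebesgue (\<lambda>x. ((conv (mollifier ?h) f x - conv (mollifier ?h) g x) + (conv (mollifier ?h) g x - g x)) + (g x - f x))
      \<le> e / 4 + eta * sqrt V + nrm lebesgue (\<lambda>x. g x - f x)"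
      using nrm_triangle[OF sqint_add[OF 2(1) 1(1)] 3(1)] nrm_triangle[OF 2(1) 1(1)] 1(2) 2(2) by linarith
    then show ?thesis using 3(2) etaV e by simp
  qed
  then show "\<exists>no. \<forall>n\<ge>no. norm (nrm lebesgue (\<lambda>x. conv (mollifier (1 / real (Suc n))) f x - f x) - 0) < e"
    by auto
qed

section \<open>The Kohn-Morrey identity\<close>

text \<open>\<open>d_z\<close> and \<open>d_zbar\<close> are the cases \<open>s = - \<i>\<close> and \<open>s = \<i>\<close>.\<close>

definition cd :: "complex \<Rightarrow> 'n::finite \<Rightarrow> (complex ^ 'n \<Rightarrow> complex) \<Rightarrow> complex ^ 'n \<Rightarrow> complex" where
  "cd s j f z = (dd (axis j 1) f z + s * dd (axis j \<i>) f z) / 2"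

lemma d_z_cd: "d_z j f = cd (- \<i>) j f"
  by (simp add: fun_eq_iff d_z_def cd_def dd_def)

lemma d_zbar_cd: "d_zbar j f = cd \<i> j f"
  by (simp add: fun_eq_iff d_zbar_def cd_def dd_def)

lemma C_k_differentiable: "C_k (Suc k) f \<Longrightarrow> f differentiable (at x)"
  by (simp add: C_k_Suc)

lemma cd_add:
  assumes "f differentiable (at z)" "g differentiable (at z)"
  shows "cd s j (\<lambda>z. f z + g z) z = cd s j f z + cd s j g z"
  using assms by (simp add: cd_def dd_add algebra_simps add_divide_distrib)

lemma cd_cmult:
  assumes "f differentiable (at z)" shows "cd s j (\<lambda>z. c * f z) z = c * cd s j f z"
  using dd_bounded_linear[OF bounded_linear_mult_right assms]
  by (simp add: cd_def algebra_simps add_divide_distrib)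

lemma cd_minus:
  assumes "f differentiable (at z)" shows "cd s j (\<lambda>z. - f z) z = - cd s j f z"
  using cd_cmult[OF assms, of s j "-1"] by simp

lemma cd_diff:
  assumes "f differentiable (at z)" "g differentiable (at z)"
  shows "cd s j (\<lambda>z. f z - g z) z = cd s j f z - cd s j g z"
proof -
  have "(\<lambda>z. - g z) differentiable (at z)" using assms(2) by (rule differentiable_minus)
  then show ?thesis using cd_add[OF assms(1), of "\<lambda>z. - g z"] cd_minus[OF assms(2)] by simp
qed

lemma cd_mult:
  assumes "f differentiable (at z)" "g differentiable (at z)"
  shows "cd s j (\<lambda>z. f z * g z) z = f z * cd s j g z + cd s j f z * g z"
  using assms by (simp add: cd_def dd_bilinear[OF bounded_bilinear_mult] algebra_simps add_divide_distrib)

lemma cd_cnj: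
  assumes "f differentiable (at z)" shows "cd s j (\<lambda>z. cnj (f z)) z = cnj (cd (cnj s) j f z)"
  using assms by (simp add: cd_def dd_bounded_linear[OF bounded_linear_cnj])

lemma cd_const: "cd s j (\<lambda>z. c) z = 0"
  using dd_eq[of "\<lambda>z. c" "\<lambda>v. 0" z] by (simp add: cd_def)

lemma C_k_cd: "C_k (Suc k) f \<Longrightarrow> C_k k (cd s j f)"
proof -
  assume f: "C_k (Suc k) f"
  have "C_k k (\<lambda>z. (1/2) * (dd (axis j 1) f z + s * dd (axis j \<i>) f z))"
    by (intro C_k_mult C_k_add C_k_const C_k_dd f)
  then show ?thesis by (simp add: cd_def[abs_def])
qed

lemma cd_outside:
  assumes "\<And>z. R < norm z \<Longrightarrow> f z = 0" "R < norm z" shows "cd s j f z = 0"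
  using dd_outside[OF assms] by (simp add: cd_def)

lemma cd_commute:
  assumes "C_k 2 f" shows "cd s j (cd t k f) z = cd t k (cd s j f) z"
proof -
  have f: "C_k (Suc (Suc 0)) f" using assms by (simp add: numeral_2_eq_2 del: C_k.simps)
  have d: "dd v f differentiable (at z)" for v by (rule C_k_differentiable[OF C_k_dd[OF f]])
  have *: "dd v (cd s j f) z = (dd v (dd (axis j 1) f) z + s * dd v (dd (axis j \<i>) f) z) / 2" for s j v
  proof -
    have "((\<lambda>z. (dd (axis j 1) f z + s * dd (axis j \<i>) f z) / 2) has_derivative
      (\<lambda>v. (dd v (dd (axis j 1) f) z + s * dd v (dd (axis j \<i>) f) z) / 2)) (at z)"
      by (auto intro!: derivative_eq_intros has_derivative_dd d)
    then show ?thesis unfolding cd_def[abs_def] by (rule dd_eq)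
  qed
  show ?thesis
    unfolding cd_def[of s j "cd t k f"] cd_def[of t k "cd s j f"] *
    by (simp add: dd_commute[OF assms, of "axis j 1"] dd_commute[OF assms, of "axis j \<i>"] field_simps)
qed

lemma C_k_cnj: "C_k k f \<Longrightarrow> C_k k (\<lambda>x. cnj (f x))"
  by (rule C_k_bounded_linear[OF bounded_linear_cnj])

lemma C_k_of_real: "C_k k f \<Longrightarrow> C_k k (\<lambda>x. complex_of_real (f x))"
  by (rule C_k_bounded_linear[OF bounded_linear_of_real])

lemma C_k_exp:
  fixes f :: "'a::real_normed_vector \<Rightarrow> real"
  assumes "C_k k f" shows "C_k k (\<lambda>x. exp (f x))"
  using assms
proof (induction k)
  case 0
  then show ?case by (auto intro: continuous_on_exp)
next
  case (Suc k)
  show ?case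
    by (rule C_k_SucI[where f'="\<lambda>v x. exp (f x) * dd v f x"])
      (use Suc in \<open>auto intro!: derivative_eq_intros C_k_has_derivative C_k_mult C_k_dd dest: C_k_Suc_imp\<close>)
qed

section \<open>Compactly supported functions of class C^k and integration by parts\<close>

definition C_kc :: "nat \<Rightarrow> ('a::real_normed_vector \<Rightarrow> 'b::real_normed_vector) \<Rightarrow> bool" where
  "C_kc k f \<longleftrightarrow> C_k k f \<and> (\<exists>R. \<forall>x. R < norm x \<longrightarrow> f x = 0)"

lemma C_kc_C_k: "C_kc k f \<Longrightarrow> C_k k f"
  by (simp add: C_kc_def)

lemma C_kc_antimono: "C_kc m f \<Longrightarrow> k \<le> m \<Longrightarrow> C_kc k f"
  by (auto simp: C_kc_def intro: C_k_antimono)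

lemma C_kc_mult_left: "C_k k g \<Longrightarrow> C_kc k f \<Longrightarrow> C_kc k (\<lambda>x. g x * f x :: complex)"
  by (auto simp: C_kc_def intro: C_k_mult)

lemma C_kc_mult_right: "C_k k g \<Longrightarrow> C_kc k f \<Longrightarrow> C_kc k (\<lambda>x. f x * g x :: complex)"
  by (auto simp: C_kc_def intro: C_k_mult)

lemma C_kc_add:
  assumes "C_kc k f" "C_kc k g" shows "C_kc k (\<lambda>x. f x + g x)"
proof -
  obtain R S where "\<forall>x. R < norm x \<longrightarrow> f x = 0" "\<forall>x. S < norm x \<longrightarrow> g x = 0"
    using assms by (auto simp: C_kc_def)
  then have "\<forall>x. max R S < norm x \<longrightarrow> f x + g x = 0" by auto
  then show ?thesis using assms unfolding C_kc_def by (blast intro: C_k_add)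
qed

lemma C_kc_minus: "C_kc k f \<Longrightarrow> C_kc k (\<lambda>x. - f x)"
  by (auto simp: C_kc_def intro: C_k_minus)

lemma C_kc_diff: "C_kc k f \<Longrightarrow> C_kc k g \<Longrightarrow> C_kc k (\<lambda>x. f x - g x)"
  using C_kc_add[of k f "\<lambda>x. - g x"] C_kc_minus[of k g] by simp

lemma C_kc_0: "C_kc k (\<lambda>x. 0)"
  by (simp add: C_kc_def C_k_const)

lemma C_kc_sum: "(\<And>i. i \<in> I \<Longrightarrow> C_kc k (f i)) \<Longrightarrow> C_kc k (\<lambda>x. \<Sum>i\<in>I. f i x)"
  by (induction I rule: infinite_finite_induct) (auto intro: C_kc_0 C_kc_add)

lemma C_kc_cnj: "C_kc k f \<Longrightarrow> C_kc k (\<lambda>x. cnj (f x))"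
  by (auto simp: C_kc_def intro: C_k_cnj)

lemma C_kc_cd: "C_kc (Suc k) f \<Longrightarrow> C_kc k (cd s j f)"
  unfolding C_kc_def using C_k_cd cd_outside by metis

lemma C_kc_integrable:
  fixes f :: "'a::euclidean_space \<Rightarrow> 'b::euclidean_space"
  shows "C_kc k f \<Longrightarrow> integrable lebesgue f"
  unfolding C_kc_def using continuous_supp_integrable(2) C_k_continuous by metis

lemma integral_cd:
  assumes "C_kc (Suc 0) f" shows "(LINT z|lebesgue. cd s j f z) = 0"
proof -
  obtain R where R: "\<And>x. R < norm x \<Longrightarrow> f x = 0" and f: "C_k (Suc 0) f" using assms by (auto simp: C_kc_def)
  have dc: "continuous_on UNIV (dd v f)" for v by (rule C_k_continuous[OF C_k_dd[OF f]])
  have z: "(LINT z|lebesgue. dd v f z) = 0" for v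
    using integral_dd_eq_0[OF f R] by (subst integral_completion) (auto intro!: borel_measurable_continuous_onI dc)
  have i: "integrable lebesgue (dd v f)" for v
    by (rule continuous_supp_integrable(2)[OF dc dd_outside[OF R]])
  show ?thesis unfolding cd_def by (simp add: z i)
qed

lemma cd_by_parts:
  assumes "C_k (Suc 0) f" "C_kc (Suc 0) g"
  shows "(LINT z|lebesgue. f z * cd s j g z) = - (LINT z|lebesgue. cd s j f z * g z)"
proof -
  have fg: "C_kc (Suc 0) (\<lambda>z. f z * g z)" by (rule C_kc_mult_left[OF assms])
  have "0 = (LINT z|lebesgue. cd s j (\<lambda>z. f z * g z) z)" using integral_cd[OF fg] by simp
  also have "\<dots> = (LINT z|lebesgue. f z * cd s j g z + cd s j f z * g z)"
    using assms by (intro Bochner_Integration.integral_cong refl cd_mult) (auto intro: C_k_differentiable C_kc_C_k)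
  also have "\<dots> = (LINT z|lebesgue. f z * cd s j g z) + (LINT z|lebesgue. cd s j f z * g z)"
    using assms by (intro Bochner_Integration.integral_add C_kc_integrable[of 0])
      (auto intro!: C_kc_mult_left C_kc_cd C_k_cd intro: C_k_Suc_imp C_kc_antimono)
  finally show ?thesis by (simp add: eq_neg_iff_add_eq_0)
qed

text \<open>The index pattern is the one that the commutator of the derivatives produces. Compared
  with the quadratic form of the matrix the vector is conjugated, which does not affect lower bounds
  by eigenvalues. For Hermitian matrices the sum is real, and \<open>Re\<close> only changes the
  type.\<close>

definition levi_form :: "(complex ^ 'n::finite \<Rightarrow> real) \<Rightarrow> complex ^ 'n \<Rightarrow> complex ^ 'n \<Rightarrow> real" where
  "levi_form \<phi> z w = Re (\<Sum>j\<in>UNIV. \<Sum>k\<in>UNIV. levi_matrix \<phi> z $ j $ k * w $ j * cnj (w $ k))"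

text \<open>Resting on the C^2 property alone, it can be instantiated by the given weight, by the
  perturbed weight and by the bump that is added.\<close>

locale weight =
  fixes \<phi> :: "complex ^ 'n::finite \<Rightarrow> real"
  assumes C2: "C_k 2 \<phi>"
begin

abbreviation p :: "complex ^ 'n \<Rightarrow> complex" where "p \<equiv> \<lambda>z. complex_of_real (\<phi> z)"
definition w :: "complex ^ 'n \<Rightarrow> complex" where "w z = complex_of_real (exp (- 2 * \<phi> z))"

text \<open>The formal adjoint of \<open>- \<partial>/\<partial>\<close>\<open>z\<^sub>j\<close>-bar in the weighted space.\<close>

definition del :: "'n \<Rightarrow> (complex ^ 'n \<Rightarrow> complex) \<Rightarrow> complex ^ 'n \<Rightarrow> complex" where
  "del j f z = cd (- \<i>) j f z - 2 * cd (- \<i>) j p z * f z"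

lemma cnj_w: "cnj (w z) = w z"
  by (simp add: w_def)

lemma C2p: "C_k (Suc (Suc 0)) p"
  using C_k_of_real[OF C2] by (simp add: numeral_2_eq_2 del: C_k.simps)

lemma C2w: "C_k (Suc (Suc 0)) w"
proof -
  have "C_k 2 (\<lambda>z. (- 2) * \<phi> z)" by (intro C_k_mult C_k_const C2)
  from C_k_of_real[OF C_k_exp[OF this]] show ?thesis
    by (simp add: w_def[abs_def] numeral_2_eq_2 del: C_k.simps)
qed

lemma cd_w: "cd s j w z = - 2 * cd s j p z * w z"
proof -
  have f: "\<phi> differentiable (at z)" using C2 by (auto intro: C_k_differentiable simp: numeral_2_eq_2 simp del: C_k.simps)
  have "((\<lambda>z. exp (- 2 * \<phi> z)) has_derivative (\<lambda>v. exp (- 2 * \<phi> z) * (- 2 * dd v \<phi> z))) (at z)"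
    using has_derivative_dd[OF f] by (auto intro!: derivative_eq_intros)
  from has_derivative_of_real[OF this, where 'a=complex]
  have "dd v w z = complex_of_real (exp (- 2 * \<phi> z) * (- 2 * dd v \<phi> z))" for v
    unfolding w_def[abs_def] by (intro dd_eq)
  moreover have "dd v p z = complex_of_real (dd v \<phi> z)" for v
    by (rule dd_bounded_linear[OF bounded_linear_of_real f])
  ultimately show ?thesis by (simp add: cd_def w_def field_simps)
qed

lemma cd_p_cnj: "cnj (cd s j p z) = cd (cnj s) j p z"
  using cd_cnj[of p z "cnj s" j] C_k_differentiable[OF C2p] by simp

lemma C_kc_del: "C_kc (Suc (Suc 0)) f \<Longrightarrow> C_kc (Suc 0) (del j f)"
proof -
  assume f: "C_kc (Suc (Suc 0)) f"
  have "C_kc (Suc 0) (\<lambda>z. cd (- \<i>) j f z - (2 * cd (- \<i>) j p z) * f z)"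
    by (intro C_kc_diff C_kc_cd f C_kc_mult_left C_k_mult C_k_const C_k_cd[OF C2p] C_kc_antimono[OF f]) simp
  then show ?thesis by (simp add: del_def[abs_def])
qed

lemma C_kc0_del:
  assumes f: "C_kc (Suc 0) f" shows "C_kc 0 (del j f)"
proof -
  have "C_kc 0 (\<lambda>z. cd (- \<i>) j f z - (2 * cd (- \<i>) j p z) * f z)"
    by (intro C_kc_diff C_kc_cd f C_kc_mult_left C_k_mult C_k_const C_k_antimono[OF C_k_cd[OF C2p]] C_kc_antimono[OF f]) auto
  then show ?thesis by (simp add: del_def[abs_def])
qed

text \<open>Integration by parts against \<open>cnj b * w\<close>: differentiating the weight
  produces the zero-order term of \<open>del\<close>.\<close>

lemma del_adjoint:
  assumes a: "C_k (Suc 0) a" and b: "C_kc (Suc 0) b"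
  shows "(LINT z|lebesgue. cd \<i> k a z * cnj (b z) * w z) = - (LINT z|lebesgue. a z * cnj (del k b z) * w z)"
proof -
  have w1: "C_k (Suc 0) w" by (rule C_k_Suc_imp[OF C2w])
  have b1: "C_kc (Suc 0) (\<lambda>z. cnj (b z))" by (rule C_kc_cnj[OF b])
  have bw: "C_kc (Suc 0) (\<lambda>z. cnj (b z) * w z)" by (rule C_kc_mult_right[OF w1 b1])
  have bd: "b differentiable (at z)" "(\<lambda>z. cnj (b z)) differentiable (at z)" for z
    using C_kc_C_k[OF b] C_kc_C_k[OF b1] by (auto intro: C_k_differentiable)
  have "cd \<i> k (\<lambda>z. cnj (b z) * w z) z = cnj (del k b z) * w z" for z
  proof -
    have "cd \<i> k (\<lambda>z. cnj (b z) * w z) z = cnj (b z) * cd \<i> k w z + cd \<i> k (\<lambda>z. cnj (b z)) z * w z"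
      by (rule cd_mult[OF bd(2) C_k_differentiable[OF w1]])
    also have "\<dots> = cnj (del k b z) * w z"
      unfolding cd_w cd_cnj[OF bd(1)] del_def by (simp add: cd_p_cnj algebra_simps)
    finally show ?thesis .
  qed
  then show ?thesis using cd_by_parts[OF a bw, of \<i> k] by (simp add: mult.assoc)
qed

lemma del_adjoint':
  assumes a: "C_kc (Suc 0) a" and b: "C_k (Suc 0) b"
  shows "(LINT z|lebesgue. del k a z * cnj (b z) * w z) = - (LINT z|lebesgue. a z * cnj (cd \<i> k b z) * w z)"
proof -
  have "(LINT z|lebesgue. del k a z * cnj (b z) * w z) = (LINT z|lebesgue. cnj (b z * cnj (del k a z) * w z))"
    by (simp add: mult_ac cnj_w)
  also have "\<dots> = cnj (LINT z|lebesgue. b z * cnj (del k a z) * w z)" by (rule Bochner_Integration.integral_cnj)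
  also have "\<dots> = - cnj (LINT z|lebesgue. cd \<i> k b z * cnj (a z) * w z)"
    by (simp only: del_adjoint[OF b a, of k] complex_cnj_minus minus_minus)
  also have "cnj (LINT z|lebesgue. cd \<i> k b z * cnj (a z) * w z) = (LINT z|lebesgue. cnj (cd \<i> k b z * cnj (a z) * w z))"
    by (rule Bochner_Integration.integral_cnj[symmetric])
  also have "\<dots> = (LINT z|lebesgue. a z * cnj (cd \<i> k b z) * w z)"
    by (simp add: mult_ac cnj_w)
  finally show ?thesis .
qed

text \<open>Second derivatives of \<open>f\<close> commute, so the commutator reduces to the
  derivative that falls on the coefficient \<open>2 * cd (- \<i>) j p\<close>. This is how the Levi
  matrix enters, and the source of the factor 2.\<close>

lemma cd_del_commute:
  assumes f: "C_kc (Suc (Suc 0)) f"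
  shows "cd \<i> k (del j f) z = del j (cd \<i> k f) z - 2 * levi_matrix \<phi> z $ j $ k * f z"
proof -
  have fd: "f differentiable (at z)" "cd s j f differentiable (at z)" for s j
    using C_kc_C_k[OF f] C_kc_C_k[OF C_kc_cd[OF f]] by (auto intro: C_k_differentiable)
  have pd: "(\<lambda>z. 2 * cd s j p z) differentiable (at z)" "cd s j p differentiable (at z)" for s j
    by (rule C_k_differentiable[OF C_k_mult[OF C_k_const C_k_cd[OF C2p]]] C_k_differentiable[OF C_k_cd[OF C2p]])+
  have ppd: "(\<lambda>z. 2 * cd (- \<i>) j p z * f z) differentiable (at z)"
    by (rule C_k_differentiable[OF C_kc_C_k[OF C_kc_mult_left[OF C_k_mult[OF C_k_const C_k_cd[OF C2p]] C_kc_antimono[OF f, of "Suc 0"]]]]) simp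
  have f2: "C_k 2 f" "C_k 2 p" using C_kc_C_k[OF f] C2p by (simp_all add: numeral_2_eq_2 del: C_k.simps)
  have "cd \<i> k (del j f) z = cd \<i> k (cd (- \<i>) j f) z - (2 * cd (- \<i>) j p z * cd \<i> k f z + 2 * cd \<i> k (cd (- \<i>) j p) z * f z)"
    unfolding del_def[abs_def] cd_diff[OF fd(2) ppd] cd_mult[OF pd(1) fd(1)] cd_cmult[OF pd(2)] ..
  then show ?thesis
    by (simp add: del_def levi_matrix_def d_z_cd d_zbar_cd cd_commute[OF f2(1), of \<i> k "- \<i>" j] cd_commute[OF f2(2), of \<i> k "- \<i>" j] algebra_simps)
qed

text \<open>Expanding the first square on the right and integrating by parts leaves the Levi term
  plus mixed products of dbar derivatives. Their sum equals the sum of all squared dbar derivatives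
  minus half the double sum of squared coefficients of the (0,2)-form; dropping the former turns the
  identity into the inequality.\<close>

lemma kohn_morrey:
  fixes \<alpha> :: "'n \<Rightarrow> complex ^ 'n \<Rightarrow> complex"
  assumes \<alpha>: "\<And>j. C_kc (Suc (Suc 0)) (\<alpha> j)"
  shows "(LINT z|lebesgue. 2 * levi_form \<phi> z (\<chi> j. \<alpha> j z) * exp (- 2 * \<phi> z))
    \<le> (LINT z|lebesgue. (cmod (\<Sum>j\<in>UNIV. del j (\<alpha> j) z))\<^sup>2 * exp (- 2 * \<phi> z))
    + (\<Sum>j\<in>UNIV. \<Sum>k\<in>UNIV. LINT z|lebesgue. (cmod (cd \<i> j (\<alpha> k) z - cd \<i> k (\<alpha> j) z))\<^sup>2 * exp (- 2 * \<phi> z)) / 2"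
proof -
  let ?I = "\<lambda>f. (LINT z|lebesgue. f z) :: complex"
  let ?L = "\<lambda>j k z. levi_matrix \<phi> z $ j $ k"
  have \<alpha>1: "C_kc (Suc 0) (\<alpha> j)" for j by (rule C_kc_antimono[OF \<alpha>]) simp
  have w1: "C_k (Suc 0) w" by (rule C_k_Suc_imp[OF C2w])
  have w0: "C_k 0 w" by (rule C_k_Suc_imp[OF w1])
  have L0: "C_k 0 (?L j k)" for j k
    using C_k_cd[OF C_k_cd[OF C2p], of "- \<i>" j \<i> k] by (simp add: levi_matrix_def d_z_cd d_zbar_cd del: C_k.simps)
  have D1: "C_kc (Suc 0) (del j (\<alpha> j))" for j by (rule C_kc_del[OF \<alpha>])
  have B1: "C_kc (Suc 0) (cd \<i> k (\<alpha> j))" for j k by (rule C_kc_cd[OF \<alpha>])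
  have low: "C_kc (Suc 0) f \<Longrightarrow> C_kc 0 f" for f :: "complex ^ 'n \<Rightarrow> complex" by (rule C_kc_antimono) auto
  have int3: "integrable lebesgue (\<lambda>z. f z * cnj (g z) * w z)" if "C_kc 0 f" "C_kc 0 g" for f g
    by (rule C_kc_integrable[of 0]) (intro C_kc_mult_right[OF w0] C_kc_mult_left C_kc_C_k that C_kc_cnj)
  have intL: "integrable lebesgue (\<lambda>z. ?L j k z * \<alpha> j z * cnj (\<alpha> k z) * w z)" for j k
    by (rule C_kc_integrable[of 0]) (intro C_kc_mult_right[OF w0] C_kc_mult_left[OF C_kc_C_k] C_kc_mult_left[OF L0] low \<alpha>1 C_kc_cnj)
  \<comment> \<open>\<open>del k\<close> is moved over as \<open>cd \<i> k\<close>, commuted past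
    \<open>del j\<close> at the price of the Levi term, and \<open>del j\<close> is then moved onto
    \<open>\<alpha> k\<close> as \<open>cd \<i> j\<close>.\<close>
  have tm: "?I (\<lambda>z. del j (\<alpha> j) z * cnj (del k (\<alpha> k) z) * w z)
    = 2 * ?I (\<lambda>z. ?L j k z * \<alpha> j z * cnj (\<alpha> k z) * w z) + ?I (\<lambda>z. cd \<i> k (\<alpha> j) z * cnj (cd \<i> j (\<alpha> k) z) * w z)" for j k
  proof -
    have "?I (\<lambda>z. del j (\<alpha> j) z * cnj (del k (\<alpha> k) z) * w z) = - ?I (\<lambda>z. cd \<i> k (del j (\<alpha> j)) z * cnj (\<alpha> k z) * w z)"
      using del_adjoint[OF C_kc_C_k[OF D1] \<alpha>1, of k j k] by simp
    also have "?I (\<lambda>z. cd \<i> k (del j (\<alpha> j)) z * cnj (\<alpha> k z) * w z)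
      = ?I (\<lambda>z. del j (cd \<i> k (\<alpha> j)) z * cnj (\<alpha> k z) * w z - 2 * (?L j k z * \<alpha> j z * cnj (\<alpha> k z) * w z))"
      by (intro Bochner_Integration.integral_cong refl) (simp add: cd_del_commute[OF \<alpha>] algebra_simps)
    also have "\<dots> = ?I (\<lambda>z. del j (cd \<i> k (\<alpha> j)) z * cnj (\<alpha> k z) * w z) - 2 * ?I (\<lambda>z. ?L j k z * \<alpha> j z * cnj (\<alpha> k z) * w z)"
      using int3[OF C_kc0_del[OF B1] low[OF \<alpha>1]] intL by simp
    also have "?I (\<lambda>z. del j (cd \<i> k (\<alpha> j)) z * cnj (\<alpha> k z) * w z) = - ?I (\<lambda>z. cd \<i> k (\<alpha> j) z * cnj (cd \<i> j (\<alpha> k) z) * w z)"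
      by (rule del_adjoint'[OF B1 C_kc_C_k[OF \<alpha>1]])
    finally show ?thesis by simp
  qed
  have sq: "complex_of_real ((cmod c)\<^sup>2 * exp (- 2 * \<phi> z)) = c * cnj c * w z" for c z
    by (simp only: w_def of_real_mult complex_norm_square)
  have D0: "C_kc 0 (\<lambda>z. \<Sum>j\<in>UNIV. del j (\<alpha> j) z)" by (intro C_kc_sum low D1)
  have T: "complex_of_real (LINT z|lebesgue. (cmod (\<Sum>j\<in>UNIV. del j (\<alpha> j) z))\<^sup>2 * exp (- 2 * \<phi> z))
    = (\<Sum>j\<in>UNIV. \<Sum>k\<in>UNIV. 2 * ?I (\<lambda>z. ?L j k z * \<alpha> j z * cnj (\<alpha> k z) * w z) + ?I (\<lambda>z. cd \<i> k (\<alpha> j) z * cnj (cd \<i> j (\<alpha> k) z) * w z))"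
  proof -
    have "complex_of_real (LINT z|lebesgue. (cmod (\<Sum>j\<in>UNIV. del j (\<alpha> j) z))\<^sup>2 * exp (- 2 * \<phi> z))
      = ?I (\<lambda>z. \<Sum>j\<in>UNIV. \<Sum>k\<in>UNIV. del j (\<alpha> j) z * cnj (del k (\<alpha> k) z) * w z)"
      unfolding integral_complex_of_real[symmetric] sq
      unfolding cnj_sum sum_product by (simp only: sum_distrib_right)
    also have "\<dots> = (\<Sum>j\<in>UNIV. \<Sum>k\<in>UNIV. ?I (\<lambda>z. del j (\<alpha> j) z * cnj (del k (\<alpha> k) z) * w z))"
      by (simp add: int3 low D1)
    finally show ?thesis by (simp only: tm)
  qed
  have lev: "complex_of_real (LINT z|lebesgue. 2 * levi_form \<phi> z (\<chi> j. \<alpha> j z) * exp (- 2 * \<phi> z))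
    = complex_of_real (Re (\<Sum>j\<in>UNIV. \<Sum>k\<in>UNIV. 2 * ?I (\<lambda>z. ?L j k z * \<alpha> j z * cnj (\<alpha> k z) * w z)))"
  proof -
    have "2 * levi_form \<phi> z (\<chi> j. \<alpha> j z) * exp (- 2 * \<phi> z)
      = Re (\<Sum>j\<in>UNIV. \<Sum>k\<in>UNIV. 2 * (?L j k z * \<alpha> j z * cnj (\<alpha> k z) * w z))" for z
    proof -
      have "Re (\<Sum>j\<in>UNIV. \<Sum>k\<in>UNIV. 2 * (?L j k z * \<alpha> j z * cnj (\<alpha> k z) * w z))
        = Re (complex_of_real (2 * exp (- 2 * \<phi> z)) * (\<Sum>j\<in>UNIV. \<Sum>k\<in>UNIV. ?L j k z * \<alpha> j z * cnj (\<alpha> k z)))"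
        by (simp add: w_def sum_distrib_left mult_ac)
      then show ?thesis unfolding levi_form_def by (simp only: Re_complex_of_real Im_complex_of_real times_complex.sel) simp
    qed
    then have "(LINT z|lebesgue. 2 * levi_form \<phi> z (\<chi> j. \<alpha> j z) * exp (- 2 * \<phi> z))
      = (LINT z|lebesgue. Re (\<Sum>j\<in>UNIV. \<Sum>k\<in>UNIV. 2 * (?L j k z * \<alpha> j z * cnj (\<alpha> k z) * w z)))" by simp
    also have "\<dots> = Re (\<Sum>j\<in>UNIV. \<Sum>k\<in>UNIV. 2 * ?I (\<lambda>z. ?L j k z * \<alpha> j z * cnj (\<alpha> k z) * w z))"
      by (subst integral_Re) (simp_all add: intL)
    finally show ?thesis by simp
  qed
  have cross: "complex_of_real (LINT z|lebesgue. (cmod (cd \<i> j (\<alpha> k) z - cd \<i> k (\<alpha> j) z))\<^sup>2 * exp (- 2 * \<phi> z))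
    = ?I (\<lambda>z. cd \<i> j (\<alpha> k) z * cnj (cd \<i> j (\<alpha> k) z) * w z) + ?I (\<lambda>z. cd \<i> k (\<alpha> j) z * cnj (cd \<i> k (\<alpha> j) z) * w z)
      - ?I (\<lambda>z. cd \<i> j (\<alpha> k) z * cnj (cd \<i> k (\<alpha> j) z) * w z) - ?I (\<lambda>z. cd \<i> k (\<alpha> j) z * cnj (cd \<i> j (\<alpha> k) z) * w z)" for j k
  proof -
    have "complex_of_real (LINT z|lebesgue. (cmod (cd \<i> j (\<alpha> k) z - cd \<i> k (\<alpha> j) z))\<^sup>2 * exp (- 2 * \<phi> z))
      = ?I (\<lambda>z. cd \<i> j (\<alpha> k) z * cnj (cd \<i> j (\<alpha> k) z) * w z + cd \<i> k (\<alpha> j) z * cnj (cd \<i> k (\<alpha> j) z) * w z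
      - cd \<i> j (\<alpha> k) z * cnj (cd \<i> k (\<alpha> j) z) * w z - cd \<i> k (\<alpha> j) z * cnj (cd \<i> j (\<alpha> k) z) * w z)"
      unfolding integral_complex_of_real[symmetric] sq by (intro Bochner_Integration.integral_cong refl) (simp add: algebra_simps)
    then show ?thesis by (simp add: int3 low B1)
  qed
  define S where "S j k = ?I (\<lambda>z. cd \<i> j (\<alpha> k) z * cnj (cd \<i> j (\<alpha> k) z) * w z)" for j k
  define X where "X j k = ?I (\<lambda>z. cd \<i> k (\<alpha> j) z * cnj (cd \<i> j (\<alpha> k) z) * w z)" for j k
  define Y where "Y = (\<Sum>j\<in>UNIV. \<Sum>k\<in>UNIV. 2 * ?I (\<lambda>z. ?L j k z * \<alpha> j z * cnj (\<alpha> k z) * w z))"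
  \<comment> \<open>These are the squares that the inequality drops.\<close>
  have S0: "Re (S j k) \<ge> 0" for j k
  proof -
    have "S j k = complex_of_real (LINT z|lebesgue. (cmod (cd \<i> j (\<alpha> k) z))\<^sup>2 * exp (- 2 * \<phi> z))"
      unfolding S_def integral_complex_of_real[symmetric] sq ..
    then show ?thesis by simp
  qed
  have sw: "(\<Sum>j\<in>UNIV. \<Sum>k\<in>UNIV. S k j) = (\<Sum>j\<in>UNIV. \<Sum>k\<in>UNIV. S j k)" "(\<Sum>j\<in>UNIV. \<Sum>k\<in>UNIV. X k j) = (\<Sum>j\<in>UNIV. \<Sum>k\<in>UNIV. X j k)"
    by (rule sum.swap)+
  have "complex_of_real (\<Sum>j\<in>UNIV. \<Sum>k\<in>UNIV. LINT z|lebesgue. (cmod (cd \<i> j (\<alpha> k) z - cd \<i> k (\<alpha> j) z))\<^sup>2 * exp (- 2 * \<phi> z))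
    = (\<Sum>j\<in>UNIV. \<Sum>k\<in>UNIV. S j k + S k j - X k j - X j k)"
    unfolding of_real_sum cross S_def X_def ..
  also have "\<dots> = 2 * (\<Sum>j\<in>UNIV. \<Sum>k\<in>UNIV. S j k) - 2 * (\<Sum>j\<in>UNIV. \<Sum>k\<in>UNIV. X j k)"
    unfolding sum.distrib sum_subtractf by (subst sw(1), subst sw(2)) (simp only: mult_2 diff_diff_add)
  finally have ce: "complex_of_real (\<Sum>j\<in>UNIV. \<Sum>k\<in>UNIV. LINT z|lebesgue. (cmod (cd \<i> j (\<alpha> k) z - cd \<i> k (\<alpha> j) z))\<^sup>2 * exp (- 2 * \<phi> z))
    = 2 * (\<Sum>j\<in>UNIV. \<Sum>k\<in>UNIV. S j k) - 2 * (\<Sum>j\<in>UNIV. \<Sum>k\<in>UNIV. X j k)" .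
  have c: "(\<Sum>j\<in>UNIV. \<Sum>k\<in>UNIV. LINT z|lebesgue. (cmod (cd \<i> j (\<alpha> k) z - cd \<i> k (\<alpha> j) z))\<^sup>2 * exp (- 2 * \<phi> z))
    = Re (2 * (\<Sum>j\<in>UNIV. \<Sum>k\<in>UNIV. S j k) - 2 * (\<Sum>j\<in>UNIV. \<Sum>k\<in>UNIV. X j k))"
    using arg_cong[OF ce, of Re] by (simp only: Re_complex_of_real)
  have t: "(LINT z|lebesgue. (cmod (\<Sum>j\<in>UNIV. del j (\<alpha> j) z))\<^sup>2 * exp (- 2 * \<phi> z)) = Re (Y + (\<Sum>j\<in>UNIV. \<Sum>k\<in>UNIV. X j k))"
    using arg_cong[OF T, of Re] unfolding Y_def X_def by (simp only: Re_complex_of_real sum.distrib)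
  have l: "(LINT z|lebesgue. 2 * levi_form \<phi> z (\<chi> j. \<alpha> j z) * exp (- 2 * \<phi> z)) = Re Y"
    using arg_cong[OF lev, of Re] unfolding Y_def by (simp only: Re_complex_of_real)
  have "0 \<le> Re (\<Sum>j\<in>UNIV. \<Sum>k\<in>UNIV. S j k)" using S0 by (simp add: sum_nonneg)
  then show ?thesis unfolding c t l by (simp add: diff_divide_distrib)
qed

end

section \<open>Weighted spaces and density of test functions\<close>

text \<open>As a density the weight becomes part of the measure, and the results on square
  integrable functions over arbitrary measures apply verbatim.\<close>

definition wm :: "(complex ^ 'n::finite \<Rightarrow> real) \<Rightarrow> (complex ^ 'n) measure" where
  "wm \<phi> = density lebesgue (\<lambda>z. ennreal (exp (- 2 * \<phi> z)))"

lemma wm_sets [simp, measurable_cong]: "sets (wm \<phi>) = sets lebesgue"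
  by (simp add: wm_def)

lemma wm_measurable [simp]: "borel_measurable (wm \<phi>) = borel_measurable lebesgue"
  by (rule measurable_cong_sets) simp_all

definition cvg :: "'a measure \<Rightarrow> (nat \<Rightarrow> 'a \<Rightarrow> 'b::euclidean_space) \<Rightarrow> ('a \<Rightarrow> 'b) \<Rightarrow> bool" where
  "cvg M s u \<longleftrightarrow> (\<forall>n. s n \<in> sqint M) \<and> u \<in> sqint M \<and> (\<lambda>n. nrm M (\<lambda>x. s n x - u x)) \<longlonglongrightarrow> 0"

lemma cvg_nrm: "cvg M s u \<Longrightarrow> (\<lambda>n. nrm M (s n)) \<longlonglongrightarrow> nrm M u"
  unfolding cvg_def by (auto intro: nrm_tendsto)

lemma cvg_add:
  assumes "cvg M s u" "cvg M t v" shows "cvg M (\<lambda>n x. s n x + t n x) (\<lambda>x. u x + v x)"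
  unfolding cvg_def
proof (intro conjI allI)
  show "(\<lambda>n. nrm M (\<lambda>x. s n x + t n x - (u x + v x))) \<longlonglongrightarrow> 0"
  proof (rule Lim_null_comparison)
    show "(\<lambda>n. nrm M (\<lambda>x. s n x - u x) + nrm M (\<lambda>x. t n x - v x)) \<longlonglongrightarrow> 0"
      using assms tendsto_add[of _ 0 _ _ 0] by (force simp: cvg_def)
    have "nrm M (\<lambda>x. s n x + t n x - (u x + v x)) \<le> nrm M (\<lambda>x. s n x - u x) + nrm M (\<lambda>x. t n x - v x)" for n
      using nrm_triangle[OF sqint_diff sqint_diff, of "s n" M u "t n" v] assms
      by (simp add: cvg_def algebra_simps)
    then show "\<forall>\<^sub>F n in sequentially. norm (nrm M (\<lambda>x. s n x + t n x - (u x + v x)))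
        \<le> nrm M (\<lambda>x. s n x - u x) + nrm M (\<lambda>x. t n x - v x)" by simp
  qed
qed (use assms in \<open>auto simp: cvg_def intro: sqint_add\<close>)

lemma cvg_const: "u \<in> sqint M \<Longrightarrow> cvg M (\<lambda>n. u) u"
  by (simp add: cvg_def nrm_def)

lemma cvg_sum:
  "(\<And>i. i \<in> I \<Longrightarrow> cvg M (s i) (u i)) \<Longrightarrow> cvg M (\<lambda>n x. \<Sum>i\<in>I. s i n x) (\<lambda>x. \<Sum>i\<in>I. u i x)"
  by (induction I rule: infinite_finite_induct) (auto intro: cvg_add cvg_const sqint_0)

text \<open>The bound on \<open>m\<close> is asked for only where \<open>f\<close> does not vanish,
  so that locally bounded multipliers may act on functions of compact support.\<close>

lemma sqint_bounded_mult:
  fixes f :: "'a \<Rightarrow> complex"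
  assumes m: "m \<in> borel_measurable M" and f: "f \<in> sqint M"
    and B: "\<And>x. f x \<noteq> 0 \<Longrightarrow> cmod (m x) \<le> B" "B \<ge> 0"
  shows "(\<lambda>x. m x * f x) \<in> sqint M" "nrm M (\<lambda>x. m x * f x) \<le> B * nrm M f"
proof -
  have le: "norm (m x * f x) \<le> norm (B *\<^sub>R f x)" for x
    using B(1)[of x] B(2) by (cases "f x = 0") (auto simp: norm_mult intro!: mult_right_mono)
  have Bf: "(\<lambda>x. B *\<^sub>R f x) \<in> sqint M" by (rule sqint_scaleR[OF f])
  have mf: "(\<lambda>x. m x * f x) \<in> borel_measurable M" using m sqint_measurable[OF f] by measurable
  show "(\<lambda>x. m x * f x) \<in> sqint M" by (rule sqint_mono[OF Bf mf]) (use le in simp)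
  have "nrm M (\<lambda>x. m x * f x) \<le> nrm M (\<lambda>x. B *\<^sub>R f x)" by (rule nrm_mono[OF Bf mf]) (use le in simp)
  then show "nrm M (\<lambda>x. m x * f x) \<le> B * nrm M f" using B(2) by (simp add: nrm_scaleR)
qed

lemma cvg_bounded_mult:
  fixes s :: "nat \<Rightarrow> 'a::real_normed_vector \<Rightarrow> complex"
  assumes c: "cvg M s u" and m: "m \<in> borel_measurable M" and B: "\<And>x. norm x \<le> R \<Longrightarrow> cmod (m x) \<le> B" "B \<ge> 0"
    and R: "\<And>n x. R < norm x \<Longrightarrow> s n x = 0" "\<And>x. R < norm x \<Longrightarrow> u x = 0"
  shows "cvg M (\<lambda>n x. m x * s n x) (\<lambda>x. m x * u x)"
proof -
  have d: "(\<lambda>x. s n x - u x) \<in> sqint M" for n using c by (auto simp: cvg_def intro: sqint_diff)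
  have le: "nrm M (\<lambda>x. m x * (s n x - u x)) \<le> B * nrm M (\<lambda>x. s n x - u x)" for n
    by (rule sqint_bounded_mult[OF m d _ B(2)]) (use B(1) R in \<open>metis diff_zero linorder_not_less\<close>)
  have "(\<lambda>n. nrm M (\<lambda>x. m x * (s n x - u x))) \<longlonglongrightarrow> 0"
  proof (rule Lim_null_comparison)
    show "(\<lambda>n. B * nrm M (\<lambda>x. s n x - u x)) \<longlonglongrightarrow> 0"
      by (rule tendsto_mult_right_zero) (use c in \<open>simp add: cvg_def\<close>)
  qed (use le in simp)
  moreover have "(\<lambda>x. m x * s n x) \<in> sqint M" for n
    by (rule sqint_bounded_mult[OF m _ _ B(2)]) (use B(1) R c in \<open>auto simp: cvg_def linorder_not_less[symmetric]\<close>)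
  moreover have "(\<lambda>x. m x * u x) \<in> sqint M"
    by (rule sqint_bounded_mult[OF m _ _ B(2)]) (use B(1) R c in \<open>auto simp: cvg_def linorder_not_less[symmetric]\<close>)
  ultimately show ?thesis by (simp add: cvg_def right_diff_distrib)
qed

lemma test_functions_iff: "\<psi> \<in> test_functions \<longleftrightarrow> (\<forall>k. C_kc k \<psi>)"
proof -
  have "compact (closure {z. \<psi> z \<noteq> 0}) \<longleftrightarrow> (\<exists>R. \<forall>z. R < norm z \<longrightarrow> \<psi> z = 0)"
    unfolding compact_closure bounded_iff by (auto simp: linorder_not_less[symmetric])
  then show ?thesis by (auto simp: test_functions_def C_kc_def)
qed

text \<open>The indicator function of the ball of radius 2, mollified at scale 1, is constant up to
  radius 1 and zero beyond radius 3.\<close>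

lemma cutoff_exists:
  obtains c :: "'a::euclidean_space \<Rightarrow> real"
  where "\<And>k. C_k k c" "\<And>x. 0 \<le> c x" "\<And>x. c x \<le> 1" "\<And>x. norm x \<le> 1 \<Longrightarrow> c x = 1" "\<And>x. 3 < norm x \<Longrightarrow> c x = 0"
proof -
  interpret smoothing_kernel "mollifier 1 :: 'a \<Rightarrow> real" 1 by (rule smoothing_kernel_mollifier) simp
  let ?k = "mollifier 1 :: 'a \<Rightarrow> real" and ?f = "indicat_real (cball (0::'a) 2)"
  have "integrable lborel (\<lambda>x::'a. indicator (cball 0 2) x *\<^sub>R (1::real))" by (rule borel_integrable_compact) auto
  then have f: "integrable lebesgue ?f" by (subst integrable_completion) (auto intro!: borel_measurable_indicator)
  have km[measurable]: "?k \<in> borel_measurable borel" using cont by (rule borel_measurable_continuous_onI)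
  have ki: "integrable lborel ?k" by (rule continuous_supp_integrable[OF cont outside])
  have kr: "(LINT y|lebesgue. ?k (x - y)) = 1" "integrable lebesgue (\<lambda>y. ?k (x - y))" for x
  proof -
    have "integrable (distr lborel borel (\<lambda>y. x - y)) ?k" using ki by (simp add: lborel_distr_reflect)
    then have i: "integrable lborel (\<lambda>y. ?k (x - y))" by (subst (asm) integrable_distr_eq) auto
    then show "integrable lebesgue (\<lambda>y. ?k (x - y))" by (subst integrable_completion) auto
    have "(LINT y|lebesgue. ?k (x - y)) = (LINT y|lborel. ?k (x - y))" by (rule integral_completion) measurable
    also have "\<dots> = (LINT y|distr lborel borel (\<lambda>y. x - y). ?k y)" by (subst integral_distr) auto
    finally show "(LINT y|lebesgue. ?k (x - y)) = 1" using mass by (simp add: lborel_distr_reflect)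
  qed
  obtain B where B: "\<And>x. norm (?k x) \<le> B" using continuous_supp_bounded[OF cont outside] by metis
  have ci: "integrable lebesgue (\<lambda>y. ?k (x - y) *\<^sub>R ?f y)" for x by (rule conv_integrable[OF cont B f])
  show ?thesis
  proof (rule that[of "conv ?k ?f"])
    show "C_k k (conv ?k ?f)" for k by (rule conv_C_k[OF smooth outside f])
    show "0 \<le> conv ?k ?f x" for x unfolding conv_def by (intro integral_nonneg_AE AE_I2) (simp add: nonneg)
    have "conv ?k ?f x \<le> (LINT y|lebesgue. ?k (x - y))" for x
      unfolding conv_def by (rule integral_mono[OF ci kr(2)]) (auto simp: nonneg indicator_def)
    then show "conv ?k ?f x \<le> 1" for x by (simp add: kr)
    show "conv ?k ?f x = 1" if "norm x \<le> 1" for x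
    proof -
      have "?k (x - y) *\<^sub>R ?f y = ?k (x - y)" for y
      proof (cases "norm y \<le> 2")
        case False
        then have "1 < norm (x - y)" using that norm_triangle_ineq2[of y x] by (simp add: norm_minus_commute)
        then show ?thesis by (simp add: outside)
      qed simp
      then show ?thesis unfolding conv_def by (simp only: kr)
    qed
    show "conv ?k ?f x = 0" if "3 < norm x" for x
      by (rule conv_outside[of 1 _ 2]) (use that in \<open>auto simp: outside\<close>)
  qed
qed

section \<open>Forms in terms of their coefficients\<close>

lemma norm_vec_power2: "(norm (v :: complex ^ 'n))\<^sup>2 = (\<Sum>j\<in>UNIV. (cmod (v $ j))\<^sup>2)"
  by (simp add: norm_vec_def L2_set_def sum_nonneg)

lemma measurable_vec_iff:
  "(f :: 'a \<Rightarrow> complex ^ 'n::finite) \<in> borel_measurable M \<longleftrightarrow> (\<forall>j. (\<lambda>x. f x $ j) \<in> borel_measurable M)"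
proof safe
  fix j assume f: "f \<in> borel_measurable M"
  have "continuous_on UNIV (\<lambda>v::complex ^ 'n. v $ j)" by (intro continuous_intros)
  then show "(\<lambda>x. f x $ j) \<in> borel_measurable M" using borel_measurable_continuous_on f by blast
next
  assume *: "\<forall>j. (\<lambda>x. f x $ j) \<in> borel_measurable M"
  have b: "bounded_linear (axis j :: complex \<Rightarrow> complex ^ 'n)" for j
    by (rule linear_conv_bounded_linear[THEN iffD1], rule linearI)
      (auto simp: axis_def vec_eq_iff)
  have "(\<lambda>x. axis j (f x $ j) :: complex ^ 'n) \<in> borel_measurable M" for j
    using * borel_measurable_continuous_on[OF linear_continuous_on[OF b], of "\<lambda>x. f x $ j"] by blast
  then have "(\<lambda>x. \<Sum>j\<in>UNIV. axis j (f x $ j) :: complex ^ 'n) \<in> borel_measurable M" by measurable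
  moreover have "(\<Sum>j\<in>UNIV. axis j (f x $ j) :: complex ^ 'n) = f x" for x
    by (simp add: vec_eq_iff axis_def if_distrib[of "\<lambda>g. g $ _"] cong: if_cong)
  ultimately show "f \<in> borel_measurable M" by simp
qed

lemma sqint_vec_iff:
  "(f :: 'a \<Rightarrow> complex ^ 'n::finite) \<in> sqint M \<longleftrightarrow> (\<forall>j. (\<lambda>x. f x $ j) \<in> sqint M)"
proof safe
  fix j assume f: "f \<in> sqint M"
  show "(\<lambda>x. f x $ j) \<in> sqint M"
  proof (rule sqintI[where g="\<lambda>x. norm (f x)"])
    show "(\<lambda>x. f x $ j) \<in> borel_measurable M"
      using sqint_measurable[OF f] by (simp add: measurable_vec_iff)
    show "(\<lambda>x. norm (f x)) \<in> borel_measurable M" using sqint_measurable[OF f] by measurable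
    show "integrable M (\<lambda>x. (norm (f x))\<^sup>2)" by (rule sqint_integrable[OF f])
  qed (simp add: Finite_Cartesian_Product.norm_nth_le)
next
  assume *: "\<forall>j. (\<lambda>x. f x $ j) \<in> sqint M"
  then have "f \<in> borel_measurable M" by (simp add: measurable_vec_iff sqint_measurable)
  moreover have "integrable M (\<lambda>x. (norm (f x))\<^sup>2)"
    unfolding norm_vec_power2 using * by (intro Bochner_Integration.integrable_sum) (auto simp: sqint_def)
  ultimately show "f \<in> sqint M" by (simp add: sqint_def)
qed

lemma nrm_vec_power2:
  assumes "(f :: 'a \<Rightarrow> complex ^ 'n::finite) \<in> sqint M"
  shows "(nrm M f)\<^sup>2 = (\<Sum>j\<in>UNIV. (nrm M (\<lambda>x. f x $ j))\<^sup>2)"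
  unfolding nrm_power2 norm_vec_power2
proof (rule Bochner_Integration.integral_sum)
  fix j
  have "(\<lambda>x. f x $ j) \<in> sqint M" using assms by (simp add: sqint_vec_iff)
  then show "integrable M (\<lambda>x. (cmod (f x $ j))\<^sup>2)" by (rule sqint_integrable)
qed

section \<open>Weighted against unweighted norms\<close>

context weight
begin

abbreviation W :: "(complex ^ 'n) measure" where "W \<equiv> wm \<phi>"

lemma cont_\<phi>: "continuous_on UNIV \<phi>"
  by (rule C_k_continuous[OF C2])

lemma exp_measurable [measurable]: "(\<lambda>z. exp (- 2 * \<phi> z)) \<in> borel_measurable lebesgue"
proof -
  have "continuous_on UNIV (\<lambda>z. exp (- 2 * \<phi> z))" by (intro continuous_intros cont_\<phi>)
  from borel_measurable_continuous_onI[OF this] show ?thesis by (simp add: measurable_completion)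
qed

lemmas exp_measurable' [measurable] = exp_measurable[simplified]

lemma integral_W:
  fixes f :: "complex ^ 'n \<Rightarrow> real"
  assumes "f \<in> borel_measurable lebesgue"
  shows "(LINT z|W. f z) = (LINT z|lebesgue. f z * exp (- 2 * \<phi> z))"
  using integral_density[of f lebesgue "\<lambda>z. exp (- 2 * \<phi> z)"] assms exp_measurable
  unfolding wm_def by (simp add: mult.commute)

lemma integrable_W:
  fixes f :: "complex ^ 'n \<Rightarrow> real"
  assumes "f \<in> borel_measurable lebesgue"
  shows "integrable W f \<longleftrightarrow> integrable lebesgue (\<lambda>z. f z * exp (- 2 * \<phi> z))"
  using integrable_density[of f lebesgue "\<lambda>z. exp (- 2 * \<phi> z)"] assms exp_measurable
  unfolding wm_def by (simp add: mult.commute)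

lemma nrm_W_power2:
  "f \<in> borel_measurable lebesgue \<Longrightarrow> (nrm W f)\<^sup>2 = (LINT z|lebesgue. (norm (f z))\<^sup>2 * exp (- 2 * \<phi> z))"
  unfolding nrm_power2 by (rule integral_W) measurable

lemma sqint_W_iff:
  "f \<in> sqint W \<longleftrightarrow> f \<in> borel_measurable lebesgue \<and> integrable lebesgue (\<lambda>z. (norm (f z))\<^sup>2 * exp (- 2 * \<phi> z))"
  by (auto simp: sqint_def integrable_W borel_measurable_power borel_measurable_norm)

lemma L2_eq: "L2 \<phi> = sqint W"
  by (auto simp: L2_def sqint_W_iff)

lemma L2_norm_eq: "f \<in> borel_measurable lebesgue \<Longrightarrow> L2_norm \<phi> f = nrm W f"
  using nrm_W_power2[of f] by (simp add: L2_norm_def real_sqrt_unique)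

lemma L2_forms_eq: "L2_forms \<phi> = sqint W"
  by (auto simp: L2_forms_def L2_eq sqint_vec_iff)

lemma \<phi>_bounded: obtains B where "B > 0" "\<And>z. norm z \<le> R \<Longrightarrow> \<bar>\<phi> z\<bar> \<le> B"
proof -
  have "compact (\<phi> ` cball 0 R)"
    by (intro compact_continuous_image continuous_on_subset[OF cont_\<phi>]) auto
  then obtain B where "B > 0" "\<And>y. y \<in> \<phi> ` cball 0 R \<Longrightarrow> norm y \<le> B"
    by (meson bounded_pos compact_imp_bounded)
  then show ?thesis by (intro that[of B]) auto
qed

text \<open>By continuity of \<phi> the weight is bounded above and away from 0 on the ball of
  radius \<open>R\<close>. For functions supported there the two norms are equivalent with one
  common constant, which carries convergence of mollifications over to the weighted space.\<close>

lemma sqint_W_supp: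
  obtains C where "C > 0"
    "\<And>f :: complex ^ 'n \<Rightarrow> 'b::euclidean_space. (\<And>z. R < norm z \<Longrightarrow> f z = 0) \<Longrightarrow> f \<in> sqint W \<Longrightarrow> f \<in> sqint lebesgue \<and> nrm lebesgue f \<le> C * nrm W f"
    "\<And>f :: complex ^ 'n \<Rightarrow> 'b::euclidean_space. (\<And>z. R < norm z \<Longrightarrow> f z = 0) \<Longrightarrow> f \<in> sqint lebesgue \<Longrightarrow> f \<in> sqint W \<and> nrm W f \<le> C * nrm lebesgue f"
proof -
  obtain B where B: "B > 0" "\<And>z. norm z \<le> R \<Longrightarrow> \<bar>\<phi> z\<bar> \<le> B" using \<phi>_bounded by blast
  have e: "exp (- 2 * \<phi> z) \<le> (exp B)\<^sup>2" "1 \<le> (exp B)\<^sup>2 * exp (- 2 * \<phi> z)" if "norm z \<le> R" for z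
    using B(2)[OF that] by (auto simp flip: exp_add simp: power2_eq_square)
  show ?thesis
  proof (rule that[of "exp B"])
    fix f :: "complex ^ 'n \<Rightarrow> 'b" assume 0: "\<And>z. R < norm z \<Longrightarrow> f z = 0"
    {
      assume f: "f \<in> sqint W"
      then have fm: "f \<in> borel_measurable lebesgue" by (simp add: sqint_W_iff)
      have i: "integrable lebesgue (\<lambda>z. (exp B)\<^sup>2 * ((norm (f z))\<^sup>2 * exp (- 2 * \<phi> z)))"
        using f by (simp add: sqint_W_iff)
      have le: "(norm (f z))\<^sup>2 \<le> (exp B)\<^sup>2 * ((norm (f z))\<^sup>2 * exp (- 2 * \<phi> z))" for z
        using mult_left_mono[OF e(2), of z "(norm (f z))\<^sup>2"] 0[of z] by (cases "norm z \<le> R") (auto simp: mult_ac)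
      have i': "integrable lebesgue (\<lambda>z. (norm (f z))\<^sup>2)"
        by (rule Bochner_Integration.integrable_bound[OF i]) (use fm le in auto)
      then have s: "f \<in> sqint lebesgue" using fm by (simp add: sqint_def)
      have "(nrm lebesgue f)\<^sup>2 \<le> (exp B * nrm W f)\<^sup>2"
        unfolding power_mult_distrib nrm_W_power2[OF fm] unfolding nrm_power2
        using integral_mono[OF i' i le] by simp
      then show "f \<in> sqint lebesgue \<and> nrm lebesgue f \<le> exp B * nrm W f"
        using s by (auto dest: power2_le_imp_le)
    }
    {
      assume f: "f \<in> sqint lebesgue"
      then have fm: "f \<in> borel_measurable lebesgue" by (rule sqint_measurable)
      have i: "integrable lebesgue (\<lambda>z. (exp B)\<^sup>2 * (norm (f z))\<^sup>2)"
        using sqint_integrable[OF f] by simp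
      have le: "(norm (f z))\<^sup>2 * exp (- 2 * \<phi> z) \<le> (exp B)\<^sup>2 * (norm (f z))\<^sup>2" for z
        using mult_left_mono[OF e(1), of z "(norm (f z))\<^sup>2"] 0[of z] by (cases "norm z \<le> R") (auto simp: mult_ac)
      have i': "integrable lebesgue (\<lambda>z. (norm (f z))\<^sup>2 * exp (- 2 * \<phi> z))"
        by (rule Bochner_Integration.integrable_bound[OF i]) (use fm le in auto)
      then have s: "f \<in> sqint W" using fm by (simp add: sqint_W_iff)
      have "(nrm W f)\<^sup>2 \<le> (exp B * nrm lebesgue f)\<^sup>2"
        unfolding power_mult_distrib nrm_W_power2[OF fm] unfolding nrm_power2
        using integral_mono[OF i' i le] by simp
      then show "f \<in> sqint W \<and> nrm W f \<le> exp B * nrm lebesgue f"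
        using s by (auto dest: power2_le_imp_le)
    }
  qed simp
qed

lemma cvg_W:
  fixes s :: "nat \<Rightarrow> complex ^ 'n \<Rightarrow> 'b::euclidean_space"
  assumes "cvg lebesgue s u" "\<And>n z. R < norm z \<Longrightarrow> s n z = 0" "\<And>z. R < norm z \<Longrightarrow> u z = 0"
  shows "cvg W s u"
proof -
  obtain C where C: "C > 0" "\<And>f :: complex ^ 'n \<Rightarrow> 'b. (\<And>z. R < norm z \<Longrightarrow> f z = 0) \<Longrightarrow> f \<in> sqint lebesgue \<Longrightarrow> f \<in> sqint W \<and> nrm W f \<le> C * nrm lebesgue f"
    using sqint_W_supp by metis
  have s: "\<And>n. s n \<in> sqint W" "u \<in> sqint W" using C(2) assms by (auto simp: cvg_def)
  have le: "nrm W (\<lambda>x. s n x - u x) \<le> C * nrm lebesgue (\<lambda>x. s n x - u x)" for n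
    using C(2)[of "\<lambda>x. s n x - u x"] assms by (auto simp: cvg_def sqint_diff)
  have "(\<lambda>n. nrm W (\<lambda>x. s n x - u x)) \<longlonglongrightarrow> 0"
  proof (rule Lim_null_comparison)
    show "(\<lambda>n. C * nrm lebesgue (\<lambda>x. s n x - u x)) \<longlonglongrightarrow> 0"
      by (rule tendsto_mult_right_zero) (use assms(1) in \<open>simp add: cvg_def\<close>)
  qed (use le in simp)
  with s show ?thesis by (simp add: cvg_def)
qed

text \<open>Compact support of \<open>g\<close> neutralizes the weight. All pairings with test
  functions are thus genuine integrals rather than the default value 0 of a non-integrable
  integrand.\<close>

lemma sqint_W_mult_C_kc:
  assumes "f \<in> sqint W" "C_kc k g" shows "(\<lambda>z. g z * f z :: complex) \<in> sqint lebesgue"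
    and "integrable lebesgue (\<lambda>z. g z * f z)" "(\<lambda>z. g z * f z) \<in> sqint W"
proof -
  obtain R where R: "\<And>z. R < norm z \<Longrightarrow> g z = 0" using assms(2) by (auto simp: C_kc_def)
  have gc: "continuous_on UNIV g" using C_k_continuous[OF C_kc_C_k[OF assms(2)]] .
  obtain B where B: "B > 0" "\<And>z. norm (g z) \<le> B" using continuous_supp_bounded[OF gc R] by blast
  have gm: "g \<in> borel_measurable W"
    using borel_measurable_continuous_onI[OF gc] by (simp add: measurable_completion)
  show s: "(\<lambda>z. g z * f z) \<in> sqint W"
    by (rule sqint_bounded_mult[OF gm assms(1), of B]) (use B in \<open>auto intro: less_imp_le\<close>)
  obtain C where C: "\<And>f :: complex ^ 'n \<Rightarrow> complex. (\<And>z. R < norm z \<Longrightarrow> f z = 0) \<Longrightarrow> f \<in> sqint W \<Longrightarrow> f \<in> sqint lebesgue \<and> nrm lebesgue f \<le> C * nrm W f"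
    using sqint_W_supp by metis
  show l: "(\<lambda>z. g z * f z) \<in> sqint lebesgue"
    using C[of "\<lambda>z. g z * f z"] s R by simp
  show "integrable lebesgue (\<lambda>z. g z * f z)"
    by (rule sqint_supp_integrable[OF l, of R]) (use R in simp)
qed

end

section \<open>The weak adjoint and the basic estimate\<close>

lemma cvg_minus: "cvg M s u \<Longrightarrow> cvg M (\<lambda>n x. - s n x) (\<lambda>x. - u x)"
  unfolding cvg_def
  using sqint_scaleR[of _ M "-1"] nrm_minus_commute[of M] by (fastforce simp: nrm_minus_commute)

lemma cvg_diff: "cvg M s u \<Longrightarrow> cvg M t v \<Longrightarrow> cvg M (\<lambda>n x. s n x - t n x) (\<lambda>x. u x - v x)"
  using cvg_add[of M s u "\<lambda>n x. - t n x" "\<lambda>x. - v x"] cvg_minus[of M t v] by simp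

text \<open>As a function of the integration variable the kernel is a test function, so weak
  equations can be tested with it; this is how they turn into classical identities for mollified
  functions.\<close>

lemma reflected_kernel_C_kc:
  fixes k :: "'a::euclidean_space \<Rightarrow> real"
  assumes "\<And>m. C_k m k" "\<And>x. e < norm x \<Longrightarrow> k x = 0"
  shows "C_kc m (\<lambda>y. complex_of_real (k (x - y)))"
  unfolding C_kc_def
proof
  have bl: "bounded_linear (\<lambda>y::'a. - y)" by (intro bounded_linear_minus bounded_linear_ident)
  show "C_k m (\<lambda>y. complex_of_real (k (x - y)))"
    using C_k_of_real[OF C_k_affine[OF bl assms(1), of m x]] by simp
  have "k (x - y) = 0" if "norm x + e < norm y" for y
    using assms(2)[of "x - y"] that norm_triangle_ineq2[of y x] by (simp add: norm_minus_commute)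
  then show "\<exists>R. \<forall>y. R < norm y \<longrightarrow> complex_of_real (k (x - y)) = 0" by auto
qed

text \<open>The derivative in \<open>x\<close> is traded for one in the integration variable, with a
  change of sign. The right-hand side is then a distributional derivative of \<open>g\<close>
  evaluated on a test function.\<close>

lemma cd_conv:
  fixes g :: "complex ^ 'n::finite \<Rightarrow> complex"
  assumes k: "\<And>m. C_k m k" "\<And>x. e < norm x \<Longrightarrow> k x = 0" and g: "integrable lebesgue g"
  shows "cd s j (conv k g) x = - (LINT y|lebesgue. g y * cd s j (\<lambda>y. complex_of_real (k (x - y))) y)"
proof -
  have kd: "k differentiable (at z)" for z by (rule C_k_differentiable[OF k(1)])
  have bl: "bounded_linear (\<lambda>y::complex ^ 'n. - y)" by (intro bounded_linear_minus bounded_linear_ident)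
  have dK: "dd v (\<lambda>y. complex_of_real (k (x - y))) y = - complex_of_real (dd v k (x - y))" for v y
  proof -
    have "dd v (\<lambda>y. k (- y + x)) y = dd (- v) k (- y + x)" by (rule dd_affine[OF bl kd])
    also have "\<dots> = - dd v k (- y + x)" by (rule linear_neg[OF linear_dd[OF kd]])
    finally have 1: "dd v (\<lambda>y. k (x - y)) y = - dd v k (x - y)" by simp
    have "(\<lambda>y. k (- y + x)) differentiable (at y)" by (rule C_k_differentiable[OF C_k_affine[OF bl k(1)]])
    then show ?thesis using dd_bounded_linear[OF bounded_linear_of_real, of "\<lambda>y. k (x - y)" y v] 1 by simp
  qed
  obtain B where B: "\<And>x v. norm (dd v k x) \<le> B * norm v" using C1_supp_lipschitz[OF k(1,2)] by metis
  have i: "integrable lebesgue (\<lambda>y. dd v k (x - y) *\<^sub>R g y)" for v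
    by (rule conv_integrable[OF C_k_continuous[OF C_k_dd[OF k(1)]] B g])
  have "(LINT y|lebesgue. g y * cd s j (\<lambda>y. complex_of_real (k (x - y))) y)
    = (LINT y|lebesgue. - ((dd (axis j 1) k (x - y) *\<^sub>R g y + s * (dd (axis j \<i>) k (x - y) *\<^sub>R g y)) / 2))"
    by (intro Bochner_Integration.integral_cong refl) (simp add: cd_def dK scaleR_conv_of_real field_simps)
  also have "\<dots> = - ((conv (dd (axis j 1) k) g x + s * conv (dd (axis j \<i>) k) g x) / 2)"
    by (simp only: Bochner_Integration.integral_minus integral_divide_zero conv_def
        Bochner_Integration.integral_add[OF i integrable_mult_right[OF i]] integral_mult_right_zero)
  finally show ?thesis by (simp add: cd_def dd_conv[OF k g])
qed

context weight
begin

text \<open>By the Leibniz rule the derivative is placed on the product of cut-off and kernel. That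
  product is itself a test function, so the last integral can be evaluated by a weak equation for
  \<open>f\<close> without the cut-off.\<close>

lemma cd_conv_cutoff:
  assumes k: "\<And>m. C_k m k" "\<And>x. e < norm x \<Longrightarrow> k x = 0"
    and c: "\<And>m. C_kc m c" and f: "f \<in> sqint W"
  shows "cd s j (conv k (\<lambda>z. c z * f z)) x
    = conv k (\<lambda>z. cd s j c z * f z) x
      - (LINT y|lebesgue. cd s j (\<lambda>y. c y * complex_of_real (k (x - y))) y * f y)"
proof -
  let ?K = "\<lambda>y. complex_of_real (k (x - y))"
  have K: "C_kc m ?K" for m by (rule reflected_kernel_C_kc[OF k])
  have cK: "C_kc m (\<lambda>y. c y * ?K y)" for m by (rule C_kc_mult_left[OF C_kc_C_k[OF c] K])
  have cK': "C_kc m (\<lambda>y. cd s j c y * ?K y)" for m by (rule C_kc_mult_left[OF C_kc_C_k[OF C_kc_cd[OF c]] K])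
  have eq: "c y * f y * cd s j ?K y = cd s j (\<lambda>y. c y * ?K y) y * f y - (cd s j c y * ?K y) * f y" for y
    using cd_mult[of c y ?K s j] C_k_differentiable[OF C_kc_C_k[OF c]] C_k_differentiable[OF C_kc_C_k[OF K]]
    by (simp add: algebra_simps)
  have i: "integrable lebesgue (\<lambda>y. cd s j (\<lambda>y. c y * ?K y) y * f y)" "integrable lebesgue (\<lambda>y. (cd s j c y * ?K y) * f y)"
    by (rule sqint_W_mult_C_kc[OF f C_kc_cd[OF cK]] sqint_W_mult_C_kc[OF f cK'])+
  have "cd s j (conv k (\<lambda>z. c z * f z)) x = - (LINT y|lebesgue. c y * f y * cd s j ?K y)"
    by (rule cd_conv[OF k sqint_W_mult_C_kc(2)[OF f c]])
  also have "(LINT y|lebesgue. c y * f y * cd s j ?K y)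
    = (LINT y|lebesgue. cd s j (\<lambda>y. c y * ?K y) y * f y) - (LINT y|lebesgue. (cd s j c y * ?K y) * f y)"
    unfolding eq by (rule Bochner_Integration.integral_diff[OF i])
  also have "(LINT y|lebesgue. (cd s j c y * ?K y) * f y) = conv k (\<lambda>z. cd s j c z * f z) x"
    unfolding conv_def by (intro Bochner_Integration.integral_cong refl) (simp add: scaleR_conv_of_real)
  finally show ?thesis by simp
qed

text \<open>Closedness of \<open>a\<close> is tested with the product of cut-off and kernel; what
  remains are the terms in which the derivative hits \<open>c\<close>.\<close>

lemma conv_cutoff_closed:
  assumes k: "\<And>m. C_k m k" "\<And>x. e < norm x \<Longrightarrow> k x = 0"
    and c: "\<And>m. C_kc m c" and a: "a \<in> sqint W" "dbar_closed a"
  shows "cd \<i> j (conv k (\<lambda>z. c z * a z $ l)) x - cd \<i> l (conv k (\<lambda>z. c z * a z $ j)) x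
    = conv k (\<lambda>z. cd \<i> j c z * a z $ l) x - conv k (\<lambda>z. cd \<i> l c z * a z $ j) x"
proof -
  have aj: "(\<lambda>z. a z $ j) \<in> sqint W" for j using a(1) by (simp add: sqint_vec_iff)
  have "(\<lambda>y. c y * complex_of_real (k (x - y))) \<in> test_functions"
    unfolding test_functions_iff by (intro allI C_kc_mult_left[OF C_kc_C_k[OF c]] reflected_kernel_C_kc[OF k])
  then have "- (LINT y|lebesgue. a y $ l * cd \<i> j (\<lambda>y. c y * complex_of_real (k (x - y))) y)
     + (LINT y|lebesgue. a y $ j * cd \<i> l (\<lambda>y. c y * complex_of_real (k (x - y))) y) = 0"
    using a(2) unfolding dbar_closed_def d_zbar_cd by blast
  then have "(LINT y|lebesgue. cd \<i> j (\<lambda>y. c y * complex_of_real (k (x - y))) y * a y $ l)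
     = (LINT y|lebesgue. cd \<i> l (\<lambda>y. c y * complex_of_real (k (x - y))) y * a y $ j)"
    by (simp add: mult.commute)
  moreover have "cd \<i> j (conv k (\<lambda>z. c z * a z $ l)) x = conv k (\<lambda>z. cd \<i> j c z * a z $ l) x
      - (LINT y|lebesgue. cd \<i> j (\<lambda>y. c y * complex_of_real (k (x - y))) y * a y $ l)" for j l
    by (rule cd_conv_cutoff[OF k c aj])
  ultimately show ?thesis by simp
qed

definition weak_adjoint :: "(complex ^ 'n \<Rightarrow> complex ^ 'n) \<Rightarrow> (complex ^ 'n \<Rightarrow> complex) \<Rightarrow> bool" where
  "weak_adjoint a v \<longleftrightarrow> (\<forall>\<psi>. C_kc (Suc 0) \<psi> \<longrightarrow>
     (LINT z|lebesgue. (\<Sum>j\<in>UNIV. a z $ j * cd (- \<i>) j \<psi> z) * w z) = (LINT z|lebesgue. v z * \<psi> z * w z))"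

lemma C_k_winv: "C_k (Suc (Suc 0)) (\<lambda>z. complex_of_real (exp (2 * \<phi> z)))"
proof -
  have "C_k 2 (\<lambda>z. 2 * \<phi> z)" by (intro C_k_mult C_k_const C2)
  from C_k_of_real[OF C_k_exp[OF this]] show ?thesis by (simp add: numeral_2_eq_2 del: C_k.simps)
qed

lemma C1p: "C_k (Suc 0) (cd s j p)"
  by (rule C_k_cd[OF C2p])

text \<open>Friedrichs' commutator: the last sum measures how multiplication by derivatives of
  \<phi> fails to commute with the convolution. It contains no derivative of \<open>a\<close>, so it
  tends to 0 with the radius of the kernel.\<close>

lemma conv_cutoff_adjoint:
  assumes k: "\<And>m. C_k m k" "\<And>x. e < norm x \<Longrightarrow> k x = 0"
    and c: "\<And>m. C_kc m c" and a: "a \<in> sqint W" and v: "v \<in> sqint W" "weak_adjoint a v"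
  shows "(\<Sum>j\<in>UNIV. del j (conv k (\<lambda>z. c z * a z $ j)) x)
    = (\<Sum>j\<in>UNIV. conv k (\<lambda>z. cd (- \<i>) j c z * a z $ j) x) - conv k (\<lambda>z. c z * v z) x
      + (\<Sum>j\<in>UNIV. 2 * (conv k (\<lambda>z. cd (- \<i>) j p z * (c z * a z $ j)) x - cd (- \<i>) j p x * conv k (\<lambda>z. c z * a z $ j) x))"
proof -
  let ?K = "\<lambda>y. complex_of_real (k (x - y))"
  let ?cK = "\<lambda>y. c y * ?K y"
  have aj: "(\<lambda>z. a z $ j) \<in> sqint W" for j using a by (simp add: sqint_vec_iff)
  have K: "C_kc m ?K" for m by (rule reflected_kernel_C_kc[OF k])
  have cK: "C_kc m ?cK" for m by (rule C_kc_mult_left[OF C_kc_C_k[OF c] K])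
  \<comment> \<open>Dividing by the weight cancels \<open>w\<close> in the weak equation and leaves
    the product of cut-off and kernel.\<close>
  define \<psi> where "\<psi> z = complex_of_real (exp (2 * \<phi> z)) * ?cK z" for z
  have \<psi>: "C_kc (Suc 0) \<psi>"
    unfolding \<psi>_def[abs_def] by (rule C_kc_mult_left[OF C_k_Suc_imp[OF C_k_winv] cK])
  have \<psi>w: "\<psi> z * w z = ?cK z" for z
    by (simp add: \<psi>_def w_def mult_ac flip: of_real_mult exp_add mult.assoc)
  have pcK: "C_kc (Suc 0) (\<lambda>z. cd (- \<i>) j p z * ?cK z)" for j by (rule C_kc_mult_left[OF C1p cK])
  have c\<psi>: "cd (- \<i>) j \<psi> z * w z = cd (- \<i>) j ?cK z + 2 * (cd (- \<i>) j p z * ?cK z)" for j z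
  proof -
    have "cd (- \<i>) j ?cK z = cd (- \<i>) j (\<lambda>z. \<psi> z * w z) z" by (simp only: \<psi>w)
    also have "\<dots> = \<psi> z * cd (- \<i>) j w z + cd (- \<i>) j \<psi> z * w z"
      by (rule cd_mult[OF C_k_differentiable[OF C_kc_C_k[OF \<psi>]] C_k_differentiable[OF C2w]])
    finally show ?thesis unfolding cd_w \<psi>w[symmetric] by (simp add: algebra_simps)
  qed
  have i1: "integrable lebesgue (\<lambda>z. cd (- \<i>) j ?cK z * a z $ j)" for j
    by (rule sqint_W_mult_C_kc[OF aj C_kc_cd[OF cK]])
  have i2: "integrable lebesgue (\<lambda>z. cd (- \<i>) j p z * ?cK z * a z $ j)" for j
    by (rule sqint_W_mult_C_kc[OF aj pcK])
  have cv: "(LINT z|lebesgue. v z * \<psi> z * w z) = conv k (\<lambda>z. c z * v z) x"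
    unfolding conv_def mult.assoc \<psi>w
    by (intro Bochner_Integration.integral_cong refl) (simp add: scaleR_conv_of_real)
  have cp: "(LINT z|lebesgue. cd (- \<i>) j p z * ?cK z * a z $ j) = conv k (\<lambda>z. cd (- \<i>) j p z * (c z * a z $ j)) x" for j
    unfolding conv_def by (intro Bochner_Integration.integral_cong refl) (simp add: scaleR_conv_of_real)
  have "(LINT z|lebesgue. (\<Sum>j\<in>UNIV. a z $ j * cd (- \<i>) j \<psi> z) * w z)
    = (LINT z|lebesgue. (\<Sum>j\<in>UNIV. cd (- \<i>) j ?cK z * a z $ j + 2 * (cd (- \<i>) j p z * ?cK z * a z $ j)))"
  proof (intro Bochner_Integration.integral_cong refl)
    fix z
    have "(\<Sum>j\<in>UNIV. a z $ j * cd (- \<i>) j \<psi> z) * w z = (\<Sum>j\<in>UNIV. a z $ j * (cd (- \<i>) j \<psi> z * w z))"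
      by (simp add: sum_distrib_right mult.assoc)
    then show "(\<Sum>j\<in>UNIV. a z $ j * cd (- \<i>) j \<psi> z) * w z = (\<Sum>j\<in>UNIV. cd (- \<i>) j ?cK z * a z $ j + 2 * (cd (- \<i>) j p z * ?cK z * a z $ j))"
      unfolding c\<psi> by (simp add: algebra_simps)
  qed
  also have "\<dots> = (\<Sum>j\<in>UNIV. LINT z|lebesgue. cd (- \<i>) j ?cK z * a z $ j + 2 * (cd (- \<i>) j p z * ?cK z * a z $ j))"
    by (rule Bochner_Integration.integral_sum) (intro Bochner_Integration.integrable_add integrable_mult_right i1 i2)
  also have "\<dots> = (\<Sum>j\<in>UNIV. (LINT z|lebesgue. cd (- \<i>) j ?cK z * a z $ j) + 2 * conv k (\<lambda>z. cd (- \<i>) j p z * (c z * a z $ j)) x)"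
  proof (rule sum.cong[OF refl])
    fix j
    have "(LINT z|lebesgue. cd (- \<i>) j ?cK z * a z $ j + 2 * (cd (- \<i>) j p z * ?cK z * a z $ j))
      = (LINT z|lebesgue. cd (- \<i>) j ?cK z * a z $ j) + (LINT z|lebesgue. 2 * (cd (- \<i>) j p z * ?cK z * a z $ j))"
      by (rule Bochner_Integration.integral_add[OF i1 integrable_mult_right[OF i2]])
    also have "(LINT z|lebesgue. 2 * (cd (- \<i>) j p z * ?cK z * a z $ j)) = 2 * (LINT z|lebesgue. cd (- \<i>) j p z * ?cK z * a z $ j)"
      by (rule integral_mult_right_zero)
    finally show "(LINT z|lebesgue. cd (- \<i>) j ?cK z * a z $ j + 2 * (cd (- \<i>) j p z * ?cK z * a z $ j))
      = (LINT z|lebesgue. cd (- \<i>) j ?cK z * a z $ j) + 2 * conv k (\<lambda>z. cd (- \<i>) j p z * (c z * a z $ j)) x"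
      unfolding cp .
  qed
  finally have e: "(LINT z|lebesgue. (\<Sum>j\<in>UNIV. a z $ j * cd (- \<i>) j \<psi> z) * w z)
    = (\<Sum>j\<in>UNIV. (LINT z|lebesgue. cd (- \<i>) j ?cK z * a z $ j) + 2 * conv k (\<lambda>z. cd (- \<i>) j p z * (c z * a z $ j)) x)" .
  have "(LINT z|lebesgue. (\<Sum>j\<in>UNIV. a z $ j * cd (- \<i>) j \<psi> z) * w z) = (LINT z|lebesgue. v z * \<psi> z * w z)"
    using v(2) \<psi> unfolding weak_adjoint_def by blast
  then have "(\<Sum>j\<in>UNIV. (LINT z|lebesgue. cd (- \<i>) j ?cK z * a z $ j)) + (\<Sum>j\<in>UNIV. 2 * conv k (\<lambda>z. cd (- \<i>) j p z * (c z * a z $ j)) x)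
    = conv k (\<lambda>z. c z * v z) x"
    unfolding e cv sum.distrib .
  then have key: "(\<Sum>j\<in>UNIV. LINT z|lebesgue. cd (- \<i>) j ?cK z * a z $ j)
    = conv k (\<lambda>z. c z * v z) x - (\<Sum>j\<in>UNIV. 2 * conv k (\<lambda>z. cd (- \<i>) j p z * (c z * a z $ j)) x)"
    by (simp only: eq_diff_eq)
  have ec: "cd (- \<i>) j (conv k (\<lambda>z. c z * a z $ j)) x
    = conv k (\<lambda>z. cd (- \<i>) j c z * a z $ j) x - (LINT z|lebesgue. cd (- \<i>) j ?cK z * a z $ j)" for j
    by (rule cd_conv_cutoff[OF k c aj])
  show ?thesis
    unfolding del_def ec sum_subtractf key
    by (simp add: sum_subtractf right_diff_distrib mult.assoc)
qed

lemma levi_integrable: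
  assumes \<alpha>: "\<And>j. C_kc (Suc 0) (\<alpha> j)"
  shows "integrable lebesgue (\<lambda>z. 2 * levi_form \<phi> z (\<chi> j. \<alpha> j z) * exp (- 2 * \<phi> z))"
proof -
  have L0: "C_k 0 (\<lambda>z. levi_matrix \<phi> z $ j $ k)" for j k
    using C_k_cd[OF C_k_cd[OF C2p], of "- \<i>" j \<i> k] by (simp add: levi_matrix_def d_z_cd d_zbar_cd del: C_k.simps)
  have w0: "C_k 0 w" by (rule C_k_Suc_imp[OF C_k_Suc_imp[OF C2w]])
  have \<alpha>0: "C_kc 0 (\<alpha> j)" for j by (rule C_kc_antimono[OF \<alpha>]) simp
  let ?F = "\<lambda>z. (\<Sum>j\<in>UNIV. \<Sum>k\<in>UNIV. levi_matrix \<phi> z $ j $ k * \<alpha> j z * cnj (\<alpha> k z))"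
  have "C_kc 0 (\<lambda>z. ?F z * w z)"
    by (intro C_kc_mult_right[OF w0] C_kc_sum C_kc_mult_left[OF C_kc_C_k] C_kc_mult_left[OF L0] \<alpha>0 C_kc_cnj)
  then have "integrable lebesgue (\<lambda>z. 2 * Re (?F z * w z))" using C_kc_integrable by (intro integrable_mult_right integrable_Re)
  moreover have "2 * Re (?F z * w z) = 2 * levi_form \<phi> z (\<chi> j. \<alpha> j z) * exp (- 2 * \<phi> z)" for z
  proof -
    have "Re (c * w z) = Re c * exp (- 2 * \<phi> z)" for c by (simp add: w_def)
    then show ?thesis by (simp only: levi_form_def vec_lambda_beta mult.assoc)
  qed
  ultimately show ?thesis by simp
qed

lemma cvg_conv:
  fixes f :: "complex ^ 'n \<Rightarrow> 'b::euclidean_space"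
  assumes f: "f \<in> sqint lebesgue" "\<And>z. R < norm z \<Longrightarrow> f z = 0"
  shows "cvg lebesgue (\<lambda>n. conv (mollifier (1 / real (Suc n))) f) f"
  unfolding cvg_def
proof (intro conjI allI f(1))
  show "(\<lambda>n. nrm lebesgue (\<lambda>x. conv (mollifier (1 / real (Suc n))) f x - f x)) \<longlonglongrightarrow> 0"
    by (rule mollifier_tendsto[OF f])
  show "conv (mollifier (1 / real (Suc n))) f \<in> sqint lebesgue" for n
  proof -
    interpret smoothing_kernel "mollifier (1 / real (Suc n)) :: complex ^ 'n \<Rightarrow> real" "1 / real (Suc n)"
      by (rule smoothing_kernel_mollifier) simp
    show ?thesis by (rule conv_sqint[OF f(1) sqint_supp_integrable[OF f]])
  qed
qed

text \<open>The Kohn-Morrey inequality for mollifications of \<open>c a\<close>, in the limit of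
  small radii. Boundedness of \<open>lam\<close> makes multiplication by
  \<open>sqrt (2 * lam z)\<close> continuous in norm, so the left-hand side converges as
  well.\<close>

lemma cutoff_estimate:
  assumes c: "\<And>m. C_kc m c" and a: "a \<in> sqint W" "dbar_closed a" and v: "v \<in> sqint W" "weak_adjoint a v"
    and lam: "lam \<in> borel_measurable lebesgue" "\<And>z. 0 \<le> lam z" "\<And>z. lam z \<le> \<Lambda>"
      "\<And>z u. lam z * (norm u)\<^sup>2 \<le> levi_form \<phi> z u"
  shows "(\<Sum>j\<in>UNIV. (nrm W (\<lambda>z. complex_of_real (sqrt (2 * lam z)) * (c z * a z $ j)))\<^sup>2)
    \<le> (nrm W (\<lambda>z. (\<Sum>j\<in>UNIV. cd (- \<i>) j c z * a z $ j) - c z * v z))\<^sup>2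
      + (\<Sum>j\<in>UNIV. \<Sum>k\<in>UNIV. (nrm W (\<lambda>z. cd \<i> j c z * a z $ k - cd \<i> k c z * a z $ j))\<^sup>2) / 2"
proof -
  have aj: "(\<lambda>z. a z $ j) \<in> sqint W" for j using a(1) by (simp add: sqint_vec_iff)
  obtain R where R: "\<And>z. R < norm z \<Longrightarrow> c z = 0" using c by (auto simp: C_kc_def)
  define k where "k n = (mollifier (1 / real (Suc n)) :: complex ^ 'n \<Rightarrow> real)" for n
  have kk: "smoothing_kernel (k n) (1 / real (Suc n))" for n unfolding k_def by (rule smoothing_kernel_mollifier) simp
  have kC: "C_k m (k n)" for m n using smoothing_kernel.smooth[OF kk] .
  have k0: "1 / real (Suc n) < norm x \<Longrightarrow> k n x = 0" for n x using smoothing_kernel.outside[OF kk] .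
  have h1: "1 / real (Suc n) \<le> 1" for n by simp
  have out: "conv (k n) f x = 0" if "\<And>z. R < norm z \<Longrightarrow> f z = 0" "R + 1 < norm x" for n x and f :: "complex ^ 'n \<Rightarrow> complex"
  proof -
    have "R + 1 / real (Suc n) < norm x" using that(2) h1[of n] by linarith
    then show ?thesis using conv_outside[of "1 / real (Suc n)" "k n" R f x] k0 that(1) by blast
  qed
  have cv: "cvg lebesgue (\<lambda>n. conv (k n) (\<lambda>z. g z * f z)) (\<lambda>z. g z * f z)" if "C_kc m g" "f \<in> sqint W" for m and g f :: "complex ^ 'n \<Rightarrow> complex"
  proof -
    obtain S where "\<And>z. S < norm z \<Longrightarrow> g z = 0" using \<open>C_kc m g\<close> by (auto simp: C_kc_def)
    then show ?thesis unfolding k_def by (intro cvg_conv[of _ S] sqint_W_mult_C_kc[OF that(2,1)]) auto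
  qed
  define b where "b j z = c z * a z $ j" for j z
  have b0: "R < norm z \<Longrightarrow> b j z = 0" for j z by (simp add: b_def R)
  have bi: "integrable lebesgue (b j)" for j unfolding b_def[abs_def] by (rule sqint_W_mult_C_kc[OF aj c])
  have bc: "cvg lebesgue (\<lambda>n. conv (k n) (b j)) (b j)" for j unfolding b_def[abs_def] by (rule cv[OF c aj])
  have dc0: "R < norm z \<Longrightarrow> cd s j c z = 0" for s j z by (rule cd_outside[OF R])
  have dcc: "C_kc 0 (cd s j c)" for s j by (rule C_kc_cd[OF c])
  have BO: "conv (k n) (b j) x = 0" if "R + 1 < norm x" for n j x
    by (rule out[of "b j"]) (use b0 that in auto)
  have BCk: "C_k m (conv (k n) (b j))" for m n j
    by (rule conv_C_k[of "k n" "1 / real (Suc n)" "b j", OF _ _ bi]) (use kC k0 in blast)+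
  have BC: "C_kc m (conv (k n) (b j))" for m n j
    unfolding C_kc_def using BCk BO by blast
  have pb: "\<exists>B\<ge>0. \<forall>z. norm z \<le> R + 1 \<longrightarrow> cmod (cd (- \<i>) j p z) \<le> B" for j
  proof -
    have "compact (cd (- \<i>) j p ` cball 0 (R + 1))"
      by (intro compact_continuous_image continuous_on_subset[OF C_k_continuous[OF C1p]]) auto
    then obtain B where "B > 0" "\<And>y. y \<in> cd (- \<i>) j p ` cball 0 (R + 1) \<Longrightarrow> norm y \<le> B"
      by (meson bounded_pos compact_imp_bounded)
    then show ?thesis by (intro exI[of _ B]) auto
  qed
  have pm: "cd (- \<i>) j p \<in> borel_measurable lebesgue" for j
    using borel_measurable_continuous_onI[OF C_k_continuous[OF C1p]] by (simp add: measurable_completion)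
  have eqT: "(\<Sum>j\<in>UNIV. del j (conv (k n) (\<lambda>z. c z * a z $ j)) x)
    = (\<Sum>j\<in>UNIV. conv (k n) (\<lambda>z. cd (- \<i>) j c z * a z $ j) x) - conv (k n) (\<lambda>z. c z * v z) x
      + (\<Sum>j\<in>UNIV. 2 * (conv (k n) (\<lambda>z. cd (- \<i>) j p z * (c z * a z $ j)) x
          - cd (- \<i>) j p x * conv (k n) (\<lambda>z. c z * a z $ j) x))" for n x
    by (rule conv_cutoff_adjoint[of "k n" "1 / real (Suc n)", OF _ _ c a(1) v]) (use kC k0 in blast)+
  have eqA: "cd \<i> j (conv (k n) (\<lambda>z. c z * a z $ l)) x - cd \<i> l (conv (k n) (\<lambda>z. c z * a z $ j)) x
    = conv (k n) (\<lambda>z. cd \<i> j c z * a z $ l) x - conv (k n) (\<lambda>z. cd \<i> l c z * a z $ j) x" for n x j l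
    by (rule conv_cutoff_closed[of "k n" "1 / real (Suc n)", OF _ _ c a]) (use kC k0 in blast)+
  \<comment> \<open>The commutator terms converge to differences of equal functions and so drop out
    of the limit; the derivatives of \<phi> are bounded on the ball that contains all
    supports.\<close>
  have T: "cvg lebesgue (\<lambda>n x. \<Sum>j\<in>UNIV. del j (conv (k n) (b j)) x)
    (\<lambda>z. (\<Sum>j\<in>UNIV. cd (- \<i>) j c z * a z $ j) - c z * v z
      + (\<Sum>j\<in>UNIV. 2 * (cd (- \<i>) j p z * b j z - cd (- \<i>) j p z * b j z)))"
    unfolding b_def eqT
  proof (intro cvg_add cvg_diff cvg_sum)
    fix j
    show "cvg lebesgue (\<lambda>n. conv (k n) (\<lambda>z. cd (- \<i>) j c z * a z $ j)) (\<lambda>z. cd (- \<i>) j c z * a z $ j)"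
      by (rule cv[OF dcc aj])
    show "cvg lebesgue (\<lambda>n. conv (k n) (\<lambda>z. c z * v z)) (\<lambda>z. c z * v z)" by (rule cv[OF c v(1)])
    have 1: "cvg lebesgue (\<lambda>n. conv (k n) (\<lambda>z. cd (- \<i>) j p z * (c z * a z $ j))) (\<lambda>z. cd (- \<i>) j p z * (c z * a z $ j))"
      using cv[OF C_kc_mult_left[OF C1p[of "- \<i>" j] c] aj[of j]] by (simp add: mult.assoc)
    obtain B where B: "B \<ge> 0" "\<And>z. norm z \<le> R + 1 \<Longrightarrow> cmod (cd (- \<i>) j p z) \<le> B" using pb by blast
    have 2: "cvg lebesgue (\<lambda>n x. cd (- \<i>) j p x * conv (k n) (b j) x) (\<lambda>x. cd (- \<i>) j p x * b j x)"
      by (rule cvg_bounded_mult[OF bc pm B(2) B(1)]) (use BO b0 in auto)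
    have "cvg lebesgue (\<lambda>n x. 2 *\<^sub>R (conv (k n) (\<lambda>z. cd (- \<i>) j p z * (c z * a z $ j)) x - cd (- \<i>) j p x * conv (k n) (b j) x))
      (\<lambda>x. 2 *\<^sub>R (cd (- \<i>) j p x * (c x * a x $ j) - cd (- \<i>) j p x * b j x))"
      unfolding scaleR_2 by (intro cvg_add cvg_diff 1 2)
    then show "cvg lebesgue (\<lambda>n x. 2 * (conv (k n) (\<lambda>z. cd (- \<i>) j p z * (c z * a z $ j)) x - cd (- \<i>) j p x * conv (k n) (\<lambda>z. c z * a z $ j) x))
      (\<lambda>z. 2 * (cd (- \<i>) j p z * (c z * a z $ j) - cd (- \<i>) j p z * (c z * a z $ j)))"
      by (simp add: b_def[abs_def] scaleR_conv_of_real)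
  qed
  have TW: "cvg W (\<lambda>n x. \<Sum>j\<in>UNIV. del j (conv (k n) (b j)) x) (\<lambda>z. (\<Sum>j\<in>UNIV. cd (- \<i>) j c z * a z $ j) - c z * v z)"
  proof (rule cvg_W[of _ _ "R + 1"])
    show "cvg lebesgue (\<lambda>n x. \<Sum>j\<in>UNIV. del j (conv (k n) (b j)) x) (\<lambda>z. (\<Sum>j\<in>UNIV. cd (- \<i>) j c z * a z $ j) - c z * v z)"
      using T by simp
    show "(\<Sum>j\<in>UNIV. del j (conv (k n) (b j)) z) = 0" if "R + 1 < norm z" for n z
      using BO[OF that] cd_outside[OF BO that] by (simp add: del_def)
    show "(\<Sum>j\<in>UNIV. cd (- \<i>) j c z * a z $ j) - c z * v z = 0" if "R + 1 < norm z" for z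
      using that by (simp add: R dc0)
  qed
  have AW: "cvg W (\<lambda>n x. cd \<i> j (conv (k n) (b l)) x - cd \<i> l (conv (k n) (b j)) x) (\<lambda>z. cd \<i> j c z * a z $ l - cd \<i> l c z * a z $ j)" for j l
  proof (rule cvg_W[of _ _ "R + 1"])
    show "cvg lebesgue (\<lambda>n x. cd \<i> j (conv (k n) (b l)) x - cd \<i> l (conv (k n) (b j)) x) (\<lambda>z. cd \<i> j c z * a z $ l - cd \<i> l c z * a z $ j)"
      unfolding b_def eqA by (intro cvg_diff cv[OF dcc aj])
    show "cd \<i> j (conv (k n) (b l)) z - cd \<i> l (conv (k n) (b j)) z = 0" if "R + 1 < norm z" for n z
      using cd_outside[OF BO that] by simp
    show "cd \<i> j c z * a z $ l - cd \<i> l c z * a z $ j = 0" if "R + 1 < norm z" for z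
      using that by (simp add: dc0)
  qed
  have lm: "(\<lambda>z. complex_of_real (sqrt (2 * lam z))) \<in> borel_measurable lebesgue" using lam(1) by measurable
  have \<Lambda>: "0 \<le> \<Lambda>" using lam(2,3)[of 0] by linarith
  have lb: "cmod (complex_of_real (sqrt (2 * lam z))) \<le> sqrt (2 * \<Lambda>)" for z using lam(2,3)[of z] by simp
  have bW: "cvg W (\<lambda>n. conv (k n) (b j)) (b j)" for j
    by (rule cvg_W[of _ _ "R + 1", OF bc]) (use BO b0 in auto)
  have LW: "cvg W (\<lambda>n x. complex_of_real (sqrt (2 * lam x)) * conv (k n) (b j) x) (\<lambda>x. complex_of_real (sqrt (2 * lam x)) * b j x)" for j
    by (rule cvg_bounded_mult[OF bW _ lb, of _ "R + 1"]) (use lm BO b0 \<Lambda> in auto)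
  have "(\<Sum>j\<in>UNIV. (nrm W (\<lambda>x. complex_of_real (sqrt (2 * lam x)) * conv (k n) (b j) x))\<^sup>2)
    \<le> (nrm W (\<lambda>x. \<Sum>j\<in>UNIV. del j (conv (k n) (b j)) x))\<^sup>2
      + (\<Sum>j\<in>UNIV. \<Sum>l\<in>UNIV. (nrm W (\<lambda>x. cd \<i> j (conv (k n) (b l)) x - cd \<i> l (conv (k n) (b j)) x))\<^sup>2) / 2" for n
  proof -
    have Lm: "(\<lambda>x. complex_of_real (sqrt (2 * lam x)) * conv (k n) (b j) x) \<in> sqint W" for j using LW by (simp add: cvg_def)
    have Tm: "(\<lambda>x. \<Sum>j\<in>UNIV. del j (conv (k n) (b j)) x) \<in> sqint W" using TW by (simp add: cvg_def)
    have Am: "(\<lambda>x. cd \<i> j (conv (k n) (b l)) x - cd \<i> l (conv (k n) (b j)) x) \<in> sqint W" for j l using AW by (simp add: cvg_def)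
    have "(\<Sum>j\<in>UNIV. (nrm W (\<lambda>x. complex_of_real (sqrt (2 * lam x)) * conv (k n) (b j) x))\<^sup>2)
      = (LINT z|lebesgue. (\<Sum>j\<in>UNIV. (norm (complex_of_real (sqrt (2 * lam z)) * conv (k n) (b j) z))\<^sup>2 * exp (- 2 * \<phi> z)))"
    proof (subst Bochner_Integration.integral_sum)
      show "integrable lebesgue (\<lambda>z. (norm (complex_of_real (sqrt (2 * lam z)) * conv (k n) (b j) z))\<^sup>2 * exp (- 2 * \<phi> z))" for j
        using Lm[of j] unfolding sqint_W_iff by blast
      show "(\<Sum>j\<in>UNIV. (nrm W (\<lambda>x. complex_of_real (sqrt (2 * lam x)) * conv (k n) (b j) x))\<^sup>2)
        = (\<Sum>j\<in>UNIV. LINT z|lebesgue. (norm (complex_of_real (sqrt (2 * lam z)) * conv (k n) (b j) z))\<^sup>2 * exp (- 2 * \<phi> z))"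
        by (intro sum.cong refl nrm_W_power2) (use Lm in \<open>simp add: sqint_W_iff\<close>)
    qed
    also have "\<dots> \<le> (LINT z|lebesgue. 2 * levi_form \<phi> z (\<chi> j. conv (k n) (b j) z) * exp (- 2 * \<phi> z))"
    proof (rule integral_mono)
      show "integrable lebesgue (\<lambda>z. \<Sum>j\<in>UNIV. (norm (complex_of_real (sqrt (2 * lam z)) * conv (k n) (b j) z))\<^sup>2 * exp (- 2 * \<phi> z))"
        using Lm unfolding sqint_W_iff by (intro Bochner_Integration.integrable_sum) blast
      show "integrable lebesgue (\<lambda>z. 2 * levi_form \<phi> z (\<chi> j. conv (k n) (b j) z) * exp (- 2 * \<phi> z))"
        by (rule levi_integrable[OF BC])
      fix z
      have "(\<Sum>j\<in>UNIV. (norm (complex_of_real (sqrt (2 * lam z)) * conv (k n) (b j) z))\<^sup>2)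
        = 2 * (lam z * (norm (\<chi> j. conv (k n) (b j) z))\<^sup>2)"
        using lam(2)[of z] by (simp add: norm_vec_power2 norm_mult power_mult_distrib sum_distrib_left mult.assoc)
      also have "\<dots> \<le> 2 * levi_form \<phi> z (\<chi> j. conv (k n) (b j) z)" using lam(4) by simp
      finally show "(\<Sum>j\<in>UNIV. (norm (complex_of_real (sqrt (2 * lam z)) * conv (k n) (b j) z))\<^sup>2 * exp (- 2 * \<phi> z))
        \<le> 2 * levi_form \<phi> z (\<chi> j. conv (k n) (b j) z) * exp (- 2 * \<phi> z)"
        unfolding sum_distrib_right[symmetric] by (rule mult_right_mono) simp
    qed
    also have "\<dots> \<le> (LINT z|lebesgue. (cmod (\<Sum>j\<in>UNIV. del j (conv (k n) (b j)) z))\<^sup>2 * exp (- 2 * \<phi> z))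
      + (\<Sum>j\<in>UNIV. \<Sum>l\<in>UNIV. LINT z|lebesgue. (cmod (cd \<i> j (conv (k n) (b l)) z - cd \<i> l (conv (k n) (b j)) z))\<^sup>2 * exp (- 2 * \<phi> z)) / 2"
      by (rule kohn_morrey[OF BC])
    also have "(LINT z|lebesgue. (cmod (\<Sum>j\<in>UNIV. del j (conv (k n) (b j)) z))\<^sup>2 * exp (- 2 * \<phi> z))
      = (nrm W (\<lambda>x. \<Sum>j\<in>UNIV. del j (conv (k n) (b j)) x))\<^sup>2"
      by (rule nrm_W_power2[symmetric]) (use Tm in \<open>simp add: sqint_W_iff\<close>)
    also have "(\<Sum>j\<in>UNIV. \<Sum>l\<in>UNIV. LINT z|lebesgue. (cmod (cd \<i> j (conv (k n) (b l)) z - cd \<i> l (conv (k n) (b j)) z))\<^sup>2 * exp (- 2 * \<phi> z))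
      = (\<Sum>j\<in>UNIV. \<Sum>l\<in>UNIV. (nrm W (\<lambda>x. cd \<i> j (conv (k n) (b l)) x - cd \<i> l (conv (k n) (b j)) x))\<^sup>2)"
      by (intro sum.cong refl nrm_W_power2[symmetric]) (use Am in \<open>simp add: sqint_W_iff\<close>)
    finally show ?thesis .
  qed
  then have "(\<Sum>j\<in>UNIV. (nrm W (\<lambda>x. complex_of_real (sqrt (2 * lam x)) * b j x))\<^sup>2)
    \<le> (nrm W (\<lambda>z. (\<Sum>j\<in>UNIV. cd (- \<i>) j c z * a z $ j) - c z * v z))\<^sup>2
      + (\<Sum>j\<in>UNIV. \<Sum>l\<in>UNIV. (nrm W (\<lambda>z. cd \<i> j c z * a z $ l - cd \<i> l c z * a z $ j))\<^sup>2) / 2"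
    by (intro LIMSEQ_le[OF tendsto_sum[OF tendsto_power[OF cvg_nrm[OF LW]]]
          tendsto_add[OF tendsto_power[OF cvg_nrm[OF TW]] tendsto_divide[OF tendsto_sum[OF tendsto_sum[OF tendsto_power[OF cvg_nrm[OF AW]]]] tendsto_const]]]) auto
  then show ?thesis by (simp add: b_def)
qed

end

section \<open>Hoermander's \<open>L\<^sup>2\<close> estimate\<close>

text \<open>The functional is prescribed through parameters \<open>p\<close> instead of the vectors
  \<open>D p\<close>. The norm bound makes it well defined: parameters with the same vector differ
  by a combination whose vector has norm 0.\<close>

lemma riesz_indexed:
  fixes D :: "'p \<Rightarrow> 'a \<Rightarrow> 'b::euclidean_space"
  assumes P: "P \<noteq> {}" "\<And>p. p \<in> P \<Longrightarrow> D p \<in> sqint M"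
    and comb: "\<And>p q a b. p \<in> P \<Longrightarrow> q \<in> P \<Longrightarrow>
      \<exists>r\<in>P. D r = (\<lambda>x. a *\<^sub>R D p x + b *\<^sub>R D q x) \<and> l r = a * l p + b * l q"
    and bd: "\<And>p. p \<in> P \<Longrightarrow> \<bar>l p\<bar> \<le> A * nrm M (D p)" and A: "A \<ge> 0"
  obtains u where "u \<in> sqint M" "\<And>p. p \<in> P \<Longrightarrow> ip M u (D p) = l p" "nrm M u \<le> A"
proof -
  have wd: "l p = l q" if "p \<in> P" "q \<in> P" "D p = D q" for p q
  proof -
    obtain r where r: "r \<in> P" "D r = (\<lambda>x. 1 *\<^sub>R D p x + (-1) *\<^sub>R D q x)" "l r = 1 * l p + (-1) * l q"
      using comb[OF \<open>p \<in> P\<close> \<open>q \<in> P\<close>] by blast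
    have "nrm M (D r) = 0" unfolding r(2) using that(3) by (simp add: nrm_def)
    then show ?thesis using bd[OF r(1)] r(3) by simp
  qed
  define L where "L v = l (SOME p. p \<in> P \<and> D p = v)" for v
  have L: "L (D p) = l p" if "p \<in> P" for p
  proof -
    have "(SOME q. q \<in> P \<and> D q = D p) \<in> P \<and> D (SOME q. q \<in> P \<and> D q = D p) = D p"
      by (rule someI[of _ p]) (simp add: that)
    then show ?thesis unfolding L_def using wd that by blast
  qed
  show thesis
  proof (rule riesz_subspace[of "D ` P" M L A])
    show "D ` P \<subseteq> sqint M" "D ` P \<noteq> {}" using P by auto
    fix f g a b assume "f \<in> D ` P" "g \<in> D ` P"
    then obtain p q where pq: "p \<in> P" "q \<in> P" "f = D p" "g = D q" by auto
    obtain r where r: "r \<in> P" "D r = (\<lambda>x. a *\<^sub>R D p x + b *\<^sub>R D q x)" "l r = a * l p + b * l q"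
      using comb[OF pq(1,2)] by blast
    show "(\<lambda>x. a *\<^sub>R f x + b *\<^sub>R g x) \<in> D ` P" unfolding pq(3,4) r(2)[symmetric] using r(1) by blast
    show "L (\<lambda>x. a *\<^sub>R f x + b *\<^sub>R g x) = a * L f + b * L g"
      unfolding pq(3,4) r(2)[symmetric] using L[OF r(1)] L[OF pq(1)] L[OF pq(2)] r(3) by simp
  next
    show "\<bar>L v\<bar> \<le> A * nrm M v" if "v \<in> D ` P" for v using that L bd by auto
  next
    fix s u
    assume "u \<in> sqint M" "\<And>v. v \<in> D ` P \<Longrightarrow> ip M u v = L v" "nrm M u \<le> A"
    then show thesis using that[of u] L by auto
  qed (rule A)
qed

text \<open>Dilations of a single cut-off function. The decay of the gradients like
  \<open>1 / Suc n\<close> lets estimates with a cut-off pass to the whole space.\<close>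

lemma scaled_cutoffs:
  obtains c :: "nat \<Rightarrow> complex ^ 'n::finite \<Rightarrow> complex" and B :: real
  where "\<And>n m. C_kc m (c n)" "\<And>n z. cmod (c n z) \<le> 1" "\<And>n z. norm z \<le> real (Suc n) \<Longrightarrow> c n z = 1"
    "B \<ge> 0" "\<And>n s j z. cmod s = 1 \<Longrightarrow> cmod (cd s j (c n) z) \<le> B / real (Suc n)"
proof -
  obtain h :: "complex ^ 'n \<Rightarrow> real" where h: "\<And>k. C_k k h" "\<And>x. 0 \<le> h x" "\<And>x. h x \<le> 1"
    "\<And>x. norm x \<le> 1 \<Longrightarrow> h x = 1" "\<And>x. 3 < norm x \<Longrightarrow> h x = 0"
    using cutoff_exists by blast
  define F where "F z = complex_of_real (h z)" for z
  have FC: "C_k k F" for k unfolding F_def[abs_def] by (rule C_k_of_real[OF h(1)])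
  have F0: "F z = 0" if "3 < norm z" for z using h(5)[OF that] by (simp add: F_def)
  obtain B where B: "B > 0" "\<And>x v. norm (dd v F x) \<le> B * norm v" using C1_supp_lipschitz[OF FC F0] by metis
  define c where "c n z = F ((1 / real (Suc n)) *\<^sub>R z + 0)" for n z
  have bl: "bounded_linear (\<lambda>z::complex ^ 'n. (1 / real (Suc n)) *\<^sub>R z)" for n by (rule bounded_linear_scaleR_right)
  have cC: "C_k m (c n)" for m n unfolding c_def[abs_def] by (rule C_k_affine[OF bl FC])
  show thesis
  proof (rule that[of c B])
    have "c n z = 0" if "3 * real (Suc n) < norm z" for n z
    proof -
      have "3 < norm ((1 / real (Suc n)) *\<^sub>R z + 0)" using that by (simp add: pos_less_divide_eq)
      then show ?thesis unfolding c_def by (rule F0)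
    qed
    then show "C_kc m (c n)" for m n unfolding C_kc_def using cC by blast
    show "cmod (c n z) \<le> 1" for n z using h(2,3) by (simp add: c_def F_def)
    show "c n z = 1" if "norm z \<le> real (Suc n)" for n z
    proof -
      have "norm ((1 / real (Suc n)) *\<^sub>R z + 0) \<le> 1" using that by (simp add: pos_divide_le_eq)
      then show ?thesis unfolding c_def F_def using h(4) by simp
    qed
    show "cmod (cd s j (c n) z) \<le> B / real (Suc n)" if "cmod s = 1" for n s j z
    proof -
      have b: "cmod (dd v (c n) z) \<le> B / real (Suc n)" if "norm v = 1" for v
      proof -
        have "dd v (c n) z = dd ((1 / real (Suc n)) *\<^sub>R v) F ((1 / real (Suc n)) *\<^sub>R z + 0)"
          unfolding c_def[abs_def] by (rule dd_affine[OF bl C_k_differentiable[OF FC]])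
        then have "cmod (dd v (c n) z) \<le> B * norm ((1 / real (Suc n)) *\<^sub>R v)" using B(2) by metis
        then show ?thesis using that by simp
      qed
      have na: "norm (axis j 1 :: complex ^ 'n) = 1" "norm (axis j \<i> :: complex ^ 'n) = 1"
        by (simp_all add: norm_eq_sqrt_inner inner_axis_axis)
      \<comment> \<open>The factor 1/2 in \<open>cd\<close> compensates for the two
        summands.\<close>
      have "cmod (dd (axis j 1) (c n) z + s * dd (axis j \<i>) (c n) z) \<le> B / real (Suc n) + B / real (Suc n)"
        by (rule order_trans[OF norm_triangle_ineq add_mono])
          (use b[OF na(1)] b[OF na(2)] \<open>cmod s = 1\<close> in \<open>auto simp: norm_mult\<close>)
      then show ?thesis by (simp add: cd_def norm_divide mult.commute)
    qed
  qed (use B in simp)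
qed

context weight
begin

text \<open>The cut-offs in \<open>cutoff_estimate\<close> exhaust the space. Every term with a
  gradient of the cut-off tends to 0, and for closed \<open>a\<close> the only other term on the
  right is the one with \<open>v\<close>.\<close>

lemma basic_estimate:
  assumes a: "a \<in> sqint W" "dbar_closed a" and v: "v \<in> sqint W" "weak_adjoint a v"
    and lam: "lam \<in> borel_measurable lebesgue" "\<And>z. 0 \<le> lam z" "\<And>z. lam z \<le> \<Lambda>"
      "\<And>z u. lam z * (norm u)\<^sup>2 \<le> levi_form \<phi> z u"
  shows "(\<lambda>z. sqrt (2 * lam z) *\<^sub>R a z) \<in> sqint W" "nrm W (\<lambda>z. sqrt (2 * lam z) *\<^sub>R a z) \<le> nrm W v"
proof -
  obtain c B where c: "\<And>n m. C_kc m (c n :: complex ^ 'n \<Rightarrow> complex)" "\<And>n z. cmod (c n z) \<le> 1"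
    "\<And>n z. norm z \<le> real (Suc n) \<Longrightarrow> c n z = 1"
    and B: "B \<ge> 0" "\<And>n s j z. cmod s = 1 \<Longrightarrow> cmod (cd s j (c n) z) \<le> B / real (Suc n)"
    using scaled_cutoffs by metis
  have aj: "(\<lambda>z. a z $ j) \<in> sqint W" for j using a(1) by (simp add: sqint_vec_iff)
  have \<Lambda>: "0 \<le> \<Lambda>" using lam(2,3)[of 0] by linarith
  have lm: "(\<lambda>z. complex_of_real (sqrt (2 * lam z))) \<in> borel_measurable W" using lam(1) by simp
  have lb: "cmod (complex_of_real (sqrt (2 * lam z))) \<le> sqrt (2 * \<Lambda>)" for z using lam(2,3)[of z] by simp
  have la: "(\<lambda>z. complex_of_real (sqrt (2 * lam z)) * a z $ j) \<in> sqint W" for j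
    by (rule sqint_bounded_mult[OF lm aj lb]) (use \<Lambda> in simp)
  have eqv: "(sqrt (2 * lam z) *\<^sub>R a z) $ j = complex_of_real (sqrt (2 * lam z)) * a z $ j" for z j
    by (subst vector_scaleR_component) (rule scaleR_conv_of_real)
  show sv: "(\<lambda>z. sqrt (2 * lam z) *\<^sub>R a z) \<in> sqint W" unfolding sqint_vec_iff eqv using la by blast
  have cv: "cvg W (\<lambda>n z. c n z * f z) f" if f: "f \<in> sqint W" for f
    unfolding cvg_def
  proof (intro conjI allI f sqint_W_mult_C_kc(3)[OF f c(1)])
    show "(\<lambda>n. nrm W (\<lambda>z. c n z * f z - f z)) \<longlonglongrightarrow> 0"
    proof (rule nrm_tendsto_dominated[where w="\<lambda>z. 2 * norm (f z)"])
      show "(\<lambda>z. c n z * f z) \<in> borel_measurable W" for n by (rule sqint_measurable[OF sqint_W_mult_C_kc(3)[OF f c(1)]])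
      show "f \<in> borel_measurable W" by (rule sqint_measurable[OF f])
      show "integrable W (\<lambda>z. (2 * norm (f z))\<^sup>2)" using sqint_integrable[OF f] by (simp add: power_mult_distrib)
      show "AE z in W. (\<lambda>n. c n z * f z) \<longlonglongrightarrow> f z"
      proof (intro AE_I2 tendsto_eventually)
        fix z :: "complex ^ 'n"
        obtain N where N: "norm z \<le> real N" using real_arch_simple by blast
        show "\<forall>\<^sub>F n in sequentially. c n z * f z = f z"
          using eventually_ge_at_top[of N]
        proof eventually_elim
          case (elim n)
          then have "norm z \<le> real (Suc n)" using N by linarith
          then show ?case by (simp add: c(3))
        qed
      qed
      show "AE z in W. norm (c n z * f z - f z) \<le> 2 * norm (f z)" for n
      proof (intro AE_I2)
        fix z
        have "norm (c n z * f z) \<le> norm (f z)" using c(2)[of n z] by (simp add: norm_mult mult_left_le_one_le)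
        then show "norm (c n z * f z - f z) \<le> 2 * norm (f z)" using norm_triangle_ineq4[of "c n z * f z" "f z"] by linarith
      qed
    qed
  qed
  have cv0: "cvg W (\<lambda>n z. cd s j (c n) z * f z) (\<lambda>z. 0)" if f: "f \<in> sqint W" and s: "cmod s = 1" for f s j
    unfolding cvg_def
  proof (intro conjI allI sqint_0)
    have dc: "C_kc 0 (cd s j (c n))" for n by (rule C_kc_cd[OF c(1)])
    show "(\<lambda>z. cd s j (c n) z * f z) \<in> sqint W" for n by (rule sqint_W_mult_C_kc(3)[OF f dc])
    have m: "cd s j (c n) \<in> borel_measurable W" for n
      using borel_measurable_integrable[OF C_kc_integrable[OF dc]] by simp
    have "nrm W (\<lambda>z. cd s j (c n) z * f z) \<le> B / real (Suc n) * nrm W f" for n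
      by (rule sqint_bounded_mult(2)[OF m f B(2)[OF s]]) (use B(1) in simp)
    then have le: "nrm W (\<lambda>z. cd s j (c n) z * f z - 0) \<le> (B * nrm W f) * (1 / real (Suc n))" for n
      by simp
    show "(\<lambda>n. nrm W (\<lambda>z. cd s j (c n) z * f z - 0)) \<longlonglongrightarrow> 0"
    proof (rule Lim_null_comparison)
      show "(\<lambda>n. (B * nrm W f) * (1 / real (Suc n))) \<longlonglongrightarrow> 0"
        by (rule tendsto_mult_right_zero) (use LIMSEQ_Suc[OF lim_1_over_n] in simp)
    qed (use le in simp)
  qed
  have L: "cvg W (\<lambda>n z. complex_of_real (sqrt (2 * lam z)) * (c n z * a z $ j)) (\<lambda>z. complex_of_real (sqrt (2 * lam z)) * a z $ j)" for j
    using cv[OF la, of j] by (simp add: mult.left_commute)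
  have T: "cvg W (\<lambda>n z. (\<Sum>j\<in>UNIV. cd (- \<i>) j (c n) z * a z $ j) - c n z * v z) (\<lambda>z. (\<Sum>j\<in>(UNIV::'n set). 0) - v z)"
    by (intro cvg_diff cvg_sum cv0 aj cv v) simp_all
  have A: "cvg W (\<lambda>n z. cd \<i> j (c n) z * a z $ k - cd \<i> k (c n) z * a z $ j) (\<lambda>z. 0 - 0)" for j k
    by (intro cvg_diff cv0 aj) simp_all
  have lim1: "(\<lambda>n. \<Sum>j\<in>UNIV. (nrm W (\<lambda>z. complex_of_real (sqrt (2 * lam z)) * (c n z * a z $ j)))\<^sup>2)
    \<longlonglongrightarrow> (\<Sum>j\<in>UNIV. (nrm W (\<lambda>z. complex_of_real (sqrt (2 * lam z)) * a z $ j))\<^sup>2)"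
    by (intro tendsto_sum tendsto_power cvg_nrm L)
  have lim2: "(\<lambda>n. (nrm W (\<lambda>z. (\<Sum>j\<in>UNIV. cd (- \<i>) j (c n) z * a z $ j) - c n z * v z))\<^sup>2
      + (\<Sum>j\<in>UNIV. \<Sum>k\<in>UNIV. (nrm W (\<lambda>z. cd \<i> j (c n) z * a z $ k - cd \<i> k (c n) z * a z $ j))\<^sup>2) / 2)
    \<longlonglongrightarrow> (nrm W (\<lambda>z. (\<Sum>j\<in>(UNIV::'n set). 0) - v z))\<^sup>2
      + (\<Sum>j\<in>(UNIV::'n set). \<Sum>k\<in>(UNIV::'n set). (nrm W (\<lambda>z. 0 - 0 :: complex))\<^sup>2) / 2"
    by (intro tendsto_add tendsto_divide tendsto_sum tendsto_power cvg_nrm T A tendsto_const) simp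
  have "(\<Sum>j\<in>UNIV. (nrm W (\<lambda>z. complex_of_real (sqrt (2 * lam z)) * a z $ j))\<^sup>2)
    \<le> (nrm W (\<lambda>z. (\<Sum>j\<in>(UNIV::'n set). 0) - v z))\<^sup>2 + (\<Sum>j\<in>(UNIV::'n set). \<Sum>k\<in>(UNIV::'n set). (nrm W (\<lambda>z. 0 - 0 :: complex))\<^sup>2) / 2"
    by (rule LIMSEQ_le[OF lim1 lim2]) (use cutoff_estimate[OF c(1) a v lam] in blast)
  also have "\<dots> = (nrm W v)\<^sup>2" by (simp add: nrm_def)
  finally have "(nrm W (\<lambda>z. sqrt (2 * lam z) *\<^sub>R a z))\<^sup>2 \<le> (nrm W v)\<^sup>2"
    unfolding nrm_vec_power2[OF sv] eqv .
  then show "nrm W (\<lambda>z. sqrt (2 * lam z) *\<^sub>R a z) \<le> nrm W v" by (rule power2_le_imp_le) simp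
qed

text \<open>The elements of the weighted spaces that represent the pairings \<open>u \<mapsto> Re (\<integral> u \<zeta>)\<close>.\<close>

definition dual1 :: "(complex ^ 'n \<Rightarrow> complex) \<Rightarrow> complex ^ 'n \<Rightarrow> complex" where
  "dual1 \<zeta> z = complex_of_real (exp (2 * \<phi> z)) * cnj (\<zeta> z)"

definition dual :: "('n \<Rightarrow> complex ^ 'n \<Rightarrow> complex) \<Rightarrow> complex ^ 'n \<Rightarrow> complex ^ 'n" where
  "dual \<zeta> z = (\<chi> j. dual1 (\<zeta> j) z)"

lemma dual1_sqint:
  assumes "C_kc 0 \<zeta>" shows "dual1 \<zeta> \<in> sqint W"
proof -
  have "C_kc 0 (dual1 \<zeta>)"
    unfolding dual1_def[abs_def] by (rule C_kc_mult_left[OF C_k_antimono[OF C_k_winv] C_kc_cnj[OF assms]]) simp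
  then obtain R where R: "\<And>z. R < norm z \<Longrightarrow> dual1 \<zeta> z = 0" and cont: "continuous_on UNIV (dual1 \<zeta>)"
    unfolding C_kc_def by auto
  have "dual1 \<zeta> \<in> sqint lebesgue" by (rule sqint_continuous_supp[OF cont R])
  moreover obtain C where "\<And>f :: complex ^ 'n \<Rightarrow> complex. (\<And>z. R < norm z \<Longrightarrow> f z = 0) \<Longrightarrow> f \<in> sqint lebesgue \<Longrightarrow> f \<in> sqint W \<and> nrm W f \<le> C * nrm lebesgue f"
    using sqint_W_supp by metis
  ultimately show ?thesis using R by blast
qed

lemma dual_sqint: "(\<And>j. C_kc 0 (\<zeta> j)) \<Longrightarrow> dual \<zeta> \<in> sqint W"
  unfolding sqint_vec_iff by (simp add: dual_def dual1_sqint)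

lemma pairing_integrable:
  fixes u :: "complex ^ 'n \<Rightarrow> complex"
  assumes "u \<in> sqint W" "C_kc 0 \<zeta>" shows "integrable lebesgue (\<lambda>z. u z * \<zeta> z)"
  using sqint_W_mult_C_kc(2)[OF assms] by (simp add: mult.commute)

lemma inner_dual1: "exp (- 2 * \<phi> z) * (x \<bullet> dual1 \<zeta> z) = Re (x * \<zeta> z)"
proof -
  have "x \<bullet> dual1 \<zeta> z = exp (2 * \<phi> z) * Re (x * \<zeta> z)"
    by (simp add: dual1_def inner_complex_def algebra_simps)
  then show ?thesis by (simp flip: mult.assoc exp_add)
qed

lemma ip_dual1:
  assumes u: "u \<in> sqint W" and \<zeta>: "C_kc 0 \<zeta>"
  shows "ip W u (dual1 \<zeta>) = Re (LINT z|lebesgue. u z * \<zeta> z)"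
proof -
  have m: "(\<lambda>z. u z \<bullet> dual1 \<zeta> z) \<in> borel_measurable lebesgue"
    using sqint_measurable[OF u] sqint_measurable[OF dual1_sqint[OF \<zeta>]] by simp
  have "ip W u (dual1 \<zeta>) = (LINT z|lebesgue. exp (- 2 * \<phi> z) * (u z \<bullet> dual1 \<zeta> z))"
    unfolding ip_def integral_W[OF m] by (simp only: mult.commute)
  also have "\<dots> = Re (LINT z|lebesgue. u z * \<zeta> z)"
    unfolding inner_dual1 by (rule integral_Re[OF pairing_integrable[OF assms]])
  finally show ?thesis .
qed

lemma ip_dual:
  assumes u: "u \<in> sqint W" and \<zeta>: "\<And>j. C_kc 0 (\<zeta> j)"
  shows "ip W u (dual \<zeta>) = Re (LINT z|lebesgue. (\<Sum>j\<in>UNIV. u z $ j * \<zeta> j z))"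
proof -
  have uj: "(\<lambda>z. u z $ j) \<in> sqint W" for j using u by (simp add: sqint_vec_iff)
  have "ip W u (dual \<zeta>) = (\<Sum>j\<in>UNIV. ip W (\<lambda>z. u z $ j) (dual1 (\<zeta> j)))"
    unfolding ip_def inner_vec_def dual_def vec_lambda_beta
    by (rule Bochner_Integration.integral_sum) (rule sqint_inner_integrable[OF uj dual1_sqint[OF \<zeta>]])
  also have "\<dots> = (\<Sum>j\<in>UNIV. Re (LINT z|lebesgue. u z $ j * \<zeta> j z))" by (simp add: ip_dual1[OF uj \<zeta>])
  also have "\<dots> = Re (LINT z|lebesgue. (\<Sum>j\<in>UNIV. u z $ j * \<zeta> j z))"
    by (subst Bochner_Integration.integral_sum) (simp_all add: pairing_integrable[OF uj \<zeta>])
  finally show ?thesis .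
qed

section \<open>Closed forms and the kernel of dbar as annihilators\<close>

lemma test_C_kc: "\<psi> \<in> test_functions \<Longrightarrow> C_kc m \<psi>"
  by (simp add: test_functions_iff)

lemma test_cmult: "\<psi> \<in> test_functions \<Longrightarrow> (\<lambda>z. c * \<psi> z) \<in> test_functions"
  unfolding test_functions_iff by (intro allI C_kc_mult_left C_k_const) blast

lemma test_add: "\<psi> \<in> test_functions \<Longrightarrow> \<theta> \<in> test_functions \<Longrightarrow> (\<lambda>z. \<psi> z + \<theta> z) \<in> test_functions"
  unfolding test_functions_iff by (blast intro: C_kc_add)

lemma cd_test: "\<psi> \<in> test_functions \<Longrightarrow> cd s j \<psi> \<in> test_functions"
  unfolding test_functions_iff using C_kc_cd by blast

lemma cd_cmult_test: "\<psi> \<in> test_functions \<Longrightarrow> cd s j (\<lambda>z. c * \<psi> z) = (\<lambda>z. c * cd s j \<psi> z)"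
  using cd_cmult[OF C_k_differentiable[OF C_kc_C_k[OF test_C_kc]]] by blast

text \<open>The tuple whose pairing with \<open>a\<close> is the \<open>j\<close>, \<open>k\<close>
  coefficient of dbar \<open>a\<close> tested with \<open>\<psi>\<close>, so that closedness becomes
  orthogonality to \<open>dual (rot j k \<psi>)\<close>. The two conditionals are kept separate so
  that they cancel for \<open>j = k\<close>.\<close>

definition rot :: "'n \<Rightarrow> 'n \<Rightarrow> (complex ^ 'n \<Rightarrow> complex) \<Rightarrow> 'n \<Rightarrow> complex ^ 'n \<Rightarrow> complex" where
  "rot j k \<psi> m z = (if m = j then cd \<i> k \<psi> z else 0) - (if m = k then cd \<i> j \<psi> z else 0)"

lemma rot_C_kc: "\<psi> \<in> test_functions \<Longrightarrow> C_kc 0 (rot j k \<psi> m)"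
  unfolding rot_def[abs_def]
  by (intro C_kc_diff; cases "m = j"; cases "m = k") (simp_all add: C_kc_0 test_C_kc cd_test)

text \<open>The real scalar product sees only real parts; since test functions may be multiplied by
  \<open>\<i>\<close>, nothing is lost. Closed forms thus are the annihilator of a set, onto which
  one can project.\<close>

lemma dbar_closed_iff:
  assumes a: "a \<in> sqint W"
  shows "dbar_closed a \<longleftrightarrow> (\<forall>\<psi>\<in>test_functions. \<forall>j k. ip W a (dual (rot j k \<psi>)) = 0)"
proof -
  have aj: "(\<lambda>z. a z $ j) \<in> sqint W" for j using a by (simp add: sqint_vec_iff)
  define T where "T \<psi> j k = - (LINT z|lebesgue. a z $ k * cd \<i> j \<psi> z) + (LINT z|lebesgue. a z $ j * cd \<i> k \<psi> z)" for \<psi> j k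
  have ip: "ip W a (dual (rot j k \<psi>)) = Re (T \<psi> j k)" if "\<psi> \<in> test_functions" for \<psi> j k
  proof -
    have i: "integrable lebesgue (\<lambda>z. a z $ m * cd \<i> l \<psi> z)" for m l
      by (rule pairing_integrable[OF aj test_C_kc[OF cd_test[OF that]]])
    have "(\<Sum>m\<in>UNIV. a z $ m * rot j k \<psi> m z) = a z $ j * cd \<i> k \<psi> z - a z $ k * cd \<i> j \<psi> z" for z
      by (simp add: rot_def right_diff_distrib sum_subtractf if_distrib[of "\<lambda>x. _ * x"] cong: if_cong)
    then show ?thesis using ip_dual[OF a, of "rot j k \<psi>"] rot_C_kc[OF that] i by (simp add: T_def)
  qed
  have T\<i>: "T (\<lambda>z. \<i> * \<psi> z) j k = \<i> * T \<psi> j k" if "\<psi> \<in> test_functions" for \<psi> j k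
    unfolding T_def cd_cmult_test[OF that] by (simp add: mult.left_commute[of _ \<i>] algebra_simps)
  have "dbar_closed a \<longleftrightarrow> (\<forall>\<psi>\<in>test_functions. \<forall>j k. T \<psi> j k = 0)"
    by (simp only: dbar_closed_def d_zbar_cd T_def)
  also have "\<dots> \<longleftrightarrow> (\<forall>\<psi>\<in>test_functions. \<forall>j k. Re (T \<psi> j k) = 0)"
  proof (intro iffI ballI allI)
    fix \<psi> :: "complex ^ 'n \<Rightarrow> complex" and j k :: 'n
    assume *: "\<forall>\<psi>\<in>test_functions. \<forall>j k. Re (T \<psi> j k) = 0" and \<psi>: "\<psi> \<in> test_functions"
    have "Re (T (\<lambda>z. \<i> * \<psi> z) j k) = 0" using * test_cmult[OF \<psi>] by blast
    then show "T \<psi> j k = 0" using * \<psi> T\<i>[OF \<psi>] by (simp add: complex_eq_iff)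
  qed simp
  finally show ?thesis using ip by simp
qed

lemma ker_dbar_iff:
  assumes h: "h \<in> sqint W"
  shows "dbar_eq h (\<lambda>z. 0) \<longleftrightarrow> (\<forall>\<psi>\<in>test_functions. \<forall>j. ip W h (dual1 (cd \<i> j \<psi>)) = 0)"
proof -
  define T where "T \<psi> j = (LINT z|lebesgue. h z * cd \<i> j \<psi> z)" for \<psi> j
  have ip: "ip W h (dual1 (cd \<i> j \<psi>)) = Re (T \<psi> j)" if "\<psi> \<in> test_functions" for \<psi> j
    unfolding T_def by (rule ip_dual1[OF h test_C_kc[OF cd_test[OF that]]])
  have T\<i>: "T (\<lambda>z. \<i> * \<psi> z) j = \<i> * T \<psi> j" if "\<psi> \<in> test_functions" for \<psi> j
    unfolding T_def cd_cmult_test[OF that] by (simp add: mult.left_commute[of _ \<i>])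
  have "dbar_eq h (\<lambda>z. 0) \<longleftrightarrow> (\<forall>\<psi>\<in>test_functions. \<forall>j. T \<psi> j = 0)"
    by (simp add: dbar_eq_def d_zbar_cd T_def)
  also have "\<dots> \<longleftrightarrow> (\<forall>\<psi>\<in>test_functions. \<forall>j. Re (T \<psi> j) = 0)"
  proof (intro iffI ballI allI)
    fix \<psi> :: "complex ^ 'n \<Rightarrow> complex" and j :: 'n
    assume *: "\<forall>\<psi>\<in>test_functions. \<forall>j. Re (T \<psi> j) = 0" and \<psi>: "\<psi> \<in> test_functions"
    have "Re (T (\<lambda>z. \<i> * \<psi> z) j) = 0" using * test_cmult[OF \<psi>] by blast
    then show "T \<psi> j = 0" using * \<psi> T\<i>[OF \<psi>] by (simp add: complex_eq_iff)
  qed simp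
  finally show ?thesis using ip by simp
qed

end

text \<open>By continuity of the scalar product the annihilator of any set is a closed
  subspace.\<close>

lemma projection_annihilator:
  fixes f :: "'a \<Rightarrow> 'b::euclidean_space"
  assumes f: "f \<in> sqint M" and G: "G \<subseteq> sqint M"
  obtains p where "p \<in> sqint M" "\<And>g. g \<in> G \<Longrightarrow> ip M p g = 0"
    "\<And>v. v \<in> sqint M \<Longrightarrow> (\<And>g. g \<in> G \<Longrightarrow> ip M v g = 0) \<Longrightarrow> ip M (\<lambda>x. f x - p x) v = 0"
proof -
  let ?V = "{v \<in> sqint M. \<forall>g\<in>G. ip M v g = 0}"
  show thesis
  proof (rule projection_closed_subspace[of ?V M f])
    show "?V \<noteq> {}" using sqint_0[of M] by (auto simp: ip_def intro!: exI[of _ "\<lambda>x. 0"])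
    show "(\<lambda>x. a *\<^sub>R v x + b *\<^sub>R u x) \<in> ?V" if "v \<in> ?V" "u \<in> ?V" for v u a b
      using that G by (auto simp: sqint_add sqint_scaleR ip_scaleR_left subset_iff ip_add_left)
    show "u \<in> ?V" if s: "\<And>n. s n \<in> ?V" and u: "u \<in> sqint M" and lim: "(\<lambda>n. nrm M (\<lambda>x. s n x - u x)) \<longlonglongrightarrow> 0" for s u
    proof -
      have "ip M u g = 0" if "g \<in> G" for g
      proof -
        have "(\<lambda>n. ip M (s n) g) \<longlonglongrightarrow> ip M u g" by (rule ip_tendsto[OF _ u lim]) (use s G that in auto)
        moreover have "ip M (s n) g = 0" for n using s[of n] that by simp
        ultimately show ?thesis by (simp add: LIMSEQ_const_iff)
      qed
      then show ?thesis using u by simp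
    qed
    fix p assume "p \<in> ?V" "\<And>v. v \<in> ?V \<Longrightarrow> ip M (\<lambda>x. f x - p x) v = 0"
    then show thesis using that[of p] by auto
  qed (use f in auto)
qed

context weight
begin

text \<open>Both derivatives are moved to the test function, where they commute. Second derivatives
  of \<open>\<eta>\<close> never occur, so class C^1 suffices.\<close>

lemma dbar_closed_gradient:
  fixes \<eta> :: "complex ^ 'n \<Rightarrow> complex"
  assumes \<eta>: "C_kc (Suc 0) \<eta>"
  shows "dbar_closed (\<lambda>z. \<chi> j. cd \<i> j \<eta> z)"
  unfolding dbar_closed_def d_zbar_cd vec_lambda_beta
proof (intro ballI allI)
  fix \<psi> :: "complex ^ 'n \<Rightarrow> complex" and j k :: 'n assume \<psi>: "\<psi> \<in> test_functions"
  have e: "(LINT z|lebesgue. cd \<i> k \<eta> z * cd \<i> j \<psi> z) = - (LINT z|lebesgue. \<eta> z * cd \<i> k (cd \<i> j \<psi>) z)" for j k :: 'n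
    using cd_by_parts[OF C_kc_C_k[OF \<eta>] test_C_kc[OF cd_test[OF \<psi>]], of \<i> k \<i> j] by simp
  have "cd \<i> k (cd \<i> j \<psi>) z = cd \<i> j (cd \<i> k \<psi>) z" for z :: "complex ^ 'n" by (rule cd_commute[OF C_kc_C_k[OF test_C_kc[OF \<psi>]]])
  then show "- (LINT z|lebesgue. cd \<i> k \<eta> z * cd \<i> j \<psi> z) + (LINT z|lebesgue. cd \<i> j \<eta> z * cd \<i> k \<psi> z) = 0"
    by (simp add: e)
qed

text \<open>The duality estimate: only the \<open>\<partial>\<close>-bar closed part of \<open>dual \<psi>\<close> pairs with \<open>f\<close>, and the closed part
  has the same weak adjoint, so that the basic estimate applies to it.\<close>

lemma hormander_bound:
  assumes lam: "lam \<in> borel_measurable lebesgue" "\<And>z. lam0 \<le> lam z" "lam0 > 0" "\<And>z. lam z \<le> \<Lambda>"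
      "\<And>z u. lam z * (norm u)\<^sup>2 \<le> levi_form \<phi> z u"
    and f: "f \<in> sqint W" "dbar_closed f" and \<psi>: "\<And>j. \<psi> j \<in> test_functions"
  shows "\<bar>ip W f (dual \<psi>)\<bar> \<le> nrm W (\<lambda>z. (1 / sqrt (2 * lam z)) *\<^sub>R f z) * nrm W (dual1 (\<lambda>z. \<Sum>j\<in>UNIV. cd \<i> j (\<psi> j) z))"
proof -
  have lam0: "0 \<le> lam z" "0 < lam z" for z using lam(2)[of z] lam(3) by auto
  let ?D = "dual1 (\<lambda>z. \<Sum>j\<in>UNIV. cd \<i> j (\<psi> j) z)"
  \<comment> \<open>Its annihilator in the weighted space consists of the closed forms.\<close>
  let ?G = "{dual (rot j k \<psi>) | j k \<psi>. \<psi> \<in> test_functions}"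
  have G: "?G \<subseteq> sqint W" using dual_sqint rot_C_kc by blast
  have cl: "dbar_closed a \<longleftrightarrow> (\<forall>g\<in>?G. ip W a g = 0)" if "a \<in> sqint W" for a
    unfolding dbar_closed_iff[OF that] by blast
  have \<alpha>: "dual \<psi> \<in> sqint W" by (rule dual_sqint) (rule test_C_kc[OF \<psi>])
  have DC: "C_kc 0 (\<lambda>z. \<Sum>j\<in>UNIV. cd \<i> j (\<psi> j) z)" by (intro C_kc_sum test_C_kc cd_test \<psi>)
  have D: "?D \<in> sqint W" by (rule dual1_sqint[OF DC])
  obtain p where p: "p \<in> sqint W" "\<And>g. g \<in> ?G \<Longrightarrow> ip W p g = 0"
    "\<And>v. v \<in> sqint W \<Longrightarrow> (\<And>g. g \<in> ?G \<Longrightarrow> ip W v g = 0) \<Longrightarrow> ip W (\<lambda>x. dual \<psi> x - p x) v = 0"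
    using projection_annihilator[OF \<alpha> G] by blast
  have pc: "dbar_closed p" using cl[OF p(1)] p(2) by blast
  have orth: "ip W (\<lambda>x. dual \<psi> x - p x) v = 0" if "v \<in> sqint W" "dbar_closed v" for v
    by (rule p(3)[OF that(1)]) (use cl[OF that(1)] that(2) in blast)
  have dp: "(\<lambda>x. dual \<psi> x - p x) \<in> sqint W" by (rule sqint_diff[OF \<alpha> p(1)])
  \<comment> \<open>\<open>dual \<psi> - p\<close> is orthogonal to all closed forms, in particular
    to dbar gradients of compactly supported functions, and these are what the weak adjoint is
    tested with. Hence \<open>p\<close> has the weak adjoint of \<open>dual \<psi>\<close>, which
    integration by parts identifies as \<open>- ?D\<close>.\<close>
  have wa: "weak_adjoint p (\<lambda>z. - ?D z)"
    unfolding weak_adjoint_def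
  proof (intro allI impI)
    fix \<eta> :: "complex ^ 'n \<Rightarrow> complex" assume \<eta>: "C_kc (Suc 0) \<eta>"
    define \<zeta> where "\<zeta> \<theta> j z = cd (- \<i>) j \<theta> z * w z" for \<theta> :: "complex ^ 'n \<Rightarrow> complex" and j z
    have \<zeta>C: "C_kc 0 (\<zeta> \<theta> j)" if "C_kc (Suc 0) \<theta>" for \<theta> j
      unfolding \<zeta>_def[abs_def] by (rule C_kc_mult_right[OF C_k_antimono[OF C2w] C_kc_cd[OF that]]) simp
    have Re0: "Re (LINT z|lebesgue. (\<Sum>j\<in>UNIV. (dual \<psi> z - p z) $ j * \<zeta> \<theta> j z)) = 0" if \<theta>: "C_kc (Suc 0) \<theta>" for \<theta>
    proof -
      \<comment> \<open>The exponential factors cancel, so \<open>dual (\<zeta> \<theta>)\<close> is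
        the dbar gradient of \<open>cnj \<theta>\<close> and hence a closed form.\<close>
      have "dual1 (\<zeta> \<theta> j) z = cd \<i> j (\<lambda>z. cnj (\<theta> z)) z" for j z
      proof -
        have "complex_of_real (exp (2 * \<phi> z)) * complex_of_real (exp (- 2 * \<phi> z)) = 1"
          by (simp flip: of_real_mult exp_add)
        then have "complex_of_real (exp (2 * \<phi> z)) * (x * w z) = x" for x
          by (simp add: w_def mult.left_commute)
        then show ?thesis
          by (simp add: dual1_def \<zeta>_def cnj_w cd_cnj[OF C_k_differentiable[OF C_kc_C_k[OF \<theta>]]])
      qed
      then have "dual (\<zeta> \<theta>) = (\<lambda>z. \<chi> j. cd \<i> j (\<lambda>z. cnj (\<theta> z)) z)" by (simp add: dual_def fun_eq_iff)
      then have "dbar_closed (dual (\<zeta> \<theta>))" using dbar_closed_gradient[OF C_kc_cnj[OF \<theta>]] by simp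
      then show ?thesis using orth[OF dual_sqint[OF \<zeta>C[OF \<theta>]]] ip_dual[OF dp \<zeta>C[OF \<theta>]] by simp
    qed
    have i\<eta>: "C_kc (Suc 0) (\<lambda>z. \<i> * \<eta> z)" by (rule C_kc_mult_left[OF C_k_const \<eta>])
    have \<zeta>\<i>: "\<zeta> (\<lambda>z. \<i> * \<eta> z) j z = \<i> * \<zeta> \<eta> j z" for j z
      by (simp add: \<zeta>_def cd_cmult[OF C_k_differentiable[OF C_kc_C_k[OF \<eta>]]])
    define F where "F \<theta> = (LINT z|lebesgue. (\<Sum>j\<in>UNIV. (dual \<psi> z - p z) $ j * \<zeta> \<theta> j z))" for \<theta>
    have F0: "Re (F \<theta>) = 0" if "C_kc (Suc 0) \<theta>" for \<theta> unfolding F_def by (rule Re0[OF that])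
    have "(\<Sum>j\<in>UNIV. (dual \<psi> z - p z) $ j * \<zeta> (\<lambda>z. \<i> * \<eta> z) j z) = \<i> * (\<Sum>j\<in>UNIV. (dual \<psi> z - p z) $ j * \<zeta> \<eta> j z)" for z
      by (simp add: \<zeta>\<i> sum_distrib_left mult.left_commute)
    then have "F (\<lambda>z. \<i> * \<eta> z) = \<i> * F \<eta>" unfolding F_def by (simp only: integral_mult_right_zero)
    then have "F \<eta> = 0" using F0[OF \<eta>] F0[OF i\<eta>] by (simp add: complex_eq_iff)
    then have z: "(LINT z|lebesgue. (\<Sum>j\<in>UNIV. (dual \<psi> z - p z) $ j * \<zeta> \<eta> j z)) = 0" unfolding F_def .
    have pj: "(\<lambda>z. p z $ j) \<in> sqint W" "(\<lambda>z. dual \<psi> z $ j) \<in> sqint W" for j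
      using p(1) \<alpha> by (auto simp: sqint_vec_iff)
    have i1: "integrable lebesgue (\<lambda>z. \<Sum>j\<in>UNIV. p z $ j * \<zeta> \<eta> j z)" "integrable lebesgue (\<lambda>z. \<Sum>j\<in>UNIV. dual \<psi> z $ j * \<zeta> \<eta> j z)"
      by (intro Bochner_Integration.integrable_sum pairing_integrable pj \<zeta>C[OF \<eta>])+
    have "(LINT z|lebesgue. (\<Sum>j\<in>UNIV. dual \<psi> z $ j * \<zeta> \<eta> j z)) - (LINT z|lebesgue. (\<Sum>j\<in>UNIV. p z $ j * \<zeta> \<eta> j z)) = 0"
      using z i1 by (simp add: left_diff_distrib sum_subtractf)
    then have e1: "(LINT z|lebesgue. (\<Sum>j\<in>UNIV. p z $ j * \<zeta> \<eta> j z)) = (LINT z|lebesgue. (\<Sum>j\<in>UNIV. dual \<psi> z $ j * \<zeta> \<eta> j z))" by simp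
    have ew: "complex_of_real (exp (2 * \<phi> z)) * w z = 1" for z by (simp add: w_def flip: of_real_mult exp_add)
    have "dual \<psi> z $ j * \<zeta> \<eta> j z = (complex_of_real (exp (2 * \<phi> z)) * w z) * (cnj (\<psi> j z) * cd (- \<i>) j \<eta> z)" for j z
      unfolding dual_def dual1_def \<zeta>_def by (simp add: mult_ac)
    then have e2: "dual \<psi> z $ j * \<zeta> \<eta> j z = cnj (\<psi> j z) * cd (- \<i>) j \<eta> z" for j z by (simp add: ew)
    have c\<psi>: "C_kc m (\<lambda>z. cnj (\<psi> j z))" for j m by (rule C_kc_cnj[OF test_C_kc[OF \<psi>]])
    have cc: "cd (- \<i>) j (\<lambda>z. cnj (\<psi> j z)) z = cnj (cd \<i> j (\<psi> j) z)" for j z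
      using cd_cnj[OF C_k_differentiable[OF C_kc_C_k[OF test_C_kc[OF \<psi>]]], of "- \<i>" j j z] by simp
    have i2: "integrable lebesgue (\<lambda>z. cnj (\<psi> j z) * cd (- \<i>) j \<eta> z)" for j
      by (rule C_kc_integrable[OF C_kc_mult_left[OF C_kc_C_k[OF c\<psi>] C_kc_cd[OF \<eta>]]])
    have i3: "integrable lebesgue (\<lambda>z. cnj (cd \<i> j (\<psi> j) z) * \<eta> z)" for j
      by (rule C_kc_integrable[of 0]) (intro C_kc_mult_left C_kc_antimono[OF \<eta>] C_k_cnj C_kc_C_k[OF test_C_kc[OF cd_test[OF \<psi>]]], simp)
    have "(LINT z|lebesgue. (\<Sum>j\<in>UNIV. p z $ j * cd (- \<i>) j \<eta> z) * w z) = (LINT z|lebesgue. (\<Sum>j\<in>UNIV. p z $ j * \<zeta> \<eta> j z))"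
      by (simp add: \<zeta>_def sum_distrib_right mult.assoc)
    also have "\<dots> = (LINT z|lebesgue. (\<Sum>j\<in>UNIV. cnj (\<psi> j z) * cd (- \<i>) j \<eta> z))" unfolding e1 e2 ..
    also have "\<dots> = (\<Sum>j\<in>UNIV. LINT z|lebesgue. cnj (\<psi> j z) * cd (- \<i>) j \<eta> z)"
      by (rule Bochner_Integration.integral_sum[OF i2])
    also have "\<dots> = (\<Sum>j\<in>UNIV. - (LINT z|lebesgue. cnj (cd \<i> j (\<psi> j) z) * \<eta> z))"
      using cd_by_parts[OF C_kc_C_k[OF c\<psi>] \<eta>] by (simp add: cc)
    also have "\<dots> = - (LINT z|lebesgue. (\<Sum>j\<in>UNIV. cnj (cd \<i> j (\<psi> j) z) * \<eta> z))"
      unfolding sum_negf by (simp only: Bochner_Integration.integral_sum[OF i3])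
    also have "\<dots> = (LINT z|lebesgue. - (\<Sum>j\<in>UNIV. cnj (cd \<i> j (\<psi> j) z) * \<eta> z))" by simp
    also have "\<dots> = (LINT z|lebesgue. - ?D z * \<eta> z * w z)"
    proof (rule Bochner_Integration.integral_cong[OF refl])
      fix z
      have "- ?D z * \<eta> z * w z = - (complex_of_real (exp (2 * \<phi> z)) * w z) * (cnj (\<Sum>j\<in>UNIV. cd \<i> j (\<psi> j) z) * \<eta> z)"
        unfolding dual1_def by (simp add: mult_ac)
      then show "- (\<Sum>j\<in>UNIV. cnj (cd \<i> j (\<psi> j) z) * \<eta> z) = - ?D z * \<eta> z * w z"
        by (simp add: ew sum_distrib_right)
    qed
    finally show "(LINT z|lebesgue. (\<Sum>j\<in>UNIV. p z $ j * cd (- \<i>) j \<eta> z) * w z) = (LINT z|lebesgue. - ?D z * \<eta> z * w z)" .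
  qed
  have mD: "(\<lambda>z. - ?D z) \<in> sqint W" using sqint_scaleR[OF D, of "-1"] by simp
  have nD: "nrm W (\<lambda>z. - ?D z) = nrm W ?D" by (simp add: nrm_def)
  have be: "(\<lambda>z. sqrt (2 * lam z) *\<^sub>R p z) \<in> sqint W" "nrm W (\<lambda>z. sqrt (2 * lam z) *\<^sub>R p z) \<le> nrm W ?D"
    using basic_estimate[OF p(1) pc mD wa lam(1) lam0(1) lam(4,5)] nD by auto
  have fs: "(\<lambda>z. (1 / sqrt (2 * lam z)) *\<^sub>R f z) \<in> sqint W"
  proof (rule sqint_mono[OF sqint_scaleR[OF f(1), of "1 / sqrt (2 * lam0)"]])
    show "(\<lambda>z. (1 / sqrt (2 * lam z)) *\<^sub>R f z) \<in> borel_measurable W"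
      using lam(1) sqint_measurable[OF f(1)] by simp
    show "AE z in W. norm ((1 / sqrt (2 * lam z)) *\<^sub>R f z) \<le> norm ((1 / sqrt (2 * lam0)) *\<^sub>R f z)"
    proof (intro AE_I2)
      fix z
      have le: "1 / sqrt (2 * lam z) \<le> 1 / sqrt (2 * lam0)" using lam(2)[of z] lam(3) by (intro divide_left_mono) auto
      show "norm ((1 / sqrt (2 * lam z)) *\<^sub>R f z) \<le> norm ((1 / sqrt (2 * lam0)) *\<^sub>R f z)"
        using mult_right_mono[OF le norm_ge_zero[of "f z"]] lam0[of z] lam(3) by simp
    qed
  qed
  have "ip W f (dual \<psi>) = ip W f p"
  proof -
    have "ip W (\<lambda>x. dual \<psi> x - p x) f = 0" by (rule orth[OF f])
    then show ?thesis using ip_diff_left[OF \<alpha> p(1) f(1)] by (simp add: ip_commute[of W f])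
  qed
  \<comment> \<open>Inserting \<open>sqrt (2 * lam z)\<close> and its inverse leaves the factor with
    \<open>p\<close> to the basic estimate and puts the gain on \<open>f\<close>.\<close>
  also have "\<dots> = ip W (\<lambda>z. (1 / sqrt (2 * lam z)) *\<^sub>R f z) (\<lambda>z. sqrt (2 * lam z) *\<^sub>R p z)"
    unfolding ip_def using lam0(2) by (intro Bochner_Integration.integral_cong refl) (simp add: less_imp_neq[symmetric])
  finally have "\<bar>ip W f (dual \<psi>)\<bar> \<le> nrm W (\<lambda>z. (1 / sqrt (2 * lam z)) *\<^sub>R f z) * nrm W (\<lambda>z. sqrt (2 * lam z) *\<^sub>R p z)"
    using ip_Cauchy_Schwarz[OF fs be(1)] by simp
  also have "\<dots> \<le> nrm W (\<lambda>z. (1 / sqrt (2 * lam z)) *\<^sub>R f z) * nrm W ?D"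
    by (rule mult_left_mono[OF be(2)]) simp
  finally show ?thesis .
qed

text \<open>By \<open>hormander_bound\<close> the pairing of \<open>f\<close> with a tuple of test
  functions is bounded by the norm attached to their dbar divergence; the Riesz representative of
  minus this functional is the solution. The lower bound \<open>lam0\<close> makes the norm on the
  right that of a square integrable form.\<close>

theorem hormander:
  assumes lam: "lam \<in> borel_measurable lebesgue" "\<And>z. lam0 \<le> lam z" "lam0 > 0" "\<And>z. lam z \<le> \<Lambda>"
      "\<And>z u. lam z * (norm u)\<^sup>2 \<le> levi_form \<phi> z u"
    and f: "f \<in> sqint W" "dbar_closed f"
  obtains u where "u \<in> sqint W" "dbar_eq u f" "nrm W u \<le> nrm W (\<lambda>z. (1 / sqrt (2 * lam z)) *\<^sub>R f z)"
proof -
  let ?P = "{\<psi> :: 'n \<Rightarrow> complex ^ 'n \<Rightarrow> complex. \<forall>j. \<psi> j \<in> test_functions}"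
  let ?D = "\<lambda>\<psi>. dual1 (\<lambda>z. \<Sum>j\<in>UNIV. cd \<i> j (\<psi> j) z)"
  have fj: "(\<lambda>z. f z $ j) \<in> sqint W" for j using f(1) by (simp add: sqint_vec_iff)
  have zero: "(\<lambda>z::complex ^ 'n. 0 :: complex) \<in> test_functions" unfolding test_functions_iff by (simp add: C_kc_0)
  have DC: "C_kc 0 (\<lambda>z. \<Sum>j\<in>UNIV. cd \<i> j (\<psi> j) z)" if "\<psi> \<in> ?P" for \<psi>
    using that by (intro C_kc_sum test_C_kc cd_test) simp
  obtain u where u: "u \<in> sqint W" "\<And>\<psi>. \<psi> \<in> ?P \<Longrightarrow> ip W u (?D \<psi>) = - ip W f (dual \<psi>)"
    "nrm W u \<le> nrm W (\<lambda>z. (1 / sqrt (2 * lam z)) *\<^sub>R f z)"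
  proof (rule riesz_indexed[of ?P ?D W "\<lambda>\<psi>. - ip W f (dual \<psi>)" "nrm W (\<lambda>z. (1 / sqrt (2 * lam z)) *\<^sub>R f z)"])
    have "(\<lambda>j z. 0) \<in> ?P" using zero by simp
    then show "?P \<noteq> {}" by (metis empty_iff)
    show "?D \<psi> \<in> sqint W" if "\<psi> \<in> ?P" for \<psi> by (rule dual1_sqint[OF DC[OF that]])
    show "\<bar>- ip W f (dual \<psi>)\<bar> \<le> nrm W (\<lambda>z. (1 / sqrt (2 * lam z)) *\<^sub>R f z) * nrm W (?D \<psi>)" if "\<psi> \<in> ?P" for \<psi>
      using hormander_bound[OF lam f] that by simp
    fix \<psi> \<theta> :: "'n \<Rightarrow> complex ^ 'n \<Rightarrow> complex" and a b :: real
    assume \<psi>: "\<psi> \<in> ?P" and \<theta>: "\<theta> \<in> ?P"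
    let ?r = "\<lambda>j z. complex_of_real a * \<psi> j z + complex_of_real b * \<theta> j z"
    have rP: "?r \<in> ?P"
      using \<psi> \<theta> by (auto intro!: test_add test_cmult)
    have d: "\<psi> j differentiable (at z)" "\<theta> j differentiable (at z)" for j z
      using \<psi> \<theta> C_k_differentiable[OF C_kc_C_k[OF test_C_kc]] by auto
    have dm: "(\<lambda>z. complex_of_real a * \<psi> j z) differentiable (at z)" "(\<lambda>z. complex_of_real b * \<theta> j z) differentiable (at z)" for j z
      using d by (auto intro!: differentiable_mult)
    have cdr: "cd \<i> j (?r j) z = complex_of_real a * cd \<i> j (\<psi> j) z + complex_of_real b * cd \<i> j (\<theta> j) z" for j z
      by (simp add: cd_add[OF dm] cd_cmult[OF d(1)] cd_cmult[OF d(2)])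
    have "?D ?r = (\<lambda>z. a *\<^sub>R ?D \<psi> z + b *\<^sub>R ?D \<theta> z)"
      unfolding dual1_def cdr by (simp add: fun_eq_iff sum.distrib scaleR_conv_of_real algebra_simps flip: sum_distrib_left)
    moreover have "dual ?r = (\<lambda>z. a *\<^sub>R dual \<psi> z + b *\<^sub>R dual \<theta> z)"
      unfolding dual_def dual1_def
      by (simp only: fun_eq_iff vec_eq_iff vector_add_component vector_scaleR_component vec_lambda_beta)
        (simp add: scaleR_conv_of_real algebra_simps)
    moreover have "ip W f (\<lambda>z. a *\<^sub>R dual \<psi> z + b *\<^sub>R dual \<theta> z) = a * ip W f (dual \<psi>) + b * ip W f (dual \<theta>)"
    proof -
      have "dual \<psi> \<in> sqint W" "dual \<theta> \<in> sqint W" using \<psi> \<theta> by (auto intro!: dual_sqint test_C_kc)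
      then show ?thesis
        using ip_add_left[of "\<lambda>z. a *\<^sub>R dual \<psi> z" W "\<lambda>z. b *\<^sub>R dual \<theta> z" f] f(1)
        by (simp add: sqint_scaleR ip_scaleR_left ip_commute[of W f])
    qed
    ultimately have *: "?D ?r = (\<lambda>z. a *\<^sub>R ?D \<psi> z + b *\<^sub>R ?D \<theta> z) \<and>
      - ip W f (dual ?r) = a * - ip W f (dual \<psi>) + b * - ip W f (dual \<theta>)" by simp
    show "\<exists>r\<in>?P. ?D r = (\<lambda>z. a *\<^sub>R ?D \<psi> z + b *\<^sub>R ?D \<theta> z) \<and>
      - ip W f (dual r) = a * - ip W f (dual \<psi>) + b * - ip W f (dual \<theta>)"
      by (rule bexI[of _ ?r]) (rule *, rule rP)
  qed (simp, blast)
  have Re: "Re (LINT z|lebesgue. u z * cd \<i> j \<eta> z) = - Re (LINT z|lebesgue. f z $ j * \<eta> z)"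
    if \<eta>: "\<eta> \<in> test_functions" for \<eta> j
  proof -
    \<comment> \<open>A tuple with a single nonzero component isolates the \<open>j\<close>-th
      equation.\<close>
    define \<psi> where "\<psi> k z = (if k = j then \<eta> z else 0)" for k z
    have \<psi>e: "\<psi> k = (if k = j then \<eta> else (\<lambda>z. 0))" for k by (simp add: \<psi>_def fun_eq_iff)
    have \<psi>: "\<psi> \<in> ?P" using \<eta> zero by (simp add: \<psi>e)
    have s1: "(\<Sum>k\<in>UNIV. cd \<i> k (\<psi> k) z) = cd \<i> j \<eta> z" for z
    proof -
      have "cd \<i> k (\<psi> k) z = (if k = j then cd \<i> j \<eta> z else 0)" for k by (simp add: \<psi>e cd_const)
      then show ?thesis by simp
    qed
    have s2: "(\<Sum>k\<in>UNIV. f z $ k * \<psi> k z) = f z $ j * \<eta> z" for z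
    proof -
      have "f z $ k * \<psi> k z = (if k = j then f z $ j * \<eta> z else 0)" for k by (simp add: \<psi>e)
      then show ?thesis by simp
    qed
    have "ip W u (?D \<psi>) = - ip W f (dual \<psi>)" by (rule u(2)[OF \<psi>])
    moreover have "ip W u (?D \<psi>) = Re (LINT z|lebesgue. u z * cd \<i> j \<eta> z)"
      using ip_dual1[OF u(1) DC[OF \<psi>]] by (simp add: s1)
    moreover have "ip W f (dual \<psi>) = Re (LINT z|lebesgue. f z $ j * \<eta> z)"
      using ip_dual[OF f(1), of \<psi>] \<psi> by (simp add: s2 test_C_kc)
    ultimately show ?thesis by simp
  qed
  have "dbar_eq u f"
    unfolding dbar_eq_def d_zbar_cd
  proof (intro ballI allI)
    fix \<eta> :: "complex ^ 'n \<Rightarrow> complex" and j :: 'n assume \<eta>: "\<eta> \<in> test_functions"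
    have "Re (LINT z|lebesgue. u z * cd \<i> j (\<lambda>z. \<i> * \<eta> z) z) = - Re (LINT z|lebesgue. f z $ j * (\<i> * \<eta> z))"
      by (rule Re[OF test_cmult[OF \<eta>]])
    then have "Im (LINT z|lebesgue. u z * cd \<i> j \<eta> z) = - Im (LINT z|lebesgue. f z $ j * \<eta> z)"
      unfolding cd_cmult_test[OF \<eta>] by (simp add: mult.left_commute[of _ \<i>])
    then show "- (LINT z|lebesgue. u z * cd \<i> j \<eta> z) = (LINT z|lebesgue. f z $ j * \<eta> z)"
      using Re[OF \<eta>, of j] by (simp add: complex_eq_iff)
  qed
  with u show thesis using that by blast
qed

end

section \<open>Bounded perturbations of the weight\<close>

lemma matrix_vector_inner:
  fixes A :: "complex ^ 'n::finite ^ 'n"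
  shows "(A *v v) \<bullet> x = Re (\<Sum>j\<in>UNIV. \<Sum>k\<in>UNIV. A $ j $ k * cnj (x $ j) * v $ k)"
proof -
  have "(A *v v) $ j \<bullet> x $ j = Re (\<Sum>k\<in>UNIV. A $ j $ k * cnj (x $ j) * v $ k)" for j
  proof -
    have "(A *v v) $ j \<bullet> x $ j = Re ((A *v v) $ j * cnj (x $ j))" by (simp add: inner_complex_def)
    also have "(A *v v) $ j * cnj (x $ j) = (\<Sum>k\<in>UNIV. A $ j $ k * cnj (x $ j) * v $ k)"
      by (simp add: matrix_vector_mult_def sum_distrib_left mult_ac)
    finally show ?thesis .
  qed
  then show ?thesis by (simp add: inner_vec_def)
qed

context
  fixes A :: "complex ^ 'n::finite ^ 'n"
  assumes hermitian: "\<And>j k. cnj (A $ j $ k) = A $ k $ j"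
begin

lemma hermitian_self_adjoint: "(A *v v) \<bullet> x = (A *v x) \<bullet> v"
proof -
  have "(A *v v) \<bullet> x = Re (cnj (\<Sum>j\<in>UNIV. \<Sum>k\<in>UNIV. A $ j $ k * cnj (x $ j) * v $ k))"
    unfolding matrix_vector_inner by (simp only: cnj.simps)
  also have "cnj (\<Sum>j\<in>UNIV. \<Sum>k\<in>UNIV. A $ j $ k * cnj (x $ j) * v $ k) = (\<Sum>j\<in>UNIV. \<Sum>k\<in>UNIV. A $ k $ j * cnj (v $ k) * x $ j)"
    by (simp add: hermitian mult_ac)
  also have "\<dots> = (\<Sum>k\<in>UNIV. \<Sum>j\<in>UNIV. A $ k $ j * cnj (v $ k) * x $ j)" by (rule sum.swap)
  finally show ?thesis unfolding matrix_vector_inner .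
qed

lemma real_smult_vec: "complex_of_real t *s v = t *\<^sub>R (v :: complex ^ 'n)"
  unfolding vec_eq_iff vector_smult_component vector_scaleR_component by (simp add: scaleR_conv_of_real)

text \<open>Eigenvectors for distinct real eigenvalues are orthogonal, hence independent. Finiteness
  gives \<open>Min\<close> its intended meaning in \<open>lowest_eigenvalue\<close>.\<close>

lemma finite_real_eigenvalues: "finite {t::real. \<exists>v. v \<noteq> 0 \<and> A *v v = complex_of_real t *s v}"
proof -
  let ?S = "{t::real. \<exists>v. v \<noteq> 0 \<and> A *v v = complex_of_real t *s v}"
  define e where "e t = (SOME v. v \<noteq> 0 \<and> A *v v = t *\<^sub>R v)" for t
  have e: "e t \<noteq> 0 \<and> A *v e t = t *\<^sub>R e t" if "t \<in> ?S" for t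
    unfolding e_def by (rule someI_ex) (use that in \<open>simp add: real_smult_vec\<close>)
  have inj: "inj_on e ?S"
  proof (rule inj_onI)
    fix t s assume t: "t \<in> ?S" and s: "s \<in> ?S" and eq: "e t = e s"
    have "t *\<^sub>R e t = s *\<^sub>R e t" using e[OF t] e[OF s] eq by metis
    then show "t = s" using e[OF t] by simp
  qed
  have "pairwise orthogonal (e ` ?S)"
  proof (rule pairwiseI)
    fix a b assume "a \<in> e ` ?S" "b \<in> e ` ?S" and ne: "a \<noteq> b"
    then obtain t s where ts: "t \<in> ?S" "s \<in> ?S" "a = e t" "b = e s" by blast
    have "t * (e t \<bullet> e s) = s * (e t \<bullet> e s)"
      using hermitian_self_adjoint[of "e t" "e s"] e[OF ts(1)] e[OF ts(2)] by (simp add: inner_commute)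
    moreover have "t \<noteq> s" using ne ts by blast
    ultimately show "orthogonal a b" using ts by (simp add: orthogonal_def)
  qed
  then have "independent (e ` ?S)" by (rule pairwise_orthogonal_independent) (use e in force)
  then have "finite (e ` ?S)" by (rule finiteI_independent)
  then show ?thesis using inj by (rule finite_imageD)
qed

text \<open>The Rayleigh quotient attains its minimum on the unit sphere, and a minimizer is an eigenvector.\<close>

lemma lowest_eigenvalue_le: "lowest_eigenvalue A * (norm v)\<^sup>2 \<le> (A *v v) \<bullet> v"
proof -
  have bl: "bounded_linear ((*v) A)" by (simp add: linear_conv_bounded_linear[symmetric] matrix_vector_mul_linear)
  have comp: "compact (sphere (0::complex ^ 'n) 1)" by simp
  obtain j :: 'n where True by simp
  have "norm (axis j 1 :: complex ^ 'n) = 1" by (simp add: norm_eq_sqrt_inner inner_axis_axis)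
  then have ne: "sphere (0::complex ^ 'n) 1 \<noteq> {}" by force
  have "continuous_on (sphere 0 1) (\<lambda>v. (A *v v) \<bullet> v)"
    by (intro continuous_intros linear_continuous_on bl)
  from continuous_attains_inf[OF comp ne this]
  obtain e where e: "norm e = 1" "\<And>y. norm y = 1 \<Longrightarrow> (A *v e) \<bullet> e \<le> (A *v y) \<bullet> y" by auto
  define t where "t = (A *v e) \<bullet> e"
  have ge: "t * (y \<bullet> y) \<le> (A *v y) \<bullet> y" for y
  proof (cases "y = 0")
    case False
    define x where "x = (1 / norm y) *\<^sub>R y"
    have "norm x = 1" using False by (simp add: x_def)
    then have "t \<le> (A *v x) \<bullet> x" unfolding t_def by (rule e(2))
    also have "\<dots> = (1 / norm y)\<^sup>2 * ((A *v y) \<bullet> y)"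
      unfolding x_def by (simp add: linear_scale[OF bounded_linear.linear[OF bl]] power2_eq_square)
    finally have "t * (norm y)\<^sup>2 \<le> (A *v y) \<bullet> y" using False by (simp add: power_divide pos_le_divide_eq)
    then show ?thesis by (simp add: dot_square_norm)
  qed simp
  \<comment> \<open>First-order condition at the minimizer. Since \<open>ge\<close> holds for
    vectors of any norm, no constraint enters the variation in direction \<open>x\<close>.\<close>
  have "(A *v e - t *\<^sub>R e) \<bullet> x = 0" for x
  proof (rule quadratic_nonneg_imp)
    show "0 \<le> (A *v x) \<bullet> x - t * (x \<bullet> x)" using ge[of x] by simp
    fix s :: real
    have lin: "A *v (e + s *\<^sub>R x) = A *v e + s *\<^sub>R (A *v x)"
      by (simp add: linear_add[OF bounded_linear.linear[OF bl]] linear_scale[OF bounded_linear.linear[OF bl]])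
    have "e \<bullet> e = 1" using e(1) by (simp add: dot_square_norm)
    then have "(A *v (e + s *\<^sub>R x)) \<bullet> (e + s *\<^sub>R x) - t * ((e + s *\<^sub>R x) \<bullet> (e + s *\<^sub>R x))
      = 2 * s * ((A *v e - t *\<^sub>R e) \<bullet> x) + s\<^sup>2 * ((A *v x) \<bullet> x - t * (x \<bullet> x))"
      unfolding lin using hermitian_self_adjoint[of x e]
      by (simp add: inner_simps inner_commute[of x e] t_def[symmetric] algebra_simps power2_eq_square)
    then show "0 \<le> 2 * s * ((A *v e - t *\<^sub>R e) \<bullet> x) + s\<^sup>2 * ((A *v x) \<bullet> x - t * (x \<bullet> x))"
      using ge[of "e + s *\<^sub>R x"] by linarith
  qed
  then have "A *v e - t *\<^sub>R e = 0" using inner_eq_zero_iff by blast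
  then have "A *v e = complex_of_real t *s e" unfolding real_smult_vec by simp
  moreover have "e \<noteq> 0" using e(1) by auto
  ultimately have "lowest_eigenvalue A \<le> t"
    unfolding lowest_eigenvalue_def by (intro Min_le finite_real_eigenvalues) blast
  then have "lowest_eigenvalue A * (norm v)\<^sup>2 \<le> t * (norm v)\<^sup>2" by (rule mult_right_mono) simp
  also have "\<dots> \<le> (A *v v) \<bullet> v" using ge[of v] by (simp add: dot_square_norm)
  finally show ?thesis .
qed

end

section \<open>The Levi form: bounds, sums and dilations\<close>

lemma levi_matrix_cd: "levi_matrix \<phi> z $ j $ k = cd (- \<i>) j (cd \<i> k (\<lambda>w. complex_of_real (\<phi> w))) z"
  by (simp add: levi_matrix_def d_z_cd d_zbar_cd)

context weight
begin

text \<open>Reality of \<phi> and symmetry of second derivatives make the matrix Hermitian; the Levi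
  form at \<open>u\<close> is its quadratic form at the conjugate vector, which has the same
  norm.\<close>

lemma lowest_eigenvalue_levi_form: "lowest_eigenvalue (levi_matrix \<phi> z) * (norm u)\<^sup>2 \<le> levi_form \<phi> z u"
proof -
  have C2p': "C_k 2 p" using C2p by (simp add: numeral_2_eq_2 del: C_k.simps)
  have h: "cnj (levi_matrix \<phi> z $ j $ k) = levi_matrix \<phi> z $ k $ j" for j k
  proof -
    have "cnj (levi_matrix \<phi> z $ j $ k) = cd \<i> j (\<lambda>z. cnj (cd \<i> k p z)) z"
      using cd_cnj[OF C_k_differentiable[OF C1p[of \<i> k]], of \<i> j z] by (simp add: levi_matrix_cd)
    also have "\<dots> = cd \<i> j (cd (- \<i>) k p) z" by (simp add: cd_p_cnj)
    also have "\<dots> = cd (- \<i>) k (cd \<i> j p) z" by (rule cd_commute[OF C2p'])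
    finally show ?thesis by (simp add: levi_matrix_cd)
  qed
  define v :: "complex ^ 'n" where "v = (\<chi> j. cnj (u $ j))"
  have "(levi_matrix \<phi> z *v v) \<bullet> v = levi_form \<phi> z u"
    unfolding matrix_vector_inner levi_form_def by (simp add: v_def)
  moreover have "(norm v)\<^sup>2 = (norm u)\<^sup>2" by (simp add: norm_vec_power2 v_def)
  ultimately show ?thesis using lowest_eigenvalue_le[OF h, of v] by simp
qed

lemma levi_form_abs_le:
  assumes "\<And>j k. cmod (levi_matrix \<phi> z $ j $ k) \<le> B j k"
  shows "\<bar>levi_form \<phi> z u\<bar> \<le> (\<Sum>j\<in>UNIV. \<Sum>k\<in>UNIV. B j k) * (norm u)\<^sup>2"
proof -
  have "\<bar>levi_form \<phi> z u\<bar> \<le> cmod (\<Sum>j\<in>UNIV. \<Sum>k\<in>UNIV. levi_matrix \<phi> z $ j $ k * u $ j * cnj (u $ k))"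
    unfolding levi_form_def by (rule abs_Re_le_cmod)
  also have "\<dots> \<le> (\<Sum>j\<in>UNIV. \<Sum>k\<in>UNIV. B j k * (norm u)\<^sup>2)"
  proof (intro sum_norm_le)
    fix j k
    have "cmod (levi_matrix \<phi> z $ j $ k * u $ j * cnj (u $ k)) = cmod (levi_matrix \<phi> z $ j $ k) * (cmod (u $ j) * cmod (u $ k))"
      by (simp add: norm_mult mult.assoc)
    also have "\<dots> \<le> B j k * (norm u * norm u)"
      using assms[of j k] norm_ge_zero[of "levi_matrix \<phi> z $ j $ k"]
      by (intro mult_mono Finite_Cartesian_Product.norm_nth_le) (auto intro: order_trans[OF norm_ge_zero])
    finally show "cmod (levi_matrix \<phi> z $ j $ k * u $ j * cnj (u $ k)) \<le> B j k * (norm u)\<^sup>2"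
      by (simp add: power2_eq_square)
  qed
  finally show ?thesis by (simp add: sum_distrib_right)
qed

lemma levi_continuous: "continuous_on UNIV (\<lambda>z. levi_matrix \<phi> z $ j $ k)"
  using C_k_continuous[OF C_k_cd[OF C1p, of "- \<i>" j \<i> k]] by (simp add: levi_matrix_cd)

end

lemma levi_form_add:
  assumes "C_k 2 \<phi>" "C_k 2 \<psi>"
  shows "levi_form (\<lambda>z. \<phi> z + s * \<psi> z) z u = levi_form \<phi> z u + s * levi_form \<psi> z u"
proof -
  interpret a: weight \<phi> by unfold_locales (rule assms)
  interpret b: weight \<psi> by unfold_locales (rule assms)
  have d: "a.p differentiable (at z)" "b.p differentiable (at z)"
    "cd t k a.p differentiable (at z)" "cd t k b.p differentiable (at z)" for z t k
    using C_k_differentiable[OF a.C2p] C_k_differentiable[OF b.C2p] C_k_differentiable[OF a.C1p] C_k_differentiable[OF b.C1p] by auto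
  have dm: "(\<lambda>z. complex_of_real s * b.p z) differentiable (at z)" "(\<lambda>z. complex_of_real s * cd t k b.p z) differentiable (at z)" for z t k
    using d by (auto intro!: differentiable_mult)
  have 1: "cd t k (\<lambda>z. complex_of_real (\<phi> z + s * \<psi> z)) = (\<lambda>z. cd t k a.p z + complex_of_real s * cd t k b.p z)" for t k
    using cd_add[OF d(1) dm(1)] cd_cmult[OF d(2)] by (simp add: fun_eq_iff)
  have m: "levi_matrix (\<lambda>z. \<phi> z + s * \<psi> z) z $ j $ k = levi_matrix \<phi> z $ j $ k + complex_of_real s * levi_matrix \<psi> z $ j $ k" for j k
    unfolding levi_matrix_cd 1 cd_add[OF d(3) dm(2)] cd_cmult[OF d(4)] ..
  have "(\<Sum>j\<in>UNIV. \<Sum>k\<in>UNIV. (levi_matrix \<phi> z $ j $ k + complex_of_real s * levi_matrix \<psi> z $ j $ k) * u $ j * cnj (u $ k))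
    = (\<Sum>j\<in>UNIV. \<Sum>k\<in>UNIV. levi_matrix \<phi> z $ j $ k * u $ j * cnj (u $ k)) + complex_of_real s * (\<Sum>j\<in>UNIV. \<Sum>k\<in>UNIV. levi_matrix \<psi> z $ j $ k * u $ j * cnj (u $ k))"
    by (simp add: sum_distrib_left sum.distrib algebra_simps)
  then show ?thesis unfolding levi_form_def m by simp
qed

text \<open>Dividing by the square of \<open>r\<close> compensates the two derivatives, so bounds
  for the Levi form survive every dilation. The summand 0 matches the shape of the affine maps in
  \<open>C_k_affine\<close>.\<close>

lemma levi_form_scaled:
  assumes "C_k 2 \<psi>" and "r \<noteq> 0"
  shows "levi_form (\<lambda>z. \<psi> (r *\<^sub>R z + 0) / r\<^sup>2) z u = levi_form \<psi> (r *\<^sub>R z + 0) u"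
proof -
  interpret weight \<psi> by unfold_locales (rule assms)
  have bl: "bounded_linear (\<lambda>z::complex ^ 'n. r *\<^sub>R z)" by (rule bounded_linear_scaleR_right)
  have c: "cd t k (\<lambda>z. F (r *\<^sub>R z + 0)) z = complex_of_real r * cd t k F (r *\<^sub>R z + 0)" if F: "\<And>z. F differentiable (at z)" for F t k z
  proof -
    have "dd v (\<lambda>z. F (r *\<^sub>R z + 0)) z = r *\<^sub>R dd v F (r *\<^sub>R z + 0)" for v
      using dd_affine[OF bl F] linear_scale[OF linear_dd[OF F]] by metis
    then show ?thesis by (simp add: cd_def scaleR_conv_of_real algebra_simps)
  qed
  have d: "p differentiable (at z)" "cd t k p differentiable (at z)" for z t k
    using C_k_differentiable[OF C2p] C_k_differentiable[OF C1p] by auto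
  have ds: "(\<lambda>z. p (r *\<^sub>R z + 0)) differentiable (at z)" "(\<lambda>z. cd t k p (r *\<^sub>R z + 0)) differentiable (at z)" for z t k
    by (rule C_k_differentiable[OF C_k_affine[OF bl C2p]] C_k_differentiable[OF C_k_affine[OF bl C1p]])+
  have 1: "(\<lambda>z. complex_of_real (\<psi> (r *\<^sub>R z + 0) / r\<^sup>2)) = (\<lambda>z. complex_of_real (1 / r\<^sup>2) * p (r *\<^sub>R z + 0))"
    by (simp add: fun_eq_iff)
  have 2: "cd t k (\<lambda>z. complex_of_real (1 / r\<^sup>2) * p (r *\<^sub>R z + 0)) = (\<lambda>z. complex_of_real (1 / r) * cd t k p (r *\<^sub>R z + 0))" for t k
    using assms(2) unfolding fun_eq_iff cd_cmult[OF ds(1)] c[OF d(1)] by (simp add: power2_eq_square)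
  have "levi_matrix (\<lambda>z. \<psi> (r *\<^sub>R z + 0) / r\<^sup>2) z $ j $ k = levi_matrix \<psi> (r *\<^sub>R z + 0) $ j $ k" for j k
    unfolding levi_matrix_cd 1 2 cd_cmult[OF ds(2)] c[OF d(2)] using assms(2) by simp
  then show ?thesis by (simp add: levi_form_def)
qed

text \<open>A cut-off version of \<open>\<parallel>z\<parallel>\<^sup>2\<close>.\<close>

lemma plurisubharmonic_bump:
  obtains g :: "complex ^ 'n::finite \<Rightarrow> real" and C B :: real
  where "C_k 2 g" "C \<ge> 0" "\<And>z. \<bar>g z\<bar> \<le> B" "\<And>z u. norm z < 1 \<Longrightarrow> levi_form g z u = (norm u)\<^sup>2"
    "\<And>z u. \<bar>levi_form g z u\<bar> \<le> C * (norm u)\<^sup>2"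
proof -
  obtain h :: "complex ^ 'n \<Rightarrow> real" where h: "\<And>k. C_k k h" "\<And>x. norm x \<le> 1 \<Longrightarrow> h x = 1" "\<And>x. 3 < norm x \<Longrightarrow> h x = 0"
    using cutoff_exists by metis
  define g where "g z = (z \<bullet> z) * h z" for z
  have qC: "C_k k (\<lambda>z::complex ^ 'n. z \<bullet> z)" for k
    by (rule C_k_bilinear[OF bounded_bilinear_inner]) (rule C_k_linear[OF bounded_linear_ident])+
  have gC: "C_k 2 g" unfolding g_def[abs_def] by (intro C_k_mult qC h)
  have g0: "g z = 0" if "3 < norm z" for z using h(3)[OF that] by (simp add: g_def)
  interpret weight g by unfold_locales (rule gC)
  obtain B where B: "\<And>z. norm (g z) \<le> B" using continuous_supp_bounded[OF C_k_continuous[OF gC] g0] by metis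
  have L0: "levi_matrix g z $ j $ k = 0" if "3 < norm z" for z j k
  proof -
    have p0: "p z = 0" if "3 < norm z" for z using g0[OF that] by simp
    show ?thesis unfolding levi_matrix_cd by (rule cd_outside[OF cd_outside[OF p0] that])
  qed
  have "\<exists>b. \<forall>z. cmod (levi_matrix g z $ j $ k) \<le> b" for j k
    by (rule continuous_supp_bounded[OF levi_continuous[of j k] L0]) auto
  then obtain b where b: "\<And>j k z. cmod (levi_matrix g z $ j $ k) \<le> b j k" by metis
  have b0: "b j k \<ge> 0" for j k using b[of 0 j k] norm_ge_zero order_trans by blast
  show thesis
  proof (rule that[OF gC, of "\<Sum>j\<in>UNIV. \<Sum>k\<in>UNIV. b j k" B])
    show "0 \<le> (\<Sum>j\<in>UNIV. \<Sum>k\<in>UNIV. b j k)" by (intro sum_nonneg b0)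
    show "\<bar>g z\<bar> \<le> B" for z using B[of z] by simp
    show "\<bar>levi_form g z u\<bar> \<le> (\<Sum>j\<in>UNIV. \<Sum>k\<in>UNIV. b j k) * (norm u)\<^sup>2" for z u
      by (rule levi_form_abs_le[OF b])
    fix z u :: "complex ^ 'n" assume z: "norm z < 1"
    let ?U = "ball (0::complex ^ 'n) 1"
    \<comment> \<open>On the unit ball \<open>p\<close> agrees with the squared norm, whose
      derivative is explicit; for \<open>t = \<i>\<close> the formula gives the coordinate
      \<open>y $ k\<close>.\<close>
    have 1: "cd t k p y = complex_of_real (y \<bullet> axis k 1) + t * complex_of_real (y \<bullet> axis k \<i>)"
      if "y \<in> ?U" for t :: complex and k y
    proof -
      have "dd v p y = 2 * complex_of_real (y \<bullet> v)" for v
      proof -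
        have "((\<lambda>y. complex_of_real (y \<bullet> y)) has_derivative (\<lambda>v. complex_of_real (2 * (y \<bullet> v)))) (at y)"
          by (auto intro!: derivative_eq_intros simp: inner_commute)
        then have "(p has_derivative (\<lambda>v. complex_of_real (2 * (y \<bullet> v)))) (at y)"
        proof (rule has_derivative_transform_within_open)
          show "open ?U" "y \<in> ?U" using \<open>y \<in> ?U\<close> by auto
          show "complex_of_real (x \<bullet> x) = p x" if "x \<in> ?U" for x
            using that h(2)[of x] by (simp add: g_def)
        qed
        from dd_eq[OF this] show ?thesis by simp
      qed
      then show ?thesis by (simp add: cd_def)
    qed
    have 2: "cd \<i> k p y = y $ k" if "y \<in> ?U" for k y
      using 1[OF that, of \<i> k] by (simp add: inner_axis inner_complex_def complex_eq_iff)
    have 3: "dd v (cd \<i> k p) z = v $ k" for v k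
    proof -
      have "bounded_linear (\<lambda>y::complex ^ 'n. y $ k)" by (rule bounded_linear_vec_nth)
      then have "((\<lambda>y::complex ^ 'n. y $ k) has_derivative (\<lambda>v. v $ k)) (at z)" by (rule bounded_linear_imp_has_derivative)
      then have "(cd \<i> k p has_derivative (\<lambda>v. v $ k)) (at z)"
        by (rule has_derivative_transform_within_open[OF _ open_ball, of _ _ z UNIV 0 1]) (use z 2 in auto)
      then show ?thesis by (rule dd_eq)
    qed
    have lm: "levi_matrix g z $ j $ k = (if j = k then 1 else 0)" for j k
      unfolding levi_matrix_cd cd_def[of _ _ "cd \<i> k p"] 3 by (simp add: axis_def)
    have "(\<Sum>j\<in>UNIV. \<Sum>k\<in>UNIV. levi_matrix g z $ j $ k * u $ j * cnj (u $ k)) = (\<Sum>j\<in>UNIV. u $ j * cnj (u $ j))"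
      by (simp add: lm if_distrib[of "\<lambda>x. x * _"] cong: if_cong)
    also have "\<dots> = complex_of_real ((norm u)\<^sup>2)"
      unfolding norm_vec_power2 of_real_sum complex_norm_square ..
    finally show "levi_form g z u = (norm u)\<^sup>2" by (simp add: levi_form_def)
  qed
qed

text \<open>The constants are chosen in the order \<open>K\<close>, \<open>M\<close>,
  \<open>R\<close>: \<open>- K\<close> is a lower bound for the Levi form of \<phi> everywhere,
  \<open>M\<close> is the largest loss that \<open>K + 1\<close> times the bump can cause, and
  beyond radius \<open>R\<close> the Levi form of \<phi> exceeds that loss by 1. The bump is then
  dilated so that its Levi form is the squared norm inside radius \<open>R\<close>; dilation
  invariance keeps \<open>M\<close> valid.\<close>

lemma (in weight) strictly_positive_perturbation:
  assumes lim: "filterlim (\<lambda>z. lowest_eigenvalue (levi_matrix \<phi> z)) at_top at_infinity"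
  obtains \<phi>' m where "weight \<phi>'" "\<And>z. \<bar>\<phi>' z - \<phi> z\<bar> \<le> m" "\<And>z u. (norm u)\<^sup>2 \<le> levi_form \<phi>' z u"
    "\<And>L. \<exists>R>0. \<forall>z u. R < norm z \<longrightarrow> L * (norm u)\<^sup>2 \<le> levi_form \<phi>' z u"
proof -
  obtain g :: "complex ^ 'n \<Rightarrow> real" and C B where g: "C_k 2 g" "C \<ge> 0" "\<And>z. \<bar>g z\<bar> \<le> B"
    "\<And>z u. norm z < 1 \<Longrightarrow> levi_form g z u = (norm u)\<^sup>2" "\<And>z u. \<bar>levi_form g z u\<bar> \<le> C * (norm u)\<^sup>2"
    using plurisubharmonic_bump by blast
  have ev: "\<exists>R>0. \<forall>z u. R \<le> norm z \<longrightarrow> L * (norm u)\<^sup>2 \<le> levi_form \<phi> z u" for L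
  proof -
    obtain b where b: "\<And>z. b \<le> norm z \<Longrightarrow> L \<le> lowest_eigenvalue (levi_matrix \<phi> z)"
      using lim unfolding filterlim_at_top eventually_at_infinity by blast
    have "L * (norm u)\<^sup>2 \<le> levi_form \<phi> z u" if "max b 1 \<le> norm z" for z u
      using b[of z] that mult_right_mono[of L _ "(norm u)\<^sup>2"] lowest_eigenvalue_levi_form[of z u] by fastforce
    then show ?thesis by (intro exI[of _ "max b 1"]) auto
  qed
  obtain R1 where R1: "R1 > 0" "\<And>z u. R1 \<le> norm z \<Longrightarrow> 0 * (norm u)\<^sup>2 \<le> levi_form \<phi> z u" using ev[of 0] by blast
  have "\<exists>b. \<forall>z. norm z \<le> R1 \<longrightarrow> cmod (levi_matrix \<phi> z $ j $ k) \<le> b" for j k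
  proof -
    have "compact ((\<lambda>z. levi_matrix \<phi> z $ j $ k) ` cball 0 R1)"
      by (intro compact_continuous_image continuous_on_subset[OF levi_continuous]) auto
    then obtain b where "\<And>y. y \<in> (\<lambda>z. levi_matrix \<phi> z $ j $ k) ` cball 0 R1 \<Longrightarrow> norm y \<le> b"
      by (meson bounded_pos compact_imp_bounded)
    then show ?thesis by (intro exI[of _ b]) auto
  qed
  then obtain b where b: "\<And>j k z. norm z \<le> R1 \<Longrightarrow> cmod (levi_matrix \<phi> z $ j $ k) \<le> b j k" by metis
  have b0: "b j k \<ge> 0" for j k
    by (rule order_trans[OF norm_ge_zero b[of 0 j k]]) (use R1(1) in simp)
  define K where "K = (\<Sum>j\<in>UNIV. \<Sum>k\<in>UNIV. b j k)"
  have K0: "K \<ge> 0" unfolding K_def by (intro sum_nonneg b0)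
  \<comment> \<open>Compactness gives the bound up to radius \<open>R1\<close>; beyond it the Levi
    form is nonnegative.\<close>
  have K: "- K * (norm u)\<^sup>2 \<le> levi_form \<phi> z u" for z u
  proof (cases "norm z \<le> R1")
    case True
    have "\<bar>levi_form \<phi> z u\<bar> \<le> K * (norm u)\<^sup>2" unfolding K_def by (rule levi_form_abs_le[OF b[OF True]])
    then show ?thesis by linarith
  next
    case False
    have "- K * (norm u)\<^sup>2 \<le> 0" using K0 by (simp add: mult_nonneg_nonneg)
    then show ?thesis using R1(2)[of z u] False by linarith
  qed
  define M where "M = (K + 1) * C"
  obtain R where R: "R > 0" "\<And>z u. R \<le> norm z \<Longrightarrow> (M + 1) * (norm u)\<^sup>2 \<le> levi_form \<phi> z u" using ev by blast
  define r where "r = 1 / R"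
  have r: "r \<noteq> 0" using R by (simp add: r_def)
  define \<psi> where "\<psi> z = g (r *\<^sub>R z + 0) / r\<^sup>2" for z
  have bl: "bounded_linear (\<lambda>z::complex ^ 'n. r *\<^sub>R z)" by (rule bounded_linear_scaleR_right)
  have "C_k 2 (\<lambda>z. (1 / r\<^sup>2) * g (r *\<^sub>R z + 0))" by (intro C_k_mult C_k_const C_k_affine[OF bl g(1)])
  then have \<psi>C: "C_k 2 \<psi>" by (simp add: \<psi>_def[abs_def])
  have \<psi>l: "levi_form \<psi> z u = levi_form g (r *\<^sub>R z + 0) u" for z u
    unfolding \<psi>_def[abs_def] by (rule levi_form_scaled[OF g(1) r])
  define \<phi>' where "\<phi>' z = \<phi> z + (K + 1) * \<psi> z" for z
  have l: "levi_form \<phi>' z u = levi_form \<phi> z u + (K + 1) * levi_form g (r *\<^sub>R z + 0) u" for z u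
    unfolding \<phi>'_def[abs_def] levi_form_add[OF C2 \<psi>C] \<psi>l ..
  have low: "levi_form \<phi> z u - M * (norm u)\<^sup>2 \<le> levi_form \<phi>' z u" for z u
  proof -
    have "- (C * (norm u)\<^sup>2) \<le> levi_form g (r *\<^sub>R z + 0) u" using g(5)[of "r *\<^sub>R z + 0" u] by linarith
    then have "(K + 1) * - (C * (norm u)\<^sup>2) \<le> (K + 1) * levi_form g (r *\<^sub>R z + 0) u" using K0 by (intro mult_left_mono) auto
    then show ?thesis unfolding l M_def by (simp add: algebra_simps)
  qed
  show thesis
  proof (rule that[of \<phi>' "(K + 1) * (B / r\<^sup>2)"])
    show "weight \<phi>'" unfolding \<phi>'_def[abs_def] by unfold_locales (intro C_k_add C_k_mult C_k_const C2 \<psi>C)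
    show "\<bar>\<phi>' z - \<phi> z\<bar> \<le> (K + 1) * (B / r\<^sup>2)" for z
    proof -
      have "\<bar>\<psi> z\<bar> \<le> B / r\<^sup>2" unfolding \<psi>_def using g(3) by (simp add: divide_right_mono)
      then have "(K + 1) * \<bar>\<psi> z\<bar> \<le> (K + 1) * (B / r\<^sup>2)" using K0 by (intro mult_left_mono) auto
      then show ?thesis using K0 by (simp add: \<phi>'_def abs_mult)
    qed
    \<comment> \<open>Inside radius \<open>R\<close> the contribution \<open>K + 1\<close> of the
      bump outweighs \<open>- K\<close>; outside, the growth \<open>M + 1\<close> outweighs the loss
      \<open>M\<close>.\<close>
    show "(norm u)\<^sup>2 \<le> levi_form \<phi>' z u" for z u
    proof (cases "norm z < R")
      case True
      then have "norm (r *\<^sub>R z + 0) < 1" using R(1) by (simp add: r_def divide_less_eq)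
      then have "levi_form \<phi>' z u = levi_form \<phi> z u + (K + 1) * (norm u)\<^sup>2" using l g(4) by metis
      then show ?thesis using K[of u z] by (simp add: algebra_simps)
    next
      case False
      then show ?thesis using R(2)[of z u] low[of z u] by (simp add: algebra_simps)
    qed
    show "\<exists>R>0. \<forall>z u. R < norm z \<longrightarrow> L * (norm u)\<^sup>2 \<le> levi_form \<phi>' z u" for L
    proof -
      obtain S where S: "S > 0" "\<And>z u. S \<le> norm z \<Longrightarrow> (L + M) * (norm u)\<^sup>2 \<le> levi_form \<phi> z u" using ev by blast
      have "L * (norm u)\<^sup>2 \<le> levi_form \<phi>' z u" if "S < norm z" for z u
        using S(2)[of z u] low[of z u] that by (simp add: algebra_simps)
      then show ?thesis using S(1) by blast
    qed
  qed
qed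

section \<open>Rellich's lemma\<close>

lemma sqint_translate:
  fixes f :: "'a::euclidean_space \<Rightarrow> 'b::euclidean_space"
  assumes f: "f \<in> sqint lebesgue"
  shows "(\<lambda>x. f (x - y)) \<in> sqint lebesgue" "nrm lebesgue (\<lambda>x. f (x - y)) \<le> nrm lebesgue f"
proof -
  have fm: "f \<in> borel_measurable lebesgue" by (rule sqint_measurable[OF f])
  obtain g where g: "g \<in> borel_measurable borel" "AE x in lebesgue. f x = g x"
    using lebesgue_ex_borel[OF fm] by blast
  have "(\<lambda>x. g (x - y)) \<in> borel_measurable borel" using g(1) by measurable
  then have "(\<lambda>x. g (x - y)) \<in> borel_measurable lebesgue" by (simp add: measurable_completion)
  moreover have "AE x in lebesgue. g (x - y) = f (x - y)"
    using AE_lebesgue_translate[OF g(2), of y] by eventually_elim simp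
  ultimately have m: "(\<lambda>x. f (x - y)) \<in> borel_measurable lebesgue" by (rule borel_measurable_AE)
  have "(\<integral>\<^sup>+x. ennreal ((norm (f (x - y)))\<^sup>2) \<partial>lebesgue) \<le> ennreal ((nrm lebesgue f)\<^sup>2)"
    unfolding nn_integral_lebesgue_translate[OF fm] nn_integral_nrm[OF f] by simp
  from sqint_nn_integralI[OF m this nrm_nonneg]
  show "(\<lambda>x. f (x - y)) \<in> sqint lebesgue" "nrm lebesgue (\<lambda>x. f (x - y)) \<le> nrm lebesgue f" by auto
qed

lemma nrm_sum:
  "(\<And>i. i \<in> I \<Longrightarrow> f i \<in> sqint M) \<Longrightarrow> nrm M (\<lambda>x. \<Sum>i\<in>I. f i x) \<le> (\<Sum>i\<in>I. nrm M (f i))"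
proof (induction I rule: infinite_finite_induct)
  case (insert i I)
  have "nrm M (\<lambda>x. f i x + (\<Sum>i\<in>I. f i x)) \<le> nrm M (f i) + nrm M (\<lambda>x. \<Sum>i\<in>I. f i x)"
    by (rule nrm_triangle) (use insert in \<open>auto intro: sqint_sum\<close>)
  also have "\<dots> \<le> nrm M (f i) + (\<Sum>i\<in>I. nrm M (f i))" using insert by simp
  finally show ?case using insert(1,2) by simp
qed (simp_all add: nrm_def)

lemma C_kc_sqint:
  fixes f :: "'a::euclidean_space \<Rightarrow> 'b::euclidean_space"
  shows "C_kc k f \<Longrightarrow> f \<in> sqint lebesgue"
  unfolding C_kc_def using sqint_continuous_supp C_k_continuous by metis

text \<open>Telescoping into \<open>m\<close> steps: translating the difference for \<open>m\<close>
  steps by \<open>h\<close> does not increase its norm, so each further step adds at most the norm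
  of one step.\<close>

lemma nrm_translate_multiple:
  fixes a :: "'a::euclidean_space \<Rightarrow> 'b::euclidean_space"
  assumes a: "a \<in> sqint lebesgue"
  shows "nrm lebesgue (\<lambda>x. a (x - real m *\<^sub>R h) - a x) \<le> real m * nrm lebesgue (\<lambda>x. a (x - h) - a x)"
proof (induction m)
  case (Suc m)
  let ?d = "\<lambda>x. a (x - real m *\<^sub>R h) - a x"
  have d: "?d \<in> sqint lebesgue" "(\<lambda>x. a (x - h) - a x) \<in> sqint lebesgue"
    by (intro sqint_diff sqint_translate a)+
  have "(\<lambda>x. a (x - real (Suc m) *\<^sub>R h) - a x) = (\<lambda>x. ?d (x - h) + (a (x - h) - a x))"
    by (simp add: algebra_simps)
  then have "nrm lebesgue (\<lambda>x. a (x - real (Suc m) *\<^sub>R h) - a x)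
    \<le> nrm lebesgue (\<lambda>x. ?d (x - h)) + nrm lebesgue (\<lambda>x. a (x - h) - a x)"
    using nrm_triangle[OF sqint_translate(1)[OF d(1), of h] d(2)] by simp
  also have "\<dots> \<le> nrm lebesgue ?d + nrm lebesgue (\<lambda>x. a (x - h) - a x)"
    using sqint_translate(2)[OF d(1), of h] by simp
  also have "\<dots> \<le> real (Suc m) * nrm lebesgue (\<lambda>x. a (x - h) - a x)"
    using Suc by (simp add: algebra_simps)
  finally show ?case .
qed (simp add: nrm_def)

text \<open>Splitting \<open>h\<close> into \<open>Suc n\<close> equal steps bounds the left-hand
  side by the norm of a difference quotient, and the difference quotients converge to the derivative
  in norm.\<close>

lemma nrm_translate_le_dd:
  fixes a :: "'a::euclidean_space \<Rightarrow> 'b::euclidean_space"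
  assumes a: "C_kc (Suc 0) a"
  shows "nrm lebesgue (\<lambda>x. a (x - h) - a x) \<le> nrm lebesgue (dd (- h) a)"
proof -
  obtain R where aC: "C_k (Suc 0) a" and R: "\<And>x. R < norm x \<Longrightarrow> a x = 0" using a by (auto simp: C_kc_def)
  let ?q = "\<lambda>n x. real (Suc n) *\<^sub>R (a (x + (1 / real (Suc n)) *\<^sub>R (- h)) - a x)"
  obtain B where B: "B > 0" "\<And>n x. norm (?q n x) \<le> indicator (cball 0 (R + norm (- h))) x *\<^sub>R (B * norm (- h))"
    "\<And>x. (\<lambda>n. ?q n x) \<longlonglongrightarrow> dd (- h) a x"
    using difference_quotients[OF aC R] by blast
  have as: "a \<in> sqint lebesgue" by (rule C_kc_sqint[OF a])
  have ds: "dd (- h) a \<in> sqint lebesgue"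
    by (rule sqint_continuous_supp[OF C_k_continuous[OF C_k_dd[OF aC]] dd_outside[OF R]])
  have qs: "?q n \<in> sqint lebesgue" for n
    using sqint_scaleR[OF sqint_diff[OF sqint_translate(1)[OF as, of "(1 / real (Suc n)) *\<^sub>R h"] as], of "real (Suc n)"] by simp
  define w where "w x = 2 * (B * norm h) * indicat_real (cball 0 (R + norm h)) x" for x :: 'a
  have "(\<lambda>n. nrm lebesgue (\<lambda>x. ?q n x - dd (- h) a x)) \<longlonglongrightarrow> 0"
  proof (rule nrm_tendsto_dominated[where w=w])
    show "?q n \<in> borel_measurable lebesgue" for n by (rule sqint_measurable[OF qs])
    show "dd (- h) a \<in> borel_measurable lebesgue" by (rule sqint_measurable[OF ds])
    have "w \<in> sqint lebesgue"
      using sqint_scaleR[OF indicator_cball_sqint, of "2 * (B * norm h)" "R + norm h"] by (simp add: w_def[abs_def])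
    then show "integrable lebesgue (\<lambda>x. (w x)\<^sup>2)" using sqint_integrable by force
    show "AE x in lebesgue. (\<lambda>n. ?q n x) \<longlonglongrightarrow> dd (- h) a x" by (rule AE_I2) (rule B(3))
    show "AE x in lebesgue. norm (?q n x - dd (- h) a x) \<le> w x" for n
    proof (rule AE_I2)
      fix x :: 'a
      let ?b = "indicator (cball 0 (R + norm (- h))) x *\<^sub>R (B * norm (- h))"
      have "norm (dd (- h) a x) \<le> ?b"
        by (rule LIMSEQ_le_const2[OF tendsto_norm[OF B(3)]]) (use B(2) in blast)
      then have "norm (?q n x - dd (- h) a x) \<le> ?b + ?b"
        using B(2)[of n x] norm_triangle_ineq4[of "?q n x" "dd (- h) a x"] by linarith
      then show "norm (?q n x - dd (- h) a x) \<le> w x" by (simp add: w_def)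
    qed
  qed
  then have lim: "(\<lambda>n. nrm lebesgue (?q n)) \<longlonglongrightarrow> nrm lebesgue (dd (- h) a)" by (rule nrm_tendsto[OF qs ds])
  show ?thesis
  proof (rule LIMSEQ_le_const[OF lim], intro exI allI impI)
    fix n
    have "nrm lebesgue (\<lambda>x. a (x - real (Suc n) *\<^sub>R ((1 / real (Suc n)) *\<^sub>R h)) - a x)
      \<le> real (Suc n) * nrm lebesgue (\<lambda>x. a (x - (1 / real (Suc n)) *\<^sub>R h) - a x)"
      by (rule nrm_translate_multiple[OF as])
    also have "\<dots> = nrm lebesgue (?q n)" by (simp add: nrm_scaleR del: of_nat_Suc)
    finally show "nrm lebesgue (\<lambda>x. a (x - h) - a x) \<le> nrm lebesgue (?q n)" by (simp del: of_nat_Suc)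
  qed
qed

text \<open>Two integrations by parts exchange the derivatives. For compactly supported functions
  dbar thus controls the full gradient, which is why a Rellich lemma holds for dbar alone.\<close>

lemma nrm_cd_conj:
  fixes a :: "complex ^ 'n::finite \<Rightarrow> complex"
  assumes a: "C_kc (Suc (Suc 0)) a"
  shows "nrm lebesgue (cd (- \<i>) j a) = nrm lebesgue (cd \<i> j a)"
proof -
  have a1: "C_kc (Suc 0) a" by (rule C_kc_antimono[OF a]) simp
  have ca: "C_kc (Suc 0) (\<lambda>z. cnj (a z))" by (rule C_kc_cnj[OF a1])
  have dC: "C_k (Suc 0) (cd s j a)" for s by (rule C_kc_C_k[OF C_kc_cd[OF a]])
  have c: "cd s j (\<lambda>z. cnj (a z)) z = cnj (cd (cnj s) j a z)" for s z
    by (rule cd_cnj[OF C_k_differentiable[OF C_kc_C_k[OF a]]])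
  have "C_k 2 a" using C_kc_C_k[OF a] by (simp add: numeral_2_eq_2 del: C_k.simps)
  then have cm: "cd \<i> j (cd (- \<i>) j a) z = cd (- \<i>) j (cd \<i> j a) z" for z by (rule cd_commute)
  have sq: "complex_of_real ((nrm lebesgue (cd s j a))\<^sup>2) = (LINT z|lebesgue. cd s j a z * cnj (cd s j a z))" for s
    unfolding nrm_power2 integral_complex_of_real[symmetric] complex_norm_square ..
  have "complex_of_real ((nrm lebesgue (cd (- \<i>) j a))\<^sup>2) = (LINT z|lebesgue. cd (- \<i>) j a z * cd \<i> j (\<lambda>z. cnj (a z)) z)"
    unfolding sq c by simp
  also have "\<dots> = - (LINT z|lebesgue. cd \<i> j (cd (- \<i>) j a) z * cnj (a z))" by (rule cd_by_parts[OF dC ca])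
  also have "\<dots> = (LINT z|lebesgue. cd \<i> j a z * cd (- \<i>) j (\<lambda>z. cnj (a z)) z)"
    unfolding cm cd_by_parts[OF dC ca] ..
  also have "\<dots> = complex_of_real ((nrm lebesgue (cd \<i> j a))\<^sup>2)"
    unfolding sq c by simp
  finally have "(nrm lebesgue (cd (- \<i>) j a))\<^sup>2 = (nrm lebesgue (cd \<i> j a))\<^sup>2" by (simp only: of_real_eq_iff)
  then show ?thesis by (simp add: power2_eq_iff_nonneg)
qed

lemma dd_cd:
  fixes a :: "complex ^ 'n::finite \<Rightarrow> complex"
  assumes "a differentiable (at z)"
  shows "dd h a z = (\<Sum>j\<in>UNIV. h $ j * cd (- \<i>) j a z + cnj (h $ j) * cd \<i> j a z)"
proof -
  have lin: "linear (\<lambda>v. dd v a z)" by (rule linear_dd[OF assms])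
  have "h = (\<Sum>j\<in>UNIV. Re (h $ j) *\<^sub>R axis j 1 + Im (h $ j) *\<^sub>R axis j \<i>)"
  proof -
    have "(\<Sum>j\<in>UNIV. Re (h $ j) *\<^sub>R axis j 1 + Im (h $ j) *\<^sub>R axis j \<i> :: complex ^ 'n) $ i = h $ i" for i
    proof -
      have "(\<Sum>j\<in>UNIV. Re (h $ j) *\<^sub>R axis j 1 + Im (h $ j) *\<^sub>R axis j \<i> :: complex ^ 'n) $ i
        = (\<Sum>j\<in>UNIV. if j = i then h $ i else 0)"
        unfolding sum_component by (intro sum.cong refl) (auto simp: axis_def complex_eq_iff)
      then show ?thesis by simp
    qed
    then show ?thesis by (simp add: vec_eq_iff)
  qed
  then have "dd h a z = dd (\<Sum>j\<in>UNIV. Re (h $ j) *\<^sub>R axis j 1 + Im (h $ j) *\<^sub>R axis j \<i>) a z" by simp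
  also have "\<dots> = (\<Sum>j\<in>UNIV. Re (h $ j) *\<^sub>R dd (axis j 1) a z + Im (h $ j) *\<^sub>R dd (axis j \<i>) a z)"
    by (simp only: linear_sum[OF lin] linear_add[OF lin] linear_scale[OF lin])
  also have "\<dots> = (\<Sum>j\<in>UNIV. h $ j * cd (- \<i>) j a z + cnj (h $ j) * cd \<i> j a z)"
    by (intro sum.cong refl) (simp add: cd_def complex_eq_iff field_simps)
  finally show ?thesis .
qed

lemma nrm_dd_le:
  fixes a :: "complex ^ 'n::finite \<Rightarrow> complex"
  assumes a: "C_kc (Suc (Suc 0)) a"
  shows "nrm lebesgue (dd h a) \<le> norm h * (\<Sum>j\<in>UNIV. 2 * nrm lebesgue (cd \<i> j a))"
proof -
  have s: "cd t j a \<in> sqint lebesgue" for t j by (rule C_kc_sqint[OF C_kc_cd[OF a]])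
  have m: "(\<lambda>z. c * cd t j a z) \<in> sqint lebesgue \<and> nrm lebesgue (\<lambda>z. c * cd t j a z) \<le> norm h * nrm lebesgue (cd t j a)"
    if "cmod c \<le> norm h" for c t j
    using sqint_bounded_mult[of "\<lambda>z. c" lebesgue "cd t j a" "norm h"] s that by auto
  have hj: "cmod (h $ j) \<le> norm h" "cmod (cnj (h $ j)) \<le> norm h" for j
    by (simp_all add: Finite_Cartesian_Product.norm_nth_le)
  have ts: "(\<lambda>z. h $ j * cd (- \<i>) j a z + cnj (h $ j) * cd \<i> j a z) \<in> sqint lebesgue" for j
    using m[OF hj(1)] m[OF hj(2)] by (auto intro: sqint_add)
  have "dd h a = (\<lambda>z. \<Sum>j\<in>UNIV. h $ j * cd (- \<i>) j a z + cnj (h $ j) * cd \<i> j a z)"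
    using dd_cd[OF C_k_differentiable[OF C_kc_C_k[OF a]]] by blast
  then have "nrm lebesgue (dd h a) \<le> (\<Sum>j\<in>UNIV. nrm lebesgue (\<lambda>z. h $ j * cd (- \<i>) j a z + cnj (h $ j) * cd \<i> j a z))"
    using nrm_sum[of UNIV "\<lambda>j z. h $ j * cd (- \<i>) j a z + cnj (h $ j) * cd \<i> j a z" lebesgue] ts by simp
  also have "\<dots> \<le> (\<Sum>j\<in>UNIV. norm h * (2 * nrm lebesgue (cd \<i> j a)))"
  proof (rule sum_mono)
    fix j
    have "nrm lebesgue (\<lambda>z. h $ j * cd (- \<i>) j a z + cnj (h $ j) * cd \<i> j a z)
      \<le> nrm lebesgue (\<lambda>z. h $ j * cd (- \<i>) j a z) + nrm lebesgue (\<lambda>z. cnj (h $ j) * cd \<i> j a z)"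
      by (rule nrm_triangle) (use m[OF hj(1)] m[OF hj(2)] in auto)
    also have "\<dots> \<le> norm h * nrm lebesgue (cd (- \<i>) j a) + norm h * nrm lebesgue (cd \<i> j a)"
      by (intro add_mono) (use m[OF hj(1)] m[OF hj(2)] in auto)
    finally show "nrm lebesgue (\<lambda>z. h $ j * cd (- \<i>) j a z + cnj (h $ j) * cd \<i> j a z) \<le> norm h * (2 * nrm lebesgue (cd \<i> j a))"
      by (simp add: nrm_cd_conj[OF a])
  qed
  finally show ?thesis by (simp add: sum_distrib_left)
qed

context
  fixes v :: "complex ^ 'n::finite \<Rightarrow> complex" and g :: "complex ^ 'n \<Rightarrow> complex ^ 'n" and T :: real
  assumes v: "v \<in> sqint lebesgue" "\<And>z. T < norm z \<Longrightarrow> v z = 0"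
    and g: "g \<in> sqint lebesgue" "\<And>z. T < norm z \<Longrightarrow> g z = 0"
    and dbar: "dbar_eq v g"
begin

text \<open>Testing with the reflected kernel shows that the dbar derivatives of the mollified
  \<open>v\<close> are the mollified coefficients of \<open>g\<close>, whose norms are no larger.
  The estimate for smooth functions then passes to the limit.\<close>

lemma translation_estimate:
  "nrm lebesgue (\<lambda>x. v (x - h) - v x) \<le> norm h * (\<Sum>j\<in>UNIV. 2 * nrm lebesgue (\<lambda>z. g z $ j))"
proof -
  define k where "k n = (mollifier (1 / real (Suc n)) :: complex ^ 'n \<Rightarrow> real)" for n
  have kk: "smoothing_kernel (k n) (1 / real (Suc n))" for n unfolding k_def by (rule smoothing_kernel_mollifier) simp
  have kC: "C_k m (k n)" for m n using smoothing_kernel.smooth[OF kk] .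
  have k0: "1 / real (Suc n) < norm x \<Longrightarrow> k n x = 0" for n x using smoothing_kernel.outside[OF kk] .
  have vi: "integrable lebesgue v" by (rule sqint_supp_integrable[OF v])
  have gj: "(\<lambda>z. g z $ j) \<in> sqint lebesgue" "integrable lebesgue (\<lambda>z. g z $ j)" for j
  proof -
    show s: "(\<lambda>z. g z $ j) \<in> sqint lebesgue" using g(1) by (simp add: sqint_vec_iff)
    show "integrable lebesgue (\<lambda>z. g z $ j)" by (rule sqint_supp_integrable[OF s, of T]) (use g(2) in simp)
  qed
  define a where "a n = conv (k n) v" for n
  have aC: "C_kc m (a n)" for m n
  proof -
    have "C_k m (a n)" unfolding a_def by (rule conv_C_k[of "k n" "1 / real (Suc n)" v, OF _ _ vi]) (use kC k0 in blast)+
    moreover have "a n x = 0" if "T + 1 / real (Suc n) < norm x" for x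
      unfolding a_def using conv_outside[of "1 / real (Suc n)" "k n" T v x] k0 v(2) that by blast
    ultimately show ?thesis unfolding C_kc_def by blast
  qed
  have cda: "cd \<i> j (a n) = conv (k n) (\<lambda>z. g z $ j)" for n j
  proof
    fix x
    have "(\<lambda>y. complex_of_real (k n (x - y))) \<in> test_functions"
      unfolding test_functions_iff
      by (intro allI) (rule reflected_kernel_C_kc[of "k n" "1 / real (Suc n)"], use kC k0 in blast, use kC k0 in blast)
    then have "- (LINT z|lebesgue. v z * cd \<i> j (\<lambda>y. complex_of_real (k n (x - y))) z) = (LINT z|lebesgue. g z $ j * complex_of_real (k n (x - z)))"
      using dbar unfolding dbar_eq_def d_zbar_cd by blast
    moreover have "cd \<i> j (conv (k n) v) x = - (LINT y|lebesgue. v y * cd \<i> j (\<lambda>y. complex_of_real (k n (x - y))) y)"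
      by (rule cd_conv[of "k n" "1 / real (Suc n)", OF _ _ vi]) (use kC k0 in blast)+
    ultimately show "cd \<i> j (a n) x = conv (k n) (\<lambda>z. g z $ j) x"
      unfolding a_def conv_def by (simp add: scaleR_conv_of_real mult.commute)
  qed
  have bound: "nrm lebesgue (\<lambda>x. a n (x - h) - a n x) \<le> norm h * (\<Sum>j\<in>UNIV. 2 * nrm lebesgue (\<lambda>z. g z $ j))" for n
  proof -
    have "nrm lebesgue (\<lambda>x. a n (x - h) - a n x) \<le> nrm lebesgue (dd (- h) (a n))" by (rule nrm_translate_le_dd[OF aC])
    also have "\<dots> \<le> norm (- h) * (\<Sum>j\<in>UNIV. 2 * nrm lebesgue (cd \<i> j (a n)))" by (rule nrm_dd_le[OF aC])
    also have "\<dots> \<le> norm (- h) * (\<Sum>j\<in>UNIV. 2 * nrm lebesgue (\<lambda>z. g z $ j))"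
      unfolding cda using smoothing_kernel.conv_sqint(2)[OF kk gj] by (intro mult_left_mono sum_mono) auto
    finally show ?thesis by simp
  qed
  \<comment> \<open>\<open>cvg_conv\<close> concerns Lebesgue measure although it lives in the
    locale \<open>weight\<close>; a constant weight instantiates it.\<close>
  have an: "cvg lebesgue a v" unfolding a_def[abs_def] k_def by (rule weight.cvg_conv[OF _ v]) (unfold_locales, rule C_k_const)
  have as: "a n \<in> sqint lebesgue" for n using an by (simp add: cvg_def)
  have "cvg lebesgue (\<lambda>n x. a n (x - h)) (\<lambda>x. v (x - h))"
    unfolding cvg_def
  proof (intro conjI allI sqint_translate as v)
    show "(\<lambda>n. nrm lebesgue (\<lambda>x. a n (x - h) - v (x - h))) \<longlonglongrightarrow> 0"
    proof (rule Lim_null_comparison)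
      show "(\<lambda>n. nrm lebesgue (\<lambda>x. a n x - v x)) \<longlonglongrightarrow> 0" using an by (simp add: cvg_def)
    qed (use sqint_translate(2)[OF sqint_diff[OF as v(1)], where y=h] in simp)
  qed
  from cvg_nrm[OF cvg_diff[OF this an]] show ?thesis
    by (rule LIMSEQ_le_const2) (use bound in blast)
qed

text \<open>For shifts up to the radius of the kernel the translation estimate is the modulus of
  continuity that \<open>conv_deviation\<close> asks for with \<open>c = 1\<close>.\<close>

lemma mollification_rate:
  "nrm lebesgue (\<lambda>x. conv (mollifier (1 / real (Suc n))) v x - v x)
     \<le> 1 / real (Suc n) * (\<Sum>j\<in>UNIV. 2 * nrm lebesgue (\<lambda>z. g z $ j))"
proof -
  interpret smoothing_kernel "mollifier (1 / real (Suc n)) :: complex ^ 'n \<Rightarrow> real" "1 / real (Suc n)"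
    by (rule smoothing_kernel_mollifier) simp
  let ?G = "\<Sum>j\<in>UNIV. 2 * nrm lebesgue (\<lambda>z. g z $ j)"
  have G: "0 \<le> ?G" by (intro sum_nonneg) simp
  have "(\<integral>\<^sup>+x. ennreal ((norm (v (x - y) - 1 *\<^sub>R v x))\<^sup>2) \<partial>lebesgue) \<le> ennreal ((1 / real (Suc n) * ?G)\<^sup>2)"
    if y: "norm y \<le> 1 / real (Suc n)" for y
  proof -
    have s: "(\<lambda>x. v (x - y) - v x) \<in> sqint lebesgue" by (intro sqint_diff sqint_translate v)
    have "nrm lebesgue (\<lambda>x. v (x - y) - v x) \<le> norm y * ?G" by (rule translation_estimate)
    also have "\<dots> \<le> 1 / real (Suc n) * ?G" by (rule mult_right_mono[OF y G])
    finally have "(nrm lebesgue (\<lambda>x. v (x - y) - v x))\<^sup>2 \<le> (1 / real (Suc n) * ?G)\<^sup>2" by (rule power_mono) simp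
    then show ?thesis using nn_integral_nrm[OF s] by (simp add: ennreal_leI)
  qed
  from conv_deviation(2)[OF v(1) sqint_supp_integrable[OF v] _ this] show ?thesis using G by simp
qed

end

lemma nrm_le_real:
  fixes f :: "'a \<Rightarrow> 'b::euclidean_space" and w :: "'a \<Rightarrow> real"
  assumes w: "w \<in> sqint M" and f: "f \<in> sqint M" and le: "\<And>x. norm (f x) \<le> w x"
  shows "nrm M f \<le> nrm M w"
proof -
  have "(norm (f x))\<^sup>2 \<le> (norm (w x))\<^sup>2" for x
    using le[of x] norm_ge_zero[of "f x"] by (intro power_mono) auto
  then show ?thesis unfolding nrm_def
    by (intro real_sqrt_le_mono integral_mono sqint_integrable w f)
qed

text \<open>Cauchy-Schwarz on the ball bounds the integral of \<open>norm (u z)\<close> by the norm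
  of \<open>u\<close>; bounds for the kernel and its differences do the rest. \<open>B\<close>
  depends only on the kernel and on \<open>T\<close>, so bounded families are
  equicontinuous.\<close>

lemma conv_equi_Lipschitz:
  fixes u :: "complex ^ 'n::finite \<Rightarrow> complex"
  assumes k: "smoothing_kernel k e"
  obtains B where "B > 0"
    "\<And>u :: complex ^ 'n \<Rightarrow> complex. u \<in> sqint lebesgue \<Longrightarrow> (\<And>z. T < norm z \<Longrightarrow> u z = 0) \<Longrightarrow>
      (\<forall>x. cmod (conv k u x) \<le> B * nrm lebesgue u) \<and> (\<forall>x y. cmod (conv k u x - conv k u y) \<le> B * nrm lebesgue u * norm (x - y))"
proof -
  interpret smoothing_kernel k e by (rule k)
  obtain B1 where B1: "B1 > 0" "\<And>x y. norm (k x - k y) \<le> B1 * norm (x - y)"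
    using C1_supp_lipschitz[OF smooth outside] by metis
  obtain B0 where B0: "B0 > 0" "\<And>x. norm (k x) \<le> B0" using continuous_supp_bounded[OF cont outside] by metis
  define V where "V = nrm lebesgue (indicat_real (cball (0::complex ^ 'n) T))"
  have V: "V \<ge> 0" by (simp add: V_def)
  show thesis
  proof (rule that[of "(B0 + B1) * V + 1"])
    show "(B0 + B1) * V + 1 > 0" using B0(1) B1(1) V by (intro add_nonneg_pos mult_nonneg_nonneg) auto
    fix u :: "complex ^ 'n \<Rightarrow> complex" assume u: "u \<in> sqint lebesgue" "\<And>z. T < norm z \<Longrightarrow> u z = 0"
    have ui: "integrable lebesgue u" by (rule sqint_supp_integrable[OF u])
    have "(LINT z|lebesgue. norm (u z)) = (LINT z|lebesgue. norm (indicat_real (cball 0 T) z) * norm (u z))"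
      by (intro Bochner_Integration.integral_cong refl) (use u(2) in \<open>force simp: indicator_def\<close>)
    also have "\<dots> \<le> V * nrm lebesgue u"
      unfolding V_def by (rule sqint_mult_Cauchy_Schwarz[OF indicator_cball_sqint u(1)])
    finally have L1: "(LINT z|lebesgue. norm (u z)) \<le> V * nrm lebesgue u" .
    have main: "norm (LINT y|lebesgue. m y *\<^sub>R u y) \<le> D * (V * nrm lebesgue u)"
      if m: "integrable lebesgue (\<lambda>y. m y *\<^sub>R u y)" "\<And>y. \<bar>m y\<bar> \<le> D" "D \<ge> 0" for m D
    proof -
      have "norm (LINT y|lebesgue. m y *\<^sub>R u y) \<le> (LINT y|lebesgue. norm (m y *\<^sub>R u y))" by (rule integral_norm_bound)
      also have "\<dots> \<le> (LINT y|lebesgue. D * norm (u y))"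
        by (rule integral_mono[OF integrable_norm[OF m(1)]]) (use ui m in \<open>auto intro: mult_right_mono\<close>)
      also have "\<dots> \<le> D * (V * nrm lebesgue u)" using L1 m(3) by (simp add: mult_left_mono)
      finally show ?thesis .
    qed
    have i: "integrable lebesgue (\<lambda>y. k (x - y) *\<^sub>R u y)" for x by (rule conv_integrable[OF cont B0(2) ui])
    have nu: "0 \<le> V * nrm lebesgue u" using V by simp
    have "cmod (conv k u x) \<le> ((B0 + B1) * V + 1) * nrm lebesgue u" for x
    proof -
      have "cmod (conv k u x) \<le> B0 * (V * nrm lebesgue u)"
        unfolding conv_def by (rule main[OF i]) (use B0 in auto)
      also have "\<dots> \<le> ((B0 + B1) * V + 1) * nrm lebesgue u"
        using B1(1) nu by (simp add: algebra_simps)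
      finally show ?thesis .
    qed
    moreover have "cmod (conv k u x - conv k u y) \<le> ((B0 + B1) * V + 1) * nrm lebesgue u * norm (x - y)" for x y
    proof -
      have "conv k u x - conv k u y = (LINT z|lebesgue. (k (x - z) - k (y - z)) *\<^sub>R u z)"
        unfolding conv_def using i by (simp add: scaleR_left_diff_distrib)
      also have "cmod \<dots> \<le> (B1 * norm (x - y)) * (V * nrm lebesgue u)"
      proof (rule main)
        show "integrable lebesgue (\<lambda>z. (k (x - z) - k (y - z)) *\<^sub>R u z)"
          using Bochner_Integration.integrable_diff[OF i i] by (simp add: scaleR_left_diff_distrib)
        show "\<bar>k (x - z) - k (y - z)\<bar> \<le> B1 * norm (x - y)" for z using B1(2)[of "x - z" "y - z"] by simp
      qed (use B1 in simp)
      also have "\<dots> = (B1 * (V * nrm lebesgue u)) * norm (x - y)" by (simp add: mult_ac)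
      also have "\<dots> \<le> ((B0 + B1) * V + 1) * nrm lebesgue u * norm (x - y)"
        using B0(1) nu by (intro mult_right_mono) (auto simp: algebra_simps)
      finally show ?thesis .
    qed
    ultimately show "(\<forall>x. cmod (conv k u x) \<le> ((B0 + B1) * V + 1) * nrm lebesgue u) \<and>
      (\<forall>x y. cmod (conv k u x - conv k u y) \<le> ((B0 + B1) * V + 1) * nrm lebesgue u * norm (x - y))" by blast
  qed
qed

text \<open>Rellich's lemma for \<open>\<partial>\<close>-bar: mollification is uniformly close to the identity, and the mollified
  functions are equicontinuous.\<close>

lemma dbar_rellich:
  fixes v :: "nat \<Rightarrow> complex ^ 'n::finite \<Rightarrow> complex" and g :: "nat \<Rightarrow> complex ^ 'n \<Rightarrow> complex ^ 'n"
  assumes v: "\<And>k. v k \<in> sqint lebesgue" "\<And>k z. T < norm z \<Longrightarrow> v k z = 0" "\<And>k. nrm lebesgue (v k) \<le> C"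
    and g: "\<And>k. g k \<in> sqint lebesgue" "\<And>k z. T < norm z \<Longrightarrow> g k z = 0" "\<And>k j. nrm lebesgue (\<lambda>z. g k z $ j) \<le> C"
    and dbar: "\<And>k. dbar_eq (v k) (g k)" and d: "d > 0"
  shows "\<exists>r. strict_mono (r :: nat \<Rightarrow> nat) \<and> (\<exists>N. \<forall>k\<ge>N. \<forall>l\<ge>N. nrm lebesgue (\<lambda>z. v (r k) z - v (r l) z) \<le> d)"
proof -
  have C0: "C \<ge> 0" using nrm_nonneg order_trans v(3) by blast
  \<comment> \<open>\<open>G\<close> bounds the sum in \<open>mollification_rate\<close> for every
    \<open>k\<close>; the radius of the kernel is then chosen to make the error at most
    \<open>d / 3\<close>, uniformly in \<open>k\<close>.\<close>
  define G where "G = real CARD('n) * (2 * C)"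
  have G0: "G \<ge> 0" using C0 by (simp add: G_def)
  have "d / (3 * (G + 1)) > 0" using d G0 by simp
  from reals_Archimedean[OF this] obtain n where n: "1 / real (Suc n) < d / (3 * (G + 1))"
    unfolding inverse_eq_divide by blast
  define K where "K = (mollifier (1 / real (Suc n)) :: complex ^ 'n \<Rightarrow> real)"
  have kk: "smoothing_kernel K (1 / real (Suc n))" unfolding K_def by (rule smoothing_kernel_mollifier) simp
  have rate: "nrm lebesgue (\<lambda>x. conv K (v k) x - v k x) \<le> d / 3" for k
  proof -
    have "(\<Sum>j\<in>UNIV. 2 * nrm lebesgue (\<lambda>z. g k z $ j)) \<le> (\<Sum>j\<in>(UNIV::'n set). 2 * C)"
      by (intro sum_mono) (use g(3) in simp)
    also have "(\<Sum>j\<in>(UNIV::'n set). 2 * C) = G" by (simp add: G_def)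
    finally have sum: "(\<Sum>j\<in>UNIV. 2 * nrm lebesgue (\<lambda>z. g k z $ j)) \<le> G" .
    have "nrm lebesgue (\<lambda>x. conv K (v k) x - v k x) \<le> 1 / real (Suc n) * (\<Sum>j\<in>UNIV. 2 * nrm lebesgue (\<lambda>z. g k z $ j))"
      unfolding K_def by (rule mollification_rate[OF v(1,2) g(1,2) dbar])
    also have "\<dots> \<le> 1 / real (Suc n) * G" by (rule mult_left_mono[OF sum]) simp
    also have "\<dots> \<le> d / (3 * (G + 1)) * G" using n G0 by (intro mult_right_mono) auto
    also have "\<dots> \<le> d / 3" using d G0 by (simp add: field_simps)
    finally show ?thesis .
  qed
  obtain B where B: "B > 0" "\<And>u :: complex ^ 'n \<Rightarrow> complex. u \<in> sqint lebesgue \<Longrightarrow> (\<And>z. T < norm z \<Longrightarrow> u z = 0) \<Longrightarrow>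
      (\<forall>x. cmod (conv K u x) \<le> B * nrm lebesgue u) \<and> (\<forall>x y. cmod (conv K u x - conv K u y) \<le> B * nrm lebesgue u * norm (x - y))"
    using conv_equi_Lipschitz[OF kk] by metis
  have bd: "cmod (conv K (v k) x) \<le> B * C" for k x
    using B(2)[OF v(1,2)] B(1) v(3)[of k] by (meson mult_left_mono order_trans less_imp_le)
  have lip: "cmod (conv K (v k) x - conv K (v k) y) \<le> B * C * norm (x - y)" for k x y
  proof -
    have "cmod (conv K (v k) x - conv K (v k) y) \<le> B * nrm lebesgue (v k) * norm (x - y)" using B(2)[OF v(1,2)] by blast
    also have "\<dots> \<le> B * C * norm (x - y)" using B(1) v(3)[of k] by (intro mult_right_mono mult_left_mono) auto
    finally show ?thesis .
  qed
  \<comment> \<open>The radius of the kernel is at most 1, so all mollified functions vanish outside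
    this ball.\<close>
  let ?S = "cball (0::complex ^ 'n) (T + 1)"
  obtain F r where r: "strict_mono (r :: nat \<Rightarrow> nat)"
    "\<And>e. 0 < e \<Longrightarrow> \<exists>N. \<forall>k x. k \<ge> N \<and> x \<in> ?S \<longrightarrow> norm (conv K (v (r k)) x - F x) < e"
  proof (rule Arzela_Ascoli[of ?S "\<lambda>k. conv K (v k)" "B * C"])
    fix x :: "complex ^ 'n" and e :: real assume e: "0 < e"
    have BC: "B * C + 1 > 0" using B(1) C0 by (simp add: add_nonneg_pos)
    show "\<exists>d. 0 < d \<and> (\<forall>k y. y \<in> ?S \<and> norm (x - y) < d \<longrightarrow> norm (conv K (v k) x - conv K (v k) y) < e)"
    proof (intro exI[of _ "e / (B * C + 1)"] conjI allI impI)
      show "0 < e / (B * C + 1)" using e BC by simp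
      fix k y assume y: "y \<in> ?S \<and> norm (x - y) < e / (B * C + 1)"
      have "norm (conv K (v k) x - conv K (v k) y) \<le> (B * C + 1) * norm (x - y)"
        by (rule order_trans[OF lip mult_right_mono]) auto
      also have "\<dots> < e" using y BC by (simp add: pos_less_divide_eq mult.commute)
      finally show "norm (conv K (v k) x - conv K (v k) y) < e" .
    qed
  qed (use bd in auto)
  define V where "V = nrm lebesgue (indicat_real ?S)"
  have V: "V \<ge> 0" by (simp add: V_def)
  \<comment> \<open>A uniform deviation of \<open>2 * e\<close> on \<open>?S\<close> costs at most
    \<open>2 * e * V\<close> in norm, which is no more than \<open>d / 3\<close>.\<close>
  define e where "e = d / (6 * (V + 1))"
  have e: "e > 0" using d V by (simp add: e_def)
  obtain N where N: "\<And>k x. k \<ge> N \<Longrightarrow> x \<in> ?S \<Longrightarrow> norm (conv K (v (r k)) x - F x) < e" using r(2)[OF e] by blast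
  have cs: "conv K (v k) \<in> sqint lebesgue" for k
    by (rule smoothing_kernel.conv_sqint(1)[OF kk v(1) sqint_supp_integrable[OF v(1,2)]])
  have "nrm lebesgue (\<lambda>z. v (r k) z - v (r l) z) \<le> d" if kl: "k \<ge> N" "l \<ge> N" for k l
  proof -
    have mid: "nrm lebesgue (\<lambda>z. conv K (v (r k)) z - conv K (v (r l)) z) \<le> d / 3"
    proof -
      have "nrm lebesgue (\<lambda>z. conv K (v (r k)) z - conv K (v (r l)) z) \<le> nrm lebesgue (\<lambda>x. (2 * e) *\<^sub>R indicat_real ?S x)"
      proof (rule nrm_le_real)
        show "(\<lambda>x. (2 * e) *\<^sub>R indicat_real ?S x) \<in> sqint lebesgue" by (rule sqint_scaleR[OF indicator_cball_sqint])
        show "(\<lambda>z. conv K (v (r k)) z - conv K (v (r l)) z) \<in> sqint lebesgue" by (rule sqint_diff[OF cs cs])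
        fix x
        show "norm (conv K (v (r k)) x - conv K (v (r l)) x) \<le> (2 * e) *\<^sub>R indicat_real ?S x"
        proof (cases "x \<in> ?S")
          case True
          have "norm (conv K (v (r k)) x - conv K (v (r l)) x) \<le> norm (conv K (v (r k)) x - F x) + norm (conv K (v (r l)) x - F x)"
            by (metis norm_triangle_ineq4 diff_diff_eq2 diff_add_cancel)
          then show ?thesis using N[OF kl(1) True] N[OF kl(2) True] True by simp
        next
          case False
          have h: "1 / real (Suc n) \<le> 1" by simp
          have "conv K (v k) x = 0" for k
            using conv_outside[of "1 / real (Suc n)" K T "v k" x] smoothing_kernel.outside[OF kk] v(2) False h by fastforce
          then show ?thesis using e by simp
        qed
      qed
      also have "\<dots> = 2 * e * V" unfolding nrm_scaleR V_def using e by simp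
      also have "\<dots> \<le> d / 3"
      proof -
        have "e * (6 * (V + 1)) = d" using V by (simp add: e_def add_nonneg_eq_0_iff)
        then show ?thesis using e by (simp add: algebra_simps)
      qed
      finally show ?thesis .
    qed
    have "nrm lebesgue (\<lambda>z. v (r k) z - v (r l) z)
      \<le> nrm lebesgue (\<lambda>z. v (r k) z - conv K (v (r k)) z) + nrm lebesgue (\<lambda>z. conv K (v (r k)) z - v (r l) z)"
      by (rule nrm_triangle_diff[OF v(1) cs v(1)])
    also have "\<dots> \<le> nrm lebesgue (\<lambda>z. v (r k) z - conv K (v (r k)) z)
      + (nrm lebesgue (\<lambda>z. conv K (v (r k)) z - conv K (v (r l)) z) + nrm lebesgue (\<lambda>z. conv K (v (r l)) z - v (r l) z))"
      using nrm_triangle_diff[OF cs cs v(1), of "r k" "r l" "r l"] by simp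
    also have "\<dots> \<le> d" using rate[of "r k"] rate[of "r l"] mid by (simp add: nrm_minus_commute[of _ "v (r k)"])
    finally show ?thesis .
  qed
  with r(1) show ?thesis by blast
qed

section \<open>Canonical solutions\<close>

lemma norm_vec_smult: "norm ((c::complex) *s (v :: complex ^ 'n::finite)) = cmod c * norm v"
proof -
  have "(norm (c *s v))\<^sup>2 = (cmod c * norm v)\<^sup>2"
    by (simp add: norm_vec_power2 power_mult_distrib norm_mult sum_distrib_left)
  then show ?thesis by (simp add: power2_eq_iff_nonneg)
qed

lemmas bounded_bilinear_mult_cnj =
  bounded_bilinear.comp[OF bounded_bilinear_mult bounded_linear_ident bounded_linear_cnj]

lemma sqint_nrm_bound:
  fixes f :: "'a \<Rightarrow> 'b::euclidean_space" and w :: "'a \<Rightarrow> real"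
  assumes "f \<in> borel_measurable M" "w \<in> sqint M" "\<And>x. norm (f x) \<le> w x"
  shows "f \<in> sqint M" "nrm M f \<le> nrm M w"
proof -
  show s: "f \<in> sqint M"
    by (rule sqintI[OF assms(1) sqint_measurable[OF assms(2)]])
      (use sqint_integrable[OF assms(2)] assms(3) in \<open>auto intro: order_trans[OF _ abs_ge_self]\<close>)
  show "nrm M f \<le> nrm M w" by (rule nrm_le_real[OF assms(2) s assms(3)])
qed

lemma nrm_norm: "nrm M (\<lambda>x. norm (f x)) = nrm M f"
  by (simp add: nrm_def)

lemma nrm_component_le:
  assumes "f \<in> sqint M"
  shows "nrm M (\<lambda>x. (f x :: complex ^ 'n::finite) $ j) \<le> nrm M f"
proof -
  have "(\<lambda>x. f x $ j) \<in> sqint M" using assms by (simp add: sqint_vec_iff)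
  then show ?thesis
    using nrm_le_real[OF sqint_norm[OF assms], of "\<lambda>x. f x $ j"] by (simp add: Finite_Cartesian_Product.norm_nth_le nrm_norm)
qed

text \<open>The densities differ by a factor of at most \<open>exp (2 * m)\<close>, whose square
  root appears for norms. Since neither the dbar equation nor closedness involves the weight, a
  solution found in one space can be used in the other.\<close>

lemma weight_compare:
  assumes "weight \<phi>" "weight \<phi>'" "\<And>z. \<bar>\<phi>' z - \<phi> z\<bar> \<le> m" and f: "(f :: complex ^ 'n::finite \<Rightarrow> 'b::euclidean_space) \<in> sqint (wm \<phi>)"
  shows "f \<in> sqint (wm \<phi>')" "nrm (wm \<phi>') f \<le> exp m * nrm (wm \<phi>) f"
proof -
  interpret a: weight \<phi> by fact
  interpret b: weight \<phi>' by fact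
  have fm: "f \<in> borel_measurable lebesgue" using f by (simp add: a.sqint_W_iff)
  have i: "integrable lebesgue (\<lambda>z. (exp m)\<^sup>2 * ((norm (f z))\<^sup>2 * exp (- 2 * \<phi> z)))"
    using f unfolding a.sqint_W_iff by (intro integrable_mult_right) blast
  have le: "(norm (f z))\<^sup>2 * exp (- 2 * \<phi>' z) \<le> (exp m)\<^sup>2 * ((norm (f z))\<^sup>2 * exp (- 2 * \<phi> z))" for z
  proof -
    have "exp (- 2 * \<phi>' z) \<le> exp (2 * m + - 2 * \<phi> z)" using assms(3)[of z] by (simp add: abs_le_iff)
    also have "\<dots> = (exp m)\<^sup>2 * exp (- 2 * \<phi> z)" by (simp only: exp_add exp_double)
    finally have "(norm (f z))\<^sup>2 * exp (- 2 * \<phi>' z) \<le> (norm (f z))\<^sup>2 * ((exp m)\<^sup>2 * exp (- 2 * \<phi> z))"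
      by (rule mult_left_mono) simp
    then show ?thesis by (simp only: mult.left_commute)
  qed
  have m: "(\<lambda>z. (norm (f z))\<^sup>2 * exp (- 2 * \<phi>' z)) \<in> borel_measurable lebesgue"
    using fm b.exp_measurable by measurable
  have i': "integrable lebesgue (\<lambda>z. (norm (f z))\<^sup>2 * exp (- 2 * \<phi>' z))"
    by (rule Bochner_Integration.integrable_bound[OF i m]) (use le in \<open>auto simp del: mult_minus_left\<close>)
  then show "f \<in> sqint (wm \<phi>')" using fm unfolding b.sqint_W_iff by blast
  have "(nrm (wm \<phi>') f)\<^sup>2 \<le> (exp m * nrm (wm \<phi>) f)\<^sup>2"
    unfolding power_mult_distrib a.nrm_W_power2[OF fm] b.nrm_W_power2[OF fm]
    using integral_mono[OF i' i le] by simp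
  then show "nrm (wm \<phi>') f \<le> exp m * nrm (wm \<phi>) f" by (rule power2_le_imp_le) simp
qed

section \<open>Weak equations under linear combinations and cut-offs\<close>

context weight
begin

lemma closed_forms_iff: "f \<in> closed_forms \<phi> \<longleftrightarrow> f \<in> sqint W \<and> dbar_closed f"
  by (simp add: closed_forms_def L2_forms_eq)

lemma ker_dbar_iff_sqint: "h \<in> ker_dbar \<phi> \<longleftrightarrow> h \<in> sqint W \<and> dbar_eq h (\<lambda>z. 0)"
  by (simp add: ker_dbar_def L2_eq)

lemma L2_forms_norm_eq: "f \<in> sqint W \<Longrightarrow> L2_forms_norm \<phi> f = nrm W f"
proof -
  assume f: "f \<in> sqint W"
  have "(\<lambda>z. f z $ j) \<in> borel_measurable lebesgue" for j
    using f unfolding sqint_vec_iff sqint_W_iff by blast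
  then show ?thesis
    by (simp add: L2_forms_norm_def L2_norm_eq nrm_vec_power2[OF f, symmetric])
qed

lemma sqint_comb:
  fixes u v :: "complex ^ 'n \<Rightarrow> complex"
  assumes "u \<in> sqint W" "v \<in> sqint W" shows "(\<lambda>z. a * u z + b * v z) \<in> sqint W"
  by (intro sqint_add sqint_bounded_mult(1)[of "\<lambda>z. a" W u "cmod a"] sqint_bounded_mult(1)[of "\<lambda>z. b" W v "cmod b"] assms) simp_all

lemma integral_comb:
  fixes u v :: "complex ^ 'n \<Rightarrow> complex"
  assumes "u \<in> sqint W" "v \<in> sqint W" "C_kc 0 \<zeta>"
  shows "(LINT z|lebesgue. (a * u z + b * v z) * \<zeta> z) = a * (LINT z|lebesgue. u z * \<zeta> z) + b * (LINT z|lebesgue. v z * \<zeta> z)"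
proof -
  have "(LINT z|lebesgue. (a * u z + b * v z) * \<zeta> z) = (LINT z|lebesgue. a * (u z * \<zeta> z) + b * (v z * \<zeta> z))"
    by (simp add: algebra_simps)
  also have "\<dots> = (LINT z|lebesgue. a * (u z * \<zeta> z)) + (LINT z|lebesgue. b * (v z * \<zeta> z))"
    by (intro Bochner_Integration.integral_add integrable_mult_right pairing_integrable assms)
  finally show ?thesis by simp
qed

lemma sqint_vec_comb:
  fixes f g :: "complex ^ 'n \<Rightarrow> complex ^ 'n"
  shows "f \<in> sqint W \<Longrightarrow> g \<in> sqint W \<Longrightarrow> (\<lambda>z. a *s f z + b *s g z) \<in> sqint W"
  using sqint_comb by (simp add: sqint_vec_iff)

lemma dbar_eq_comb:
  assumes "u \<in> sqint W" "v \<in> sqint W" "f \<in> sqint W" "g \<in> sqint W" "dbar_eq u f" "dbar_eq v g"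
  shows "dbar_eq (\<lambda>z. a * u z + b * v z) (\<lambda>z. a *s f z + b *s g z)"
  unfolding dbar_eq_def d_zbar_cd
proof (intro ballI allI)
  fix \<psi> :: "complex ^ 'n \<Rightarrow> complex" and j :: 'n assume \<psi>: "\<psi> \<in> test_functions"
  have fg: "(\<lambda>z. f z $ j) \<in> sqint W" "(\<lambda>z. g z $ j) \<in> sqint W" using assms by (auto simp: sqint_vec_iff)
  have "(LINT z|lebesgue. f z $ j * \<psi> z) = - (LINT z|lebesgue. u z * cd \<i> j \<psi> z)"
    "(LINT z|lebesgue. g z $ j * \<psi> z) = - (LINT z|lebesgue. v z * cd \<i> j \<psi> z)"
    using assms(5,6) \<psi> unfolding dbar_eq_def d_zbar_cd by auto
  then show "- (LINT z|lebesgue. (a * u z + b * v z) * cd \<i> j \<psi> z) = (LINT z|lebesgue. (a *s f z + b *s g z) $ j * \<psi> z)"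
    using integral_comb[OF fg test_C_kc[OF \<psi>], of a b]
    by (simp add: integral_comb[OF assms(1,2) test_C_kc[OF cd_test[OF \<psi>]]])
qed

lemma dbar_closed_comb:
  assumes "f \<in> sqint W" "g \<in> sqint W" "dbar_closed f" "dbar_closed g"
  shows "dbar_closed (\<lambda>z. a *s f z + b *s g z)"
  unfolding dbar_closed_def d_zbar_cd
proof (intro ballI allI)
  fix \<psi> :: "complex ^ 'n \<Rightarrow> complex" and j k :: 'n assume \<psi>: "\<psi> \<in> test_functions"
  have fg: "(\<lambda>z. f z $ j) \<in> sqint W" "(\<lambda>z. g z $ j) \<in> sqint W" for j using assms by (auto simp: sqint_vec_iff)
  have e: "(LINT z|lebesgue. (a *s f z + b *s g z) $ m * cd \<i> l \<psi> z)
    = a * (LINT z|lebesgue. f z $ m * cd \<i> l \<psi> z) + b * (LINT z|lebesgue. g z $ m * cd \<i> l \<psi> z)" for m l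
    using integral_comb[OF fg test_C_kc[OF cd_test[OF \<psi>]]] by simp
  have "(LINT z|lebesgue. f z $ k * cd \<i> j \<psi> z) = (LINT z|lebesgue. f z $ j * cd \<i> k \<psi> z)"
    "(LINT z|lebesgue. g z $ k * cd \<i> j \<psi> z) = (LINT z|lebesgue. g z $ j * cd \<i> k \<psi> z)"
    using assms(3,4) \<psi> unfolding dbar_closed_def d_zbar_cd by (auto simp: add_eq_0_iff)
  then show "- (LINT z|lebesgue. (a *s f z + b *s g z) $ k * cd \<i> j \<psi> z) + (LINT z|lebesgue. (a *s f z + b *s g z) $ j * cd \<i> k \<psi> z) = 0"
    unfolding e by simp
qed

text \<open>The weak form of dbar composed with dbar being 0: both derivatives act on the test
  function, where they commute.\<close>

lemma dbar_eq_closed: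
  assumes "dbar_eq v h" shows "dbar_closed (h :: complex ^ 'n \<Rightarrow> complex ^ 'n)"
  unfolding dbar_closed_def d_zbar_cd
proof (intro ballI allI)
  fix \<psi> :: "complex ^ 'n \<Rightarrow> complex" and j k :: 'n assume \<psi>: "\<psi> \<in> test_functions"
  have e: "(LINT z|lebesgue. h z $ m * cd \<i> l \<psi> z) = - (LINT z|lebesgue. v z * cd \<i> m (cd \<i> l \<psi>) z)" for m l
    using assms cd_test[OF \<psi>] unfolding dbar_eq_def d_zbar_cd by auto
  have "cd \<i> k (cd \<i> j \<psi>) z = cd \<i> j (cd \<i> k \<psi>) z" for z :: "complex ^ 'n" by (rule cd_commute[OF C_kc_C_k[OF test_C_kc[OF \<psi>]]])
  then show "- (LINT z|lebesgue. h z $ k * cd \<i> j \<psi> z) + (LINT z|lebesgue. h z $ j * cd \<i> k \<psi> z) = 0"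
    unfolding e by simp
qed

text \<open>The equation for \<open>u\<close> is tested with \<open>c z * \<psi> z\<close>; the
  Leibniz rule on this test function yields the term with the derivative of
  \<open>c\<close>.\<close>

lemma dbar_eq_cutoff:
  assumes c: "\<And>m. C_kc m c" and u: "u \<in> sqint W" and f: "f \<in> sqint W" and uf: "dbar_eq u f"
  shows "dbar_eq (\<lambda>z. c z * u z) (\<lambda>z. \<chi> j. c z * f z $ j + cd \<i> j c z * u z)"
  unfolding dbar_eq_def d_zbar_cd vec_lambda_beta
proof (intro ballI allI)
  fix \<psi> :: "complex ^ 'n \<Rightarrow> complex" and j :: 'n assume \<psi>: "\<psi> \<in> test_functions"
  have fj: "(\<lambda>z. f z $ j) \<in> sqint W" using f by (simp add: sqint_vec_iff)
  have c\<psi>: "(\<lambda>z. c z * \<psi> z) \<in> test_functions"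
    unfolding test_functions_iff by (intro allI C_kc_mult_left[OF C_kc_C_k[OF c]] test_C_kc[OF \<psi>])
  have dc\<psi>: "C_kc 0 (\<lambda>z. cd \<i> j c z * \<psi> z)" by (intro C_kc_mult_left[OF C_kc_C_k[OF C_kc_cd[OF c]]] test_C_kc[OF \<psi>])
  have eq: "c z * u z * cd \<i> j \<psi> z = u z * cd \<i> j (\<lambda>z. c z * \<psi> z) z - u z * (cd \<i> j c z * \<psi> z)" for z
    using cd_mult[OF C_k_differentiable[OF C_kc_C_k[OF c]] C_k_differentiable[OF C_kc_C_k[OF test_C_kc[OF \<psi>]]], of \<i> j z]
    by (simp add: algebra_simps)
  have i: "integrable lebesgue (\<lambda>z. u z * cd \<i> j (\<lambda>z. c z * \<psi> z) z)" "integrable lebesgue (\<lambda>z. u z * (cd \<i> j c z * \<psi> z))"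
    "integrable lebesgue (\<lambda>z. f z $ j * (c z * \<psi> z))"
    by (rule pairing_integrable[OF u test_C_kc[OF cd_test[OF c\<psi>]]] pairing_integrable[OF u dc\<psi>] pairing_integrable[OF fj test_C_kc[OF c\<psi>]])+
  have "- (LINT z|lebesgue. c z * u z * cd \<i> j \<psi> z)
    = - (LINT z|lebesgue. u z * cd \<i> j (\<lambda>z. c z * \<psi> z) z) + (LINT z|lebesgue. u z * (cd \<i> j c z * \<psi> z))"
    unfolding eq Bochner_Integration.integral_diff[OF i(1,2)] by simp
  also have "- (LINT z|lebesgue. u z * cd \<i> j (\<lambda>z. c z * \<psi> z) z) = (LINT z|lebesgue. f z $ j * (c z * \<psi> z))"
    using uf c\<psi> unfolding dbar_eq_def d_zbar_cd by blast
  also have "(LINT z|lebesgue. f z $ j * (c z * \<psi> z)) + (LINT z|lebesgue. u z * (cd \<i> j c z * \<psi> z))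
    = (LINT z|lebesgue. f z $ j * (c z * \<psi> z) + u z * (cd \<i> j c z * \<psi> z))"
    by (rule Bochner_Integration.integral_add[OF i(3,2), symmetric])
  also have "\<dots> = (LINT z|lebesgue. (c z * f z $ j + cd \<i> j c z * u z) * \<psi> z)"
    by (intro Bochner_Integration.integral_cong refl) (simp add: algebra_simps)
  finally show "- (LINT z|lebesgue. c z * u z * cd \<i> j \<psi> z) = (LINT z|lebesgue. (c z * f z $ j + cd \<i> j c z * u z) * \<psi> z)" .
qed

lemma cutoff_form_sqint:
  assumes c: "\<And>m. C_kc m c" and u: "u \<in> sqint W" and f: "f \<in> sqint W"
  shows "(\<lambda>z. \<chi> j. c z * f z $ j + cd \<i> j c z * u z) \<in> sqint W"
  unfolding sqint_vec_iff vec_lambda_beta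
  by (intro allI sqint_add sqint_W_mult_C_kc(3)[OF _ c[of 0]] sqint_W_mult_C_kc(3)[OF u C_kc_cd[OF c]])
    (use f in \<open>simp add: sqint_vec_iff\<close>)

lemma W_density:
  fixes g :: "complex ^ 'n \<Rightarrow> complex"
  assumes "integrable W g"
  shows "integrable lebesgue (\<lambda>z. g z * complex_of_real (exp (- 2 * \<phi> z)))"
    "(LINT z|W. g z) = (LINT z|lebesgue. g z * complex_of_real (exp (- 2 * \<phi> z)))"
proof -
  have m: "g \<in> borel_measurable lebesgue" using borel_measurable_integrable[OF assms] by simp
  have ae: "AE z in lebesgue. 0 \<le> exp (- 2 * \<phi> z)" by simp
  have e: "(\<lambda>z. g z * complex_of_real (exp (- 2 * \<phi> z))) = (\<lambda>z. exp (- 2 * \<phi> z) *\<^sub>R g z)"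
    by (intro ext) (simp only: scaleR_conv_of_real mult.commute)
  show "integrable lebesgue (\<lambda>z. g z * complex_of_real (exp (- 2 * \<phi> z)))"
    using assms unfolding e wm_def integrable_density[OF m exp_measurable ae] .
  show "(LINT z|W. g z) = (LINT z|lebesgue. g z * complex_of_real (exp (- 2 * \<phi> z)))"
    unfolding e wm_def integral_density[OF m exp_measurable ae] ..
qed

lemma L2_inner_eq:
  assumes "u \<in> sqint W" "h \<in> sqint W"
  shows "Re (L2_inner \<phi> u h) = ip W u h" "Im (L2_inner \<phi> u h) = ip W u (\<lambda>z. \<i> * h z)"
proof -
  have i: "integrable W (\<lambda>z. u z * cnj (h z))" by (rule sqint_bilinear_integrable[OF bounded_bilinear_mult_cnj assms])
  have "L2_inner \<phi> u h = (LINT z|W. u z * cnj (h z))"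
    unfolding L2_inner_def by (rule W_density(2)[OF i, symmetric])
  then show "Re (L2_inner \<phi> u h) = ip W u h" "Im (L2_inner \<phi> u h) = ip W u (\<lambda>z. \<i> * h z)"
    using integral_Re[OF i] integral_Im[OF i] by (simp_all add: ip_def inner_complex_def algebra_simps)
qed

lemma dbar_eq_diff:
  assumes "u \<in> sqint W" "v \<in> sqint W" "f \<in> sqint W" "g \<in> sqint W" "dbar_eq u f" "dbar_eq v g"
  shows "dbar_eq (\<lambda>z. u z - v z) (\<lambda>z. f z - g z)"
  using dbar_eq_comb[OF assms, of 1 "-1"] by simp

text \<open>The kernel of dbar is stable under multiplication by \<open>\<i>\<close>, so
  orthogonality for the real scalar product already gives it for the complex one.\<close>

lemma canonical_iff:
  "canonical_solution \<phi> f u \<longleftrightarrow> u \<in> sqint W \<and> dbar_eq u f \<and> (\<forall>h\<in>ker_dbar \<phi>. ip W u h = 0)"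
proof -
  have "(\<forall>h\<in>ker_dbar \<phi>. L2_inner \<phi> u h = 0) \<longleftrightarrow> (\<forall>h\<in>ker_dbar \<phi>. ip W u h = 0)" if u: "u \<in> sqint W"
  proof (intro iffI ballI)
    fix h assume *: "\<forall>h\<in>ker_dbar \<phi>. ip W u h = 0" and h: "h \<in> ker_dbar \<phi>"
    have hs: "h \<in> sqint W" "dbar_eq h (\<lambda>z. 0)" using h by (auto simp: ker_dbar_iff_sqint)
    have "(\<lambda>z. \<i> * h z) \<in> ker_dbar \<phi>"
      using sqint_comb[OF hs(1) sqint_0, of \<i> 0] dbar_eq_comb[OF hs(1) sqint_0 sqint_0 sqint_0 hs(2), of "\<i>" 0]
      by (simp add: ker_dbar_iff_sqint dbar_eq_def)
    then show "L2_inner \<phi> u h = 0" using * h L2_inner_eq[OF u hs(1)] by (simp add: complex_eq_iff)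
  next
    fix h assume *: "\<forall>h\<in>ker_dbar \<phi>. L2_inner \<phi> u h = 0" and h: "h \<in> ker_dbar \<phi>"
    then show "ip W u h = 0" using L2_inner_eq(1)[OF u, of h] by (simp add: ker_dbar_iff_sqint)
  qed
  then show ?thesis by (auto simp: canonical_solution_def L2_eq)
qed

text \<open>\<open>u - v\<close> lies in the kernel, to which \<open>u\<close> is orthogonal, so the
  squared norm of \<open>u\<close> is \<open>ip W v u\<close>. A norm bound for any solution
  therefore bounds the canonical one.\<close>

lemma canonical_minimal:
  assumes u: "canonical_solution \<phi> f u" and v: "v \<in> sqint W" "dbar_eq v f" and f: "f \<in> sqint W"
  shows "nrm W u \<le> nrm W v"
proof -
  have us: "u \<in> sqint W" "dbar_eq u f" and o: "\<And>h. h \<in> ker_dbar \<phi> \<Longrightarrow> ip W u h = 0"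
    using u by (auto simp: canonical_iff)
  have "(\<lambda>z. u z - v z) \<in> ker_dbar \<phi>"
    using dbar_eq_diff[OF us(1) v(1) f f us(2) v(2)] sqint_diff[OF us(1) v(1)] by (simp add: ker_dbar_iff_sqint)
  then have "ip W (\<lambda>z. u z - v z) u = 0" using o by (simp add: ip_commute[of W _ u])
  then have "(nrm W u)\<^sup>2 = ip W v u" using ip_diff_left[OF us(1) v(1) us(1)] by (simp add: nrm_ip)
  also have "\<dots> \<le> nrm W v * nrm W u" using ip_Cauchy_Schwarz[OF v(1) us(1)] by simp
  finally have "nrm W u * nrm W u \<le> nrm W v * nrm W u" by (simp add: power2_eq_square)
  then show ?thesis using nrm_nonneg[of W u] nrm_nonneg[of W v]
    by (cases "nrm W u = 0") (auto simp: mult_le_cancel_right)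
qed

lemma canonical_unique:
  assumes u: "canonical_solution \<phi> f u" and v: "canonical_solution \<phi> f v" and f: "f \<in> sqint W"
  shows "AE z in lebesgue. u z = v z"
proof -
  have us: "u \<in> sqint W" "dbar_eq u f" and vs: "v \<in> sqint W" "dbar_eq v f"
    and o: "\<And>h. h \<in> ker_dbar \<phi> \<Longrightarrow> ip W u h = 0" "\<And>h. h \<in> ker_dbar \<phi> \<Longrightarrow> ip W v h = 0"
    using u v by (auto simp: canonical_iff)
  let ?d = "\<lambda>z. u z - v z"
  have d: "?d \<in> sqint W" by (rule sqint_diff[OF us(1) vs(1)])
  have "?d \<in> ker_dbar \<phi>"
    using dbar_eq_diff[OF us(1) vs(1) f f us(2) vs(2)] d by (simp add: ker_dbar_iff_sqint)
  then have "(nrm W ?d)\<^sup>2 = 0" using ip_diff_left[OF us(1) vs(1) d] o by (simp add: nrm_ip)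
  then have "(LINT z|lebesgue. (norm (?d z))\<^sup>2 * exp (- 2 * \<phi> z)) = 0"
    using d nrm_W_power2[of ?d] unfolding sqint_W_iff by simp
  moreover have "integrable lebesgue (\<lambda>z. (norm (?d z))\<^sup>2 * exp (- 2 * \<phi> z))" using d unfolding sqint_W_iff by blast
  ultimately have "AE z in lebesgue. (norm (?d z))\<^sup>2 * exp (- 2 * \<phi> z) = 0"
    by (subst (asm) integral_nonneg_eq_0_iff_AE) simp_all
  then show ?thesis by eventually_elim simp
qed

text \<open>Subtract from a solution its projection onto the kernel, which is closed because it is
  an annihilator.\<close>

lemma canonical_exists:
  assumes u: "u \<in> sqint W" "dbar_eq u f" and f: "f \<in> sqint W"
  shows "\<exists>v. canonical_solution \<phi> f v"
proof -
  let ?G = "{dual1 (cd \<i> j \<psi>) | j \<psi>. \<psi> \<in> test_functions}"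
  have G: "?G \<subseteq> sqint W" using dual1_sqint test_C_kc cd_test by blast
  have k: "h \<in> ker_dbar \<phi> \<longleftrightarrow> h \<in> sqint W \<and> (\<forall>g\<in>?G. ip W h g = 0)" for h
    unfolding ker_dbar_iff_sqint using ker_dbar_iff[of h] by blast
  obtain p where p: "p \<in> sqint W" "\<And>g. g \<in> ?G \<Longrightarrow> ip W p g = 0"
    "\<And>v. v \<in> sqint W \<Longrightarrow> (\<And>g. g \<in> ?G \<Longrightarrow> ip W v g = 0) \<Longrightarrow> ip W (\<lambda>x. u x - p x) v = 0"
    using projection_annihilator[OF u(1) G] by blast
  have pk: "p \<in> ker_dbar \<phi>" using p(1,2) k by blast
  then have "dbar_eq p (\<lambda>z. 0)" by (simp add: ker_dbar_iff_sqint)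
  then have "dbar_eq (\<lambda>z. u z - p z) f" using dbar_eq_diff[OF u(1) p(1) f sqint_0 u(2)] by simp
  moreover have "ip W (\<lambda>z. u z - p z) h = 0" if "h \<in> ker_dbar \<phi>" for h using p(3) k that by blast
  ultimately show ?thesis using sqint_diff[OF u(1) p(1)] canonical_iff by blast
qed

text \<open>Besides linearity of the operator, this lets estimates for canonical solutions be
  applied to differences of members of a sequence.\<close>

lemma canonical_comb:
  assumes f: "f \<in> sqint W" "canonical_solution \<phi> f u" and g: "g \<in> sqint W" "canonical_solution \<phi> g v"
  shows "canonical_solution \<phi> (\<lambda>z. a *s f z + b *s g z) (\<lambda>z. a * u z + b * v z)"
proof -
  have us: "u \<in> sqint W" "dbar_eq u f" "\<And>h. h \<in> ker_dbar \<phi> \<Longrightarrow> L2_inner \<phi> u h = 0"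
    and vs: "v \<in> sqint W" "dbar_eq v g" "\<And>h. h \<in> ker_dbar \<phi> \<Longrightarrow> L2_inner \<phi> v h = 0"
    using f g by (auto simp: canonical_solution_def L2_eq)
  have "L2_inner \<phi> (\<lambda>z. a * u z + b * v z) h = a * L2_inner \<phi> u h + b * L2_inner \<phi> v h" if h: "h \<in> sqint W" for h
  proof -
    have i: "integrable lebesgue (\<lambda>z. x z * cnj (h z) * complex_of_real (exp (- 2 * \<phi> z)))" if x: "x \<in> sqint W" for x
      by (rule W_density(1)[OF sqint_bilinear_integrable[OF bounded_bilinear_mult_cnj x h]])
    have "L2_inner \<phi> (\<lambda>z. a * u z + b * v z) h
      = (LINT z|lebesgue. a * (u z * cnj (h z) * complex_of_real (exp (- 2 * \<phi> z))) + b * (v z * cnj (h z) * complex_of_real (exp (- 2 * \<phi> z))))"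
      unfolding L2_inner_def by (intro Bochner_Integration.integral_cong refl) (simp add: algebra_simps)
    also have "\<dots> = a * L2_inner \<phi> u h + b * L2_inner \<phi> v h"
      unfolding L2_inner_def
      by (subst Bochner_Integration.integral_add[OF integrable_mult_right[OF i[OF us(1)]] integrable_mult_right[OF i[OF vs(1)]]])
        (simp only: integral_mult_right_zero)
    finally show ?thesis .
  qed
  then have "L2_inner \<phi> (\<lambda>z. a * u z + b * v z) h = 0" if "h \<in> ker_dbar \<phi>" for h
    using us(3)[OF that] vs(3)[OF that] that by (simp add: ker_dbar_iff_sqint)
  then show ?thesis
    unfolding canonical_solution_def L2_eq
    using sqint_comb[OF us(1) vs(1)] dbar_eq_comb[OF us(1) vs(1) f(1) g(1) us(2) vs(2)] by blast
qed

end

section \<open>Compactness\<close>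

context weight
begin

lemma indicator_cball_measurable:
  fixes u :: "complex ^ 'n \<Rightarrow> complex"
  assumes "u \<in> sqint W"
  shows "(\<lambda>z. indicat_real (cball 0 S) z *\<^sub>R u z) \<in> borel_measurable W"
proof (rule borel_measurable_scaleR)
  show "indicat_real (cball (0::complex ^ 'n) S) \<in> borel_measurable W" by (intro borel_measurable_indicator) simp
qed (rule sqint_measurable[OF assms])

context
  assumes lim: "filterlim (\<lambda>z. lowest_eigenvalue (levi_matrix \<phi> z)) at_top at_infinity"
begin

text \<open>Hoermander's theorem for the perturbed weight, with the constant 1 as lower bound of the
  Levi form; the change to that weight and back contributes a factor \<open>exp m\<close>
  each.\<close>

lemma dbar_solvable:
  obtains K where "K \<ge> 0"
    "\<And>f. f \<in> sqint W \<Longrightarrow> dbar_closed f \<Longrightarrow> \<exists>u\<in>sqint W. dbar_eq u f \<and> nrm W u \<le> K * nrm W f"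
proof -
  obtain \<phi>' m where p: "weight \<phi>'" "\<And>z. \<bar>\<phi>' z - \<phi> z\<bar> \<le> m" "\<And>z u. (norm u)\<^sup>2 \<le> levi_form \<phi>' z u"
    using strictly_positive_perturbation[OF lim] by metis
  interpret p: weight \<phi>' by (rule p(1))
  have p': "\<bar>\<phi> z - \<phi>' z\<bar> \<le> m" for z using p(2)[of z] by (simp add: abs_minus_commute)
  show thesis
  proof (rule that[of "exp m * exp m"])
    fix f :: "complex ^ 'n \<Rightarrow> complex ^ 'n" assume f: "f \<in> sqint W" "dbar_closed f"
    have f': "f \<in> sqint p.W" "nrm p.W f \<le> exp m * nrm W f"
      using weight_compare[OF weight_axioms p(1,2) f(1)] by auto
    obtain u where u: "u \<in> sqint p.W" "dbar_eq u f" "nrm p.W u \<le> nrm p.W (\<lambda>z. (1 / sqrt (2 * 1)) *\<^sub>R f z)"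
      by (rule p.hormander[of "\<lambda>z. 1" 1 1 f]) (use p(3) f'(1) f(2) in auto)
    have "nrm p.W (\<lambda>z. (1 / sqrt (2 * 1)) *\<^sub>R f z) \<le> nrm p.W f"
      unfolding nrm_scaleR by (rule mult_left_le_one_le) auto
    then have "nrm p.W u \<le> exp m * nrm W f" using u(3) f'(2) by linarith
    then have 1: "exp m * nrm p.W u \<le> exp m * (exp m * nrm W f)" by (rule mult_left_mono) simp
    have 2: "u \<in> sqint W" "nrm W u \<le> exp m * nrm p.W u"
      using weight_compare[OF p(1) weight_axioms p' u(1)] by auto
    show "\<exists>u\<in>sqint W. dbar_eq u f \<and> nrm W u \<le> exp m * exp m * nrm W f"
      unfolding mult.assoc by (intro bexI[of _ u] conjI u(2) order_trans[OF 2(2) 1] 2(1))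
  qed simp
qed

text \<open>Correcting \<open>c u\<close>, for a cut-off function \<open>c\<close>, to a solution only involves the part of \<open>f\<close> far out,
  where the Levi form is large.\<close>

lemma canonical_estimate:
  assumes eps: "eps > 0"
  obtains S C where "C \<ge> 0" "\<And>f u. f \<in> sqint W \<Longrightarrow> dbar_closed f \<Longrightarrow> canonical_solution \<phi> f u \<Longrightarrow>
    nrm W u \<le> eps * nrm W f + C * nrm W (\<lambda>z. indicat_real (cball 0 S) z *\<^sub>R u z)"
proof -
  obtain \<phi>' m where p: "weight \<phi>'" "\<And>z. \<bar>\<phi>' z - \<phi> z\<bar> \<le> m" "\<And>z u. (norm u)\<^sup>2 \<le> levi_form \<phi>' z u"
    "\<And>L. \<exists>R>0. \<forall>z u. R < norm z \<longrightarrow> L * (norm u)\<^sup>2 \<le> levi_form \<phi>' z u"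
    using strictly_positive_perturbation[OF lim] by metis
  interpret p: weight \<phi>' by (rule p(1))
  have p': "\<bar>\<phi> z - \<phi>' z\<bar> \<le> m" for z using p(2)[of z] by (simp add: abs_minus_commute)
  \<comment> \<open>The product \<open>exp m * exp m\<close> pays for the change to the perturbed
    weight and back, so that exactly \<open>eps\<close> remains in the end.\<close>
  define q where "q = exp m * exp m / eps"
  have q: "q > 0" using eps by (simp add: q_def)
  \<comment> \<open>Makes \<open>sqrt (2 * L)\<close> at least \<open>2 * q\<close>, where the 2
    accounts for \<open>cmod (1 - c z) \<le> 2\<close>; the summand 1 keeps \<open>L\<close> at
    least 1.\<close>
  define L where "L = 1 + 2 * q\<^sup>2"
  have L: "L \<ge> 1" by (simp add: L_def)
  have sL: "2 / sqrt (2 * L) \<le> 1 / q"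
  proof -
    have "2 * q = sqrt ((2 * q)\<^sup>2)" by (rule real_sqrt_unique[symmetric]) (use q in auto)
    also have "\<dots> \<le> sqrt (2 * L)" by (rule real_sqrt_le_mono) (simp add: L_def power_mult_distrib)
    finally have "2 / sqrt (2 * L) \<le> 2 / (2 * q)" using q L by (intro divide_left_mono mult_pos_pos) auto
    then show ?thesis by simp
  qed
  obtain R where R: "R > 0" "\<And>z u. R < norm z \<Longrightarrow> L * (norm u)\<^sup>2 \<le> levi_form \<phi>' z u" using p(4) by blast
  \<comment> \<open>Hoermander's estimate asks for a bounded function, hence the truncation at
    \<open>L\<close>. Up to the radius of the jump \<open>c\<close> equals 1, so the part
    \<open>(1 - c) f\<close> of the error only meets the large value.\<close>
  define lam where "lam z = (if z \<in> cball 0 R then 1 else L)" for z :: "complex ^ 'n"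
  have lam: "lam \<in> borel_measurable lebesgue" "\<And>z. 1 \<le> lam z" "(1::real) > 0" "\<And>z. lam z \<le> L"
    "\<And>z u. lam z * (norm u)\<^sup>2 \<le> levi_form \<phi>' z u"
  proof -
    have "lam \<in> borel_measurable borel" unfolding lam_def[abs_def] by (intro measurable_If_set) auto
    then show "lam \<in> borel_measurable lebesgue" by (simp add: measurable_completion)
  qed (use L p(3) R(2) in \<open>auto simp: lam_def\<close>)
  obtain cs B where cs: "\<And>n k. C_kc k (cs n :: complex ^ 'n \<Rightarrow> complex)" "\<And>n z. cmod (cs n z) \<le> 1"
    "\<And>n z. norm z \<le> real (Suc n) \<Longrightarrow> cs n z = 1" "B \<ge> 0" "\<And>n s j z. cmod s = 1 \<Longrightarrow> cmod (cd s j (cs n) z) \<le> B / real (Suc n)"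
    using scaled_cutoffs by metis
  obtain n where n: "R \<le> real n" using real_arch_simple by blast
  define c where "c = cs n"
  have c: "\<And>k. C_kc k c" "\<And>z. cmod (c z) \<le> 1" "\<And>z. norm z \<le> R \<Longrightarrow> c z = 1" using cs n by (auto simp: c_def)
  have dcb: "cmod (cd \<i> j c z) \<le> B" for j z
  proof -
    have "cmod (cd \<i> j c z) \<le> B / real (Suc n)" unfolding c_def by (rule cs(5)) simp
    also have "\<dots> \<le> B" using cs(4) by (simp add: divide_le_eq mult_le_cancel_left1)
    finally show ?thesis .
  qed
  obtain S where S: "\<And>z. S < norm z \<Longrightarrow> c z = 0" using c(1) by (auto simp: C_kc_def)
  have dS: "cd \<i> j c z = 0" if "S < norm z" for j z by (rule cd_outside[OF S that])
  \<comment> \<open>The number of coefficients turns the componentwise bound for the gradient of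
    \<open>c\<close> into one for the form.\<close>
  define D where "D = real CARD('n) * B"
  have D: "D \<ge> 0" using cs(4) by (simp add: D_def)
  show thesis
  proof (rule that[of "1 + exp m * (D * exp m)" S])
    show "1 + exp m * (D * exp m) \<ge> 0" using D by simp
    fix f u assume f: "f \<in> sqint W" "dbar_closed f" and can: "canonical_solution \<phi> f u"
    have u: "u \<in> sqint W" "dbar_eq u f" using can by (auto simp: canonical_iff)
    define I where "I z = indicat_real (cball 0 S) z *\<^sub>R u z" for z
    have Im: "I \<in> borel_measurable W" unfolding I_def[abs_def] by (rule indicator_cball_measurable[OF u(1)])
    have Is: "I \<in> sqint W" by (rule sqint_mono[OF u(1) Im]) (auto simp: I_def indicator_def)
    define h where "h z = (\<chi> j. c z * f z $ j + cd \<i> j c z * u z)" for z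
    have h: "h \<in> sqint W" "dbar_eq (\<lambda>z. c z * u z) h"
      unfolding h_def[abs_def] by (rule cutoff_form_sqint[OF c(1) u(1) f(1)] dbar_eq_cutoff[OF c(1) u(1) f(1) u(2)])+
    \<comment> \<open>The error left by \<open>c u\<close>, closed as a difference of closed forms.
      With \<open>v\<close> solving dbar \<open>v = g\<close>, the sum \<open>c u + v\<close> solves
      the original equation and competes with the minimal solution \<open>u\<close>.\<close>
    define g where "g z = 1 *s f z + (- 1) *s h z" for z
    have g: "g \<in> sqint W" "dbar_closed g"
      unfolding g_def[abs_def] by (rule sqint_vec_comb[OF f(1) h(1)] dbar_closed_comb[OF f(1) h(1) f(2) dbar_eq_closed[OF h(2)]])+
    have g': "g \<in> sqint p.W" by (rule weight_compare[OF weight_axioms p(1,2) g(1)])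
    obtain v where v: "v \<in> sqint p.W" "dbar_eq v g" "nrm p.W v \<le> nrm p.W (\<lambda>z. (1 / sqrt (2 * lam z)) *\<^sub>R g z)"
      using p.hormander[OF lam g' g(2)] by blast
    have f': "f \<in> sqint p.W" "nrm p.W f \<le> exp m * nrm W f" using weight_compare[OF weight_axioms p(1,2) f(1)] by auto
    have I': "I \<in> sqint p.W" "nrm p.W I \<le> exp m * nrm W I" using weight_compare[OF weight_axioms p(1,2) Is] by auto
    have v': "v \<in> sqint W" "nrm W v \<le> exp m * nrm p.W v" using weight_compare[OF p(1) weight_axioms p' v(1)] by auto
    let ?w = "\<lambda>z. (1 / q) *\<^sub>R norm (f z) + D *\<^sub>R norm (I z)"
    have ws: "(\<lambda>z. (1 / q) *\<^sub>R norm (f z)) \<in> sqint p.W" "(\<lambda>z. D *\<^sub>R norm (I z)) \<in> sqint p.W"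
      by (intro sqint_scaleR sqint_norm f' I')+
    have "nrm p.W (\<lambda>z. (1 / sqrt (2 * lam z)) *\<^sub>R g z) \<le> nrm p.W ?w"
    proof (rule sqint_nrm_bound(2))
      show "(\<lambda>z. (1 / sqrt (2 * lam z)) *\<^sub>R g z) \<in> borel_measurable p.W"
        using lam(1) sqint_measurable[OF g'] by simp
      show "?w \<in> sqint p.W" by (rule sqint_add[OF ws])
      fix z
      have l: "0 < 1 / sqrt (2 * lam z)" "1 / sqrt (2 * lam z) \<le> 1" using lam(2)[of z] by (auto simp: divide_le_eq)
      have gz: "g z = (1 - c z) *s f z - (\<chi> j. cd \<i> j c z * u z)"
        by (simp add: g_def h_def vec_eq_iff algebra_simps)
      have "norm (\<chi> j. cd \<i> j c z * u z) \<le> (\<Sum>j\<in>UNIV. cmod (cd \<i> j c z * u z))"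
        using L2_set_le_sum[of UNIV "\<lambda>j. cmod (cd \<i> j c z * u z)"] by (simp add: norm_vec_def)
      \<comment> \<open>The derivatives of \<open>c\<close> vanish outside the ball of radius
        \<open>S\<close>, so \<open>u\<close> may be replaced by \<open>I\<close> here.\<close>
      also have "\<dots> \<le> (\<Sum>j\<in>(UNIV::'n set). B * norm (I z))"
      proof (rule sum_mono)
        fix j
        show "cmod (cd \<i> j c z * u z) \<le> B * norm (I z)"
        proof (cases "norm z \<le> S")
          case True
          then show ?thesis using dcb[of j z] by (simp add: norm_mult I_def mult_right_mono)
        next
          case False
          then show ?thesis using dS[of z j] cs(4) by simp
        qed
      qed
      also have "\<dots> = D * norm (I z)" by (simp add: D_def)
      finally have b2: "norm (\<chi> j. cd \<i> j c z * u z) \<le> D * norm (I z)" .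
      have b1: "(1 / sqrt (2 * lam z)) * norm ((1 - c z) *s f z) \<le> (1 / q) * norm (f z)"
      proof (cases "norm z \<le> R")
        case True
        then show ?thesis using c(3)[OF True] q by (simp add: norm_vec_smult)
      next
        case False
        have "cmod (1 - c z) \<le> 2" using norm_triangle_ineq4[of 1 "c z"] c(2)[of z] by simp
        then have "(1 / sqrt (2 * L)) * (cmod (1 - c z) * norm (f z)) \<le> (1 / sqrt (2 * L)) * (2 * norm (f z))"
          using L by (intro mult_left_mono mult_right_mono) auto
        also have "\<dots> = (2 / sqrt (2 * L)) * norm (f z)" by simp
        also have "\<dots> \<le> (1 / q) * norm (f z)" by (rule mult_right_mono[OF sL]) simp
        finally have "(1 / sqrt (2 * L)) * (cmod (1 - c z) * norm (f z)) \<le> (1 / q) * norm (f z)" .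
        moreover have "lam z = L" using False by (simp add: lam_def)
        ultimately show ?thesis unfolding norm_vec_smult by (simp only:)
      qed
      have "norm ((1 / sqrt (2 * lam z)) *\<^sub>R g z) = (1 / sqrt (2 * lam z)) * norm (g z)" using l(1) by simp
      also have "\<dots> \<le> (1 / sqrt (2 * lam z)) * (norm ((1 - c z) *s f z) + norm (\<chi> j. cd \<i> j c z * u z))"
        unfolding gz using l(1) by (intro mult_left_mono norm_triangle_ineq4) auto
      also have "\<dots> \<le> (1 / q) * norm (f z) + 1 * norm (\<chi> j. cd \<i> j c z * u z)"
        unfolding distrib_left using b1 l by (intro add_mono mult_right_mono) auto
      also have "\<dots> \<le> ?w z" using b2 by simp
      finally show "norm ((1 / sqrt (2 * lam z)) *\<^sub>R g z) \<le> ?w z" .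
    qed
    also have "\<dots> \<le> nrm p.W (\<lambda>z. (1 / q) *\<^sub>R norm (f z)) + nrm p.W (\<lambda>z. D *\<^sub>R norm (I z))" by (rule nrm_triangle[OF ws])
    also have "\<dots> = (1 / q) * nrm p.W f + D * nrm p.W I" unfolding nrm_scaleR nrm_norm using q D by simp
    also have "\<dots> \<le> (1 / q) * (exp m * nrm W f) + D * (exp m * nrm W I)"
      using f'(2) I'(2) q D by (intro add_mono mult_left_mono) auto
    finally have "nrm p.W v \<le> (1 / q) * (exp m * nrm W f) + D * (exp m * nrm W I)" using v(3) by linarith
    then have "exp m * nrm p.W v \<le> exp m * ((1 / q) * (exp m * nrm W f) + D * (exp m * nrm W I))"
      by (rule mult_left_mono) simp
    also have "\<dots> = eps * nrm W f + exp m * (D * exp m) * nrm W I"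
      using eps by (simp add: q_def field_simps)
    finally have vb: "nrm W v \<le> eps * nrm W f + exp m * (D * exp m) * nrm W I" using v'(2) by linarith
    have cus: "(\<lambda>z. c z * u z) \<in> sqint W" by (rule sqint_W_mult_C_kc(3)[OF u(1) c(1)])
    have cub: "nrm W (\<lambda>z. c z * u z) \<le> nrm W I"
    proof (rule nrm_mono[OF Is sqint_measurable[OF cus]])
      show "AE z in W. norm (c z * u z) \<le> norm (I z)"
      proof (rule AE_I2)
        fix z
        show "norm (c z * u z) \<le> norm (I z)"
          using S[of z] c(2)[of z] by (cases "norm z \<le> S") (auto simp: I_def norm_mult mult_left_le_one_le)
      qed
    qed
    have "dbar_eq (\<lambda>z. 1 * (c z * u z) + 1 * v z) (\<lambda>z. 1 *s h z + 1 *s g z)"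
      by (rule dbar_eq_comb[OF cus v'(1) h(1) g(1) h(2) v(2)])
    moreover have "(\<lambda>z. 1 *s h z + 1 *s g z) = f" by (simp add: g_def fun_eq_iff vec_eq_iff)
    ultimately have "dbar_eq (\<lambda>z. c z * u z + v z) f" by simp
    then have "nrm W u \<le> nrm W (\<lambda>z. c z * u z + v z)" by (rule canonical_minimal[OF can sqint_add[OF cus v'(1)] _ f(1)])
    also have "\<dots> \<le> nrm W (\<lambda>z. c z * u z) + nrm W v" by (rule nrm_triangle[OF cus v'(1)])
    finally have "nrm W u \<le> eps * nrm W f + (1 + exp m * (D * exp m)) * nrm W I"
      using vb cub by (simp add: algebra_simps)
    then show "nrm W u \<le> eps * nrm W f + (1 + exp m * (D * exp m)) * nrm W (\<lambda>z. indicat_real (cball 0 S) z *\<^sub>R u z)"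
      by (simp add: I_def[abs_def])
  qed
qed

text \<open>Rellich's lemma for \<open>c u\<close>, with a cut-off \<open>c\<close> equal to 1 on
  the ball. The supports lie in a fixed ball, where weighted and unweighted norms are comparable
  with constant \<open>K\<close>; hence the tolerance \<open>d / K\<close>.\<close>

lemma local_compactness:
  assumes f: "\<And>k. f k \<in> sqint W" "\<And>k. nrm W (f k) \<le> C" and u: "\<And>k. u k \<in> sqint W" "\<And>k. nrm W (u k) \<le> C"
    and uf: "\<And>k. dbar_eq (u k) (f k)" and d: "d > 0"
  shows "\<exists>r. strict_mono (r :: nat \<Rightarrow> nat) \<and> (\<exists>N. \<forall>k\<ge>N. \<forall>l\<ge>N.
    nrm W (\<lambda>z. indicat_real (cball 0 S) z *\<^sub>R (u (r k) z - u (r l) z)) \<le> d)"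
proof -
  have C0: "C \<ge> 0" using nrm_nonneg order_trans u(2) by blast
  obtain cs B where cs: "\<And>n k. C_kc k (cs n :: complex ^ 'n \<Rightarrow> complex)" "\<And>n z. cmod (cs n z) \<le> 1"
    "\<And>n z. norm z \<le> real (Suc n) \<Longrightarrow> cs n z = 1" "B \<ge> 0" "\<And>n s j z. cmod s = 1 \<Longrightarrow> cmod (cd s j (cs n) z) \<le> B / real (Suc n)"
    using scaled_cutoffs by metis
  obtain n where n: "S \<le> real n" using real_arch_simple by blast
  define c where "c = cs n"
  have c: "\<And>k. C_kc k c" "\<And>z. cmod (c z) \<le> 1" "\<And>z. norm z \<le> S \<Longrightarrow> c z = 1" using cs n by (auto simp: c_def)
  have dcb: "cmod (cd \<i> j c z) \<le> B" for j z
  proof -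
    have "cmod (cd \<i> j c z) \<le> B / real (Suc n)" unfolding c_def by (rule cs(5)) simp
    also have "\<dots> \<le> B" using cs(4) by (simp add: divide_le_eq mult_le_cancel_left1)
    finally show ?thesis .
  qed
  obtain T where T: "\<And>z. T < norm z \<Longrightarrow> c z = 0" using c(1) by (auto simp: C_kc_def)
  have dT: "cd \<i> j c z = 0" if "T < norm z" for j z by (rule cd_outside[OF T that])
  obtain K where K: "K > 0"
    "\<And>f :: complex ^ 'n \<Rightarrow> complex. (\<And>z. T < norm z \<Longrightarrow> f z = 0) \<Longrightarrow> f \<in> sqint W \<Longrightarrow> f \<in> sqint lebesgue \<and> nrm lebesgue f \<le> K * nrm W f"
    "\<And>f :: complex ^ 'n \<Rightarrow> complex. (\<And>z. T < norm z \<Longrightarrow> f z = 0) \<Longrightarrow> f \<in> sqint lebesgue \<Longrightarrow> f \<in> sqint W \<and> nrm W f \<le> K * nrm lebesgue f"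
    using sqint_W_supp[of T, where 'b=complex] by blast
  define v where "v k z = c z * u k z" for k z
  define h where "h k z = (\<chi> j. c z * f k z $ j + cd \<i> j c z * u k z)" for k z
  have h: "h k \<in> sqint W" "dbar_eq (v k) (h k)" for k
    unfolding h_def[abs_def] v_def[abs_def] by (rule cutoff_form_sqint[OF c(1) u(1) f(1)] dbar_eq_cutoff[OF c(1) u(1) f(1) uf])+
  have cm: "c \<in> borel_measurable W" "cd \<i> j c \<in> borel_measurable W" for j
    using borel_measurable_integrable[OF C_kc_integrable[OF c(1)]] borel_measurable_integrable[OF C_kc_integrable[OF C_kc_cd[OF c(1)]]] by auto
  have vW: "v k \<in> sqint W" "nrm W (v k) \<le> C" for k
  proof -
    show "v k \<in> sqint W" unfolding v_def[abs_def] by (rule sqint_W_mult_C_kc(3)[OF u(1) c(1)])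
    have "nrm W (v k) \<le> 1 * nrm W (u k)" unfolding v_def[abs_def] by (rule sqint_bounded_mult(2)[OF cm(1) u(1)]) (use c(2) in auto)
    then show "nrm W (v k) \<le> C" using u(2)[of k] by linarith
  qed
  have hW: "(\<lambda>z. h k z $ j) \<in> sqint W" "nrm W (\<lambda>z. h k z $ j) \<le> (1 + B) * C" for k j
  proof -
    show "(\<lambda>z. h k z $ j) \<in> sqint W" using h(1) by (simp add: sqint_vec_iff)
    have fj: "(\<lambda>z. f k z $ j) \<in> sqint W" using f(1) by (simp add: sqint_vec_iff)
    have 1: "(\<lambda>z. c z * f k z $ j) \<in> sqint W" "nrm W (\<lambda>z. c z * f k z $ j) \<le> 1 * nrm W (\<lambda>z. f k z $ j)"
      by (rule sqint_bounded_mult[OF cm(1) fj c(2) zero_le_one])+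
    have 2: "(\<lambda>z. cd \<i> j c z * u k z) \<in> sqint W" "nrm W (\<lambda>z. cd \<i> j c z * u k z) \<le> B * nrm W (u k)"
      by (rule sqint_bounded_mult[OF cm(2) u(1) dcb cs(4)])+
    have "nrm W (\<lambda>z. h k z $ j) \<le> nrm W (\<lambda>z. c z * f k z $ j) + nrm W (\<lambda>z. cd \<i> j c z * u k z)"
      unfolding h_def vec_lambda_beta by (rule nrm_triangle[OF 1(1) 2(1)])
    also have "\<dots> \<le> C + B * C"
      using 1(2) 2(2) nrm_component_le[OF f(1), of k j] f(2)[of k] mult_left_mono[OF u(2)[of k] cs(4)] by linarith
    finally show "nrm W (\<lambda>z. h k z $ j) \<le> (1 + B) * C" by (simp add: algebra_simps)
  qed
  have v0: "v k z = 0" "h k z = 0" if "T < norm z" for k z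
    using T[OF that] dT[OF that] by (simp_all add: v_def h_def vec_eq_iff)
  have vl: "v k \<in> sqint lebesgue" "nrm lebesgue (v k) \<le> K * ((1 + B) * C)" for k
  proof -
    have "v k \<in> sqint lebesgue \<and> nrm lebesgue (v k) \<le> K * nrm W (v k)" by (rule K(2)[OF v0(1) vW(1)])
    moreover have "K * nrm W (v k) \<le> K * ((1 + B) * C)"
      using vW(2)[of k] C0 cs(4) K(1) by (intro mult_left_mono) (auto simp: algebra_simps add_increasing2)
    ultimately show "v k \<in> sqint lebesgue" "nrm lebesgue (v k) \<le> K * ((1 + B) * C)" by auto
  qed
  have hl: "(\<lambda>z. h k z $ j) \<in> sqint lebesgue" "nrm lebesgue (\<lambda>z. h k z $ j) \<le> K * ((1 + B) * C)" for k j
  proof -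
    have "(\<lambda>z. h k z $ j) \<in> sqint lebesgue \<and> nrm lebesgue (\<lambda>z. h k z $ j) \<le> K * nrm W (\<lambda>z. h k z $ j)"
      by (rule K(2)[OF _ hW(1)]) (simp add: v0)
    moreover have "K * nrm W (\<lambda>z. h k z $ j) \<le> K * ((1 + B) * C)"
      using hW(2)[of k j] K(1) by (intro mult_left_mono) auto
    ultimately show "(\<lambda>z. h k z $ j) \<in> sqint lebesgue" "nrm lebesgue (\<lambda>z. h k z $ j) \<le> K * ((1 + B) * C)" by auto
  qed
  have hlv: "h k \<in> sqint lebesgue" for k using hl(1) by (simp add: sqint_vec_iff)
  have "d / K > 0" using d K(1) by simp
  from dbar_rellich[where v = v and g = h and T = T and C = "K * ((1 + B) * C)", OF vl(1) v0(1) vl(2) hlv v0(2) hl(2) h(2) this]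
  obtain r N where r: "strict_mono (r :: nat \<Rightarrow> nat)"
    "\<And>k l. k \<ge> N \<Longrightarrow> l \<ge> N \<Longrightarrow> nrm lebesgue (\<lambda>z. v (r k) z - v (r l) z) \<le> d / K" by blast
  have "nrm W (\<lambda>z. indicat_real (cball 0 S) z *\<^sub>R (u (r k) z - u (r l) z)) \<le> d" if "k \<ge> N" "l \<ge> N" for k l
  proof -
    let ?v = "\<lambda>z. v (r k) z - v (r l) z"
    have vs: "?v \<in> sqint W" by (rule sqint_diff[OF vW(1) vW(1)])
    have "nrm W (\<lambda>z. indicat_real (cball 0 S) z *\<^sub>R (u (r k) z - u (r l) z)) \<le> nrm W ?v"
    proof (rule nrm_mono[OF vs])
      show "(\<lambda>z. indicat_real (cball 0 S) z *\<^sub>R (u (r k) z - u (r l) z)) \<in> borel_measurable W"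
        by (rule indicator_cball_measurable[OF sqint_diff[OF u(1) u(1)]])
      show "AE z in W. norm (indicat_real (cball 0 S) z *\<^sub>R (u (r k) z - u (r l) z)) \<le> norm (?v z)"
        by (rule AE_I2) (auto simp: v_def c(3) indicator_def)
    qed
    also have "\<dots> \<le> K * nrm lebesgue ?v"
      using K(3)[of ?v] v0(1) sqint_diff[OF vl(1) vl(1)] by simp
    also have "\<dots> \<le> K * (d / K)" using r(2)[OF that] K(1) by (intro mult_left_mono) auto
    also have "\<dots> = d" using K(1) by simp
    finally show ?thesis .
  qed
  with r(1) show ?thesis by blast
qed

text \<open>Solvability makes the choice in \<open>S_can\<close> one from a nonempty set.\<close>

lemma S_can_canonical: "f \<in> closed_forms \<phi> \<Longrightarrow> canonical_solution \<phi> f (S_can \<phi> f)"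
proof -
  assume f: "f \<in> closed_forms \<phi>"
  obtain u where "u \<in> sqint W" "dbar_eq u f"
    using dbar_solvable f unfolding closed_forms_iff by metis
  then have "\<exists>v. canonical_solution \<phi> f v" using canonical_exists f by (simp add: closed_forms_iff)
  then show ?thesis unfolding S_can_def by (rule someI_ex)
qed

text \<open>The estimate is applied to differences of the sequence, whose data have norm at most
  \<open>2 * C\<close>. The order of choices matters: \<open>eps'\<close> determines the ball and
  the constant \<open>D\<close>, and only then is the tolerance for Rellich's lemma fixed.\<close>

lemma S_can_subsequence:
  assumes F: "\<And>k. F k \<in> closed_forms \<phi>" "\<And>k. nrm W (F k) \<le> C" and eps: "eps > 0"
  shows "\<exists>r. strict_mono (r :: nat \<Rightarrow> nat) \<and> (\<exists>N. \<forall>k\<ge>N. \<forall>l\<ge>N.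
    nrm W (\<lambda>z. S_can \<phi> (F (r k)) z - S_can \<phi> (F (r l)) z) \<le> eps)"
proof -
  have C0: "C \<ge> 0" using nrm_nonneg order_trans F(2) by blast
  have f: "F k \<in> sqint W" "dbar_closed (F k)" for k using F(1) by (auto simp: closed_forms_iff)
  define u where "u k = S_can \<phi> (F k)" for k
  have can: "canonical_solution \<phi> (F k) (u k)" for k unfolding u_def by (rule S_can_canonical[OF F(1)])
  have u: "u k \<in> sqint W" "dbar_eq (u k) (F k)" for k using can by (auto simp: canonical_iff)
  obtain K where K: "K \<ge> 0" "\<And>f. f \<in> sqint W \<Longrightarrow> dbar_closed f \<Longrightarrow> \<exists>u\<in>sqint W. dbar_eq u f \<and> nrm W u \<le> K * nrm W f"
    using dbar_solvable by blast
  have ub: "nrm W (u k) \<le> K * C" for k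
  proof -
    obtain v where v: "v \<in> sqint W" "dbar_eq v (F k)" "nrm W v \<le> K * nrm W (F k)" using K(2)[OF f] by blast
    have "nrm W (u k) \<le> nrm W v" by (rule canonical_minimal[OF can v(1,2) f(1)])
    also have "\<dots> \<le> K * C" using v(3) mult_left_mono[OF F(2)[of k] K(1)] by linarith
    finally show ?thesis .
  qed
  \<comment> \<open>Keeps the data term \<open>eps' * (2 * C)\<close> below half of
    \<open>eps\<close>; the summand 1 covers \<open>C = 0\<close>.\<close>
  define eps' where "eps' = eps / (4 * (C + 1))"
  have eps': "eps' > 0" using eps C0 by (simp add: eps'_def)
  have e1: "eps' * (2 * C) \<le> eps / 2"
  proof -
    have "4 * (C + 1) \<noteq> 0" using add_nonneg_pos[OF C0 zero_less_one] by simp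
    from eps'_def[unfolded nonzero_eq_divide_eq[OF this]] have "eps' * (4 * (C + 1)) = eps" .
    moreover have "eps' * (4 * (C + 1)) = 2 * (eps' * (2 * C)) + 4 * eps'" by algebra
    ultimately show ?thesis using eps' by linarith
  qed
  obtain S D where D: "D \<ge> 0" and est: "\<And>f u. f \<in> sqint W \<Longrightarrow> dbar_closed f \<Longrightarrow> canonical_solution \<phi> f u \<Longrightarrow>
    nrm W u \<le> eps' * nrm W f + D * nrm W (\<lambda>z. indicat_real (cball 0 S) z *\<^sub>R u z)"
  proof (rule canonical_estimate[OF eps'], goal_cases)
    case (1 S D)
    show ?case by (rule 1(1)[OF 1(2,3)])
  qed
  have "eps / (2 * (D + 1)) > 0" using eps D by simp
  have Cm: "nrm W (F k) \<le> max C (K * C)" "nrm W (u k) \<le> max C (K * C)" for k using F(2)[of k] ub[of k] by auto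
  obtain r N where r: "strict_mono (r :: nat \<Rightarrow> nat)" "\<And>k l. k \<ge> N \<Longrightarrow> l \<ge> N \<Longrightarrow>
    nrm W (\<lambda>z. indicat_real (cball 0 S) z *\<^sub>R (u (r k) z - u (r l) z)) \<le> eps / (2 * (D + 1))"
    using local_compactness[where f = F and u = u and S = S, OF f(1) Cm(1) u(1) Cm(2) u(2) \<open>eps / (2 * (D + 1)) > 0\<close>] by blast
  have "nrm W (\<lambda>z. u (r k) z - u (r l) z) \<le> eps" if kl: "k \<ge> N" "l \<ge> N" for k l
  proof -
    let ?f = "\<lambda>z. F (r k) z - F (r l) z" and ?u = "\<lambda>z. u (r k) z - u (r l) z"
    have "canonical_solution \<phi> (\<lambda>z. 1 *s F (r k) z + (- 1) *s F (r l) z) (\<lambda>z. 1 * u (r k) z + (- 1) * u (r l) z)"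
      by (rule canonical_comb[OF f(1) can f(1) can])
    then have cu: "canonical_solution \<phi> ?f ?u" by simp
    have fs: "?f \<in> sqint W" "dbar_closed ?f"
      using sqint_diff[OF f(1) f(1)] dbar_closed_comb[OF f(1) f(1) f(2) f(2), of 1 "r k" "- 1" "r l"] by auto
    have "nrm W ?f \<le> nrm W (F (r k)) + nrm W (\<lambda>z. (- 1) *\<^sub>R F (r l) z)"
      using nrm_triangle[OF f(1) sqint_scaleR[OF f(1)], of "r k" "- 1" "r l"] by simp
    also have "\<dots> \<le> 2 * C" unfolding nrm_scaleR using F(2)[of "r k"] F(2)[of "r l"] by simp
    finally have nf: "nrm W ?f \<le> 2 * C" .
    have "nrm W ?u \<le> eps' * nrm W ?f + D * nrm W (\<lambda>z. indicat_real (cball 0 S) z *\<^sub>R ?u z)" by (rule est[OF fs cu])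
    also have "\<dots> \<le> eps' * (2 * C) + D * (eps / (2 * (D + 1)))"
      using nf r(2)[OF kl] eps' D by (intro add_mono mult_left_mono) auto
    also have "\<dots> \<le> eps"
    proof -
      have "D * (eps / (2 * (D + 1))) \<le> (D + 1) * (eps / (2 * (D + 1)))" using eps D by (intro mult_right_mono) auto
      also have "\<dots> = (D + 1) * eps / ((D + 1) * 2)" by (simp only: times_divide_eq_right mult.commute[of 2])
      also have "\<dots> = eps / 2" by (rule nonzero_mult_divide_mult_cancel_left) (use add_nonneg_pos[OF D zero_less_one] in simp)
      finally show ?thesis using e1 by linarith
    qed
    finally show ?thesis .
  qed
  with r(1) show ?thesis unfolding u_def by blast
qed

lemma S_can_compact: "compact_operator \<phi> (S_can \<phi>)"
  unfolding compact_operator_def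
proof (intro conjI ballI allI impI)
  show "S_can \<phi> f \<in> L2 \<phi>" if "f \<in> closed_forms \<phi>" for f
    using S_can_canonical[OF that] by (simp add: canonical_solution_def)
  fix f g a b assume f: "f \<in> closed_forms \<phi>" and g: "g \<in> closed_forms \<phi>"
  have fs: "f \<in> sqint W" "dbar_closed f" "g \<in> sqint W" "dbar_closed g" using f g by (auto simp: closed_forms_iff)
  have "(\<lambda>w. a *s f w + b *s g w) \<in> closed_forms \<phi>"
    using sqint_vec_comb[OF fs(1,3)] dbar_closed_comb[OF fs(1,3,2,4)] by (simp add: closed_forms_iff)
  from S_can_canonical[OF this] canonical_comb[OF fs(1) S_can_canonical[OF f] fs(3) S_can_canonical[OF g]]
  show "AE z in lebesgue. S_can \<phi> (\<lambda>w. a *s f w + b *s g w) z = a * S_can \<phi> f z + b * S_can \<phi> g z"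
    by (rule canonical_unique[OF _ _ sqint_vec_comb[OF fs(1,3)]])
next
  fix F :: "nat \<Rightarrow> complex ^ 'n \<Rightarrow> complex ^ 'n"
  assume "(\<forall>k. F k \<in> closed_forms \<phi>) \<and> (\<exists>C. \<forall>k. L2_forms_norm \<phi> (F k) \<le> C)"
  then obtain C where F: "\<And>k. F k \<in> closed_forms \<phi>" "\<And>k. L2_forms_norm \<phi> (F k) \<le> C" by blast
  have fs: "F k \<in> sqint W" for k using F(1) by (simp add: closed_forms_iff)
  have FC: "nrm W (F k) \<le> C" for k using F(2)[of k] by (simp add: L2_forms_norm_eq[OF fs])
  define u where "u k = S_can \<phi> (F k)" for k
  have us: "u k \<in> sqint W" for k using S_can_canonical[OF F(1)] by (simp add: canonical_iff u_def)
  \<comment> \<open>Eventual oscillation of at most \<open>1 / Suc n\<close> persists under further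
    subsequences, as the diagonal construction requires. The diagonal sequence, shifted by
    \<open>Suc n\<close>, has property \<open>P n\<close> for every \<open>n\<close> and is
    therefore Cauchy.\<close>
  define P where "P n s \<longleftrightarrow> (\<exists>N. \<forall>k\<ge>N. \<forall>l\<ge>N. nrm W (\<lambda>z. u (s k) z - u (s l) z) \<le> 1 / real (Suc n))"
    for n :: nat and s :: "nat \<Rightarrow> nat"
  interpret subseqs P
  proof
    fix n and s :: "nat \<Rightarrow> nat" assume "strict_mono s"
    have "1 / real (Suc n) > 0" by simp
    from S_can_subsequence[OF F(1) FC this, of "\<lambda>k. s k"]
    show "\<exists>r'. strict_mono r' \<and> P n (s \<circ> r')" by (simp add: P_def u_def)
  qed
  have "P n (diagseq \<circ> ((+) (Suc n)))" for n
  proof (rule diagseq_holds)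
    fix r s n assume r: "strict_mono (r :: nat \<Rightarrow> nat)" and "P n s"
    then obtain N where N: "\<And>k l. k \<ge> N \<Longrightarrow> l \<ge> N \<Longrightarrow> nrm W (\<lambda>z. u (s k) z - u (s l) z) \<le> 1 / real (Suc n)"
      unfolding P_def by blast
    have "N \<le> r k" if "N \<le> k" for k using seq_suble[OF r, of k] that by linarith
    then show "P n (s \<circ> r)" unfolding P_def o_def using N by blast
  qed
  then have diag: "\<exists>N. \<forall>k\<ge>N. \<forall>l\<ge>N. nrm W (\<lambda>z. u (diagseq (Suc n + k)) z - u (diagseq (Suc n + l)) z) \<le> 1 / real (Suc n)" for n
    by (simp add: P_def)
  have "\<exists>N. \<forall>k\<ge>N. \<forall>l\<ge>N. nrm W (\<lambda>z. u (diagseq k) z - u (diagseq l) z) < e" if "e > 0" for e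
  proof -
    from reals_Archimedean[OF that] obtain n where n: "1 / real (Suc n) < e" unfolding inverse_eq_divide by blast
    obtain N where N: "\<And>k l. k \<ge> N \<Longrightarrow> l \<ge> N \<Longrightarrow> nrm W (\<lambda>z. u (diagseq (Suc n + k)) z - u (diagseq (Suc n + l)) z) \<le> 1 / real (Suc n)"
      using diag[of n] by blast
    show ?thesis
    proof (intro exI[of _ "Suc n + N"] allI impI)
      fix k l assume kl: "Suc n + N \<le> k" "Suc n + N \<le> l"
      have "nrm W (\<lambda>z. u (diagseq (Suc n + (k - Suc n))) z - u (diagseq (Suc n + (l - Suc n))) z) \<le> 1 / real (Suc n)"
        by (rule N) (use kl in auto)
      then show "nrm W (\<lambda>z. u (diagseq k) z - u (diagseq l) z) < e" using kl n by simp
    qed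
  qed
  then obtain g where g: "g \<in> sqint W" "(\<lambda>k. nrm W (\<lambda>z. u (diagseq k) z - g z)) \<longlonglongrightarrow> 0"
    using sqint_complete[of "\<lambda>k. u (diagseq k)" W] us by blast
  have "L2_norm \<phi> (\<lambda>z. S_can \<phi> (F (diagseq k)) z - g z) = nrm W (\<lambda>z. u (diagseq k) z - g z)" for k
  proof -
    have "(\<lambda>z. u (diagseq k) z - g z) \<in> borel_measurable lebesgue"
      using sqint_diff[OF us g(1)] unfolding sqint_W_iff by blast
    from L2_norm_eq[OF this] show ?thesis by (simp add: u_def)
  qed
  then show "\<exists>r. \<exists>g\<in>L2 \<phi>. strict_mono r \<and> (\<lambda>k. L2_norm \<phi> (\<lambda>z. S_can \<phi> (F (r k)) z - g z)) \<longlonglongrightarrow> 0"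
    using g subseq_diagseq by (intro exI[of _ diagseq] bexI[of _ g]) (auto simp: L2_eq)
qed

lemma S_can_welldef: "S_can_well_defined \<phi>"
  unfolding S_can_well_defined_def
proof (intro ballI conjI allI impI)
  fix f assume f: "f \<in> closed_forms \<phi>"
  show "\<exists>u. canonical_solution \<phi> f u" using S_can_canonical[OF f] by blast
  fix u v assume "canonical_solution \<phi> f u" "canonical_solution \<phi> f v"
  then show "AE z in lebesgue. u z = v z" by (rule canonical_unique) (use f in \<open>simp add: closed_forms_iff\<close>)
qed

end

end

theorem theorem5p2:
  fixes \<phi> :: "complex ^ 'n \<Rightarrow> real"
  assumes "plurisubharmonic \<phi>"
    and "C_k 2 \<phi>"
    and "filterlim (\<lambda>z. lowest_eigenvalue (levi_matrix \<phi> z)) at_top at_infinity"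
  shows "S_can_well_defined \<phi> \<and> compact_operator \<phi> (S_can \<phi>)"
proof -
  interpret weight \<phi> by unfold_locales (rule assms(2))
  show ?thesis using S_can_welldef[OF assms(3)] S_can_compact[OF assms(3)] by blast
qed

end
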